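(* Consider non-ageing linear viscoelastic materials with $m\ge 1$ observable parameters. Their impulse responses are the $m\times m$ matrices $f=(f_{ij})$ of functions, null for $t<0$, of the form $$(\ast)\qquad f_{ij}(t)=\int_{(0,\infty)}(1-e^{-\lambda t})\,\nu_{ij}(d\lambda)+tL_{ij}+K_{ij}\qquad(t\ge 0),$$ where $L=(L_{ij})$ and $K=(K_{ij})$ are symmetric positive semidefinite matrices and $(\nu_{ij})$ is a symmetric positive semidefinite matrix of $\sigma$-finite measures on $(0,\infty)$ with $\int_{(0,\infty)}\frac{x}{1+x}\,d|\nu_{ij}|(x)<+\infty$ for all $i,j=1,\dots,m$. The impulse responses $f=(f_{ij})$ and the relaxation functions $r=(r_{ij})$, regarded as distributions on $\mathbb{R}$ null for $t<0$, are linked by $$\sum_k f'_{ik}*r'_{kj}=\delta_{ij}\,\delta_0\qquad\text{for all } i,j.$$ Then: (i) The relaxation functions are the distributions, null for $t<0$, of the form $$r_{ij}=A_{ij}1_{\{t\ge0\}}+B_{ij}\,\delta_0+1_{\{t\ge0\}}\int_{(0,\infty)}e^{-tx}\,d\rho_{ij}(x),$$ where $(A_{ij})$, $(B_{ij})$ and $(\rho_{ij})$ are symmetric positive semidefinite matrices, the $\rho_{ij}$ being measures on $(0,\infty)$ such that $\int_{(0,\infty)}\frac{1}{1+x}\,d|\rho_{ij}|(x)<+\infty$. (ii) The primitives $R_{ij}(t)$, null for $t<0$, of the $r_{ij}(t)$ are exactly the functions of the form $(\ast)$. Consequently they are the impulse responses of a non-ageing linear viscoelastic material, called the conjugate material of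 the initial material. (iii) In terms of the impulse responses $f^{(1)}$, $f^{(2)}$ of two materials, the conjugation relation is expressed by $$\sum_k f^{(1)}_{ik}*f^{(2)}_{kj}(t)=\delta_{ij}\,\frac{t^2}{2}\,1_{\{t\ge0\}}\qquad\text{for all } i,j.$$ (iv) The conjugation relation is symmetric, and putting the rheological models of two materials in series corresponds to putting the conjugate materials in parallel, and conversely.
   Context: The impulse response $f_{ij}(t)$ is the response of the $i$-th observable parameter to a unit step, applied at time $0$, of the force associated with the $j$-th parameter. Derivatives, primitives and convolutions $*$ are taken in the sense of distributions on $\mathbb{R}$ null for $t<0$; $\delta_0$ is the Dirac mass at $0$ and $\delta_{ij}$ the Kronecker symbol. A symmetric positive semidefinite matrix of measures $(\nu_{ij})$ on $(0,\infty)$ is one such that for every relatively compact Borel set $E\subset(0,\infty)$ the matrix $(\nu_{ij}(E))$ is symmetric positive semidefinite; $|\nu_{ij}|$ denotes the total variation measure. Putting two materials with the same observable parameters in series means adding their impulse responses; putting them in parallel means adding their relaxation functions.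
   Formalization: In (i) and (ii) the relaxation functions and their primitives are the nondegenerate matrices of the stated forms (no nonzero constant vector in the kernel), and materials are the impulse responses having relaxation functions; singular cases such as f = 0 or r = 0 have none. *)

theory Defs
  imports "HOL-Analysis.Analysis"
begin

section \<open>Distributions on the real line\<close>

definition support :: "(real \<Rightarrow> real) \<Rightarrow> real set" where
  "support \<phi> = closure {x. \<phi> x \<noteq> 0}"

definition test_function :: "(real \<Rightarrow> real) \<Rightarrow> bool" where
  "test_function \<phi> \<longleftrightarrow>
     (\<forall>n x. (deriv ^^ n) \<phi> differentiable (at x)) \<and> compact (support \<phi>)"

text \<open>Distributions are represented by functionals on all functions, of which only the values at
  test functions matter; equality of distributions is therefore the relation \<open>=\<^sub>D\<close>.\<close>

type_synonym functional = "(real \<Rightarrow> real) \<Rightarrow> real"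

definition dist_eq :: "functional \<Rightarrow> functional \<Rightarrow> bool" (infix "=\<^sub>D" 50) where
  "S =\<^sub>D T \<longleftrightarrow> (\<forall>\<phi>. test_function \<phi> \<longrightarrow> S \<phi> = T \<phi>)"

definition is_distribution :: "functional \<Rightarrow> bool" where
  "is_distribution T \<longleftrightarrow>
     (\<forall>\<phi> \<psi> a b. test_function \<phi> \<and> test_function \<psi> \<longrightarrow>
        T (\<lambda>x. a * \<phi> x + b * \<psi> x) = a * T \<phi> + b * T \<psi>) \<and>
     (\<forall>K. compact K \<longrightarrow> (\<exists>C N. \<forall>\<phi>. test_function \<phi> \<and> support \<phi> \<subseteq> K \<longrightarrow>
        \<bar>T \<phi>\<bar> \<le> C * (\<Sum>n\<le>N. SUP x. \<bar>(deriv ^^ n) \<phi> x\<bar>)))"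

text \<open>Distributions null for \<open>t < 0\<close>.\<close>

definition causal_distribution :: "functional \<Rightarrow> bool" where
  "causal_distribution T \<longleftrightarrow> is_distribution T \<and>
     (\<forall>\<phi>. test_function \<phi> \<and> support \<phi> \<subseteq> {..<0} \<longrightarrow> T \<phi> = 0)"

definition dist_of :: "(real \<Rightarrow> real) \<Rightarrow> functional" where
  "dist_of g = (\<lambda>\<phi>. LBINT t. g t * \<phi> t)"

definition dirac0 :: functional where
  "dirac0 = (\<lambda>\<phi>. \<phi> 0)"

definition dist_deriv :: "functional \<Rightarrow> functional" where
  "dist_deriv T = (\<lambda>\<phi>. - T (deriv \<phi>))"

definition causal_primitive :: "functional \<Rightarrow> functional \<Rightarrow> bool" where
  "causal_primitive R T \<longleftrightarrow> causal_distribution R \<and> dist_deriv R =\<^sub>D T"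

text \<open>A smooth function that is \<open>0\<close> on \<open>(-\<infinity>, -2]\<close> and \<open>1\<close> on \<open>[-1, \<infinity>)\<close>.\<close>

definition flat_exp :: "real \<Rightarrow> real" where
  "flat_exp x = (if x \<le> 0 then 0 else exp (- 1 / x))"

definition cutoff :: "real \<Rightarrow> real" where
  "cutoff x = flat_exp (x + 2) / (flat_exp (x + 2) + flat_exp (- 1 - x))"

text \<open>Convolution of distributions null for \<open>t < 0\<close>. The function \<open>x \<mapsto> T\<^sub>y (\<phi> (x + y))\<close> is smooth
  and vanishes for large \<open>x\<close>, but not for \<open>x \<rightarrow> -\<infinity>\<close>; multiplying it by \<open>cutoff\<close> makes it a test
  function without changing it near \<open>[0, \<infinity>)\<close>, which contains the support of \<open>S\<close>.\<close>

definition convolution :: "functional \<Rightarrow> functional \<Rightarrow> functional" (infixl "\<star>" 70) where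
  "S \<star> T = (\<lambda>\<phi>. S (\<lambda>x. cutoff x * T (\<lambda>y. \<phi> (x + y))))"

section \<open>Signed measures on the open half-line\<close>

text \<open>Relatively compact Borel subsets of \<open>(0, \<infinity>)\<close>.\<close>

definition rc_borel :: "real set \<Rightarrow> bool" where
  "rc_borel E \<longleftrightarrow> E \<in> sets borel \<and> (\<exists>K. compact K \<and> K \<subseteq> {0<..} \<and> E \<subseteq> K)"

text \<open>An off-diagonal entry \<open>\<nu>\<^sub>i\<^sub>j\<close> may have infinite positive and negative parts, so that
  \<open>\<nu>\<^sub>i\<^sub>j E\<close> only makes sense for relatively compact \<open>E\<close>. The integrability conditions imposed below
  make the total variation finite on such sets. Values on other sets are irrelevant.\<close>

definition signed_measure :: "(real set \<Rightarrow> real) \<Rightarrow> bool" where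
  "signed_measure \<nu> \<longleftrightarrow>
     (\<forall>E :: nat \<Rightarrow> real set. (\<forall>n. E n \<in> sets borel) \<and> disjoint_family E \<and> rc_borel (\<Union>n. E n)
        \<longrightarrow> (\<lambda>n. \<nu> (E n)) sums \<nu> (\<Union>n. E n))"

text \<open>Jordan decomposition: positive and negative part, total variation and integral. These are
  Borel measures on \<open>UNIV\<close> that give no mass to \<open>(-\<infinity>, 0]\<close>.\<close>

definition pos_part :: "(real set \<Rightarrow> real) \<Rightarrow> real measure" where
  "pos_part \<nu> = measure_of UNIV (sets borel)
     (\<lambda>E. SUP A\<in>{A. rc_borel A \<and> A \<subseteq> E}. ennreal (\<nu> A))"

definition neg_part :: "(real set \<Rightarrow> real) \<Rightarrow> real measure" where
  "neg_part \<nu> = pos_part (\<lambda>E. - \<nu> E)"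

definition total_variation :: "(real set \<Rightarrow> real) \<Rightarrow> real measure" where
  "total_variation \<nu> = measure_of UNIV (sets borel)
     (\<lambda>E. emeasure (pos_part \<nu>) E + emeasure (neg_part \<nu>) E)"

definition signed_integral :: "(real set \<Rightarrow> real) \<Rightarrow> (real \<Rightarrow> real) \<Rightarrow> real" where
  "signed_integral \<nu> g = (LINT x|pos_part \<nu>. g x) - (LINT x|neg_part \<nu>. g x)"

definition sym_psd :: "real^'m::finite^'m \<Rightarrow> bool" where
  "sym_psd M \<longleftrightarrow> transpose M = M \<and> (\<forall>x. 0 \<le> x \<bullet> (M *v x))"

definition psd_measures :: "('m::finite \<Rightarrow> 'm \<Rightarrow> real set \<Rightarrow> real) \<Rightarrow> bool" where
  "psd_measures \<nu> \<longleftrightarrow> (\<forall>i j. signed_measure (\<nu> i j)) \<and>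
     (\<forall>E. rc_borel E \<longrightarrow> sym_psd (\<chi> i j. \<nu> i j E))"

section \<open>Viscoelastic materials\<close>

text \<open>The form \<open>(\<ast>)\<close>.\<close>

definition impulse_response :: "('m::finite \<Rightarrow> 'm \<Rightarrow> real \<Rightarrow> real) \<Rightarrow> bool" where
  "impulse_response f \<longleftrightarrow> (\<exists>\<nu> (L :: real^'m^'m) (K :: real^'m^'m).
     sym_psd L \<and> sym_psd K \<and> psd_measures \<nu> \<and>
     (\<forall>i j. (\<integral>\<^sup>+x. ennreal (x / (1 + x)) \<partial>total_variation (\<nu> i j)) < \<infinity>) \<and>
     (\<forall>i j t. f i j t =
        (if t < 0 then 0
         else signed_integral (\<nu> i j) (\<lambda>x. 1 - exp (- x * t)) + t * L $ i $ j + K $ i $ j)))"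

abbreviation dist_mat :: "('m \<Rightarrow> 'm \<Rightarrow> real \<Rightarrow> real) \<Rightarrow> 'm \<Rightarrow> 'm \<Rightarrow> functional" where
  "dist_mat f \<equiv> \<lambda>i j. dist_of (f i j)"

definition relaxation :: "('m::finite \<Rightarrow> 'm \<Rightarrow> real \<Rightarrow> real) \<Rightarrow> ('m \<Rightarrow> 'm \<Rightarrow> functional) \<Rightarrow> bool" where
  "relaxation f r \<longleftrightarrow> (\<forall>i j. causal_distribution (r i j)) \<and>
     (\<forall>i j. (\<lambda>\<phi>. \<Sum>k\<in>UNIV. (dist_deriv (dist_of (f i k)) \<star> dist_deriv (r k j)) \<phi>)
        =\<^sub>D (\<lambda>\<phi>. (if i = j then 1 else 0) * dirac0 \<phi>))"

definition relaxation_form :: "('m::finite \<Rightarrow> 'm \<Rightarrow> functional) \<Rightarrow> bool" where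
  "relaxation_form r \<longleftrightarrow> (\<exists>(A :: real^'m^'m) (B :: real^'m^'m) \<rho>.
     sym_psd A \<and> sym_psd B \<and> psd_measures \<rho> \<and>
     (\<forall>i j. (\<integral>\<^sup>+x. ennreal (1 / (1 + x)) \<partial>total_variation (\<rho> i j)) < \<infinity>) \<and>
     (\<forall>i j. r i j =\<^sub>D (\<lambda>\<phi>. A $ i $ j * dist_of (indicator {0..}) \<phi> + B $ i $ j * dirac0 \<phi> +
        dist_of (\<lambda>t. indicator {0..} t * signed_integral (\<rho> i j) (\<lambda>x. exp (- t * x))) \<phi>)))"

text \<open>A material with singular response, such as \<open>f = 0\<close>, has no relaxation functions: the matrix
  \<open>f'\<close> then has no convolution inverse. Materials are required to have relaxation functions;
  \<open>nondegenerate\<close> is the explicit condition on a matrix of distributions that excludes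
  singular ones: no nonzero constant vector is in its kernel.\<close>

definition material :: "('m::finite \<Rightarrow> 'm \<Rightarrow> real \<Rightarrow> real) \<Rightarrow> bool" where
  "material f \<longleftrightarrow> impulse_response f \<and> (\<exists>r. relaxation f r)"

definition nondegenerate :: "('m::finite \<Rightarrow> 'm \<Rightarrow> functional) \<Rightarrow> bool" where
  "nondegenerate T \<longleftrightarrow>
     (\<forall>c :: real^'m. (\<forall>i. (\<lambda>\<phi>. \<Sum>j\<in>UNIV. T i j \<phi> * c $ j) =\<^sub>D (\<lambda>\<phi>. 0)) \<longrightarrow> c = 0)"

definition conjugate ::
    "('m::finite \<Rightarrow> 'm \<Rightarrow> real \<Rightarrow> real) \<Rightarrow> ('m \<Rightarrow> 'm \<Rightarrow> real \<Rightarrow> real) \<Rightarrow> bool" where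
  "conjugate f h \<longleftrightarrow> impulse_response f \<and> impulse_response h \<and>
     (\<exists>r. relaxation f r \<and> (\<forall>i j. causal_primitive (dist_of (h i j)) (r i j)))"

definition in_series :: "('m::finite \<Rightarrow> 'm \<Rightarrow> real \<Rightarrow> real) \<Rightarrow> ('m \<Rightarrow> 'm \<Rightarrow> real \<Rightarrow> real)
    \<Rightarrow> ('m \<Rightarrow> 'm \<Rightarrow> real \<Rightarrow> real) \<Rightarrow> bool" where
  "in_series f1 f2 f \<longleftrightarrow> (\<forall>i j t. f i j t = f1 i j t + f2 i j t)"

definition in_parallel :: "('m::finite \<Rightarrow> 'm \<Rightarrow> real \<Rightarrow> real) \<Rightarrow> ('m \<Rightarrow> 'm \<Rightarrow> real \<Rightarrow> real)
    \<Rightarrow> ('m \<Rightarrow> 'm \<Rightarrow> real \<Rightarrow> real) \<Rightarrow> bool" where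
  "in_parallel f1 f2 f \<longleftrightarrow> (\<exists>r1 r2. relaxation f1 r1 \<and> relaxation f2 r2 \<and>
     relaxation f (\<lambda>i j \<phi>. r1 i j \<phi> + r2 i j \<phi>))"

end

theory Submission
  imports Defs "HOL-Probability.Helly_Selection" "HOL-Real_Asymp.Real_Asymp"
begin

text \<open>An impulse response \<open>f\<close> is encoded by the matrix sequence \<open>M\<close> that its exponential moments
  determine by \<open>\<integral> t\<^sup>n e\<^sup>-\<^sup>t f(t) dt = n! \<Sum>\<^sub>k\<^sub>\<le>\<^sub>n M\<^sub>k\<close>. The \<open>M\<^sub>k\<close> are the moments of a positive
  matrix measure on \<open>[0, 1]\<close> in the variable \<open>u = 1 / (1 + \<lambda>)\<close>, where the atom at \<open>u = 1\<close> is \<open>L\<close>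
  and the atom at \<open>u = 0\<close> is \<open>K\<close>. By the Hausdorff moment problem, the sequences that occur are
  those for which \<open>M\<^sub>k\<^sub>+\<^sub>1\<close> and \<open>M\<^sub>k - M\<^sub>k\<^sub>+\<^sub>1\<close> are Hankel positive. In terms of the generating
  series \<open>F(z) = \<Sum>\<^sub>k M\<^sub>k z\<^sup>k\<close>, the conjugation relation reads \<open>F(z) H(z) = 1 / (1 - z)\<close>; inverting
  a series reverses the sign of its Hankel forms, so that the two conditions on \<open>F\<close> and \<open>(1 - z)
  F\<close> are exchanged and the conjugate sequence is again of this form. All identities between
  functions follow from those between moments because a functional controlled by \<open>sup e\<^sup>t\<^sup>/\<^sup>2
  |\<psi>(t)|\<close> that vanishes at all \<open>t\<^sup>n e\<^sup>-\<^sup>t\<close> vanishes at every continuous \<open>\<psi>\<close> that is zero for large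
  \<open>t\<close>. The matrix \<open>M\<^sub>0\<close> is invertible exactly if \<open>f\<close> is nondegenerate, since \<open>M\<^sub>0 c = 0\<close> forces
  \<open>f(t) c = 0\<close> for all \<open>t\<close>.\<close>

section \<open>Test functions\<close>

text \<open>With \<open>z = 1 - p\<close>, where \<open>p\<close> is the Laplace variable,
  \<open>F\<close> is the Taylor series at \<open>p = 1\<close> of the Laplace transform of the
  derivative of \<open>f\<close>. Expanding at a single point replaces the function theory of
  matrix-valued Laplace transforms by algebra of formal power series, where invertibility of the
  constant coefficient is all that an inverse requires. Two obstacles shape the rest. Off-diagonal
  measures are signed and may have infinite positive and negative mass, while the moment problem and
  the Jordan decomposition are scalar. A matrix measure is therefore carried as a family of positive
  measures \<open>\<sigma> v\<close>, quadratic in the vector \<open>v\<close>, and entries are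
  recovered by polarization. A relaxation matrix \<open>r\<close> is a priori an arbitrary causal
  distribution without any growth bound, so exponential moments of \<open>r\<close> make no sense.
  Hence \<open>r\<close> is never expanded: an inverse \<open>h\<close> of \<open>f\<close> is
  constructed from moments, and any \<open>r\<close> is identified with the derivative of
  \<open>h\<close> by convolving its defining relation with \<open>h\<close>. Symmetry of the
  matrices and commutativity of scalar convolution make left and right inverses agree.\<close>

definition smooth :: "(real \<Rightarrow> real) \<Rightarrow> bool" where
  "smooth \<phi> \<longleftrightarrow> (\<forall>n x. (deriv ^^ n) \<phi> differentiable (at x))"

text \<open>An invariant that survives one differentiation suffices, so no formula for the n-th
  derivative has to be guessed.\<close>

lemma smooth_coinduct:
  assumes "P \<phi>" and step: "\<And>\<psi>. P \<psi> \<Longrightarrow> (\<forall>x. \<psi> differentiable (at x)) \<and> P (deriv \<psi>)"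
  shows "smooth \<phi>"
proof -
  have "P ((deriv ^^ n) \<phi>)" for n by (induction n) (use assms in auto)
  thus ?thesis unfolding smooth_def using step by blast
qed

lemma smooth_deriv: "smooth \<phi> \<Longrightarrow> smooth (deriv \<phi>)"
  unfolding smooth_def by (metis funpow_simps_right(2) comp_apply)

lemma smooth_DERIV: "smooth \<phi> \<Longrightarrow> (\<phi> has_real_derivative deriv \<phi> x) (at x)"
  unfolding smooth_def DERIV_deriv_iff_real_differentiable by (metis funpow_0)

lemma smooth_higher: "smooth \<phi> \<Longrightarrow> smooth ((deriv ^^ n) \<phi>)"
  by (induction n) (simp_all add: smooth_deriv)

lemma smooth_continuous: "smooth \<phi> \<Longrightarrow> continuous_on A \<phi>"
  by (meson DERIV_isCont continuous_at_imp_continuous_on smooth_DERIV)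

text \<open>The derivative of a product is a sum of products. Products of smooth functions alone are
  not stable under \<open>deriv\<close>, but the algebra they generate is, which gives the invariant
  for \<open>smooth_coinduct\<close> in place of the Leibniz formula.\<close>

inductive smooth_algebra :: "(real \<Rightarrow> real) \<Rightarrow> bool" where
  base: "smooth f \<Longrightarrow> smooth_algebra f"
| add: "smooth_algebra f \<Longrightarrow> smooth_algebra g \<Longrightarrow> smooth_algebra (\<lambda>x. f x + g x)"
| mult: "smooth_algebra f \<Longrightarrow> smooth_algebra g \<Longrightarrow> smooth_algebra (\<lambda>x. f x * g x)"

lemma smooth_algebra_deriv:
  "smooth_algebra \<psi> \<Longrightarrow> (\<forall>x. (\<psi> has_real_derivative deriv \<psi> x) (at x)) \<and> smooth_algebra (deriv \<psi>)"
proof (induction rule: smooth_algebra.induct)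
  case (base f)
  thus ?case by (auto intro: smooth_DERIV smooth_algebra.base smooth_deriv)
next
  case (add f g)
  have D: "((\<lambda>x. f x + g x) has_real_derivative (deriv f x + deriv g x)) (at x)" for x
    using add.IH by (auto intro: DERIV_add)
  hence "deriv (\<lambda>x. f x + g x) = (\<lambda>x. deriv f x + deriv g x)" by (intro ext DERIV_imp_deriv)
  thus ?case using add.IH D by (auto intro: smooth_algebra.add)
next
  case (mult f g)
  have D: "((\<lambda>x. f x * g x) has_real_derivative (deriv f x * g x + deriv g x * f x)) (at x)" for x
    using mult.IH by (auto intro: DERIV_mult)
  hence "deriv (\<lambda>x. f x * g x) = (\<lambda>x. deriv f x * g x + deriv g x * f x)" by (intro ext DERIV_imp_deriv)
  thus ?case using mult D by (auto intro: smooth_algebra.intros)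
qed

lemma smooth_algebra_smooth: "smooth_algebra \<psi> \<Longrightarrow> smooth \<psi>"
  by (rule smooth_coinduct[of smooth_algebra])
     (auto dest: smooth_algebra_deriv simp: DERIV_deriv_iff_real_differentiable)

lemma smooth_mult: "smooth f \<Longrightarrow> smooth g \<Longrightarrow> smooth (\<lambda>x. f x * g x)"
  by (rule smooth_algebra_smooth[OF smooth_algebra.mult[OF smooth_algebra.base smooth_algebra.base]])

lemma smooth_add: "smooth f \<Longrightarrow> smooth g \<Longrightarrow> smooth (\<lambda>x. f x + g x)"
  by (rule smooth_algebra_smooth[OF smooth_algebra.add[OF smooth_algebra.base smooth_algebra.base]])

lemma smooth_const: "smooth (\<lambda>x. c)"
  by (rule smooth_coinduct[of "\<lambda>\<psi>. \<exists>c. \<psi> = (\<lambda>x. c)"]) auto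

lemma smooth_affine:
  assumes "smooth \<phi>"
  shows "smooth (\<lambda>x. \<phi> (a * x + b))"
\<comment> \<open>The factor \<open>c\<close> collects the powers of \<open>a\<close> that the chain
  rule produces.\<close>
proof (rule smooth_coinduct[of "\<lambda>\<psi>. \<exists>\<phi> c. smooth \<phi> \<and> \<psi> = (\<lambda>x. c * \<phi> (a * x + b))"])
  show "\<exists>\<phi>' c. smooth \<phi>' \<and> (\<lambda>x. \<phi> (a * x + b)) = (\<lambda>x. c * \<phi>' (a * x + b))"
    using assms by (intro exI[of _ \<phi>] exI[of _ 1]) auto
  fix \<psi> assume "\<exists>\<phi> c. smooth \<phi> \<and> \<psi> = (\<lambda>x. c * \<phi> (a * x + b))"
  then obtain \<phi> c where \<phi>: "smooth \<phi>" "\<psi> = (\<lambda>x. c * \<phi> (a * x + b))" by blast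
  have D: "(\<psi> has_real_derivative (c * a) * deriv \<phi> (a * x + b)) (at x)" for x
    unfolding \<phi>(2) by (auto intro!: derivative_eq_intros DERIV_chain'[OF _ smooth_DERIV[OF \<phi>(1)]])
  hence "deriv \<psi> = (\<lambda>x. (c * a) * deriv \<phi> (a * x + b))" by (intro ext DERIV_imp_deriv) auto
  moreover have "\<psi> differentiable at x" for x using D[of x] by (auto simp: real_differentiable_def)
  ultimately show "(\<forall>x. \<psi> differentiable at x) \<and> (\<exists>\<phi> c. smooth \<phi> \<and> deriv \<psi> = (\<lambda>x. c * \<phi> (a * x + b)))"
    using smooth_deriv[OF \<phi>(1)] by auto
qed

lemma poly_exp_tendsto_0: "((\<lambda>y. poly p y * exp (- y)) \<longlongrightarrow> 0) (at_top :: real filter)"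
proof -
  have "((\<lambda>y. \<Sum>i\<le>degree p. coeff p i * (y ^ i / exp y)) \<longlongrightarrow> (\<Sum>i\<le>degree p. coeff p i * 0)) at_top"
    by (intro tendsto_sum tendsto_mult tendsto_const tendsto_power_div_exp_0)
  thus ?thesis by (simp add: poly_altdef sum_distrib_right exp_minus divide_inverse mult.assoc)
qed

text \<open>On the positive axis every derivative is \<open>p (1 / x) * exp (- 1 / x)\<close> for a
  polynomial \<open>p\<close>, and differentiation replaces \<open>p\<close> by
  \<open>y\<^sup>2 * (p - p')\<close> in the variable \<open>y = 1 / x\<close>. At 0 the right
  difference quotient has the same shape with the polynomial \<open>y * p\<close>, and the
  exponential beats it.\<close>

lemma smooth_flat_exp: "smooth flat_exp"
proof -
  define F where "F p = (\<lambda>x::real. if x \<le> 0 then 0 else poly p (inverse x) * exp (- inverse x))" for p :: "real poly"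
  have D: "(F p has_real_derivative F ([:0, 0, 1:] * (p - pderiv p)) x) (at x)" for p x
  proof -
    consider "x > 0" | "x < 0" | "x = 0" by linarith
    thus ?thesis
    proof cases
      case 1
      have "((\<lambda>x. poly p (inverse x) * exp (- inverse x)) has_real_derivative F ([:0, 0, 1:] * (p - pderiv p)) x) (at x)"
        using 1 unfolding F_def
        by (auto intro!: derivative_eq_intros DERIV_chain'[OF _ poly_DERIV] simp: power2_eq_square algebra_simps)
      moreover have ev: "\<forall>\<^sub>F y in nhds x. F p y = poly p (inverse y) * exp (- inverse y)"
        using eventually_nhds_in_open[of "{0<..}" x] 1 by (auto simp: F_def elim!: eventually_mono)
      ultimately show ?thesis by (simp only: DERIV_cong_ev[OF refl ev refl])
    next
      case 2
      have ev: "\<forall>\<^sub>F y in nhds x. F p y = 0"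
        using eventually_nhds_in_open[of "{..<0}" x] 2 by (auto simp: F_def elim!: eventually_mono)
      moreover have "((\<lambda>_. 0) has_real_derivative F ([:0, 0, 1:] * (p - pderiv p)) x) (at x)"
        using 2 by (simp add: F_def)
      ultimately show ?thesis by (simp only: DERIV_cong_ev[OF refl ev refl])
    next
      case 3
      have "((\<lambda>h. (F p (0 + h) - F p 0) / h) \<longlongrightarrow> 0) (at 0)"
      proof (rule filterlim_split_at)
        have "\<forall>\<^sub>F h in at_left 0. (F p (0 + h) - F p 0) / h = 0"
          unfolding eventually_at_filter by (auto simp: F_def)
        thus "((\<lambda>h. (F p (0 + h) - F p 0) / h) \<longlongrightarrow> 0) (at_left 0)" by (rule tendsto_eventually)
        have "((\<lambda>h. poly ([:0, 1:] * p) (inverse h) * exp (- inverse h)) \<longlongrightarrow> 0) (at_right 0)"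
          by (rule filterlim_compose[OF poly_exp_tendsto_0 filterlim_inverse_at_top_right])
        moreover have "\<forall>\<^sub>F h in at_right 0. poly ([:0, 1:] * p) (inverse h) * exp (- inverse h) = (F p (0 + h) - F p 0) / h"
          unfolding eventually_at_filter by (auto simp: F_def field_simps)
        ultimately show "((\<lambda>h. (F p (0 + h) - F p 0) / h) \<longlongrightarrow> 0) (at_right 0)"
          by (rule Lim_transform_eventually)
      qed
      thus ?thesis using 3 by (simp add: DERIV_def) (simp add: F_def)
    qed
  qed
  have "flat_exp = F 1" by (auto simp: flat_exp_def F_def fun_eq_iff divide_inverse)
  show ?thesis
  proof (rule smooth_coinduct[of "\<lambda>\<psi>. \<exists>p. \<psi> = F p"])
    show "\<exists>p. flat_exp = F p" using \<open>flat_exp = F 1\<close> by blast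
    fix \<psi> assume "\<exists>p. \<psi> = F p"
    then obtain p where p: "\<psi> = F p" by blast
    have "deriv (F p) = F ([:0, 0, 1:] * (p - pderiv p))" by (intro ext DERIV_imp_deriv D)
    moreover have "\<psi> differentiable at x" for x unfolding p using D[of p x] by (auto simp: real_differentiable_def)
    ultimately show "(\<forall>x. \<psi> differentiable at x) \<and> (\<exists>p. deriv \<psi> = F p)" using p by auto
  qed
qed

lemma test_function_smooth: "test_function \<phi> \<Longrightarrow> smooth \<phi>"
  by (simp add: test_function_def smooth_def)

lemma support_ext: "x \<notin> support \<phi> \<Longrightarrow> \<phi> x = 0"
  using closure_subset[of "{x. \<phi> x \<noteq> 0}"] unfolding support_def by auto

lemma support_subsetI: "closed K \<Longrightarrow> (\<And>x. x \<notin> K \<Longrightarrow> \<phi> x = 0) \<Longrightarrow> support \<phi> \<subseteq> K"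
  unfolding support_def by (rule closure_minimal) auto

lemma test_functionI:
  assumes "smooth \<phi>" "\<And>x. x \<notin> {a..b} \<Longrightarrow> \<phi> x = 0"
  shows "test_function \<phi>"
proof -
  have "support \<phi> \<subseteq> {a..b}" by (rule support_subsetI) (use assms in auto)
  moreover have "closed (support \<phi>)" by (simp add: support_def)
  ultimately have "compact (support \<phi>)" using bounded_subset[OF bounded_closed_interval] by (simp add: compact_eq_bounded_closed)
  thus ?thesis using assms(1) by (simp add: test_function_def smooth_def)
qed

lemma test_function_bounds:
  assumes "test_function \<phi>"
  shows "\<exists>R>0. support \<phi> \<subseteq> {-R..R} \<and> (\<forall>x. x \<notin> {-R..R} \<longrightarrow> \<phi> x = 0)"
proof -
  have "bounded (support \<phi>)" using assms by (simp add: test_function_def compact_imp_bounded)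
  then obtain R where R: "R > 0" "\<And>x. x \<in> support \<phi> \<Longrightarrow> norm x \<le> R" by (auto simp: bounded_pos)
  have s: "support \<phi> \<subseteq> {-R..R}" using R by (force simp: abs_le_iff)
  moreover have "\<forall>x. x \<notin> {-R..R} \<longrightarrow> \<phi> x = 0" using s support_ext[of _ \<phi>] by (metis subsetD)
  ultimately show ?thesis using R(1) by blast
qed

lemma flat_exp_0: "x \<le> 0 \<Longrightarrow> flat_exp x = 0"
  and flat_exp_pos: "0 < x \<Longrightarrow> 0 < flat_exp x"
  and flat_exp_nonneg: "0 \<le> flat_exp x"
  by (simp_all add: flat_exp_def)

lemma test_function_bump:
  assumes "a < b"
  obtains \<phi> where "test_function \<phi>" "\<And>x. 0 \<le> \<phi> x" "\<And>x. x \<notin> {a..b} \<Longrightarrow> \<phi> x = 0"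
    "\<And>x. a < x \<Longrightarrow> x < b \<Longrightarrow> 0 < \<phi> x"
proof -
  define \<phi> where "\<phi> x = flat_exp (1 * x + (- a)) * flat_exp ((-1) * x + b)" for x
  have smooth: "smooth \<phi>" unfolding \<phi>_def by (intro smooth_mult smooth_affine smooth_flat_exp)
  show ?thesis
  proof (rule that)
    show out: "\<phi> x = 0" if "x \<notin> {a..b}" for x using that by (auto simp: \<phi>_def flat_exp_0)
    show "test_function \<phi>" using smooth out by (rule test_functionI)
    show "0 \<le> \<phi> x" for x unfolding \<phi>_def by (intro mult_nonneg_nonneg flat_exp_nonneg)
    show "0 < \<phi> x" if "a < x" "x < b" for x
      unfolding \<phi>_def by (intro mult_pos_pos flat_exp_pos) (use that in auto)
  qed
qed

lemma test_function_lincomb: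
  assumes "test_function \<phi>" "test_function \<psi>"
  shows "test_function (\<lambda>x. a * \<phi> x + b * \<psi> x)"
proof -
  obtain R where R_pos: "R > 0" and R_support: "support \<phi> \<subseteq> {-R..R}" and R_out: "\<forall>x. x \<notin> {-R..R} \<longrightarrow> \<phi> x = 0"
    using test_function_bounds[OF assms(1)] by blast
  note R = R_out[rule_format]
  obtain S where S_pos: "S > 0" and S_support: "support \<psi> \<subseteq> {-S..S}" and S_out: "\<forall>x. x \<notin> {-S..S} \<longrightarrow> \<psi> x = 0"
    using test_function_bounds[OF assms(2)] by blast
  note S = S_out[rule_format]
  show ?thesis
  proof (rule test_functionI[of _ "- max R S" "max R S"])
    show "smooth (\<lambda>x. a * \<phi> x + b * \<psi> x)"
      by (intro smooth_add smooth_mult smooth_const) (intro test_function_smooth assms)+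
    fix x assume x: "x \<notin> {- max R S..max R S}"
    have "x \<notin> {-R..R}" "x \<notin> {-S..S}" using x by auto
    thus "a * \<phi> x + b * \<psi> x = 0" using R S by simp
  qed
qed

lemma deriv_lincomb:
  assumes "smooth \<phi>" "smooth \<psi>"
  shows "deriv (\<lambda>x. a * \<phi> x + b * \<psi> x) = (\<lambda>x. a * deriv \<phi> x + b * deriv \<psi> x)"
proof
  fix x
  have "((\<lambda>x. a * \<phi> x + b * \<psi> x) has_real_derivative (a * deriv \<phi> x + b * deriv \<psi> x)) (at x)"
    using smooth_DERIV[OF assms(1)] smooth_DERIV[OF assms(2)] by (auto intro!: derivative_eq_intros)
  thus "deriv (\<lambda>x. a * \<phi> x + b * \<psi> x) x = a * deriv \<phi> x + b * deriv \<psi> x" by (rule DERIV_imp_deriv)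
qed

lemma higher_deriv_lincomb:
  assumes "smooth \<phi>" "smooth \<psi>"
  shows "(deriv ^^ n) (\<lambda>x. a * \<phi> x + b * \<psi> x) = (\<lambda>x. a * (deriv ^^ n) \<phi> x + b * (deriv ^^ n) \<psi> x)"
  by (induction n) (simp_all add: deriv_lincomb smooth_higher assms)

lemma deriv_shift:
  assumes "smooth \<phi>"
  shows "deriv (\<lambda>x. \<phi> (s + x)) = (\<lambda>x. deriv \<phi> (s + x))"
proof
  fix x
  have "((\<lambda>x. \<phi> (s + x)) has_real_derivative deriv \<phi> (s + x) * 1) (at x)"
    by (rule DERIV_chain2[OF smooth_DERIV[OF assms]]) (auto intro!: derivative_eq_intros)
  hence "((\<lambda>x. \<phi> (s + x)) has_real_derivative deriv \<phi> (s + x)) (at x)" by simp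
  thus "deriv (\<lambda>x. \<phi> (s + x)) x = deriv \<phi> (s + x)" by (rule DERIV_imp_deriv)
qed

lemma higher_deriv_shift:
  "smooth \<phi> \<Longrightarrow> (deriv ^^ n) (\<lambda>x. \<phi> (s + x)) = (\<lambda>x. (deriv ^^ n) \<phi> (s + x))"
  by (induction n) (simp_all add: deriv_shift smooth_higher)

lemma test_function_shift:
  assumes "test_function \<phi>"
  shows "test_function (\<lambda>x. \<phi> (s + x))"
proof -
  obtain R where R_pos: "R > 0" and R_support: "support \<phi> \<subseteq> {-R..R}" and R_out: "\<forall>x. x \<notin> {-R..R} \<longrightarrow> \<phi> x = 0"
    using test_function_bounds[OF assms] by blast
  note R = R_out[rule_format]
  have "smooth (\<lambda>x. \<phi> (1 * x + s))" by (rule smooth_affine[OF test_function_smooth[OF assms]])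
  thus ?thesis by (intro test_functionI[of _ "-R - s" "R - s"]) (auto simp: add.commute intro!: R)
qed

lemma deriv_outside_0:
  assumes "\<And>x. x \<notin> {-R..R} \<Longrightarrow> \<phi> x = 0" "x \<notin> {-R..R}"
  shows "deriv \<phi> x = (0::real)"
proof -
  have "\<forall>\<^sub>F y in nhds x. y \<in> - {-R..R}"
    by (rule eventually_nhds_in_open) (use assms(2) in auto)
  hence "\<forall>\<^sub>F y in nhds x. \<phi> y = (\<lambda>_. 0) y" by eventually_elim (use assms(1) in auto)
  from deriv_cong_ev[OF this refl] show ?thesis by simp
qed

lemma higher_deriv_outside_0:
  assumes "\<And>x. x \<notin> {-R..R} \<Longrightarrow> \<phi> x = 0" "x \<notin> {-R..R}"
  shows "(deriv ^^ n) \<phi> x = (0::real)"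
proof -
  have "\<forall>x. x \<notin> {-R..R} \<longrightarrow> (deriv ^^ n) \<phi> x = 0"
  proof (induction n)
    case (Suc n)
    thus ?case using deriv_outside_0[of R "(deriv ^^ n) \<phi>"] by simp
  qed (use assms(1) in simp)
  thus ?thesis using assms(2) by blast
qed

lemma test_function_deriv:
  assumes "test_function \<phi>"
  shows "test_function (deriv \<phi>)"
proof -
  obtain R where R_pos: "R > 0" and R_support: "support \<phi> \<subseteq> {-R..R}" and R_out: "\<forall>x. x \<notin> {-R..R} \<longrightarrow> \<phi> x = 0"
    using test_function_bounds[OF assms] by blast
  note R = R_out[rule_format]
  show ?thesis
    by (rule test_functionI[OF smooth_deriv[OF test_function_smooth[OF assms]] deriv_outside_0[OF R]])
qed

lemma support_deriv_subset: "support (deriv \<phi>) \<subseteq> support \<phi>"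
proof (rule support_subsetI)
  show "closed (support \<phi>)" by (simp add: support_def)
  fix x assume x: "x \<notin> support \<phi>"
  have "\<forall>\<^sub>F y in nhds x. y \<in> - support \<phi>"
    by (rule eventually_nhds_in_open) (use x in \<open>auto simp: support_def\<close>)
  hence "\<forall>\<^sub>F y in nhds x. \<phi> y = (\<lambda>_. 0) y" by eventually_elim (simp add: support_ext)
  from deriv_cong_ev[OF this refl] show "deriv \<phi> x = 0" by simp
qed

lemma higher_deriv_bounded:
  assumes "test_function \<phi>"
  shows "\<exists>B\<ge>0. \<forall>x. \<bar>(deriv ^^ n) \<phi> x\<bar> \<le> B"
proof -
  obtain R where R0: "R > 0" and R_out: "\<forall>x. x \<notin> {-R..R} \<longrightarrow> \<phi> x = 0"
    using test_function_bounds[OF assms] by blast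
  note R = R_out[rule_format]
  have "compact ((deriv ^^ n) \<phi> ` {-R..R})"
    by (intro compact_continuous_image smooth_continuous smooth_higher test_function_smooth assms compact_Icc)
  then obtain B where B: "B > 0" "\<And>x. x \<in> {-R..R} \<Longrightarrow> \<bar>(deriv ^^ n) \<phi> x\<bar> \<le> B"
    by (auto dest!: compact_imp_bounded simp: bounded_pos)
  have "\<bar>(deriv ^^ n) \<phi> x\<bar> \<le> B" for x
    using B higher_deriv_outside_0[where \<phi> = \<phi> and R = R and x = x and n = n, OF R] by (cases "x \<in> {-R..R}") auto
  thus ?thesis using B by (intro exI[of _ B]) auto
qed

lemma higher_deriv_le_SUP:
  assumes "test_function \<phi>"
  shows "\<bar>(deriv ^^ n) \<phi> x\<bar> \<le> (SUP x. \<bar>(deriv ^^ n) \<phi> x\<bar>)"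
proof -
  obtain B where "\<forall>x. \<bar>(deriv ^^ n) \<phi> x\<bar> \<le> B" using higher_deriv_bounded[OF assms] by blast
  hence "bdd_above (range (\<lambda>x. \<bar>(deriv ^^ n) \<phi> x\<bar>))" by (auto intro!: bdd_aboveI2)
  thus ?thesis by (rule cSUP_upper[rotated]) simp
qed

text \<open>A bump supported where \<open>g\<close> keeps its sign would give a nonzero integral.
  Continuity is asked on the open half-line only, because an impulse response may jump at 0.\<close>

lemma fundamental_lemma:
  fixes g :: "real \<Rightarrow> real"
  assumes zero: "\<And>\<phi>. test_function \<phi> \<Longrightarrow> (LBINT t. g t * \<phi> t) = 0"
    and cont: "continuous_on {0<..} g" and t: "0 < t"
  shows "g t = 0"
proof (rule ccontr)
  assume nz: "g t \<noteq> 0"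
  define s where "s = sgn (g t)"
  have s: "s * g t > 0" "s \<noteq> 0" using nz by (auto simp: s_def sgn_mult[symmetric] sgn_if)
  have "isCont g t" using cont t by (simp add: continuous_on_eq_continuous_at)
  hence "((\<lambda>x. s * g x) \<longlongrightarrow> s * g t) (nhds t)"
    unfolding isCont_def by (intro tendsto_mult tendsto_const) (simp add: tendsto_nhds_iff)
  from order_tendstoD(1)[OF this s(1)] obtain e where e: "e > 0" "\<And>x. dist x t < e \<Longrightarrow> s * g x > 0"
    unfolding eventually_nhds_metric by blast
  \<comment> \<open>Half of the minimum keeps the closed interval around \<open>t\<close> inside
    both the region of constant sign and the positive axis.\<close>
  define d where "d = min e t / 2"
  have d: "d > 0" "d < e" "d < t" using e t by (auto simp: d_def)
  have pos: "s * g x > 0" "x > 0" if "x \<in> {t - d..t + d}" for x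
    using that d by (auto intro!: e(2) simp: dist_real_def)
  from d obtain \<phi> where \<phi>: "test_function \<phi>" "\<And>x. 0 \<le> \<phi> x" "\<And>x. x \<notin> {t - d..t + d} \<Longrightarrow> \<phi> x = 0"
    "\<And>x. t - d < x \<Longrightarrow> x < t + d \<Longrightarrow> 0 < \<phi> x"
    using test_function_bump[of "t - d" "t + d"] by auto
  have "set_integrable lborel {t - d..t + d} (\<lambda>x. s * g x * \<phi> x)"
    by (intro borel_integrable_compact[unfolded set_integrable_def[symmetric]] compact_Icc continuous_intros
      smooth_continuous test_function_smooth \<phi>(1) continuous_on_subset[OF cont]) (use pos in auto)
  hence int: "integrable lborel (\<lambda>x. s * g x * \<phi> x)"
  proof -
    have "indicator {t - d..t + d} x *\<^sub>R (s * g x * \<phi> x) = s * g x * \<phi> x" for x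
      using \<phi>(3)[of x] by (cases "x \<in> {t - d..t + d}") simp_all
    hence eq: "(\<lambda>x. indicator {t - d..t + d} x *\<^sub>R (s * g x * \<phi> x)) = (\<lambda>x. s * g x * \<phi> x)"
      by (rule ext)
    show ?thesis using \<open>set_integrable lborel _ _\<close> unfolding set_integrable_def eq .
  qed
  have nn: "0 \<le> s * g x * \<phi> x" for x
    using pos[of x] \<phi>(2)[of x] \<phi>(3)[of x] by (cases "x \<in> {t - d..t + d}") (auto intro: mult_nonneg_nonneg)
  have "(LBINT x. s * g x * \<phi> x) = s * (LBINT x. g x * \<phi> x)" by (simp add: mult.assoc)
  hence "(LBINT x. s * g x * \<phi> x) = 0" using zero[OF \<phi>(1)] by simp
  hence "AE x in lborel. s * g x * \<phi> x = 0"
    using integral_nonneg_eq_0_iff_AE[OF int] nn by auto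
  hence AE: "AE x in lborel. x \<notin> {t - d<..<t + d}"
  proof eventually_elim
    case (elim x)
    show ?case
    proof
      assume x: "x \<in> {t - d<..<t + d}"
      hence "s * g x > 0" "\<phi> x > 0" using pos(1)[of x] \<phi>(4)[of x] by auto
      hence "s * g x * \<phi> x > 0" by (rule mult_pos_pos)
      with elim show False by linarith
    qed
  qed
  have "{x \<in> space lborel. \<not> x \<notin> {t - d<..<t + d}} = {t - d<..<t + d}" by auto
  from AE_iff_measurable[OF _ this] AE have "emeasure lborel {t - d<..<t + d} = 0" by simp
  thus False using d by simp
qed

section \<open>Causal distributions\<close>

lemma is_distribution_lincomb:
  "is_distribution T \<Longrightarrow> test_function \<phi> \<Longrightarrow> test_function \<psi> \<Longrightarrow>
    T (\<lambda>x. a * \<phi> x + b * \<psi> x) = a * T \<phi> + b * T \<psi>"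
  unfolding is_distribution_def by simp

lemma is_distribution_cong:
  assumes T: "is_distribution T" and eq: "S =\<^sub>D T"
  shows "is_distribution S"
  unfolding is_distribution_def
proof (intro conjI allI impI)
  have e: "S \<phi> = T \<phi>" if "test_function \<phi>" for \<phi> using eq that by (simp add: dist_eq_def)
  fix \<phi> \<psi> a b assume "test_function \<phi> \<and> test_function \<psi>"
  thus "S (\<lambda>x. a * \<phi> x + b * \<psi> x) = a * S \<phi> + b * S \<psi>"
    using is_distribution_lincomb[OF T, of \<phi> \<psi> a b] e test_function_lincomb by simp
next
  have e: "S \<phi> = T \<phi>" if "test_function \<phi>" for \<phi> using eq that by (simp add: dist_eq_def)
  fix K :: "real set" assume "compact K"
  with T obtain C N where "\<forall>\<phi>. test_function \<phi> \<and> support \<phi> \<subseteq> K \<longrightarrow>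
        \<bar>T \<phi>\<bar> \<le> C * (\<Sum>n\<le>N. SUP x. \<bar>(deriv ^^ n) \<phi> x\<bar>)" unfolding is_distribution_def by meson
  thus "\<exists>C N. \<forall>\<phi>. test_function \<phi> \<and> support \<phi> \<subseteq> K \<longrightarrow>
        \<bar>S \<phi>\<bar> \<le> C * (\<Sum>n\<le>N. SUP x. \<bar>(deriv ^^ n) \<phi> x\<bar>)"
    using e by (intro exI[of _ C] exI[of _ N]) simp
qed

lemma causal_distribution_cong:
  "causal_distribution T \<Longrightarrow> S =\<^sub>D T \<Longrightarrow> causal_distribution S"
  unfolding causal_distribution_def using is_distribution_cong by (auto simp: dist_eq_def)

lemma dist_eq_sym: "S =\<^sub>D T \<Longrightarrow> T =\<^sub>D S"
  by (simp add: dist_eq_def)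

lemma dist_eq_trans: "S =\<^sub>D T \<Longrightarrow> T =\<^sub>D U \<Longrightarrow> S =\<^sub>D U"
  by (simp add: dist_eq_def)

lemma dist_eqD: "S =\<^sub>D T \<Longrightarrow> test_function \<phi> \<Longrightarrow> S \<phi> = T \<phi>"
  by (simp add: dist_eq_def)

lemma dist_deriv_cong: "S =\<^sub>D T \<Longrightarrow> dist_deriv S =\<^sub>D dist_deriv T"
  by (simp add: dist_eq_def dist_deriv_def test_function_deriv)

lemma seminorm_nonneg: "test_function \<phi> \<Longrightarrow> 0 \<le> (\<Sum>n\<le>N. SUP x. \<bar>(deriv ^^ n) \<phi> x\<bar>)"
  by (intro sum_nonneg order_trans[OF abs_ge_zero higher_deriv_le_SUP])

text \<open>Differentiation does not enlarge the support of a test function and shifts every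
  seminorm by one index, so the order of the continuity bound grows by one.\<close>

lemma causal_distribution_deriv:
  assumes "causal_distribution T"
  shows "causal_distribution (dist_deriv T)"
  unfolding causal_distribution_def is_distribution_def
proof (intro conjI allI impI)
  have T: "is_distribution T" using assms by (simp add: causal_distribution_def)
  {
    fix \<phi> \<psi> a b assume "test_function \<phi> \<and> test_function \<psi>"
    thus "dist_deriv T (\<lambda>x. a * \<phi> x + b * \<psi> x) = a * dist_deriv T \<phi> + b * dist_deriv T \<psi>"
      using is_distribution_lincomb[OF T, of "deriv \<phi>" "deriv \<psi>" a b]
      by (simp add: dist_deriv_def deriv_lincomb test_function_smooth test_function_deriv)
  next
    fix K :: "real set" assume "compact K"
    with T obtain C N where CN: "\<forall>\<phi>. test_function \<phi> \<and> support \<phi> \<subseteq> K \<longrightarrow>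
        \<bar>T \<phi>\<bar> \<le> C * (\<Sum>n\<le>N. SUP x. \<bar>(deriv ^^ n) \<phi> x\<bar>)" unfolding is_distribution_def by meson
    show "\<exists>C N. \<forall>\<phi>. test_function \<phi> \<and> support \<phi> \<subseteq> K \<longrightarrow>
        \<bar>dist_deriv T \<phi>\<bar> \<le> C * (\<Sum>n\<le>N. SUP x. \<bar>(deriv ^^ n) \<phi> x\<bar>)"
    proof (intro exI allI impI, elim conjE)
      fix \<phi> assume \<phi>: "test_function \<phi>" "support \<phi> \<subseteq> K"
      have "\<bar>dist_deriv T \<phi>\<bar> \<le> C * (\<Sum>n\<le>N. SUP x. \<bar>(deriv ^^ n) (deriv \<phi>) x\<bar>)"
        using CN test_function_deriv[OF \<phi>(1)] support_deriv_subset[of \<phi>] \<phi>(2)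
        by (auto simp: dist_deriv_def)
      also have "\<dots> \<le> \<bar>C\<bar> * (\<Sum>n\<le>N. SUP x. \<bar>(deriv ^^ n) (deriv \<phi>) x\<bar>)"
        by (rule mult_right_mono[OF abs_ge_self seminorm_nonneg[OF test_function_deriv[OF \<phi>(1)]]])
      also have "(\<Sum>n\<le>N. SUP x. \<bar>(deriv ^^ n) (deriv \<phi>) x\<bar>) = (\<Sum>n\<le>N. SUP x. \<bar>(deriv ^^ Suc n) \<phi> x\<bar>)"
        by (simp only: funpow_Suc_right comp_apply)
      also have "\<dots> \<le> (\<Sum>n\<le>Suc N. SUP x. \<bar>(deriv ^^ n) \<phi> x\<bar>)"
        unfolding sum.atMost_Suc_shift[of _ N]
        using seminorm_nonneg[OF \<phi>(1), of 0] by simp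
      finally show "\<bar>dist_deriv T \<phi>\<bar> \<le> \<bar>C\<bar> * (\<Sum>n\<le>Suc N. SUP x. \<bar>(deriv ^^ n) \<phi> x\<bar>)"
        by (simp add: mult_left_mono)
    qed
  next
    fix \<phi> assume "test_function \<phi> \<and> support \<phi> \<subseteq> {..<0}"
    hence "test_function (deriv \<phi>) \<and> support (deriv \<phi>) \<subseteq> {..<0}"
      using test_function_deriv[of \<phi>] order_trans[OF support_deriv_subset[of \<phi>]] by simp
    hence "T (deriv \<phi>) = 0" using assms unfolding causal_distribution_def by blast
    thus "dist_deriv T \<phi> = 0" by (simp add: dist_deriv_def)
  }
qed

section \<open>Locally bounded functions as distributions\<close>

definition locally_bounded :: "(real \<Rightarrow> real) \<Rightarrow> bool" where
  "locally_bounded g \<longleftrightarrow> g \<in> borel_measurable borel \<and> (\<forall>R. \<exists>B. \<forall>x\<in>{-R..R}. \<bar>g x\<bar> \<le> B)"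

lemma locally_bounded_dominated:
  assumes g: "locally_bounded g"
  shows "\<exists>h. integrable lborel h \<and> (\<forall>x. 0 \<le> h x) \<and> (\<forall>x\<in>{-R..R}. \<bar>g x\<bar> \<le> h x)"
proof -
  obtain B where B: "\<forall>x\<in>{-R..R}. \<bar>g x\<bar> \<le> B" using g unfolding locally_bounded_def by blast
  have "integrable lborel (\<lambda>x. indicator {-R..R} x * \<bar>B\<bar>)"
    by (intro integrable_mult_left integrable_real_indicator) (auto simp: emeasure_lborel_Icc_eq)
  moreover have "\<bar>g x\<bar> \<le> indicator {-R..R} x * \<bar>B\<bar>" if "x \<in> {-R..R}" for x
    using bspec[OF B that] that by simp
  moreover have "0 \<le> indicator {-R..R} x * \<bar>B\<bar>" for x :: real by simp
  ultimately show ?thesis by blast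
qed

lemma locally_bounded_integrable:
  assumes g: "locally_bounded g" and \<psi>: "continuous_on UNIV \<psi>" "\<And>x. x \<notin> {-R..R} \<Longrightarrow> \<psi> x = 0"
  shows "integrable lborel (\<lambda>x. g x * \<psi> x)"
proof -
  obtain h where h1: "integrable lborel h" and h2: "\<forall>x. 0 \<le> h x" and h3: "\<forall>x\<in>{-R..R}. \<bar>g x\<bar> \<le> h x"
    using locally_bounded_dominated[OF g] by blast
  note h = h1 h2[rule_format] h3[rule_format]
  have "compact (\<psi> ` {-R..R})" by (intro compact_continuous_image continuous_on_subset[OF \<psi>(1)]) auto
  then obtain C where C: "C > 0" "\<forall>x\<in>{-R..R}. \<bar>\<psi> x\<bar> \<le> C" by (auto dest!: compact_imp_bounded simp: bounded_pos)
  have [measurable]: "g \<in> borel_measurable borel" "\<psi> \<in> borel_measurable borel"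
    using g borel_measurable_continuous_onI[OF \<psi>(1)] by (auto simp: locally_bounded_def)
  have "norm (g x * \<psi> x) \<le> norm (h x * C)" for x
  proof (cases "x \<in> {-R..R}")
    case True
    thus ?thesis using h(2,3)[of x] C by (auto simp: abs_mult intro!: mult_mono)
  qed (use \<psi>(2) in auto)
  thus ?thesis
    by (intro Bochner_Integration.integrable_bound[OF integrable_mult_left[OF h(1), of C]]) auto
qed

lemma locally_bounded_test_integrable:
  assumes "locally_bounded g" "test_function \<phi>"
  shows "integrable lborel (\<lambda>x. g x * \<phi> x)"
proof -
  obtain R where R: "\<forall>x. x \<notin> {-R..R} \<longrightarrow> \<phi> x = 0" using test_function_bounds[OF assms(2)] by blast
  show ?thesis
    by (rule locally_bounded_integrable[OF assms(1) smooth_continuous[OF test_function_smooth[OF assms(2)]]])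
       (use R in blast)
qed

lemma causal_distribution_of:
  assumes g: "locally_bounded g" and null: "\<And>t. t < 0 \<Longrightarrow> g t = 0"
  shows "causal_distribution (dist_of g)"
  unfolding causal_distribution_def is_distribution_def
proof (intro conjI allI impI)
  fix \<phi> \<psi> a b assume t: "test_function \<phi> \<and> test_function \<psi>"
  have "(\<lambda>t. g t * (a * \<phi> t + b * \<psi> t)) = (\<lambda>t. a * (g t * \<phi> t) + b * (g t * \<psi> t))"
    by (simp add: algebra_simps)
  thus "dist_of g (\<lambda>x. a * \<phi> x + b * \<psi> x) = a * dist_of g \<phi> + b * dist_of g \<psi>"
    using locally_bounded_test_integrable[OF g, of \<phi>] locally_bounded_test_integrable[OF g, of \<psi>] t
    by (simp add: dist_of_def)
next
  fix K :: "real set" assume "compact K"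
  then obtain R where R: "\<forall>x\<in>K. norm x \<le> R" using compact_imp_bounded bounded_iff by metis
  obtain h where h1: "integrable lborel h" and h2: "\<forall>x. 0 \<le> h x" and h3: "\<forall>x\<in>{-R..R}. \<bar>g x\<bar> \<le> h x"
    using locally_bounded_dominated[OF g] by blast
  note h = h1 h2[rule_format] h3[rule_format]
  show "\<exists>C N. \<forall>\<phi>. test_function \<phi> \<and> support \<phi> \<subseteq> K \<longrightarrow>
        \<bar>dist_of g \<phi>\<bar> \<le> C * (\<Sum>n\<le>N. SUP x. \<bar>(deriv ^^ n) \<phi> x\<bar>)"
  proof (intro exI allI impI, elim conjE)
    fix \<phi> assume \<phi>: "test_function \<phi>" "support \<phi> \<subseteq> K"
    define S where "S = (SUP x. \<bar>\<phi> x\<bar>)"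
    have S: "\<bar>\<phi> x\<bar> \<le> S" for x using higher_deriv_le_SUP[OF \<phi>(1), of 0] by (simp add: S_def)
    have "\<bar>g x * \<phi> x\<bar> \<le> h x * S" for x
    proof (cases "x \<in> K")
      case True
      hence "x \<in> {-R..R}" using R by (auto simp: abs_le_iff)
      thus ?thesis using h(2,3)[of x] S[of x] by (auto simp: abs_mult intro!: mult_mono)
    next
      case False
      hence "\<phi> x = 0" using \<phi>(2) support_ext[of x \<phi>] by blast
      thus ?thesis using h(2)[of x] S[of x] by simp
    qed
    hence "(LBINT x. \<bar>g x * \<phi> x\<bar>) \<le> (LBINT x. h x * S)"
      by (intro integral_mono integrable_abs locally_bounded_test_integrable g \<phi> integrable_mult_left h)
    hence "\<bar>dist_of g \<phi>\<bar> \<le> (LBINT x. h x) * S"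
      unfolding dist_of_def using order_trans[OF integral_abs_bound[of lborel "\<lambda>x. g x * \<phi> x"]] by simp
    thus "\<bar>dist_of g \<phi>\<bar> \<le> (LBINT x. h x) * (\<Sum>n\<le>0. SUP x. \<bar>(deriv ^^ n) \<phi> x\<bar>)" by (simp add: S_def)
  qed
next
  fix \<phi> assume \<phi>: "test_function \<phi> \<and> support \<phi> \<subseteq> {..<0}"
  have "g t * \<phi> t = 0" for t
    using null[of t] \<phi> support_ext[of t \<phi>] by (cases "t < 0") auto
  hence "(\<lambda>t. g t * \<phi> t) = (\<lambda>t. 0)" by (rule ext)
  thus "dist_of g \<phi> = 0" unfolding dist_of_def by simp
qed

section \<open>Distributions applied to translates of a test function\<close>

text \<open>Two uses of the mean value theorem: the quotient is the derivative at some \<xi>, and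
  its distance to the derivative at \<open>x\<close> is controlled by the second derivative. The
  estimate is uniform in \<open>x\<close>, as the seminorms of a distribution require.\<close>

lemma difference_quotient_bound:
  fixes \<psi> :: "real \<Rightarrow> real"
  assumes \<psi>: "smooth \<psi>" and B: "\<And>x. \<bar>deriv (deriv \<psi>) x\<bar> \<le> B" and e: "e \<noteq> 0"
  shows "\<bar>(\<psi> (x + e) - \<psi> x) / e - deriv \<psi> x\<bar> \<le> \<bar>e\<bar> * B"
proof -
  have mvt: "\<exists>\<xi>. \<bar>\<xi> - x\<bar> \<le> \<bar>e\<bar> \<and> f (x + e) - f x = e * deriv f \<xi>" if f: "smooth f" for f e
  proof (cases "e = 0")
    case False
    then consider "e > 0" | "e < 0" by linarith
    thus ?thesis
    proof cases
      case 1
      then obtain z where "x < z" "z < x + e" "f (x + e) - f x = (x + e - x) * deriv f z"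
        using MVT2[of x "x + e" f "deriv f"] smooth_DERIV[OF f] by auto
      thus ?thesis by (intro exI[of _ z]) auto
    next
      case 2
      then obtain z where "x + e < z" "z < x" "f x - f (x + e) = (x - (x + e)) * deriv f z"
        using MVT2[of "x + e" x f "deriv f"] smooth_DERIV[OF f] by auto
      thus ?thesis by (intro exI[of _ z]) (auto simp: algebra_simps)
    qed
  qed (auto intro: exI[of _ x])
  obtain \<xi> where \<xi>: "\<bar>\<xi> - x\<bar> \<le> \<bar>e\<bar>" "\<psi> (x + e) - \<psi> x = e * deriv \<psi> \<xi>" using mvt[OF \<psi>, of e] by blast
  obtain \<zeta> where \<zeta>: "deriv \<psi> (x + (\<xi> - x)) - deriv \<psi> x = (\<xi> - x) * deriv (deriv \<psi>) \<zeta>"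
    using mvt[OF smooth_deriv[OF \<psi>], of "\<xi> - x"] by blast
  have "(\<psi> (x + e) - \<psi> x) / e - deriv \<psi> x = (\<xi> - x) * deriv (deriv \<psi>) \<zeta>"
    using \<xi>(2) \<zeta> e by simp
  thus ?thesis using \<xi>(1) B[of \<zeta>] by (simp add: abs_mult mult_mono)
qed

text \<open>The difference quotients of the translates converge in every seminorm at the rate
  \<open>\<bar>e\<bar>\<close>, each derivative being estimated by the derivative two orders higher.
  One continuity bound of \<open>T\<close> on a fixed compact set then transfers the
  convergence.\<close>

lemma distribution_shift_DERIV:
  assumes T: "is_distribution T" and \<phi>: "test_function \<phi>"
  shows "((\<lambda>s. T (\<lambda>y. \<phi> (s + y))) has_real_derivative T (\<lambda>y. deriv \<phi> (s + y))) (at s)"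
proof -
  note sm = test_function_smooth[OF \<phi>]
  obtain R where R: "R > 0" "\<forall>x. x \<notin> {-R..R} \<longrightarrow> \<phi> x = 0" using test_function_bounds[OF \<phi>] by blast
  \<comment> \<open>The margin 1 makes \<open>K\<close> contain the supports of all translates with
    \<open>\<bar>e\<bar> \<le> 1\<close>, so that one pair \<open>C\<close>, \<open>N\<close> serves
    for all of them.\<close>
  define K where "K = {-R - \<bar>s\<bar> - 1..R + \<bar>s\<bar> + 1}"
  have "compact K" by (simp add: K_def)
  with T obtain C N where CN: "\<forall>\<phi>. test_function \<phi> \<and> support \<phi> \<subseteq> K \<longrightarrow>
        \<bar>T \<phi>\<bar> \<le> C * (\<Sum>n\<le>N. SUP x. \<bar>(deriv ^^ n) \<phi> x\<bar>)" unfolding is_distribution_def by meson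
  have "\<forall>n. \<exists>B\<ge>0. \<forall>x. \<bar>(deriv ^^ n) \<phi> x\<bar> \<le> B" using higher_deriv_bounded[OF \<phi>] by blast
  then obtain B where B: "\<And>n. B n \<ge> 0" "\<And>n x. \<bar>(deriv ^^ n) \<phi> x\<bar> \<le> B n" by metis
  \<comment> \<open>The error of the difference quotient, nested as two-term combinations so that
    linearity of \<open>T\<close> and of the higher derivatives applies literally.\<close>
  define q where "q e = (\<lambda>y. 1 * ((1 / e) * \<phi> ((s + e) + y) + (- 1 / e) * \<phi> (s + y)) + (- 1) * deriv \<phi> (s + y))" for e
  note tf = test_function_shift[OF \<phi>] test_function_shift[OF test_function_deriv[OF \<phi>]]
  have tfq: "test_function (q e)" for e
    unfolding q_def by (intro test_function_lincomb tf)
  have Tq: "T (q e) = (T (\<lambda>y. \<phi> (s + e + y)) - T (\<lambda>y. \<phi> (s + y))) / e - T (\<lambda>y. deriv \<phi> (s + y))" for e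
    unfolding q_def
    by (simp only: is_distribution_lincomb[OF T] tf test_function_lincomb) (simp add: diff_divide_distrib)
  have bound: "\<bar>T (q e)\<bar> \<le> \<bar>e\<bar> * (\<bar>C\<bar> * (\<Sum>n\<le>N. B (Suc (Suc n))))" if e: "e \<noteq> 0" "\<bar>e\<bar> \<le> 1" for e
  proof -
    have "support (q e) \<subseteq> K"
    proof (rule support_subsetI)
      fix x assume x: "x \<notin> K"
      hence "s + e + x \<notin> {-R..R}" "s + x \<notin> {-R..R}" using e by (auto simp: K_def abs_if split: if_splits)
      moreover from this(2) have "deriv \<phi> (s + x) = 0" using deriv_outside_0[of R \<phi> "s + x"] R(2) by blast
      ultimately show "q e x = 0" using R(2) by (simp add: q_def)
    qed (simp add: K_def)
    hence "\<bar>T (q e)\<bar> \<le> C * (\<Sum>n\<le>N. SUP x. \<bar>(deriv ^^ n) (q e) x\<bar>)" using CN tfq by blast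
    also have "\<dots> \<le> \<bar>C\<bar> * (\<Sum>n\<le>N. SUP x. \<bar>(deriv ^^ n) (q e) x\<bar>)"
      by (rule mult_right_mono[OF abs_ge_self seminorm_nonneg[OF tfq]])
    also have "(\<Sum>n\<le>N. SUP x. \<bar>(deriv ^^ n) (q e) x\<bar>) \<le> (\<Sum>n\<le>N. \<bar>e\<bar> * B (Suc (Suc n)))"
    proof (intro sum_mono cSUP_least)
      fix n x
      let ?\<psi> = "(deriv ^^ n) \<phi>"
      have sms: "smooth (\<lambda>y. \<phi> (c + y))" "smooth (\<lambda>y. deriv \<phi> (c + y))" for c
        using tf by (auto intro: test_function_smooth)
      have "(deriv ^^ n) (q e) x = 1 * ((1 / e) * ?\<psi> ((s + e) + x) + (- 1 / e) * ?\<psi> (s + x)) + (- 1) * (deriv ^^ n) (deriv \<phi>) (s + x)"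
        unfolding q_def
        by (subst higher_deriv_lincomb, intro smooth_add smooth_mult smooth_const sms, rule sms,
            subst higher_deriv_lincomb, (rule sms)+)
           (simp only: higher_deriv_shift sm smooth_deriv)
      also have "(deriv ^^ n) (deriv \<phi>) = deriv ?\<psi>" by (simp add: funpow_swap1)
      also have "1 * ((1 / e) * ?\<psi> ((s + e) + x) + (- 1 / e) * ?\<psi> (s + x)) + (- 1) * deriv ?\<psi> (s + x)
        = (?\<psi> ((s + x) + e) - ?\<psi> (s + x)) / e - deriv ?\<psi> (s + x)"
        by (simp add: diff_divide_distrib algebra_simps)
      finally have "(deriv ^^ n) (q e) x = (?\<psi> ((s + x) + e) - ?\<psi> (s + x)) / e - deriv ?\<psi> (s + x)" .
      moreover have "\<bar>deriv (deriv ?\<psi>) z\<bar> \<le> B (Suc (Suc n))" for z using B(2)[of "Suc (Suc n)" z] by simp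
      ultimately show "\<bar>(deriv ^^ n) (q e) x\<bar> \<le> \<bar>e\<bar> * B (Suc (Suc n))"
        using difference_quotient_bound[OF smooth_higher[OF sm, of n], where e = e and x = "s + x"] e by simp
    qed simp
    finally show ?thesis by (simp add: sum_distrib_left mult.left_commute mult_left_mono)
  qed
  have "(\<lambda>e. T (q e)) \<midarrow>0\<rightarrow> 0"
  proof (rule Lim_null_comparison)
    show "\<forall>\<^sub>F e in at 0. norm (T (q e)) \<le> \<bar>e\<bar> * (\<bar>C\<bar> * (\<Sum>n\<le>N. B (Suc (Suc n))))"
      unfolding eventually_at by (intro exI[of _ 1]) (use bound in \<open>auto simp: dist_real_def\<close>)
    show "(\<lambda>e. \<bar>e\<bar> * (\<bar>C\<bar> * (\<Sum>n\<le>N. B (Suc (Suc n))))) \<midarrow>0\<rightarrow> 0"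
      by (auto intro!: tendsto_eq_intros)
  qed
  thus ?thesis unfolding DERIV_def using Tq by (simp add: LIM_zero_iff)
qed

text \<open>For large \<open>s\<close> the translate is supported in the negative half-line. For
  \<open>s\<close> tending to minus infinity nothing of the kind holds, so
  \<open>s \<mapsto> T (\<lambda>y. \<phi> (s + y))\<close> is in general no test function.\<close>

lemma causal_shift_eventually_0:
  assumes T: "causal_distribution T" and \<phi>: "test_function \<phi>"
  shows "\<exists>b. \<forall>s>b. T (\<lambda>y. \<phi> (s + y)) = 0"
proof -
  obtain R where R: "R > 0" "\<forall>x. x \<notin> {-R..R} \<longrightarrow> \<phi> x = 0" using test_function_bounds[OF \<phi>] by blast
  show ?thesis
  proof (intro exI allI impI)
    fix s assume s: "s > R"
    have "support (\<lambda>y. \<phi> (s + y)) \<subseteq> {..R - s}"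
      by (rule support_subsetI) (use R(2) in auto)
    also have "\<dots> \<subseteq> {..<0}" using s by auto
    finally show "T (\<lambda>y. \<phi> (s + y)) = 0"
      using T test_function_shift[OF \<phi>] by (auto simp: causal_distribution_def)
  qed
qed

text \<open>A vanishing derivative makes \<open>T\<close> constant along translates of a test
  function, and causality forces the constant to be 0 because the translate eventually leaves the
  half-line. Causal primitives are therefore unique.\<close>

lemma causal_deriv_eq_0:
  assumes T: "causal_distribution T" and 0: "dist_deriv T =\<^sub>D (\<lambda>\<phi>. 0)"
  shows "T =\<^sub>D (\<lambda>\<phi>. 0)"
  unfolding dist_eq_def
proof (intro allI impI)
  fix \<phi> assume \<phi>: "test_function \<phi>"
  define G where "G s = T (\<lambda>y. \<phi> (s + y))" for s
  have "T (\<lambda>y. deriv \<phi> (s + y)) = 0" for s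
    using dist_eqD[OF 0 test_function_shift[OF \<phi>, of s]]
    by (simp add: dist_deriv_def deriv_shift test_function_smooth[OF \<phi>])
  hence "(G has_real_derivative 0) (at s)" for s
    using distribution_shift_DERIV[OF _ \<phi>, of T s] T unfolding G_def by (simp add: causal_distribution_def)
  hence const: "G x = G y" for x y by (intro DERIV_isconst_all allI)
  obtain b where "\<forall>s>b. G s = 0" using causal_shift_eventually_0[OF T \<phi>] unfolding G_def by blast
  hence "G (b + 1) = 0" by simp
  hence "G 0 = 0" using const by metis
  thus "T \<phi> = 0" by (simp add: G_def)
qed

lemma causal_distribution_diff:
  assumes "causal_distribution S" "causal_distribution T"
  shows "causal_distribution (\<lambda>\<phi>. S \<phi> - T \<phi>)"
  unfolding causal_distribution_def is_distribution_def
proof (intro conjI allI impI)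
  have ST: "is_distribution S" "is_distribution T" using assms by (auto simp: causal_distribution_def)
  {
    fix \<phi> \<psi> a b assume "test_function \<phi> \<and> test_function \<psi>"
    thus "S (\<lambda>x. a * \<phi> x + b * \<psi> x) - T (\<lambda>x. a * \<phi> x + b * \<psi> x) = a * (S \<phi> - T \<phi>) + b * (S \<psi> - T \<psi>)"
      using ST by (simp add: is_distribution_lincomb algebra_simps)
  next
    fix K :: "real set" assume K: "compact K"
    from ST(1) K obtain C N where 1: "\<forall>\<phi>. test_function \<phi> \<and> support \<phi> \<subseteq> K \<longrightarrow>
        \<bar>S \<phi>\<bar> \<le> C * (\<Sum>n\<le>N. SUP x. \<bar>(deriv ^^ n) \<phi> x\<bar>)" unfolding is_distribution_def by meson
    from ST(2) K obtain D M where 2: "\<forall>\<phi>. test_function \<phi> \<and> support \<phi> \<subseteq> K \<longrightarrow>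
        \<bar>T \<phi>\<bar> \<le> D * (\<Sum>n\<le>M. SUP x. \<bar>(deriv ^^ n) \<phi> x\<bar>)" unfolding is_distribution_def by meson
    show "\<exists>C N. \<forall>\<phi>. test_function \<phi> \<and> support \<phi> \<subseteq> K \<longrightarrow>
        \<bar>S \<phi> - T \<phi>\<bar> \<le> C * (\<Sum>n\<le>N. SUP x. \<bar>(deriv ^^ n) \<phi> x\<bar>)"
    proof (intro exI allI impI, elim conjE)
      fix \<phi> assume \<phi>: "test_function \<phi>" "support \<phi> \<subseteq> K"
      let ?s = "\<lambda>N. \<Sum>n\<le>N. SUP x. \<bar>(deriv ^^ n) \<phi> x\<bar>"
      have mono: "E * ?s N \<le> \<bar>E\<bar> * ?s (max N M)" "E * ?s M \<le> \<bar>E\<bar> * ?s (max N M)" for E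
      proof -
        have "?s k \<le> ?s (max N M)" if "k \<le> max N M" for k
          by (rule sum_mono2) (use that order_trans[OF abs_ge_zero higher_deriv_le_SUP[OF \<phi>(1)]] in auto)
        thus "E * ?s N \<le> \<bar>E\<bar> * ?s (max N M)" "E * ?s M \<le> \<bar>E\<bar> * ?s (max N M)"
          by (auto intro!: mult_mono seminorm_nonneg[OF \<phi>(1)])
      qed
      have "\<bar>S \<phi> - T \<phi>\<bar> \<le> C * ?s N + D * ?s M" using 1[rule_format, of \<phi>] 2[rule_format, of \<phi>] \<phi> abs_triangle_ineq4[of "S \<phi>" "T \<phi>"] by linarith
      also have "\<dots> \<le> (\<bar>C\<bar> + \<bar>D\<bar>) * ?s (max N M)" using mono(1)[of C] mono(2)[of D] by (simp add: distrib_right)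
      finally show "\<bar>S \<phi> - T \<phi>\<bar> \<le> (\<bar>C\<bar> + \<bar>D\<bar>) * ?s (max N M)" .
    qed
  next
    fix \<phi> assume "test_function \<phi> \<and> support \<phi> \<subseteq> {..<0}"
    thus "S \<phi> - T \<phi> = 0" using assms by (simp add: causal_distribution_def)
  }
qed

lemma causal_deriv_inject:
  assumes S: "causal_distribution S" and T: "causal_distribution T"
    and eq: "dist_deriv S =\<^sub>D dist_deriv T"
  shows "S =\<^sub>D T"
proof -
  have "(\<lambda>\<phi>. S \<phi> - T \<phi>) =\<^sub>D (\<lambda>\<phi>. 0)"
    by (rule causal_deriv_eq_0[OF causal_distribution_diff[OF S T]])
       (use eq in \<open>simp add: dist_eq_def dist_deriv_def\<close>)
  thus ?thesis by (simp add: dist_eq_def)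
qed

section \<open>Convolution with a causal function\<close>

lemma cutoff_eq_1: "-1 \<le> x \<Longrightarrow> cutoff x = 1"
  using flat_exp_0[of "-1 - x"] flat_exp_pos[of "x + 2"] by (simp add: cutoff_def)

lemma convolution_dist_of:
  assumes null: "\<And>t. t < 0 \<Longrightarrow> f t = 0"
  shows "(dist_of f \<star> T) \<phi> = (LBINT t. f t * T (\<lambda>y. \<phi> (t + y)))"
proof -
  have "f t * (cutoff t * T (\<lambda>y. \<phi> (t + y))) = f t * T (\<lambda>y. \<phi> (t + y))" for t
    using null[of t] cutoff_eq_1[of t] by (cases "t < 0") auto
  thus ?thesis by (simp only: convolution_def dist_of_def)
qed

text \<open>Near the half-line that carries \<open>f\<close> the factor \<open>cutoff\<close> is 1,
  so its own derivative is not seen. Both derivatives fall on the test function and the two signs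
  cancel.\<close>

lemma convolution_dist_deriv:
  assumes null: "\<And>t. t < 0 \<Longrightarrow> f t = 0" and r: "is_distribution r" and \<phi>: "test_function \<phi>"
  shows "(dist_deriv (dist_of f) \<star> dist_deriv r) \<phi> = (LBINT t. f t * r (\<lambda>y. deriv (deriv \<phi>) (t + y)))"
proof -
  note \<phi>' = test_function_deriv[OF \<phi>]
  define G where "G x = - r (\<lambda>y. deriv \<phi> (x + y))" for x
  have eqG: "dist_deriv r (\<lambda>y. \<phi> (x + y)) = G x" for x
    by (simp add: dist_deriv_def G_def deriv_shift test_function_smooth[OF \<phi>])
  have DG: "(G has_real_derivative - r (\<lambda>y. deriv (deriv \<phi>) (x + y))) (at x)" for x
    unfolding G_def by (intro DERIV_minus distribution_shift_DERIV[OF r \<phi>'])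
  have "deriv (\<lambda>x. cutoff x * G x) t = - r (\<lambda>y. deriv (deriv \<phi>) (t + y))" if t: "t \<ge> 0" for t
  proof -
    have "\<forall>\<^sub>F x in nhds t. x \<in> {-1<..}" by (rule eventually_nhds_in_open) (use t in auto)
    hence "\<forall>\<^sub>F x in nhds t. cutoff x * G x = G x" by eventually_elim (simp add: cutoff_eq_1)
    from deriv_cong_ev[OF this refl] show ?thesis using DERIV_imp_deriv[OF DG] by simp
  qed
  hence eq: "f t * deriv (\<lambda>x. cutoff x * G x) t = - (f t * r (\<lambda>y. deriv (deriv \<phi>) (t + y)))" for t
    using null[of t] by (cases "t < 0") auto
  have "(dist_deriv (dist_of f) \<star> dist_deriv r) \<phi> = - (LBINT t. f t * deriv (\<lambda>x. cutoff x * G x) t)"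
    unfolding convolution_def eqG unfolding dist_deriv_def dist_of_def ..
  thus ?thesis unfolding eq by simp
qed

section \<open>Families of measures depending quadratically on a vector\<close>

text \<open>The polarization identity, written for an arbitrary \<open>F\<close>. It is the matrix
  of a quadratic form only if \<open>F\<close> is \<open>quadratic\<close>.\<close>

definition polar :: "(real^'m::finite \<Rightarrow> real) \<Rightarrow> 'm \<Rightarrow> 'm \<Rightarrow> real" where
  "polar F i j = (F (axis i 1 + axis j 1) - F (axis i 1 - axis j 1)) / 4"

definition quadratic :: "(real^'m::finite \<Rightarrow> real) \<Rightarrow> bool" where
  "quadratic F \<longleftrightarrow> (\<forall>v. F v = (\<Sum>i\<in>UNIV. \<Sum>j\<in>UNIV. v $ i * v $ j * polar F i j))"

definition half_line_measure :: "real measure \<Rightarrow> bool" where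
  "half_line_measure \<mu> \<longleftrightarrow> sets \<mu> = sets borel \<and> emeasure \<mu> (- {0<..}) = 0"

text \<open>A signed measure is meaningful only on relatively compact sets, so statements about
  arbitrary Borel sets are reached as limits along these intervals.\<close>

definition rc_exhaustion :: "nat \<Rightarrow> real set" where
  "rc_exhaustion n = {inverse (real (Suc n))..real (Suc n)}"

lemma rc_exhaustion_borel [measurable, simp]: "rc_exhaustion n \<in> sets borel"
  by (simp add: rc_exhaustion_def)

lemma rc_borel_exhaustion: "E \<in> sets borel \<Longrightarrow> rc_borel (E \<inter> rc_exhaustion n)"
  unfolding rc_borel_def
  by (intro conjI exI[of _ "rc_exhaustion n"])
     (auto simp: rc_exhaustion_def intro: less_le_trans[of 0 "inverse (1 + real n)"])

lemma incseq_exhaustion: "incseq rc_exhaustion"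
proof (intro monoI subsetI)
  fix m n :: nat and x :: real assume "m \<le> n" "x \<in> rc_exhaustion m"
  moreover from \<open>m \<le> n\<close> have i: "inverse (real (Suc n)) \<le> inverse (real (Suc m))"
    by (intro le_imp_inverse_le) auto
  ultimately show "x \<in> rc_exhaustion n"
    unfolding rc_exhaustion_def by (auto simp del: of_nat_Suc simp add: of_nat_le_iff intro: order_trans[OF i])
qed

lemma UN_exhaustion: "(\<Union>n. rc_exhaustion n) = {0<..}"
proof (intro equalityI subsetI)
  fix x :: real assume "x \<in> (\<Union>n. rc_exhaustion n)"
  then obtain n where "inverse (real (Suc n)) \<le> x" by (auto simp: rc_exhaustion_def simp del: of_nat_Suc)
  have "0 < inverse (real (Suc n))" by simp
  also note \<open>inverse (real (Suc n)) \<le> x\<close>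
  finally show "x \<in> {0<..}" by simp
next
  fix x :: real assume "x \<in> {0<..}"
  hence x: "x > 0" by simp
  obtain n where n: "max x (inverse x) < real n" using reals_Archimedean2 by blast
  have "inverse (real (Suc n)) \<le> inverse (inverse x)"
    by (rule le_imp_inverse_le) (use n x in auto)
  hence "x \<in> rc_exhaustion n" using n x unfolding rc_exhaustion_def by simp
  thus "x \<in> (\<Union>n. rc_exhaustion n)" by blast
qed

lemma half_line_emeasure_limit:
  assumes "half_line_measure \<mu>" and E: "E \<in> sets borel"
  shows "(\<lambda>n. emeasure \<mu> (E \<inter> rc_exhaustion n)) \<longlonglongrightarrow> emeasure \<mu> E"
proof -
  from assms have s: "sets \<mu> = sets borel" and z: "emeasure \<mu> (- {0<..}) = 0"
    by (auto simp: half_line_measure_def)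
  have "(\<lambda>n. emeasure \<mu> (E \<inter> rc_exhaustion n)) \<longlonglongrightarrow> emeasure \<mu> (\<Union>n. E \<inter> rc_exhaustion n)"
  proof (rule Lim_emeasure_incseq)
    show "range (\<lambda>i. E \<inter> rc_exhaustion i) \<subseteq> sets \<mu>"
      unfolding s using sets.Int[OF E rc_exhaustion_borel] by blast
    show "incseq (\<lambda>i. E \<inter> rc_exhaustion i)"
    proof (rule monoI)
      fix m n :: nat assume "m \<le> n"
      from monoD[OF incseq_exhaustion this] show "E \<inter> rc_exhaustion m \<subseteq> E \<inter> rc_exhaustion n" by (rule Int_mono[OF order_refl])
    qed
  qed
  also have "(\<Union>n. E \<inter> rc_exhaustion n) = E \<inter> {0<..}" by (simp only: UN_exhaustion Int_UN_distrib[symmetric])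
  also have "emeasure \<mu> (E \<inter> {0<..}) = emeasure \<mu> E"
  proof -
    have "emeasure \<mu> (E - - {0<..}) = emeasure \<mu> E"
      by (rule emeasure_Diff_null_set) (use s E z in \<open>auto simp: null_sets_def\<close>)
    thus ?thesis by (simp add: Diff_eq)
  qed
  finally show ?thesis .
qed

lemma tendsto_sum_cmult_ennreal:
  fixes c :: "'i \<Rightarrow> ennreal"
  assumes "\<And>i. i \<in> I \<Longrightarrow> c i < top" "\<And>i. i \<in> I \<Longrightarrow> ((\<lambda>n. f i n) \<longlongrightarrow> l i) F"
  shows "((\<lambda>n. \<Sum>i\<in>I. c i * f i n) \<longlongrightarrow> (\<Sum>i\<in>I. c i * l i)) F"
  using assms by (intro tendsto_sum ennreal_tendsto_cmult)

text \<open>Induction over nonnegative measurable functions. Keeping nonnegative coefficients on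
  both sides avoids every subtraction, so the measures themselves may be infinite. Finiteness of the
  coefficients enters in the monotone limit.\<close>

lemma nn_integral_combination_le:
  fixes \<mu> :: "'i \<Rightarrow> 'a measure" and \<nu> :: "'j \<Rightarrow> 'a measure" and c d :: "_ \<Rightarrow> ennreal"
  assumes c: "\<And>i. i \<in> I \<Longrightarrow> c i < top" and d: "\<And>j. j \<in> J \<Longrightarrow> d j < top"
    and \<mu>: "\<And>i. i \<in> I \<Longrightarrow> sets (\<mu> i) = sets M" and \<nu>: "\<And>j. j \<in> J \<Longrightarrow> sets (\<nu> j) = sets M"
    and le: "\<And>E. E \<in> sets M \<Longrightarrow> (\<Sum>i\<in>I. c i * emeasure (\<mu> i) E) \<le> (\<Sum>j\<in>J. d j * emeasure (\<nu> j) E)"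
    and f: "f \<in> borel_measurable M"
  shows "(\<Sum>i\<in>I. c i * (\<integral>\<^sup>+x. f x \<partial>\<mu> i)) \<le> (\<Sum>j\<in>J. d j * (\<integral>\<^sup>+x. f x \<partial>\<nu> j))"
  using f
proof (induction rule: borel_measurable_induct)
  case (cong f g)
  have "(\<integral>\<^sup>+x. f x \<partial>\<mu> i) = (\<integral>\<^sup>+x. g x \<partial>\<mu> i)" if "i \<in> I" for i
    by (rule nn_integral_cong) (use cong(3) sets_eq_imp_space_eq[OF \<mu>[OF that]] in auto)
  moreover have "(\<integral>\<^sup>+x. f x \<partial>\<nu> i) = (\<integral>\<^sup>+x. g x \<partial>\<nu> i)" if "i \<in> J" for i
    by (rule nn_integral_cong) (use cong(3) sets_eq_imp_space_eq[OF \<nu>[OF that]] in auto)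
  ultimately show ?case using cong(4) by simp
next
  case (set A)
  thus ?case using le[of A] \<mu> \<nu> by simp
next
  case (mult u k)
  have "(\<integral>\<^sup>+x. k * u x \<partial>\<mu> i) = k * (\<integral>\<^sup>+x. u x \<partial>\<mu> i)" if "i \<in> I" for i
    by (rule nn_integral_cmult) (use mult(2) measurable_cong_sets[OF \<mu>[OF that] refl] in auto)
  moreover have "(\<integral>\<^sup>+x. k * u x \<partial>\<nu> i) = k * (\<integral>\<^sup>+x. u x \<partial>\<nu> i)" if "i \<in> J" for i
    by (rule nn_integral_cmult) (use mult(2) measurable_cong_sets[OF \<nu>[OF that] refl] in auto)
  ultimately have "(\<Sum>i\<in>I. c i * (\<integral>\<^sup>+x. k * u x \<partial>\<mu> i)) = k * (\<Sum>i\<in>I. c i * (\<integral>\<^sup>+x. u x \<partial>\<mu> i))"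
    and "(\<Sum>i\<in>J. d i * (\<integral>\<^sup>+x. k * u x \<partial>\<nu> i)) = k * (\<Sum>i\<in>J. d i * (\<integral>\<^sup>+x. u x \<partial>\<nu> i))"
    by (simp_all add: sum_distrib_left mult.left_commute)
  thus ?case using mult.IH by (simp add: mult_left_mono)
next
  case (add u v)
  have m: "u \<in> borel_measurable M" "v \<in> borel_measurable M" using add.hyps by auto
  have "(\<integral>\<^sup>+x. v x + u x \<partial>\<mu> i) = (\<integral>\<^sup>+x. v x \<partial>\<mu> i) + (\<integral>\<^sup>+x. u x \<partial>\<mu> i)" if "i \<in> I" for i
    by (rule nn_integral_add) (use m measurable_cong_sets[OF \<mu>[OF that] refl] in auto)
  moreover have "(\<integral>\<^sup>+x. v x + u x \<partial>\<nu> i) = (\<integral>\<^sup>+x. v x \<partial>\<nu> i) + (\<integral>\<^sup>+x. u x \<partial>\<nu> i)" if "i \<in> J" for i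
    by (rule nn_integral_add) (use m measurable_cong_sets[OF \<nu>[OF that] refl] in auto)
  ultimately show ?case using add_mono[OF add.IH(2) add.IH(1)]
    by (simp add: distrib_left sum.distrib add.commute)
next
  case (seq U)
  have lim: "(\<lambda>n. \<integral>\<^sup>+x. U n x \<partial>N) \<longlonglongrightarrow> (\<integral>\<^sup>+x. (SUP n. U n) x \<partial>N)" if "sets N = sets M" for N
  proof -
    have [measurable]: "U n \<in> borel_measurable N" for n
      using seq(1) measurable_cong_sets[OF that refl] by blast
    have "incseq (\<lambda>n. \<integral>\<^sup>+x. U n x \<partial>N)"
      using seq by (intro monoI nn_integral_mono) (auto simp: incseq_def le_fun_def)
    from LIMSEQ_SUP[OF this] show ?thesis
      using nn_integral_monotone_convergence_SUP[of U N] seq by (simp add: SUP_apply[abs_def])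
  qed
  have 1: "(\<lambda>n. \<Sum>i\<in>I. c i * (\<integral>\<^sup>+x. U n x \<partial>\<mu> i)) \<longlonglongrightarrow> (\<Sum>i\<in>I. c i * (\<integral>\<^sup>+x. (SUP n. U n) x \<partial>\<mu> i))"
    by (intro tendsto_sum_cmult_ennreal c lim \<mu>)
  have 2: "(\<lambda>n. \<Sum>i\<in>J. d i * (\<integral>\<^sup>+x. U n x \<partial>\<nu> i)) \<longlonglongrightarrow> (\<Sum>i\<in>J. d i * (\<integral>\<^sup>+x. (SUP n. U n) x \<partial>\<nu> i))"
    by (intro tendsto_sum_cmult_ennreal d lim \<nu>)
  show ?case by (rule LIMSEQ_le[OF 1 2]) (intro exI[of _ 0] allI impI seq.IH)
qed

text \<open>Both sides are limits along the exhaustion by compact intervals, so the comparison on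
  relatively compact sets extends to all Borel sets.\<close>

lemma half_line_nn_integral_combination_le:
  fixes \<mu> :: "'i \<Rightarrow> real measure" and \<nu> :: "'j \<Rightarrow> real measure" and c d :: "_ \<Rightarrow> ennreal"
  assumes c: "\<And>i. i \<in> I \<Longrightarrow> c i < top" and d: "\<And>j. j \<in> J \<Longrightarrow> d j < top"
    and \<mu>: "\<And>i. i \<in> I \<Longrightarrow> half_line_measure (\<mu> i)" and \<nu>: "\<And>j. j \<in> J \<Longrightarrow> half_line_measure (\<nu> j)"
    and le: "\<And>E. rc_borel E \<Longrightarrow> (\<Sum>i\<in>I. c i * emeasure (\<mu> i) E) \<le> (\<Sum>j\<in>J. d j * emeasure (\<nu> j) E)"
    and f: "f \<in> borel_measurable borel"
  shows "(\<Sum>i\<in>I. c i * (\<integral>\<^sup>+x. f x \<partial>\<mu> i)) \<le> (\<Sum>j\<in>J. d j * (\<integral>\<^sup>+x. f x \<partial>\<nu> j))"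
proof (rule nn_integral_combination_le[OF c d _ _ _ f])
  fix E :: "real set" assume E: "E \<in> sets borel"
  have 1: "(\<lambda>n. \<Sum>i\<in>I. c i * emeasure (\<mu> i) (E \<inter> rc_exhaustion n)) \<longlonglongrightarrow> (\<Sum>i\<in>I. c i * emeasure (\<mu> i) E)"
    by (intro tendsto_sum_cmult_ennreal c half_line_emeasure_limit \<mu> E)
  have 2: "(\<lambda>n. \<Sum>i\<in>J. d i * emeasure (\<nu> i) (E \<inter> rc_exhaustion n)) \<longlonglongrightarrow> (\<Sum>i\<in>J. d i * emeasure (\<nu> i) E)"
    by (intro tendsto_sum_cmult_ennreal d half_line_emeasure_limit \<nu> E)
  show "(\<Sum>i\<in>I. c i * emeasure (\<mu> i) E) \<le> (\<Sum>j\<in>J. d j * emeasure (\<nu> j) E)"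
    by (rule LIMSEQ_le[OF 1 2]) (use le rc_borel_exhaustion[OF E] in auto)
qed (use \<mu> \<nu> in \<open>auto simp: half_line_measure_def\<close>)

text \<open>The coefficients are split into positive and negative parts. The relation then says that
  two nonnegative combinations of measures agree, the comparison lemma applies in both directions,
  and \<open>g\<close> is finally split into its own positive and negative part.\<close>

lemma half_line_integral_combination:
  fixes \<mu> :: "'i \<Rightarrow> real measure" and c :: "'i \<Rightarrow> real"
  assumes I: "finite I" and \<mu>: "\<And>i. i \<in> I \<Longrightarrow> half_line_measure (\<mu> i)"
    and fin: "\<And>i E. i \<in> I \<Longrightarrow> rc_borel E \<Longrightarrow> emeasure (\<mu> i) E < \<infinity>"
    and eq: "\<And>E. rc_borel E \<Longrightarrow> (\<Sum>i\<in>I. c i * measure (\<mu> i) E) = 0"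
    and g: "\<And>i. i \<in> I \<Longrightarrow> integrable (\<mu> i) g"
  shows "(\<Sum>i\<in>I. c i * (LINT x|\<mu> i. g x)) = 0"
proof (cases "I = {}")
  case False
  then obtain i0 where i0: "i0 \<in> I" by blast
  have gm: "g \<in> borel_measurable borel"
  proof -
    have "sets (\<mu> i0) = sets borel" using \<mu>[OF i0] by (simp add: half_line_measure_def)
    from measurable_cong_sets[OF this refl] show ?thesis
      using borel_measurable_integrable[OF g[OF i0]] by auto
  qed
  have sum_pm: "ennreal (\<Sum>i\<in>I. max (s * c i) 0 * a i) = (\<Sum>i\<in>I. ennreal (max (s * c i) 0) * ennreal (a i))"
    if "\<And>i. i \<in> I \<Longrightarrow> a i \<ge> 0" for s :: real and a
    using that by (subst sum_ennreal[symmetric]) (auto simp: ennreal_mult intro!: sum.cong)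
  \<comment> \<open>With \<open>s = 1\<close> and \<open>s = -1\<close> in
    \<open>max (s * c i) 0\<close> one obtains the two parts of \<open>c i\<close>.\<close>
  have diff: "(\<Sum>i\<in>I. max (1 * c i) 0 * a i) - (\<Sum>i\<in>I. max (-1 * c i) 0 * a i) = (\<Sum>i\<in>I. c i * a i)" for a
    unfolding sum_subtractf[symmetric] left_diff_distrib[symmetric]
    by (intro sum.cong refl) (auto simp: max_def)
  have rc_eq: "(\<Sum>i\<in>I. ennreal (max (1 * c i) 0) * emeasure (\<mu> i) E) = (\<Sum>i\<in>I. ennreal (max (-1 * c i) 0) * emeasure (\<mu> i) E)"
    if E: "rc_borel E" for E
  proof -
    have e: "emeasure (\<mu> i) E = ennreal (measure (\<mu> i) E)" if "i \<in> I" for i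
      using fin[OF that E] by (simp add: emeasure_eq_ennreal_measure)
    have "(\<Sum>i\<in>I. max (1 * c i) 0 * measure (\<mu> i) E) = (\<Sum>i\<in>I. max (-1 * c i) 0 * measure (\<mu> i) E)"
      using diff[of "\<lambda>i. measure (\<mu> i) E"] eq[OF E] by simp
    hence "(\<Sum>i\<in>I. ennreal (max (1 * c i) 0) * ennreal (measure (\<mu> i) E)) = (\<Sum>i\<in>I. ennreal (max (-1 * c i) 0) * ennreal (measure (\<mu> i) E))"
      by (simp only: sum_pm[symmetric] measure_nonneg)
    thus ?thesis by (simp only: e cong: sum.cong)
  qed
  have nn_eq: "(\<Sum>i\<in>I. ennreal (max (1 * c i) 0) * (\<integral>\<^sup>+x. h x \<partial>\<mu> i)) = (\<Sum>i\<in>I. ennreal (max (-1 * c i) 0) * (\<integral>\<^sup>+x. h x \<partial>\<mu> i))"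
    if "h \<in> borel_measurable borel" for h
  proof -
    have le: "(\<Sum>i\<in>I. ennreal (a i) * (\<integral>\<^sup>+x. h x \<partial>\<mu> i)) \<le> (\<Sum>i\<in>I. ennreal (b i) * (\<integral>\<^sup>+x. h x \<partial>\<mu> i))"
      if "\<And>E. rc_borel E \<Longrightarrow> (\<Sum>i\<in>I. ennreal (a i) * emeasure (\<mu> i) E) \<le> (\<Sum>i\<in>I. ennreal (b i) * emeasure (\<mu> i) E)"
      for a b :: "'i \<Rightarrow> real"
    proof (rule half_line_nn_integral_combination_le)
      show "half_line_measure (\<mu> i)" "half_line_measure (\<mu> i)" if "i \<in> I" for i using \<mu>[OF that] by this+
      show "h \<in> borel_measurable borel" by fact
    qed (simp_all add: that)
    show ?thesis
    proof (rule antisym)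
      show "(\<Sum>i\<in>I. ennreal (max (1 * c i) 0) * (\<integral>\<^sup>+x. h x \<partial>\<mu> i)) \<le> (\<Sum>i\<in>I. ennreal (max (-1 * c i) 0) * (\<integral>\<^sup>+x. h x \<partial>\<mu> i))"
        by (rule le, rule eq_refl, erule rc_eq)
      show "(\<Sum>i\<in>I. ennreal (max (-1 * c i) 0) * (\<integral>\<^sup>+x. h x \<partial>\<mu> i)) \<le> (\<Sum>i\<in>I. ennreal (max (1 * c i) 0) * (\<integral>\<^sup>+x. h x \<partial>\<mu> i))"
        by (rule le, rule eq_refl, rule sym, erule rc_eq)
    qed
  qed
  have pos: "(\<Sum>i\<in>I. c i * (LINT x|\<mu> i. h x)) = 0"
    if h: "\<And>i. i \<in> I \<Longrightarrow> integrable (\<mu> i) h" and hm: "h \<in> borel_measurable borel" and h0: "\<And>x. h x \<ge> 0" for h :: "real \<Rightarrow> real"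
  proof -
    have e: "(\<integral>\<^sup>+x. ennreal (h x) \<partial>\<mu> i) = ennreal (LINT x|\<mu> i. h x)" if "i \<in> I" for i
      using h[OF that] h0 by (simp add: nn_integral_eq_integral)
    have n: "0 \<le> (LINT x|\<mu> i. h x)" for i using h0 by simp
    have "ennreal (\<Sum>i\<in>I. max (1 * c i) 0 * (LINT x|\<mu> i. h x)) = ennreal (\<Sum>i\<in>I. max (-1 * c i) 0 * (LINT x|\<mu> i. h x))"
    proof -
      have "(\<lambda>x. ennreal (h x)) \<in> borel_measurable borel" using hm by simp
      from nn_eq[OF this] show ?thesis
        unfolding sum_pm[of "\<lambda>i. LINT x|\<mu> i. h x", OF n] by (simp only: e cong: sum.cong)
    qed
    hence "(\<Sum>i\<in>I. max (1 * c i) 0 * (LINT x|\<mu> i. h x)) = (\<Sum>i\<in>I. max (-1 * c i) 0 * (LINT x|\<mu> i. h x))"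
      by (rule ennreal_inj[THEN iffD1, rotated 2]) (auto intro!: sum_nonneg mult_nonneg_nonneg n)
    thus ?thesis using diff[of "\<lambda>i. LINT x|\<mu> i. h x"] by simp
  qed
  have "(\<Sum>i\<in>I. c i * (LINT x|\<mu> i. max (g x) 0)) = 0" "(\<Sum>i\<in>I. c i * (LINT x|\<mu> i. max (- g x) 0)) = 0"
    by (rule pos; use g gm in simp)+
  moreover have "(LINT x|\<mu> i. g x) = (LINT x|\<mu> i. max (g x) 0) - (LINT x|\<mu> i. max (- g x) 0)" if "i \<in> I" for i
  proof -
    have "(LINT x|\<mu> i. max (g x) 0) - (LINT x|\<mu> i. max (- g x) 0) = (LINT x|\<mu> i. max (g x) 0 - max (- g x) 0)"
      by (rule Bochner_Integration.integral_diff[symmetric]) (use g[OF that] in auto)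
    also have "(\<lambda>x. max (g x) 0 - max (- g x) 0) = g" by (auto simp: max_def)
    finally show ?thesis by simp
  qed
  ultimately show ?thesis by (simp add: right_diff_distrib sum_subtractf)
qed simp

section \<open>Jordan decomposition of signed measures\<close>

lemma rc_borel_subset: "rc_borel E \<Longrightarrow> A \<in> sets borel \<Longrightarrow> A \<subseteq> E \<Longrightarrow> rc_borel A"
  unfolding rc_borel_def by blast

lemma rc_borel_Un: "rc_borel A \<Longrightarrow> rc_borel B \<Longrightarrow> rc_borel (A \<union> B)"
  unfolding rc_borel_def
proof (elim conjE exE, intro conjI)
  fix K L assume "A \<in> sets borel" "B \<in> sets borel" "compact K" "compact L" "K \<subseteq> {0<..}" "A \<subseteq> K" "L \<subseteq> {0<..}" "B \<subseteq> L"
  thus "\<exists>K. compact K \<and> K \<subseteq> {0<..} \<and> A \<union> B \<subseteq> K"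
    by (intro exI[of _ "K \<union> L"] conjI compact_Un) auto
qed auto

lemma rc_borel_empty [simp]: "rc_borel {}"
  by (auto simp: rc_borel_def)

lemma rc_borel_sets: "rc_borel E \<Longrightarrow> E \<in> sets borel"
  by (simp add: rc_borel_def)

lemma rc_borel_pos: "rc_borel E \<Longrightarrow> E \<subseteq> {0<..}"
  by (auto simp: rc_borel_def)

context
  fixes \<nu> :: "real set \<Rightarrow> real" assumes \<nu>: "signed_measure \<nu>"
begin

lemma signed_measure_empty: "\<nu> {} = 0"
proof -
  have "(\<lambda>n. \<nu> {}) sums \<nu> {}"
    using \<nu>[unfolded signed_measure_def, rule_format, of "\<lambda>_. {}"] by (simp add: disjoint_family_on_def)
  hence "(\<lambda>n::nat. \<nu> {}) \<longlonglongrightarrow> 0" using summable_LIMSEQ_zero sums_summable by blast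
  thus ?thesis by (simp add: LIMSEQ_const_iff)
qed

lemma signed_measure_Un:
  assumes "rc_borel A" "rc_borel B" "A \<inter> B = {}"
  shows "\<nu> (A \<union> B) = \<nu> A + \<nu> B"
proof -
  have "(\<lambda>n. \<nu> (binaryset A B n)) sums \<nu> (\<Union>n. binaryset A B n)"
  proof (rule \<nu>[unfolded signed_measure_def, rule_format], intro conjI allI)
    show "binaryset A B n \<in> sets borel" for n
      using assms by (auto simp: binaryset_def rc_borel_sets)
    show "disjoint_family (binaryset A B)"
      using assms by (auto simp: disjoint_family_on_def binaryset_def)
    show "rc_borel (\<Union>n. binaryset A B n)"
      using assms by (simp add: UN_binaryset_eq rc_borel_Un)
  qed
  moreover have "(\<lambda>n. \<nu> (binaryset A B n)) sums (\<nu> A + \<nu> B)"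
    by (rule binaryset_sums) (rule signed_measure_empty)
  ultimately show ?thesis by (simp add: UN_binaryset_eq sums_unique2)
qed

lemma signed_measure_uminus: "signed_measure (\<lambda>E. - \<nu> E)"
  using \<nu> unfolding signed_measure_def by (auto intro: sums_minus)

text \<open>Countable additivity of the supremum. A competitor inside the union is cut along the
  \<open>F i\<close>, which bounds the union by the sum. Conversely, competitors inside finitely
  many disjoint \<open>F i\<close> are glued by finite additivity of \<nu>, which bounds every
  partial sum.\<close>

lemma emeasure_pos_part:
  assumes E: "E \<in> sets borel"
  shows "emeasure (pos_part \<nu>) E = (SUP A\<in>{A. rc_borel A \<and> A \<subseteq> E}. ennreal (\<nu> A))"
  unfolding pos_part_def
proof (rule emeasure_measure_of_sigma)
  let ?p = "\<lambda>E. SUP A\<in>{A. rc_borel A \<and> A \<subseteq> E}. ennreal (\<nu> A)"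
  show "sigma_algebra UNIV (sets borel :: real set set)"
    using sets.sigma_algebra_axioms[of "borel :: real measure"] by simp
  have "{A. rc_borel A \<and> A \<subseteq> {}} = {{}}" by auto
  thus "positive (sets borel) ?p" by (simp add: positive_def signed_measure_empty)
  show "countably_additive (sets borel) ?p"
  proof (rule countably_additiveI)
    fix F :: "nat \<Rightarrow> real set"
    assume F: "range F \<subseteq> sets borel" "disjoint_family F" "(\<Union>i. F i) \<in> sets borel"
    show "(\<Sum>i. ?p (F i)) = ?p (\<Union>i. F i)"
    proof (rule antisym)
      show "?p (\<Union>i. F i) \<le> (\<Sum>i. ?p (F i))"
      proof (rule SUP_least)
        fix A assume "A \<in> {A. rc_borel A \<and> A \<subseteq> (\<Union>i. F i)}"
        hence A: "rc_borel A" "A \<subseteq> (\<Union>i. F i)" by auto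
        have AU: "(\<Union>i. A \<inter> F i) = A" using A by blast
        have rcA: "rc_borel (A \<inter> F i)" for i
          using A F(1) by (intro rc_borel_subset[OF A(1)]) (auto simp: rc_borel_sets)
        have "(\<lambda>i. \<nu> (A \<inter> F i)) sums \<nu> (\<Union>i. A \<inter> F i)"
        proof (rule \<nu>[unfolded signed_measure_def, rule_format], intro conjI allI)
          show "A \<inter> F n \<in> sets borel" for n using rcA by (rule rc_borel_sets)
          show "disjoint_family (\<lambda>i. A \<inter> F i)" using F(2) by (auto simp: disjoint_family_on_def)
          show "rc_borel (\<Union>i. A \<inter> F i)" unfolding AU by (rule A)
        qed
        hence S: "(\<lambda>i. \<nu> (A \<inter> F i)) sums \<nu> A" unfolding AU .
        have term_le: "ennreal (\<nu> (A \<inter> F i)) \<le> ?p (F i)" for i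
          by (rule SUP_upper) (use rcA in auto)
        have "ennreal (\<Sum>i<n. \<nu> (A \<inter> F i)) \<le> (\<Sum>i. ?p (F i))" for n
        proof -
          have "ennreal (\<Sum>i<n. \<nu> (A \<inter> F i)) \<le> ennreal (\<Sum>i<n. max 0 (\<nu> (A \<inter> F i)))"
            by (intro ennreal_leI sum_mono) auto
          also have "\<dots> = (\<Sum>i<n. ennreal (max 0 (\<nu> (A \<inter> F i))))"
            by (rule sum_ennreal[symmetric]) simp
          also have "\<dots> = (\<Sum>i<n. ennreal (\<nu> (A \<inter> F i)))"
            by (intro sum.cong refl) (auto simp: max_def ennreal_neg)
          also have "\<dots> \<le> (\<Sum>i<n. ?p (F i))" by (intro sum_mono term_le)
          also have "\<dots> \<le> (\<Sum>i. ?p (F i))" by (rule sum_le_suminf) auto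
          finally show ?thesis .
        qed
        moreover have "(\<lambda>n. ennreal (\<Sum>i<n. \<nu> (A \<inter> F i))) \<longlonglongrightarrow> ennreal (\<nu> A)"
          using S unfolding sums_def by (rule tendsto_ennrealI)
        ultimately show "ennreal (\<nu> A) \<le> (\<Sum>i. ?p (F i))"
          by (meson LIMSEQ_le_const2)
      qed
    next
      have "(\<Sum>i<n. ?p (F i)) \<le> ?p (\<Union>i<n. F i)" for n
      proof (induction n)
        case (Suc n)
        have "?p (\<Union>i<n. F i) + ?p (F n) \<le> ?p (\<Union>i<Suc n. F i)"
        proof -
          have fact: "ennreal (\<nu> A) + ennreal (\<nu> B) \<le> ?p (\<Union>i<Suc n. F i)"
            if A: "rc_borel A" "A \<subseteq> (\<Union>i<n. F i)" and B: "rc_borel B" "B \<subseteq> F n" for A B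
          proof -
            have disj: "A \<inter> B = {}"
            proof (rule ccontr)
              assume "A \<inter> B \<noteq> {}"
              then obtain x i where "i < n" "x \<in> F i" "x \<in> F n" using A(2) B(2) by blast
              thus False using disjoint_family_onD[OF F(2), of i n] by auto
            qed
            have up: "ennreal (\<nu> D) \<le> ?p (\<Union>i<Suc n. F i)" if "rc_borel D" "D \<subseteq> (\<Union>i<n. F i) \<union> F n" for D
              by (rule SUP_upper) (use that in \<open>auto simp: lessThan_Suc\<close>)
            \<comment> \<open>\<open>ennreal\<close> sends negative numbers to 0, so a competitor of
              nonpositive value is dropped. Gluing it would lower the value.\<close>
            consider "\<nu> A \<le> 0" | "\<nu> B \<le> 0" | "\<nu> A > 0" "\<nu> B > 0" by linarith
            thus ?thesis
            proof cases
              case 1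
              thus ?thesis using up[of B] B by (simp only: ennreal_neg add_0_left) auto
            next
              case 2
              thus ?thesis using up[of A] A by (simp only: ennreal_neg add_0_right) auto
            next
              case 3
              hence "ennreal (\<nu> A) + ennreal (\<nu> B) = ennreal (\<nu> (A \<union> B))"
                using signed_measure_Un[OF A(1) B(1) disj] by (simp add: ennreal_plus)
              also have "\<dots> \<le> ?p (\<Union>i<Suc n. F i)"
                by (rule up) (use A B in \<open>auto intro: rc_borel_Un\<close>)
              finally show ?thesis .
            qed
          qed
          have ne: "{A. rc_borel A \<and> A \<subseteq> E} \<noteq> {}" for E by (auto intro!: exI[of _ "{}"])
          show ?thesis
            unfolding ennreal_SUP_add_left[OF ne, symmetric]
          proof (rule SUP_least)
            fix A assume A: "A \<in> {A. rc_borel A \<and> A \<subseteq> (\<Union>i<n. F i)}"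
            show "ennreal (\<nu> A) + ?p (F n) \<le> ?p (\<Union>i<Suc n. F i)"
              unfolding ennreal_SUP_add_right[OF ne]
              by (rule SUP_least) (use A fact in blast)
          qed
        qed
        with add_right_mono[OF Suc.IH, of "?p (F n)"]
        have "(\<Sum>i<n. ?p (F i)) + ?p (F n) \<le> ?p (\<Union>i<Suc n. F i)" by (rule order_trans)
        thus ?case by (simp only: sum.lessThan_Suc)
      qed simp
      hence "(\<Sum>i<n. ?p (F i)) \<le> ?p (\<Union>i. F i)" for n
        by (rule order_trans) (rule SUP_subset_mono, blast, simp)
      thus "(\<Sum>i. ?p (F i)) \<le> ?p (\<Union>i. F i)" by (intro suminf_le_const) auto
    qed
  qed
qed (use E in auto)

lemma half_line_pos_part: "half_line_measure (pos_part \<nu>)"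
proof -
  have "A = {}" if "rc_borel A" "A \<subseteq> - {0<..}" for A using rc_borel_pos[OF that(1)] that(2) by blast
  hence "{A. rc_borel A \<and> A \<subseteq> - {0<..}} = {{}}" by auto
  thus ?thesis by (simp add: half_line_measure_def emeasure_pos_part signed_measure_empty)
     (simp add: pos_part_def sets.sigma_sets_eq[of borel, simplified])
qed

end

lemma emeasure_neg_part:
  assumes "signed_measure \<nu>" "E \<in> sets borel"
  shows "emeasure (neg_part \<nu>) E = (SUP A\<in>{A. rc_borel A \<and> A \<subseteq> E}. ennreal (- \<nu> A))"
  unfolding neg_part_def by (rule emeasure_pos_part[OF signed_measure_uminus[OF assms(1)] assms(2)])

lemma half_line_neg_part: "signed_measure \<nu> \<Longrightarrow> half_line_measure (neg_part \<nu>)"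
  unfolding neg_part_def by (intro half_line_pos_part signed_measure_uminus)

lemma emeasure_total_variation:
  assumes "signed_measure \<nu>" "E \<in> sets borel"
  shows "emeasure (total_variation \<nu>) E = emeasure (pos_part \<nu>) E + emeasure (neg_part \<nu>) E"
  unfolding total_variation_def
proof (rule emeasure_measure_of_sigma)
  have s: "sets (pos_part \<nu>) = sets borel" "sets (neg_part \<nu>) = sets borel"
    using half_line_pos_part half_line_neg_part assms(1) by (auto simp: half_line_measure_def)
  show "sigma_algebra UNIV (sets borel :: real set set)"
    using sets.sigma_algebra_axioms[of "borel :: real measure"] by simp
  show "positive (sets borel) (\<lambda>E. emeasure (pos_part \<nu>) E + emeasure (neg_part \<nu>) E)"
    by (simp add: positive_def)
  show "countably_additive (sets borel) (\<lambda>E. emeasure (pos_part \<nu>) E + emeasure (neg_part \<nu>) E)"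
    by (rule countably_additiveI) (simp add: suminf_add[symmetric] suminf_emeasure s)
qed (use assms in auto)

lemma half_line_total_variation:
  assumes "signed_measure \<nu>"
  shows "half_line_measure (total_variation \<nu>)"
  unfolding half_line_measure_def
proof
  show "sets (total_variation \<nu>) = sets borel"
    by (simp add: total_variation_def sets.sigma_sets_eq[of borel, simplified])
  show "emeasure (total_variation \<nu>) (- {0<..}) = 0"
    using emeasure_total_variation[OF assms, of "- {0<..}"] half_line_pos_part[OF assms] half_line_neg_part[OF assms]
    by (simp add: half_line_measure_def)
qed

text \<open>For \<open>A \<subseteq> E\<close> one has
  \<open>\<nu> A = \<nu> E - \<nu> (E - A)\<close>, and the last term is bounded by the negative
  part. The supremum over \<open>A\<close> gives one inequality and the same argument for
  \<open>- \<nu>\<close> the other. The bound \<open>C\<close> makes both parts finite, so that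
  their difference is meaningful.\<close>

lemma jordan_decomposition:
  assumes \<nu>: "signed_measure \<nu>" and E: "rc_borel E"
    and bound: "\<And>A. rc_borel A \<Longrightarrow> A \<subseteq> E \<Longrightarrow> \<bar>\<nu> A\<bar> \<le> C"
  shows "emeasure (pos_part \<nu>) E < \<infinity>" "emeasure (neg_part \<nu>) E < \<infinity>"
    "measure (pos_part \<nu>) E - measure (neg_part \<nu>) E = \<nu> E"
proof -
  let ?p = "measure (pos_part \<nu>) E" and ?q = "measure (neg_part \<nu>) E"
  have Eb: "E \<in> sets borel" using E by (rule rc_borel_sets)
  have C: "C \<ge> 0" using bound[OF rc_borel_empty empty_subsetI] abs_ge_zero[of "\<nu> {}"] by linarith
  have b: "ennreal (\<nu> A) \<le> ennreal C" "ennreal (- \<nu> A) \<le> ennreal C" if "A \<in> {A. rc_borel A \<and> A \<subseteq> E}" for A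
    using bound[of A] that by (auto intro!: ennreal_leI)
  have "emeasure (pos_part \<nu>) E \<le> ennreal C" "emeasure (neg_part \<nu>) E \<le> ennreal C"
    unfolding emeasure_pos_part[OF \<nu> Eb] emeasure_neg_part[OF \<nu> Eb] by (rule SUP_least, erule b)+
  thus f: "emeasure (pos_part \<nu>) E < \<infinity>" "emeasure (neg_part \<nu>) E < \<infinity>"
    by (auto intro: le_less_trans)
  have pe: "emeasure (pos_part \<nu>) E = ennreal ?p" and qe: "emeasure (neg_part \<nu>) E = ennreal ?q"
    using f by (simp_all add: emeasure_eq_ennreal_measure)
  have le: "\<nu> A \<le> ?p" "- \<nu> A \<le> ?q" if "rc_borel A" "A \<subseteq> E" for A
  proof -
    have "ennreal (\<nu> A) \<le> ennreal ?p"
      unfolding pe[symmetric] emeasure_pos_part[OF \<nu> Eb] by (rule SUP_upper) (use that in auto)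
    thus "\<nu> A \<le> ?p" by (simp only: ennreal_le_iff measure_nonneg)
    have "ennreal (- \<nu> A) \<le> ennreal ?q"
      unfolding qe[symmetric] emeasure_neg_part[OF \<nu> Eb] by (rule SUP_upper) (use that in auto)
    thus "- \<nu> A \<le> ?q" by (simp only: ennreal_le_iff measure_nonneg)
  qed
  have split: "\<nu> E = \<nu> A + \<nu> (E - A)" "rc_borel (E - A)" if A: "rc_borel A" "A \<subseteq> E" for A
  proof -
    show rc: "rc_borel (E - A)" using A E by (intro rc_borel_subset[OF E]) (auto simp: rc_borel_sets)
    have "A \<union> (E - A) = E" using A by blast
    thus "\<nu> E = \<nu> A + \<nu> (E - A)" using signed_measure_Un[OF \<nu> A(1) rc] by auto
  qed
  have "emeasure (pos_part \<nu>) E \<le> ennreal (\<nu> E + ?q)"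
    unfolding emeasure_pos_part[OF \<nu> Eb]
  proof (rule SUP_least, rule ennreal_leI)
    fix A assume "A \<in> {A. rc_borel A \<and> A \<subseteq> E}"
    thus "\<nu> A \<le> \<nu> E + ?q" using split[of A] le(2)[of "E - A"] by auto
  qed
  moreover have "0 \<le> \<nu> E + ?q" using le(2)[OF E] by simp
  ultimately have 1: "?p \<le> \<nu> E + ?q" unfolding pe by simp
  have "emeasure (neg_part \<nu>) E \<le> ennreal (?p - \<nu> E)"
    unfolding emeasure_neg_part[OF \<nu> Eb]
  proof (rule SUP_least, rule ennreal_leI)
    fix A assume "A \<in> {A. rc_borel A \<and> A \<subseteq> E}"
    thus "- \<nu> A \<le> ?p - \<nu> E" using split[of A] le(1)[of "E - A"] by auto
  qed
  moreover have "0 \<le> ?p - \<nu> E" using le(1)[OF E] by simp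
  ultimately have 2: "?q \<le> ?p - \<nu> E" unfolding qe by simp
  show "?p - ?q = \<nu> E" using 1 2 by simp
qed

lemma half_line_AE: "half_line_measure \<mu> \<Longrightarrow> AE x in \<mu>. 0 < x"
  unfolding half_line_measure_def by (intro AE_I[of _ _ "- {0<..}"]) auto

lemma half_line_measurable: "half_line_measure \<mu> \<Longrightarrow> borel_measurable \<mu> = borel_measurable borel"
  unfolding half_line_measure_def by (intro measurable_cong_sets) auto

lemma half_line_density:
  assumes "half_line_measure \<mu>" "f \<in> borel_measurable borel"
  shows "half_line_measure (density \<mu> f)"
proof -
  have s: "sets \<mu> = sets borel" and z: "- {0<..} \<in> null_sets \<mu>"
    using assms(1) by (simp_all add: half_line_measure_def null_sets_def)
  have "f \<in> borel_measurable \<mu>" unfolding half_line_measurable[OF assms(1)] by fact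
  from absolutely_continuousI_density[OF this] z have "- {0<..} \<in> null_sets (density \<mu> f)"
    unfolding absolutely_continuous_def by (rule subsetD)
  thus ?thesis by (simp add: half_line_measure_def s null_sets_def)
qed

section \<open>Quadratic forms and polarization\<close>

lemma quadratic_form: "v \<bullet> (N *v v) = (\<Sum>i\<in>UNIV. \<Sum>j\<in>UNIV. v $ i * v $ j * N $ i $ j)"
  for v :: "real^'m::finite"
  by (simp add: inner_vec_def matrix_vector_mult_def sum_distrib_left ac_simps)

lemma polar_quadratic_form:
  assumes "transpose N = N"
  shows "polar (\<lambda>v. v \<bullet> (N *v v)) i j = (N::real^'m::finite^'m) $ i $ j"
proof -
  have b: "axis i 1 \<bullet> (N *v axis j 1) = N $ i $ j" for i j
    by (simp add: matrix_vector_mult_basis inner_axis_axis inner_axis' column_def)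
  have s: "N $ j $ i = N $ i $ j" using assms by (metis transpose_def vec_lambda_beta)
  show ?thesis
    unfolding polar_def
    by (simp add: matrix_vector_right_distrib matrix_vector_mult_diff_distrib inner_add_left
        inner_add_right inner_diff_left inner_diff_right b s)
qed

lemma quadratic_matrix: "transpose N = N \<Longrightarrow> quadratic (\<lambda>v. v \<bullet> (N *v v))"
  unfolding quadratic_def by (simp only: polar_quadratic_form) (simp add: quadratic_form)

lemma quadratic_uminus: "quadratic F \<Longrightarrow> F (- v) = F v"
  unfolding quadratic_def by simp

lemma polar_sym: "quadratic F \<Longrightarrow> polar F i j = polar F j i"
  using quadratic_uminus[of F "axis i 1 - axis j 1"] by (simp add: polar_def add.commute)

lemma quadratic_polar_matrix: "quadratic F \<Longrightarrow> F v = v \<bullet> ((\<chi> i j. polar F i j) *v v)"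
  unfolding quadratic_def quadratic_form by simp

lemma polar_add: "polar (\<lambda>v. F v + G v) i j = polar F i j + polar G i j"
  by (simp add: polar_def field_simps)

lemma polar_cmult: "polar (\<lambda>v. c * F v) i j = c * polar F i j"
  by (simp add: polar_def field_simps)

text \<open>The defect \<open>F v - \<Sum>\<^sub>i\<^sub>j v\<^sub>i v\<^sub>j polar F i j\<close> as one linear combination of values of \<open>F\<close>, so that
  being quadratic is preserved by integration and by differences of measures.\<close>

fun quadratic_vec :: "real^'m::finite \<Rightarrow> ('m \<times> 'm \<times> bool) option \<Rightarrow> real^'m" where
  "quadratic_vec v None = v"
| "quadratic_vec v (Some (i, j, b)) = (if b then axis i 1 + axis j 1 else axis i 1 - axis j 1)"

fun quadratic_coeff :: "real^'m::finite \<Rightarrow> ('m \<times> 'm \<times> bool) option \<Rightarrow> real" where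
  "quadratic_coeff v None = 1"
| "quadratic_coeff v (Some (i, j, b)) = (if b then - (v $ i * v $ j / 4) else v $ i * v $ j / 4)"

lemma quadratic_iff:
  "quadratic F \<longleftrightarrow> (\<forall>v. (\<Sum>k\<in>UNIV. quadratic_coeff v k * F (quadratic_vec v k)) = 0)"
proof -
  have "(\<Sum>k\<in>UNIV. quadratic_coeff v k * F (quadratic_vec v k)) =
    F v - (\<Sum>i\<in>UNIV. \<Sum>j\<in>UNIV. v $ i * v $ j * polar F i j)" for v
  proof -
    have "(\<Sum>k\<in>UNIV. quadratic_coeff v k * F (quadratic_vec v k)) =
      F v + (\<Sum>p\<in>UNIV. quadratic_coeff v (Some p) * F (quadratic_vec v (Some p)))"
      by (simp add: UNIV_option_conv sum.reindex)
    also have "(\<Sum>p\<in>UNIV. quadratic_coeff v (Some p) * F (quadratic_vec v (Some p))) =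
      (\<Sum>i\<in>UNIV. \<Sum>j\<in>UNIV. \<Sum>b\<in>UNIV. quadratic_coeff v (Some (i, j, b)) * F (quadratic_vec v (Some (i, j, b))))"
      by (simp add: UNIV_Times_UNIV[symmetric] sum.cartesian_product case_prod_unfold del: UNIV_Times_UNIV quadratic_coeff.simps quadratic_vec.simps)
    also have "\<dots> = - (\<Sum>i\<in>UNIV. \<Sum>j\<in>UNIV. v $ i * v $ j * polar F i j)"
      unfolding sum_negf[symmetric] by (intro sum.cong refl) (simp add: UNIV_bool polar_def field_simps)
    finally show ?thesis by simp
  qed
  thus ?thesis by (simp add: quadratic_def)
qed

section \<open>Positive matrix measures as quadratic families of positive measures\<close>

locale quadratic_measures =
  fixes Q :: "real^'m::finite \<Rightarrow> real measure"
  assumes half: "\<And>v. half_line_measure (Q v)"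
    and fin: "\<And>v E. rc_borel E \<Longrightarrow> emeasure (Q v) E < \<infinity>"
    and quad: "\<And>E. rc_borel E \<Longrightarrow> quadratic (\<lambda>v. measure (Q v) E)"
begin

lemma sets_Q: "sets (Q v) = sets borel"
  using half by (simp add: half_line_measure_def)

text \<open>The defect of being quadratic is one finite linear combination of values of the family.
  It vanishes on relatively compact sets, hence on integrals.\<close>

lemma quadratic_integral:
  assumes "\<And>v. integrable (Q v) g"
  shows "quadratic (\<lambda>v. LINT x|Q v. g x)"
  unfolding quadratic_iff
proof
  fix v
  show "(\<Sum>k\<in>UNIV. quadratic_coeff v k * (LINT x|Q (quadratic_vec v k). g x)) = 0"
  proof (rule half_line_integral_combination)
    fix E assume "rc_borel E"
    from quad[OF this] show "(\<Sum>k\<in>UNIV. quadratic_coeff v k * measure (Q (quadratic_vec v k)) E) = 0"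
      unfolding quadratic_iff by blast
  qed (use half fin assms in auto)
qed

lemma measure_mono:
  assumes "rc_borel E" "A \<in> sets borel" "A \<subseteq> E"
  shows "measure (Q v) A \<le> measure (Q v) E"
  using assms fin[OF assms(1), of v] sets_Q
  by (intro measure_mono_fmeasurable) (auto simp: fmeasurable_def rc_borel_sets)

end

text \<open>The signed entries \<open>\<nu> i j\<close> together with the positive measures
  \<open>Q v\<close> they polarize. Comparing the Jordan parts with \<open>Qp\<close> and
  \<open>Qm\<close> lets integrability conditions pass between the two descriptions.\<close>

locale polar_measures = quadratic_measures Q for Q :: "real^'m::finite \<Rightarrow> real measure" +
  fixes \<nu> :: "'m \<Rightarrow> 'm \<Rightarrow> real set \<Rightarrow> real"
  assumes signed: "\<And>i j. signed_measure (\<nu> i j)"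
    and link: "\<And>E i j. rc_borel E \<Longrightarrow> \<nu> i j E = polar (\<lambda>v. measure (Q v) E) i j"
begin

abbreviation "Qp i j \<equiv> Q (axis i 1 + axis j 1)"
abbreviation "Qm i j \<equiv> Q (axis i 1 - axis j 1)"

lemma jordan:
  assumes E: "rc_borel E"
  shows "emeasure (pos_part (\<nu> i j)) E < \<infinity>" "emeasure (neg_part (\<nu> i j)) E < \<infinity>"
    "measure (pos_part (\<nu> i j)) E - measure (neg_part (\<nu> i j)) E = \<nu> i j E"
proof -
  have "\<bar>\<nu> i j A\<bar> \<le> measure (Qp i j) E + measure (Qm i j) E" if A: "rc_borel A" "A \<subseteq> E" for A
  proof -
    have "measure (Qp i j) A \<le> measure (Qp i j) E" "measure (Qm i j) A \<le> measure (Qm i j) E"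
      using measure_mono[OF E rc_borel_sets[OF A(1)] A(2)] by auto
    moreover have "0 \<le> measure (Qp i j) A" "0 \<le> measure (Qm i j) A" by auto
    moreover have "\<nu> i j A = (measure (Qp i j) A - measure (Qm i j) A) / 4"
      using link[OF A(1)] by (simp add: polar_def)
    ultimately have "\<nu> i j A \<le> measure (Qp i j) E + measure (Qm i j) E"
      and "- \<nu> i j A \<le> measure (Qp i j) E + measure (Qm i j) E" by argo+
    thus ?thesis by (rule abs_leI)
  qed
  from jordan_decomposition[OF signed E this]
  show "emeasure (pos_part (\<nu> i j)) E < \<infinity>" "emeasure (neg_part (\<nu> i j)) E < \<infinity>"
    "measure (pos_part (\<nu> i j)) E - measure (neg_part (\<nu> i j)) E = \<nu> i j E" by auto
qed

text \<open>On relatively compact \<open>A\<close> the value \<open>\<nu> i j A\<close> is a quarter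
  of \<open>Qp - Qm\<close>, so \<open>Qp\<close> dominates it and \<open>Qm\<close> dominates its
  negative. Taking suprema over \<open>A \<subseteq> E\<close> gives the bounds for the Jordan
  parts.\<close>

lemma pos_part_le: "E \<in> sets borel \<Longrightarrow> emeasure (pos_part (\<nu> i j)) E \<le> emeasure (Qp i j) E"
  and neg_part_le: "E \<in> sets borel \<Longrightarrow> emeasure (neg_part (\<nu> i j)) E \<le> emeasure (Qm i j) E"
proof -
  assume E: "E \<in> sets borel"
  have *: "ennreal (\<nu> i j A) \<le> emeasure (Qp i j) E" "ennreal (- \<nu> i j A) \<le> emeasure (Qm i j) E"
    if A: "rc_borel A" "A \<subseteq> E" for A
  proof -
    have l: "\<nu> i j A = (measure (Qp i j) A - measure (Qm i j) A) / 4"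
      using link[OF A(1)] by (simp add: polar_def)
    have e: "emeasure (Q v) A = ennreal (measure (Q v) A)" for v
      using fin[OF A(1), of v] by (simp add: emeasure_eq_ennreal_measure)
    have n: "0 \<le> measure (Qp i j) A" "0 \<le> measure (Qm i j) A" by auto
    have "\<nu> i j A \<le> measure (Qp i j) A" using l n by argo
    moreover have "- \<nu> i j A \<le> measure (Qm i j) A" using l n by argo
    ultimately have "ennreal (\<nu> i j A) \<le> emeasure (Qp i j) A" "ennreal (- \<nu> i j A) \<le> emeasure (Qm i j) A"
      unfolding e by (auto intro: ennreal_leI)
    moreover have "emeasure (Q v) A \<le> emeasure (Q v) E" for v
      by (rule emeasure_mono) (use A E sets_Q in auto)
    ultimately show "ennreal (\<nu> i j A) \<le> emeasure (Qp i j) E" "ennreal (- \<nu> i j A) \<le> emeasure (Qm i j) E"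
      by (meson order_trans)+
  qed
  show "emeasure (pos_part (\<nu> i j)) E \<le> emeasure (Qp i j) E"
    unfolding emeasure_pos_part[OF signed E] by (rule SUP_least) (use * in blast)
  show "emeasure (neg_part (\<nu> i j)) E \<le> emeasure (Qm i j) E"
    unfolding emeasure_neg_part[OF signed E] by (rule SUP_least) (use * in blast)
qed

lemma half_line_parts: "half_line_measure (pos_part (\<nu> i j))" "half_line_measure (neg_part (\<nu> i j))"
  using half_line_pos_part[OF signed] half_line_neg_part[OF signed] by auto

lemma nn_integral_parts_le:
  assumes f: "f \<in> borel_measurable borel"
  shows "(\<integral>\<^sup>+x. f x \<partial>pos_part (\<nu> i j)) \<le> (\<integral>\<^sup>+x. f x \<partial>Qp i j)"
    and "(\<integral>\<^sup>+x. f x \<partial>neg_part (\<nu> i j)) \<le> (\<integral>\<^sup>+x. f x \<partial>Qm i j)"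
proof -
  have s: "sets (pos_part (\<nu> i j)) = sets borel" "sets (neg_part (\<nu> i j)) = sets borel"
    using half_line_parts by (auto simp: half_line_measure_def)
  show "(\<integral>\<^sup>+x. f x \<partial>pos_part (\<nu> i j)) \<le> (\<integral>\<^sup>+x. f x \<partial>Qp i j)"
    by (rule nn_integral_mono_measure) (use s sets_Q pos_part_le in \<open>auto simp: le_measure\<close>)
  show "(\<integral>\<^sup>+x. f x \<partial>neg_part (\<nu> i j)) \<le> (\<integral>\<^sup>+x. f x \<partial>Qm i j)"
    by (rule nn_integral_mono_measure) (use s sets_Q neg_part_le in \<open>auto simp: le_measure\<close>)
qed

lemma integrable_parts:
  fixes g :: "real \<Rightarrow> real"
  assumes g: "\<And>v. integrable (Q v) g"
  shows "integrable (pos_part (\<nu> i j)) g" "integrable (neg_part (\<nu> i j)) g"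
proof -
  have m: "g \<in> borel_measurable borel"
    using borel_measurable_integrable[OF g[of 0]] unfolding half_line_measurable[OF half[of 0]] .
  have f: "(\<integral>\<^sup>+x. ennreal (norm (g x)) \<partial>Q v) < \<infinity>" for v
    using g[of v] unfolding integrable_iff_bounded by blast
  have m': "(\<lambda>x. ennreal (norm (g x))) \<in> borel_measurable borel" using m by measurable
  show "integrable (pos_part (\<nu> i j)) g" "integrable (neg_part (\<nu> i j)) g"
    unfolding integrable_iff_bounded half_line_measurable[OF half_line_parts(1)] half_line_measurable[OF half_line_parts(2)]
    using m le_less_trans[OF nn_integral_parts_le(1)[OF m'] f] le_less_trans[OF nn_integral_parts_le(2)[OF m'] f] by auto
qed

text \<open>The positive part, the negative part, \<open>Qp\<close> and \<open>Qm\<close> satisfy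
  one linear relation with coefficients 1, -1, -1/4, 1/4 on relatively compact sets. The indices 0
  to 3 only enumerate these four measures for the combination lemma.\<close>

lemma signed_integral_polar:
  assumes g: "\<And>v. integrable (Q v) g"
  shows "signed_integral (\<nu> i j) g = polar (\<lambda>v. LINT x|Q v. g x) i j"
proof -
  define \<mu> where "\<mu> = (\<lambda>k::nat. if k = 0 then pos_part (\<nu> i j) else if k = 1 then neg_part (\<nu> i j)
    else if k = 2 then Qp i j else Qm i j)"
  define c where "c = (\<lambda>k::nat. if k = 0 then 1 else if k = 1 then -1 else if k = 2 then - (1/4) else 1/4 :: real)"
  have "(\<Sum>k\<in>{0,1,2,3}. c k * (LINT x|\<mu> k. g x)) = 0"
  proof (rule half_line_integral_combination)
    fix E assume E: "rc_borel E"
    show "(\<Sum>k\<in>{0,1,2,3}. c k * measure (\<mu> k) E) = 0"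
      using jordan(3)[OF E, of i j] link[OF E, of i j] by (simp add: c_def \<mu>_def polar_def)
  qed (use half half_line_parts fin jordan g integrable_parts[OF g] in \<open>auto simp: \<mu>_def\<close>)
  thus ?thesis by (simp add: c_def \<mu>_def signed_integral_def polar_def)
qed

lemma total_variation_finite:
  assumes f: "f \<in> borel_measurable borel" and fin: "\<And>v. (\<integral>\<^sup>+x. f x \<partial>Q v) < \<infinity>"
  shows "(\<integral>\<^sup>+x. f x \<partial>total_variation (\<nu> i j)) < \<infinity>"
proof -
  have st: "sets (total_variation (\<nu> i j)) = sets borel"
    using half_line_total_variation[OF signed] by (auto simp: half_line_measure_def)
  \<comment> \<open>The one-point index set and the factor 1 put a single integral into the shape of
    the comparison lemma.\<close>
  have "(\<Sum>k\<in>{()}. 1 * (\<integral>\<^sup>+x. f x \<partial>total_variation (\<nu> i j))) \<le>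
    (\<Sum>b\<in>UNIV. 1 * (\<integral>\<^sup>+x. f x \<partial>(if b then Qp i j else Qm i j)))"
  proof (rule nn_integral_combination_le[OF _ _ _ _ _ f])
    fix E :: "real set" assume "E \<in> sets borel"
    thus "(\<Sum>k\<in>{()}. 1 * emeasure (total_variation (\<nu> i j)) E) \<le> (\<Sum>b\<in>UNIV. 1 * emeasure (if b then Qp i j else Qm i j) E)"
      using add_mono[OF pos_part_le neg_part_le, of E E i j i j]
      by (simp add: emeasure_total_variation[OF signed] UNIV_bool add.commute)
  qed (use st sets_Q in auto)
  also have "\<dots> < \<infinity>" using fin by (simp add: UNIV_bool)
  finally show ?thesis by simp
qed

text \<open>\<open>Q v E\<close> is the quadratic form with matrix \<open>\<nu> i j E\<close> at
  \<open>v\<close>, hence at most the sum of \<open>\<bar>v $ i * v $ j\<bar>\<close> times the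
  total variations. Together with \<open>total_variation_finite\<close> this makes the integrability
  conditions on entries and on forms equivalent.\<close>

lemma finite_of_total_variation:
  assumes f: "f \<in> borel_measurable borel" and fv: "\<And>i j. (\<integral>\<^sup>+x. f x \<partial>total_variation (\<nu> i j)) < \<infinity>"
  shows "(\<integral>\<^sup>+x. f x \<partial>Q v) < \<infinity>"
proof -
  have "(\<Sum>k\<in>{()}. 1 * (\<integral>\<^sup>+x. f x \<partial>Q v)) \<le>
    (\<Sum>p\<in>UNIV. ennreal \<bar>v $ fst p * v $ snd p\<bar> * (\<integral>\<^sup>+x. f x \<partial>total_variation (\<nu> (fst p) (snd p))))"
  proof (rule half_line_nn_integral_combination_le[OF _ _ _ _ _ f])
    fix E assume E: "rc_borel E"
    note Eb = rc_borel_sets[OF E]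
    have tv: "ennreal \<bar>\<nu> i j E\<bar> \<le> emeasure (total_variation (\<nu> i j)) E" for i j
    proof -
      have "emeasure (total_variation (\<nu> i j)) E = ennreal (measure (pos_part (\<nu> i j)) E + measure (neg_part (\<nu> i j)) E)"
        using jordan[OF E, of i j]
        by (simp add: emeasure_total_variation[OF signed Eb] emeasure_eq_ennreal_measure ennreal_plus)
      moreover have "\<bar>\<nu> i j E\<bar> \<le> measure (pos_part (\<nu> i j)) E + measure (neg_part (\<nu> i j)) E"
        unfolding jordan(3)[OF E, symmetric] by (simp add: abs_le_iff)
      ultimately show ?thesis by (simp only: ennreal_leI)
    qed
    have "measure (Q v) E = (\<Sum>i\<in>UNIV. \<Sum>j\<in>UNIV. v $ i * v $ j * \<nu> i j E)"
      using quad[OF E] unfolding quadratic_def link[OF E] by blast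
    also have "\<dots> = (\<Sum>p\<in>UNIV. v $ fst p * v $ snd p * \<nu> (fst p) (snd p) E)"
      by (simp add: UNIV_Times_UNIV[symmetric] sum.cartesian_product case_prod_unfold del: UNIV_Times_UNIV)
    also have "\<dots> \<le> (\<Sum>p\<in>UNIV. \<bar>v $ fst p * v $ snd p\<bar> * \<bar>\<nu> (fst p) (snd p) E\<bar>)"
      by (intro sum_mono) (simp add: abs_mult[symmetric])
    finally have "emeasure (Q v) E \<le> ennreal (\<Sum>p\<in>UNIV. \<bar>v $ fst p * v $ snd p\<bar> * \<bar>\<nu> (fst p) (snd p) E\<bar>)"
      using fin[OF E, of v] by (simp add: emeasure_eq_ennreal_measure ennreal_leI)
    also have "\<dots> = (\<Sum>p\<in>UNIV. ennreal \<bar>v $ fst p * v $ snd p\<bar> * ennreal \<bar>\<nu> (fst p) (snd p) E\<bar>)"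
      unfolding ennreal_mult[OF abs_ge_zero abs_ge_zero, symmetric] by (rule sum_ennreal[symmetric]) simp
    also have "\<dots> \<le> (\<Sum>p\<in>UNIV. ennreal \<bar>v $ fst p * v $ snd p\<bar> * emeasure (total_variation (\<nu> (fst p) (snd p))) E)"
      by (intro sum_mono mult_left_mono tv) auto
    finally show "(\<Sum>k\<in>{()}. 1 * emeasure (Q v) E) \<le> (\<Sum>p\<in>UNIV. ennreal \<bar>v $ fst p * v $ snd p\<bar> * emeasure (total_variation (\<nu> (fst p) (snd p))) E)"
      by simp
  qed (use half half_line_total_variation[OF signed] in auto)
  also have "\<dots> < \<infinity>" using fv by (auto simp: ennreal_mult_less_top)
  finally show ?thesis by simp
qed

end

section \<open>Passage between weighted signed matrices and finite families\<close>

text \<open>What a matrix measure becomes after multiplication by an integrable weight: all masses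
  are finite, so the quadratic dependence is meaningful on every Borel set.\<close>

definition quadratic_family :: "(real^'m::finite \<Rightarrow> real measure) \<Rightarrow> bool" where
  "quadratic_family \<sigma> \<longleftrightarrow> (\<forall>v. finite_measure (\<sigma> v) \<and> half_line_measure (\<sigma> v)) \<and>
     (\<forall>E\<in>sets borel. quadratic (\<lambda>v. measure (\<sigma> v) E))"

lemma quadratic_family_measures: "quadratic_family \<sigma> \<Longrightarrow> quadratic_measures \<sigma>"
  unfolding quadratic_family_def quadratic_measures_def
  by (auto simp: rc_borel_sets finite_measure.emeasure_finite less_top[symmetric])

text \<open>Common to the weights \<open>x / (1 + x)\<close> and \<open>1 / (1 + x)\<close>. The
  lower bound on compact sets ensures that dividing a finite measure by the weight leaves relatively
  compact sets with finite mass.\<close>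

locale weight =
  fixes w :: "real \<Rightarrow> real"
  assumes meas [measurable]: "w \<in> borel_measurable borel" and pos: "\<And>x. 0 < x \<Longrightarrow> 0 < w x"
    and below: "\<And>K. compact K \<Longrightarrow> K \<subseteq> {0<..} \<Longrightarrow> \<exists>c>0. \<forall>x\<in>K. c \<le> w x"
begin

text \<open>The set function \<open>q v\<close> is the quadratic form of \<nu> at \<open>v\<close>.
  It is nonnegative, hence monotone, so the supremum defining its positive part is attained at the
  whole set and \<open>Q v\<close> extends it to a measure. Multiplying by \<open>w\<close> makes
  \<open>Q v\<close> finite, and integrals of \<open>g\<close> become integrals of
  \<open>g / w\<close>.\<close>

lemma psd_measures_imp_family:
  fixes \<nu> :: "'m::finite \<Rightarrow> 'm \<Rightarrow> real set \<Rightarrow> real"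
  assumes \<nu>: "psd_measures \<nu>" and tv: "\<And>i j. (\<integral>\<^sup>+x. ennreal (w x) \<partial>total_variation (\<nu> i j)) < \<infinity>"
  obtains \<sigma> where "quadratic_family \<sigma>"
    "\<And>g C i j. g \<in> borel_measurable borel \<Longrightarrow> (\<And>x. 0 < x \<Longrightarrow> \<bar>g x\<bar> \<le> C * w x) \<Longrightarrow>
      signed_integral (\<nu> i j) g = polar (\<lambda>v. LINT x|\<sigma> v. g x / w x) i j"
proof -
  have signed: "signed_measure (\<nu> i j)" for i j using \<nu> by (simp add: psd_measures_def)
  have psd: "sym_psd (\<chi> i j. \<nu> i j E)" if "rc_borel E" for E using \<nu> that by (simp add: psd_measures_def)
  define q where "q v E = (\<Sum>i\<in>UNIV. \<Sum>j\<in>UNIV. v $ i * v $ j * \<nu> i j E)" for v :: "real^'m" and E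
  have q_form: "q v E = v \<bullet> ((\<chi> i j. \<nu> i j E) *v v)" for v E by (simp add: q_def quadratic_form)
  have q0: "0 \<le> q v E" if "rc_borel E" for v E
    unfolding q_form using psd[OF that] by (simp add: sym_psd_def)
  have q_signed: "signed_measure (q v)" for v
    unfolding signed_measure_def q_def
    by (intro allI impI sums_sum sums_mult) (use signed in \<open>simp add: signed_measure_def\<close>)
  define Q where "Q v = pos_part (q v)" for v
  have Q_eq: "emeasure (Q v) E = ennreal (q v E)" if E: "rc_borel E" for v E
  proof -
    have "ennreal (q v A) \<le> ennreal (q v E)" if A: "rc_borel A" "A \<subseteq> E" for A
    proof -
      have rc: "rc_borel (E - A)" using A E by (intro rc_borel_subset[OF E]) (auto simp: rc_borel_sets)
      have "A \<union> (E - A) = E" using A by blast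
      hence "q v E = q v A + q v (E - A)" using signed_measure_Un[OF q_signed A(1) rc, of v] by auto
      thus ?thesis using q0[OF rc, of v] by (simp add: ennreal_leI)
    qed
    thus ?thesis unfolding Q_def emeasure_pos_part[OF q_signed rc_borel_sets[OF E]]
      by (intro antisym SUP_least SUP_upper) (use E in auto)
  qed
  have Q_measure: "measure (Q v) E = q v E" if "rc_borel E" for v E
    using Q_eq[OF that] q0[OF that] by (simp add: measure_def)
  have half: "half_line_measure (Q v)" for v unfolding Q_def by (rule half_line_pos_part[OF q_signed])
  interpret polar_measures Q \<nu>
  proof
    show "half_line_measure (Q v)" for v by (rule half)
    fix E assume E: "rc_borel E"
    have t: "transpose (\<chi> i j. \<nu> i j E) = (\<chi> i j. \<nu> i j E)" using psd[OF E] by (simp add: sym_psd_def)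
    show "emeasure (Q v) E < \<infinity>" for v using Q_eq[OF E] by simp
    show "quadratic (\<lambda>v. measure (Q v) E)"
      unfolding Q_measure[OF E] q_form by (rule quadratic_matrix[OF t])
    show "\<nu> i j E = polar (\<lambda>v. measure (Q v) E) i j" for i j
      unfolding Q_measure[OF E] q_form polar_quadratic_form[OF t] by simp
  qed (rule signed)
  define \<sigma> where "\<sigma> v = density (Q v) (\<lambda>x. ennreal (w x))" for v
  have w_fin: "(\<integral>\<^sup>+x. ennreal (w x) \<partial>Q v) < \<infinity>" for v
    by (rule finite_of_total_variation) (use tv in auto)
  note [measurable_cong] = sets_Q
  have AEpos: "AE x in Q v. 0 \<le> w x" for v
    using half_line_AE[OF half] by eventually_elim (use pos in \<open>auto simp: less_imp_le\<close>)
  have w_int: "integrable (Q v) w" for v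
  proof (rule integrableI_bounded)
    have "(\<integral>\<^sup>+x. ennreal (norm (w x)) \<partial>Q v) = (\<integral>\<^sup>+x. ennreal (w x) \<partial>Q v)"
      by (rule nn_integral_cong_AE) (use AEpos[of v] in \<open>auto elim!: eventually_mono\<close>)
    thus "(\<integral>\<^sup>+x. ennreal (norm (w x)) \<partial>Q v) < \<infinity>" using w_fin by simp
  qed simp
  have dens: "(LINT x|\<sigma> v. g x) = (LINT x|Q v. w x * g x)" if "g \<in> borel_measurable borel" for v and g :: "real \<Rightarrow> real"
    unfolding \<sigma>_def using that AEpos by (subst integral_density) auto
  have space: "space (Q v) = UNIV" for v using sets_eq_imp_space_eq[OF sets_Q] by simp
  have fam: "quadratic_family \<sigma>"
    unfolding quadratic_family_def
  proof (intro conjI allI ballI)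
    fix v
    show "finite_measure (\<sigma> v)"
      by (rule finite_measureI) (use w_fin[of v] in \<open>simp add: \<sigma>_def emeasure_density space\<close>)
    show "half_line_measure (\<sigma> v)" unfolding \<sigma>_def by (rule half_line_density[OF half]) simp
  next
    fix E :: "real set" assume [measurable]: "E \<in> sets borel"
    have "measure (\<sigma> v) E = (LINT x|Q v. w x * indicator E x)" for v
    proof -
      have "measure (\<sigma> v) E = (LINT x|\<sigma> v. indicator E x)" by (simp add: \<sigma>_def space)
      also have "\<dots> = (LINT x|Q v. w x * indicator E x)" by (rule dens) simp
      finally show ?thesis .
    qed
    moreover have "integrable (Q v) (\<lambda>x. w x * indicator E x)" for v
      by (rule integrable_real_mult_indicator[OF _ w_int]) (simp add: sets_Q)
    ultimately show "quadratic (\<lambda>v. measure (\<sigma> v) E)"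
      using quadratic_integral[of "\<lambda>x. w x * indicator E x"] by simp
  qed
  show ?thesis
  proof (rule that[OF fam])
    fix g :: "real \<Rightarrow> real" and C i j
    assume [measurable]: "g \<in> borel_measurable borel" and b: "\<And>x. 0 < x \<Longrightarrow> \<bar>g x\<bar> \<le> C * w x"
    have int: "integrable (Q v) g" for v
    proof (rule Bochner_Integration.integrable_bound[of _ "\<lambda>x. C * w x"])
      show "AE x in Q v. norm (g x) \<le> norm (C * w x)"
        using half_line_AE[OF half[of v]] by eventually_elim (use b in \<open>fastforce\<close>)
    qed (use w_int in auto)
    have "(LINT x|\<sigma> v. g x / w x) = (LINT x|Q v. g x)" for v
      unfolding dens[of "\<lambda>x. g x / w x", simplified]
      by (rule integral_cong_AE) (use half_line_AE[OF half[of v]] pos in \<open>auto elim!: eventually_mono simp: less_imp_neq[symmetric]\<close>)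
    thus "signed_integral (\<nu> i j) g = polar (\<lambda>v. LINT x|\<sigma> v. g x / w x) i j"
      using signed_integral_polar[OF int] by simp
  qed
qed

text \<open>The converse passage: the family is divided by \<open>w\<close>, and its polarization
  defines the entries. Positivity of the matrices is positivity of the measures
  \<open>Q v\<close>.\<close>

lemma family_imp_psd_measures:
  fixes \<sigma> :: "real^'m::finite \<Rightarrow> real measure"
  assumes \<sigma>: "quadratic_family \<sigma>"
  obtains \<nu> :: "'m \<Rightarrow> 'm \<Rightarrow> real set \<Rightarrow> real" where "psd_measures \<nu>"
    "\<And>i j. (\<integral>\<^sup>+x. ennreal (w x) \<partial>total_variation (\<nu> i j)) < \<infinity>"
    "\<And>g C i j. g \<in> borel_measurable borel \<Longrightarrow> (\<And>x. 0 < x \<Longrightarrow> \<bar>g x\<bar> \<le> C * w x) \<Longrightarrow>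
      signed_integral (\<nu> i j) g = polar (\<lambda>v. LINT x|\<sigma> v. g x / w x) i j"
proof -
  interpret S: quadratic_measures \<sigma> using \<sigma> by (rule quadratic_family_measures)
  have fm: "finite_measure (\<sigma> v)" for v using \<sigma> by (simp add: quadratic_family_def)
  note [measurable_cong] = S.sets_Q
  have space: "space (\<sigma> v) = UNIV" for v using sets_eq_imp_space_eq[OF S.sets_Q] by simp
  define Q where "Q v = density (\<sigma> v) (\<lambda>x. ennreal (1 / w x))" for v
  have AEpos: "AE x in \<sigma> v. 0 < w x" for v
    using half_line_AE[OF S.half] by eventually_elim (use pos in auto)
  have AEnn: "AE x in \<sigma> v. 0 \<le> 1 / w x" for v
    using AEpos by eventually_elim auto
  have setsQ: "sets (Q v) = sets borel" for v by (simp add: Q_def S.sets_Q)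
  have half: "half_line_measure (Q v)" for v
    unfolding Q_def by (rule half_line_density[OF S.half]) simp
  have int_rc: "integrable (\<sigma> v) (\<lambda>x. 1 / w x * indicator E x)" if E: "rc_borel E" for v E
  proof -
    obtain K c where K: "compact K" "K \<subseteq> {0<..}" "E \<subseteq> K" "c > 0" "\<And>x. x \<in> K \<Longrightarrow> c \<le> w x"
      using E below unfolding rc_borel_def by metis
    have b: "norm (1 / w x * indicator E x) \<le> 1 / c" for x
    proof (cases "x \<in> E")
      case True
      hence "c \<le> w x" using K by blast
      thus ?thesis using True \<open>c > 0\<close> by (simp add: frac_le)
    qed (use \<open>c > 0\<close> in simp)
    have [measurable]: "E \<in> sets borel" using E by (rule rc_borel_sets)
    show ?thesis using b
      by (intro finite_measure.integrable_const_bound[OF fm, of _ "1 / c"]) auto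
  qed
  have dens: "(LINT x|Q v. g x) = (LINT x|\<sigma> v. 1 / w x * g x)" if "g \<in> borel_measurable borel" for v and g :: "real \<Rightarrow> real"
    unfolding Q_def using that AEnn by (subst integral_density) auto
  have Q_fin: "emeasure (Q v) E < \<infinity>" if E: "rc_borel E" for v E
  proof -
    have [measurable]: "E \<in> sets borel" using E by (rule rc_borel_sets)
    have "emeasure (Q v) E = (\<integral>\<^sup>+x. ennreal (norm (1 / w x * indicator E x)) \<partial>\<sigma> v)"
      unfolding Q_def
      by (subst emeasure_density)
         (auto intro!: nn_integral_cong_AE eventually_mono[OF AEpos] simp: indicator_def)
    thus ?thesis using int_rc[OF E, of v] by (simp add: integrable_iff_bounded)
  qed
  have Q_measure: "measure (Q v) E = (LINT x|\<sigma> v. 1 / w x * indicator E x)" if E: "rc_borel E" for v E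
  proof -
    have [measurable]: "E \<in> sets borel" using E by (rule rc_borel_sets)
    have "measure (Q v) E = (LINT x|Q v. indicator E x)" by (simp add: Q_def space)
    also have "\<dots> = (LINT x|\<sigma> v. 1 / w x * indicator E x)" by (rule dens) simp
    finally show ?thesis .
  qed
  have quadQ: "quadratic (\<lambda>v. measure (Q v) E)" if E: "rc_borel E" for E
    unfolding Q_measure[OF E] by (rule S.quadratic_integral[OF int_rc[OF E]])
  \<comment> \<open>On a set of infinite mass \<open>measure\<close> returns 0. Such values are
    harmless, since only relatively compact sets are ever tested.\<close>
  define \<nu> where "\<nu> i j E = polar (\<lambda>v. measure (Q v) E) i j" for i j E
  have signed: "signed_measure (\<nu> i j)" for i j
    unfolding signed_measure_def
  proof (intro allI impI, elim conjE)
    fix F :: "nat \<Rightarrow> real set"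
    assume F: "\<forall>n. F n \<in> sets borel" "disjoint_family F" "rc_borel (\<Union>n. F n)"
    have "(\<lambda>n. measure (Q v) (F n)) sums measure (Q v) (\<Union>n. F n)" for v
      by (rule measure_UNION) (use F Q_fin[OF F(3), of v] in \<open>auto simp: setsQ\<close>)
    thus "(\<lambda>n. \<nu> i j (F n)) sums \<nu> i j (\<Union>n. F n)"
      unfolding \<nu>_def polar_def by (intro sums_divide sums_diff)
  qed
  interpret polar_measures Q \<nu>
    by unfold_locales (use half Q_fin quadQ signed in \<open>auto simp: \<nu>_def\<close>)
  show ?thesis
  proof (rule that[of \<nu>])
    show "psd_measures \<nu>"
      unfolding psd_measures_def sym_psd_def
    proof (intro conjI allI impI signed)
      fix E assume E: "rc_borel E"
      show "transpose (\<chi> i j. \<nu> i j E) = (\<chi> i j. \<nu> i j E)"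
        using polar_sym[OF quadQ[OF E]] by (simp add: transpose_def vec_eq_iff \<nu>_def)
      show "0 \<le> x \<bullet> ((\<chi> i j. \<nu> i j E) *v x)" for x
        unfolding \<nu>_def quadratic_polar_matrix[OF quadQ[OF E], symmetric] by simp
    qed
    show "(\<integral>\<^sup>+x. ennreal (w x) \<partial>total_variation (\<nu> i j)) < \<infinity>" for i j
    proof (rule total_variation_finite)
      fix v
      have "(\<integral>\<^sup>+x. ennreal (w x) \<partial>Q v) = (\<integral>\<^sup>+x. ennreal (1 / w x) * ennreal (w x) \<partial>\<sigma> v)"
        unfolding Q_def by (subst nn_integral_density) auto
      also have "\<dots> = (\<integral>\<^sup>+x. 1 \<partial>\<sigma> v)"
        by (rule nn_integral_cong_AE) (auto intro!: eventually_mono[OF AEpos] simp: ennreal_mult[symmetric])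
      also have "\<dots> < \<infinity>" using finite_measure.emeasure_finite[OF fm, of v "space (\<sigma> v)"] by (simp add: less_top)
      finally show "(\<integral>\<^sup>+x. ennreal (w x) \<partial>Q v) < \<infinity>" .
    qed simp
    fix g :: "real \<Rightarrow> real" and C i j
    assume [measurable]: "g \<in> borel_measurable borel" and b: "\<And>x. 0 < x \<Longrightarrow> \<bar>g x\<bar> \<le> C * w x"
    have int\<sigma>: "integrable (\<sigma> v) (\<lambda>x. 1 / w x * g x)" for v
    proof (rule finite_measure.integrable_const_bound[OF fm, of _ C])
      show "AE x in \<sigma> v. norm (1 / w x * g x) \<le> C"
        using half_line_AE[OF S.half[of v]]
      proof eventually_elim
        case (elim x)
        thus ?case using b[OF elim] pos[OF elim] by (simp add: abs_mult field_simps)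
      qed
    qed simp
    have int: "integrable (Q v) g" for v
      unfolding Q_def using int\<sigma>[of v] AEnn by (subst integrable_density) auto
    have "(LINT x|Q v. g x) = (LINT x|\<sigma> v. g x / w x)" for v
      by (simp add: dens)
    thus "signed_integral (\<nu> i j) g = polar (\<lambda>v. LINT x|\<sigma> v. g x / w x) i j"
      using signed_integral_polar[OF int] by simp
  qed
qed

end

section \<open>The Hausdorff moment problem\<close>

text \<open>The linear extension of \<open>x\<^sup>n \<mapsto> m n\<close> to polynomials, which is
  integration as soon as \<open>m\<close> is a moment sequence.\<close>

definition poly_functional :: "(nat \<Rightarrow> real) \<Rightarrow> real poly \<Rightarrow> real" where
  "poly_functional m p = (\<Sum>i\<le>degree p. coeff p i * m i)"

lemma poly_functional_eq:
  assumes "degree p \<le> N"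
  shows "poly_functional m p = (\<Sum>i\<le>N. coeff p i * m i)"
  unfolding poly_functional_def
  by (rule sum.mono_neutral_left) (use assms in \<open>auto simp: coeff_eq_0\<close>)

lemma poly_functional_add: "poly_functional m (p + q) = poly_functional m p + poly_functional m q"
proof -
  let ?N = "max (degree p) (degree q)"
  have "degree (p + q) \<le> ?N" by (simp add: degree_add_le)
  thus ?thesis
    by (simp add: poly_functional_eq[of _ ?N] sum.distrib distrib_right)
qed

lemma poly_functional_0 [simp]: "poly_functional m 0 = 0"
  by (simp add: poly_functional_def)

lemma poly_functional_sum: "poly_functional m (sum p A) = (\<Sum>i\<in>A. poly_functional m (p i))"
  by (induction A rule: infinite_finite_induct) (simp_all add: poly_functional_add)

lemma poly_functional_smult: "poly_functional m (smult c p) = c * poly_functional m p"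
proof -
  have "degree (smult c p) \<le> degree p" by (rule degree_smult_le)
  thus ?thesis by (simp add: poly_functional_eq[of _ "degree p"] sum_distrib_left mult.assoc)
qed

lemma poly_functional_monom: "poly_functional m (monom c n) = c * m n"
proof -
  have "poly_functional m (monom c n) = (\<Sum>i\<le>n. (if n = i then c else 0) * m i)"
    by (simp add: poly_functional_eq[of _ n] degree_monom_le)
  also have "\<dots> = (\<Sum>i\<le>n. if n = i then c * m i else 0)" by (intro sum.cong) auto
  also have "\<dots> = c * m n" by simp
  finally show ?thesis .
qed

lemma poly_functional_monom_mult_square:
  "poly_functional m (monom 1 k * r\<^sup>2) =
    (\<Sum>a\<le>degree r. \<Sum>b\<le>degree r. coeff r a * coeff r b * m (k + (a + b)))"
proof -
  let ?s = "\<Sum>a\<le>degree r. monom (coeff r a) a"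
  have "monom 1 k * r\<^sup>2 = monom 1 k * (?s * ?s)"
    by (simp add: power2_eq_square poly_as_sum_of_monoms)
  also have "\<dots> = (\<Sum>a\<le>degree r. \<Sum>b\<le>degree r. monom (coeff r a * coeff r b) (k + (a + b)))"
    unfolding sum_product by (simp add: sum_distrib_left mult_monom)
  finally show ?thesis by (simp add: poly_functional_sum poly_functional_monom)
qed

text \<open>The two forms express that the functional is nonnegative on
  \<open>x * r(x)\<^sup>2\<close> and on \<open>(1 - x) * r(x)\<^sup>2\<close>, polynomials that are
  nonnegative on the unit interval.\<close>

locale hausdorff_moments =
  fixes m :: "nat \<Rightarrow> real"
  assumes psd1: "0 \<le> (\<Sum>a\<le>n. \<Sum>b\<le>n. c a * c b * m (Suc (a + b)))"
    and psd2: "0 \<le> (\<Sum>a\<le>n. \<Sum>b\<le>n. c a * c b * (m (a + b) - m (Suc (a + b))))"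
begin

abbreviation "L \<equiv> poly_functional m"
abbreviation "X \<equiv> monom (1::real) (Suc 0)"

lemma L_square1: "0 \<le> L (X * r\<^sup>2)"
  unfolding poly_functional_monom_mult_square using psd1[where n="degree r" and c="coeff r"] by simp

lemma L_square2: "0 \<le> L ((1 - X) * r\<^sup>2)"
proof -
  have "L (monom 1 0 * r\<^sup>2) = L ((1 - X) * r\<^sup>2) + L (X * r\<^sup>2)"
    unfolding poly_functional_add[symmetric] by (simp add: algebra_simps monom_0 one_pCons[symmetric])
  hence "L ((1 - X) * r\<^sup>2) = L (monom 1 0 * r\<^sup>2) - L (X * r\<^sup>2)" by simp
  also have "\<dots> = (\<Sum>a\<le>degree r. \<Sum>b\<le>degree r. coeff r a * coeff r b * (m (a + b) - m (Suc (a + b))))"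
    unfolding poly_functional_monom_mult_square by (simp add: sum_subtractf[symmetric] algebra_simps)
  finally show ?thesis using psd2[where n="degree r" and c="coeff r"] by simp
qed

text \<open>According to the parities of the exponents, the even powers are absorbed into a square
  \<open>r\<^sup>2\<close>. Where neither or both of the factors \<open>X\<close> and
  \<open>1 - X\<close> remain, the identity \<open>1 = X + (1 - X)\<close> splits the polynomial
  into two admissible terms.\<close>

lemma L_bernstein_nonneg: "0 \<le> L (X ^ k * (1 - X) ^ l)"
proof -
  define i j where "i = k div 2" and "j = l div 2"
  define r where "r = X ^ i * (1 - X) ^ j"
  have r2: "r\<^sup>2 = X ^ (2 * i) * (1 - X) ^ (2 * j)"
    by (simp add: r_def power_mult_distrib power_mult[symmetric] mult.commute)
  have split: "p = X * p + (1 - X) * p" for p :: "real poly" by (simp add: algebra_simps)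
  consider "k = 2 * i" "l = 2 * j" | "k = 2 * i + 1" "l = 2 * j" | "k = 2 * i" "l = 2 * j + 1"
    | "k = 2 * i + 1" "l = 2 * j + 1" unfolding i_def j_def by linarith
  thus ?thesis
  proof cases
    case 1
    hence "X ^ k * (1 - X) ^ l = X * r\<^sup>2 + (1 - X) * r\<^sup>2" using split[of "r\<^sup>2"] r2 by simp
    thus ?thesis using L_square1[of r] L_square2[of r] by (simp only: poly_functional_add)
  next
    case 2
    hence "X ^ k * (1 - X) ^ l = X * r\<^sup>2" using r2 by (simp add: mult.assoc)
    thus ?thesis using L_square1[of r] by (simp only:)
  next
    case 3
    hence "X ^ k * (1 - X) ^ l = (1 - X) * r\<^sup>2" using r2 by (simp add: ac_simps)
    thus ?thesis using L_square2[of r] by (simp only:)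
  next
    case 4
    have "X ^ k * (1 - X) ^ l = X * (1 - X) * r\<^sup>2"
      unfolding 4 r2 by (simp add: ac_simps)
    \<comment> \<open>Multiplying by \<open>X + (1 - X)\<close> completes in each term one of the
      two factors to a square.\<close>
    also have "\<dots> = X * (X * (1 - X) * r\<^sup>2) + (1 - X) * (X * (1 - X) * r\<^sup>2)" by (rule split)
    also have "\<dots> = (1 - X) * (X * r)\<^sup>2 + X * ((1 - X) * r)\<^sup>2"
      by (simp add: power2_eq_square ac_simps)
    finally show ?thesis using L_square1[of "(1 - X) * r"] L_square2[of "X * r"]
      by (simp only: poly_functional_add)
  qed
qed

text \<open>The mass at \<open>k / n\<close> of the discrete measures whose weak limit has the moments \<open>m\<close>.\<close>

definition weight :: "nat \<Rightarrow> nat \<Rightarrow> real" where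
  "weight n k = real (n choose k) * L (X ^ k * (1 - X) ^ (n - k))"

lemma weight_nonneg: "0 \<le> weight n k"
  unfolding weight_def by (intro mult_nonneg_nonneg L_bernstein_nonneg of_nat_0_le_iff)

text \<open>Factorial moments of the discrete measure are exact for each \<open>n\<close>: the
  product formula for binomial coefficients reduces the sum to the expansion of
  \<open>(X + (1 - X)) ^ (n - j) = 1\<close>. Ordinary powers are matched only in the limit.\<close>

lemma weight_moment:
  assumes "j \<le> n"
  shows "(\<Sum>k\<le>n. real (k choose j) / real (n choose j) * weight n k) = m j"
proof -
  have pos: "real (n choose j) > 0" using assms by simp
  have "(\<Sum>k\<le>n. real (k choose j) / real (n choose j) * weight n k) =
     (\<Sum>k=j..n. real (k choose j) / real (n choose j) * weight n k)"
    by (rule sum.mono_neutral_right) auto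
  also have "\<dots> = (\<Sum>k=j..n. real ((n - j) choose (k - j)) * L (X ^ k * (1 - X) ^ (n - k)))"
  proof (intro sum.cong refl)
    fix k assume k: "k \<in> {j..n}"
    have "(n choose k) * (k choose j) = (n choose j) * ((n - j) choose (k - j))"
      using k by (intro choose_mult) auto
    hence "real (n choose k) * real (k choose j) = real (n choose j) * real ((n - j) choose (k - j))"
      unfolding of_nat_mult[symmetric] by (rule arg_cong)
    thus "real (k choose j) / real (n choose j) * weight n k =
       real ((n - j) choose (k - j)) * L (X ^ k * (1 - X) ^ (n - k))"
      using pos by (simp add: weight_def field_simps)
  qed
  also have "\<dots> = (\<Sum>i\<le>n - j. real ((n - j) choose i) * L (X ^ (i + j) * (1 - X) ^ (n - j - i)))"
    by (rule sum.reindex_bij_witness[of _ "\<lambda>i. i + j" "\<lambda>k. k - j"]) (use assms in auto)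
  also have "\<dots> = L (X ^ j * (\<Sum>i\<le>n - j. of_nat ((n - j) choose i) * X ^ i * (1 - X) ^ (n - j - i)))"
  proof -
    have "of_nat c * p = smult (real c) p" for c and p :: "real poly" by (simp add: of_nat_poly)
    moreover have "X ^ j * (of_nat c * X ^ i * q) = of_nat c * (X ^ (i + j) * q)" for c i q
      by (simp add: power_add ac_simps)
    ultimately have "X ^ j * (of_nat c * X ^ i * q) = smult (real c) (X ^ (i + j) * q)" for c i q
      by simp
    thus ?thesis by (simp only: sum_distrib_left poly_functional_sum poly_functional_smult)
  qed
  also have "(\<Sum>i\<le>n - j. of_nat ((n - j) choose i) * X ^ i * (1 - X) ^ (n - j - i)) = 1"
    unfolding binomial_ring[symmetric] by simp
  also have "L (X ^ j * 1) = m j"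
    by (simp add: monom_power poly_functional_monom)
  finally show ?thesis .
qed

lemma binomial_ratio:
  assumes "k \<le> n" "j \<le> n"
  shows "real (k choose j) / real (n choose j) = (\<Prod>i<j. (real k - real i) / (real n - real i))"
proof -
  have "real (a choose j) = (\<Prod>i<j. real a - real i) / fact j" for a
    by (simp add: binomial_gbinomial gbinomial_prod_rev atLeast0LessThan)
  thus ?thesis by (simp add: prod_dividef)
qed

text \<open>Both quantities are products of \<open>j\<close> factors of modulus at most 1, so they
  differ by at most the sum of the differences of the factors, each of which is
  \<open>i / (n - i)\<close> times \<open>(n - k) / n\<close>. The bound does not depend on
  \<open>k\<close>.\<close>

lemma binomial_ratio_close:
  assumes k: "k \<le> n" and n: "2 * j < n"
  shows "\<bar>(real k / real n) ^ j - real (k choose j) / real (n choose j)\<bar> \<le> real j * (real j / (real n - real j))"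
proof -
  have "\<bar>(real k / real n) ^ j - real (k choose j) / real (n choose j)\<bar> =
     norm ((\<Prod>i<j. real k / real n) - (\<Prod>i<j. (real k - real i) / (real n - real i)))"
    using assms by (simp add: binomial_ratio)
  also have "\<dots> \<le> (\<Sum>i<j. norm (real k / real n - (real k - real i) / (real n - real i)))"
  proof (rule norm_prod_diff)
    fix i assume i: "i \<in> {..<j}"
    show "norm (real k / real n) \<le> 1" using assms by (auto simp: divide_simps)
    have "\<bar>real k - real i\<bar> \<le> real n - real i" using i n k by auto
    thus "norm ((real k - real i) / (real n - real i)) \<le> 1" using i n by (auto simp: divide_simps)
  qed
  also have "\<dots> \<le> (\<Sum>i<j. real j / (real n - real j))"
  proof (rule sum_mono)
    fix i assume i: "i \<in> {..<j}"
    have eq: "real k / real n - (real k - real i) / (real n - real i) = (real i / (real n - real i)) * ((real n - real k) / real n)"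
      using i n by (simp add: divide_simps) (simp add: algebra_simps)
    have "norm (real k / real n - (real k - real i) / (real n - real i)) = (real i / (real n - real i)) * ((real n - real k) / real n)"
      unfolding eq using i n k by (simp add: abs_mult)
    also have "\<dots> \<le> (real j / (real n - real j)) * 1"
      using i n k by (intro mult_mono frac_le) auto
    finally show "norm (real k / real n - (real k - real i) / (real n - real i)) \<le> real j / (real n - real j)"
      by (simp only: mult_1_right)
  qed
  finally show ?thesis by simp
qed

lemma weight_sum: "(\<Sum>k\<le>n. weight n k) = m 0"
  using weight_moment[of 0 n] by simp

lemma weight_power_limit: "(\<lambda>n. \<Sum>k\<le>n. (real k / real n) ^ j * weight n k) \<longlonglongrightarrow> m j"
proof -
  have "(\<lambda>n. (\<Sum>k\<le>n. (real k / real n) ^ j * weight n k) - m j) \<longlonglongrightarrow> 0"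
  proof (rule Lim_null_comparison)
    have "norm ((\<Sum>k\<le>n. (real k / real n) ^ j * weight n k) - m j) \<le> real j * (real j / (real n - real j)) * m 0"
      if n: "2 * j < n" for n
    proof -
      have "(\<Sum>k\<le>n. (real k / real n) ^ j * weight n k) - m j =
        (\<Sum>k\<le>n. ((real k / real n) ^ j - real (k choose j) / real (n choose j)) * weight n k)"
        using weight_moment[of j n] n by (simp add: left_diff_distrib sum_subtractf)
      also have "norm \<dots> \<le> (\<Sum>k\<le>n. real j * (real j / (real n - real j)) * weight n k)"
        by (rule order_trans[OF norm_sum sum_mono])
           (use n weight_nonneg binomial_ratio_close in \<open>simp add: abs_mult mult_right_mono del: times_divide_eq_right\<close>)
      also have "\<dots> = real j * (real j / (real n - real j)) * m 0"
        by (simp only: sum_distrib_left[symmetric] weight_sum)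
      finally show ?thesis .
    qed
    thus "\<forall>\<^sub>F n in sequentially. norm ((\<Sum>k\<le>n. (real k / real n) ^ j * weight n k) - m j) \<le> real j * (real j / (real n - real j)) * m 0"
      by (intro eventually_sequentiallyI[of "2 * j + 1"]) auto
    show "(\<lambda>n. real j * (real j / (real n - real j)) * m 0) \<longlonglongrightarrow> 0" by real_asymp
  qed
  thus ?thesis by (simp add: LIM_zero_iff)
qed

text \<open>The discrete measures with mass \<open>weight n k\<close> at \<open>k / n\<close> have
  moments converging to \<open>m\<close>, and their supports stay in the unit interval. Tightness
  gives a weak limit along a subsequence, whose moments are \<open>m\<close>. Normalization divides
  by \<open>m 0\<close>, hence the separate case of the null measure.\<close>

theorem moment_measure:
  obtains \<tau> :: "real measure" where "finite_measure \<tau>" "sets \<tau> = sets borel"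
    "emeasure \<tau> (- {0..1}) = 0" "\<And>n. (LINT x|\<tau>. x ^ n) = m n"
proof (cases "m 0 = 0")
  case True
  hence "weight n k = 0" if "k \<le> n" for n k
    using weight_sum[of n] weight_nonneg[of n] that by (simp add: sum_nonneg_eq_0_iff)
  hence "m j = 0" for j using weight_moment[of j j] by simp
  thus ?thesis using that[of "null_measure borel"]
    by (simp add: finite_measureI)
next
  case False
  have "m 0 \<ge> 0" using weight_sum[of 0] weight_nonneg[of 0] by (metis sum_nonneg)
  with False have m0: "m 0 > 0" by simp
  \<comment> \<open>For \<open>n = 0\<close> the single atom lies at \<open>0 / 0 = 0\<close>, still
    in the unit interval.\<close>
  define \<mu> where "\<mu> n = distr (point_measure {..n} (\<lambda>k. ennreal (weight n k / m 0))) borel (\<lambda>k. real k / real n)" for n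
  have prob: "prob_space (\<mu> n)" for n
  proof
    have "emeasure (\<mu> n) (space (\<mu> n)) = (\<Sum>k\<le>n. ennreal (weight n k / m 0))"
      by (simp add: \<mu>_def emeasure_distr space_point_measure emeasure_point_measure_finite)
    also have "\<dots> = ennreal ((\<Sum>k\<le>n. weight n k) / m 0)"
      using m0 weight_nonneg by (subst sum_ennreal) (auto simp: sum_divide_distrib)
    finally show "emeasure (\<mu> n) (space (\<mu> n)) = 1" using m0 by (simp add: weight_sum)
  qed
  have rd: "real_distribution (\<mu> n)" for n
    unfolding real_distribution_def real_distribution_axioms_def using prob by (auto simp: \<mu>_def)
  have integral: "(LINT x|\<mu> n. g x) = (\<Sum>k\<le>n. weight n k / m 0 * g (real k / real n))"
    if "g \<in> borel_measurable borel" for g :: "real \<Rightarrow> real" and n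
    unfolding \<mu>_def using that m0 weight_nonneg
    by (simp add: integral_distr lebesgue_integral_point_measure_finite)
  \<comment> \<open>Tightness refers to intervals that are open on the left, so the left end must
    lie below the possible atom at 0.\<close>
  have "measure (\<mu> n) {-1<..1} = 1" for n
  proof -
    have "measure (\<mu> n) {-1<..1} = (LINT x|\<mu> n. indicator {-1<..1} x)"
      by (simp add: \<mu>_def)
    also have "\<dots> = (\<Sum>k\<le>n. weight n k / m 0)"
      by (subst integral) (auto intro!: sum.cong simp: divide_simps indicator_def)
    also have "\<dots> = 1" using m0 by (simp add: weight_sum sum_divide_distrib[symmetric])
    finally show ?thesis .
  qed
  hence "tight \<mu>" unfolding tight_def using rd
    by (intro conjI allI impI exI[of _ "-1::real"] exI[of _ "1::real"]) auto
  from tight_imp_convergent_subsubsequence[OF this strict_mono_id] obtain r M where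
    r: "strict_mono r" and M: "real_distribution M" and wc: "weak_conv_m (\<mu> \<circ> id \<circ> r) M" by blast
  interpret M: real_distribution M by fact
  \<comment> \<open>Weak convergence tests bounded continuous functions on the whole line.
    \<open>clip\<close> is the identity on the unit interval and makes powers bounded, and the image
    of the limit under it lies in the unit interval by construction.\<close>
  define clip where "clip x = max 0 (min 1 (x::real))" for x
  have clip01: "0 \<le> clip x" "clip x \<le> 1" for x by (auto simp: clip_def)
  have clip_cont: "isCont clip x" for x unfolding clip_def by (intro continuous_intros)
  have clip_meas [measurable]: "clip \<in> borel_measurable borel"
    by (intro borel_measurable_continuous_onI continuous_at_imp_continuous_on ballI clip_cont)
  have lim: "(LINT x|M. clip x ^ j) = m j / m 0" for j
  proof -
    have bound: "norm (clip x ^ j) \<le> 1" for x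
      unfolding norm_power using clip01[of x] by (intro power_le_one) auto
    have "(\<lambda>n. LINT x|\<mu> (r n). clip x ^ j) \<longlonglongrightarrow> (LINT x|M. clip x ^ j)"
      using wc rd M
      by (intro weak_conv_imp_integral_bdd_continuous_conv[of "\<lambda>n. \<mu> (r n)" M _ 1])
         (use bound in \<open>auto simp: o_def intro!: continuous_intros clip_cont\<close>)
    moreover have "(LINT x|\<mu> n. clip x ^ j) = (\<Sum>k\<le>n. (real k / real n) ^ j * weight n k) / m 0" for n
    proof -
      have "clip (real k / real n) = real k / real n" if "k \<le> n" for k
        using that by (auto simp: clip_def divide_simps min_def max_def)
      thus ?thesis by (subst integral) (auto simp: sum_divide_distrib intro!: sum.cong)
    qed
    hence "(\<lambda>n. LINT x|\<mu> n. clip x ^ j) \<longlonglongrightarrow> m j / m 0"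
      using m0 by (simp add: tendsto_divide[OF weight_power_limit tendsto_const])
    hence "(\<lambda>n. LINT x|\<mu> (r n). clip x ^ j) \<longlonglongrightarrow> m j / m 0"
      using r LIMSEQ_subseq_LIMSEQ by (fastforce simp: o_def)
    ultimately show ?thesis using LIMSEQ_unique by blast
  qed
  define \<tau> where "\<tau> = density (distr M borel clip) (\<lambda>_. ennreal (m 0))"
  show ?thesis
  proof (rule that[of \<tau>])
    show "sets \<tau> = sets borel" by (simp add: \<tau>_def)
    show "finite_measure \<tau>"
      by (rule finite_measureI)
         (simp add: \<tau>_def emeasure_density emeasure_distr nn_integral_cmult_indicator M.emeasure_space_1 ennreal_mult_eq_top_iff nn_integral_cmult nn_integral_distr)
    have "clip -` (- {0..1}) \<inter> space M = {}" using clip01 by auto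
    thus "emeasure \<tau> (- {0..1}) = 0"
      by (simp add: \<tau>_def emeasure_density emeasure_distr nn_integral_cmult)
    show "(LINT x|\<tau>. x ^ n) = m n" for n
      unfolding \<tau>_def using m0 lim[of n] by (simp add: integral_density integral_distr)
  qed
qed

end

text \<open>From powers to the products \<open>x ^ k * (1 - x) ^ l\<close>, hence to Bernstein
  polynomials, which approximate \<open>g\<close> uniformly on the unit interval. The total mass
  weighted by the \<open>\<bar>c i\<bar>\<close> controls the error.\<close>

lemma integral_eq_0_of_moments:
  fixes \<mu> :: "'i \<Rightarrow> real measure" and c :: "'i \<Rightarrow> real"
  assumes I: "finite I" and fin: "\<And>i. i \<in> I \<Longrightarrow> finite_measure (\<mu> i)"
    and sets: "\<And>i. i \<in> I \<Longrightarrow> sets (\<mu> i) = sets borel"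
    and conc: "\<And>i. i \<in> I \<Longrightarrow> AE x in \<mu> i. x \<in> {0..1}"
    and mom: "\<And>n. (\<Sum>i\<in>I. c i * (LINT x|\<mu> i. x ^ n)) = 0"
    and g: "continuous_on UNIV g"
  shows "(\<Sum>i\<in>I. c i * (LINT x|\<mu> i. g x)) = 0"
proof -
  have int: "integrable (\<mu> i) h" if i: "i \<in> I" and h: "continuous_on UNIV h" for i and h :: "real \<Rightarrow> real"
  proof -
    interpret finite_measure "\<mu> i" using fin i .
    have "compact (h ` {0..1})"
      by (rule compact_continuous_image) (use h continuous_on_subset in \<open>auto\<close>)
    then obtain B where B: "\<And>x. x \<in> {0..1} \<Longrightarrow> norm (h x) \<le> B"
      using compact_imp_bounded bounded_iff by (metis image_eqI)
    have [measurable]: "h \<in> borel_measurable (\<mu> i)"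
      using borel_measurable_continuous_onI[OF h] sets[OF i] measurable_cong_sets by blast
    show ?thesis by (rule integrable_const_bound[of _ B]) (use conc[OF i] B in auto)
  qed
  have bern: "(\<Sum>i\<in>I. c i * (LINT x|\<mu> i. x ^ k * (1 - x) ^ l)) = 0" for k l
  proof (induction l arbitrary: k)
    case 0 thus ?case using mom by simp
  next
    case (Suc l)
    have "(LINT x|\<mu> i. x ^ k * (1 - x) ^ Suc l) =
       (LINT x|\<mu> i. x ^ k * (1 - x) ^ l) - (LINT x|\<mu> i. x ^ Suc k * (1 - x) ^ l)" if "i \<in> I" for i
      by (subst Bochner_Integration.integral_diff[symmetric])
         (use that in \<open>auto intro!: int continuous_intros Bochner_Integration.integral_cong simp: algebra_simps\<close>)
    hence "(\<Sum>i\<in>I. c i * (LINT x|\<mu> i. x ^ k * (1 - x) ^ Suc l)) =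
       (\<Sum>i\<in>I. c i * (LINT x|\<mu> i. x ^ k * (1 - x) ^ l)) - (\<Sum>i\<in>I. c i * (LINT x|\<mu> i. x ^ Suc k * (1 - x) ^ l))"
      by (simp add: sum_subtractf[symmetric] right_diff_distrib del: power_Suc)
    thus ?case by (simp only: Suc.IH)
  qed
  define S where "S = (\<Sum>i\<in>I. \<bar>c i\<bar> * measure (\<mu> i) (space (\<mu> i)))"
  have "\<bar>\<Sum>i\<in>I. c i * (LINT x|\<mu> i. g x)\<bar> \<le> e * S" if e: "e > 0" for e
  proof -
    from Bernstein_Weierstrass[OF continuous_on_subset[OF g] e] obtain N where
      N: "\<And>x. x \<in> {0..1} \<Longrightarrow> \<bar>g x - (\<Sum>k\<le>N. g(k/N) * Bernstein N k x)\<bar> < e" by blast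
    define B where "B x = (\<Sum>k\<le>N. g(k/N) * Bernstein N k x)" for x
    have Bc: "continuous_on UNIV B" unfolding B_def Bernstein_def by (intro continuous_intros)
    have "(LINT x|\<mu> i. B x) = (\<Sum>k\<le>N. g(k/N) * real (N choose k) * (LINT x|\<mu> i. x ^ k * (1 - x) ^ (N - k)))" if "i \<in> I" for i
    proof -
      have "(LINT x|\<mu> i. B x) = (LINT x|\<mu> i. (\<Sum>k\<le>N. g(k/N) * real (N choose k) * (x ^ k * (1 - x) ^ (N - k))))"
        by (simp add: B_def Bernstein_def mult.assoc)
      also have "\<dots> = (\<Sum>k\<le>N. LINT x|\<mu> i. g(k/N) * real (N choose k) * (x ^ k * (1 - x) ^ (N - k)))"
        by (rule Bochner_Integration.integral_sum) (intro int that continuous_intros)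
      finally show ?thesis by simp
    qed
    hence "(\<Sum>i\<in>I. c i * (LINT x|\<mu> i. B x)) = (\<Sum>k\<le>N. g(k/N) * real (N choose k) * (\<Sum>i\<in>I. c i * (LINT x|\<mu> i. x ^ k * (1 - x) ^ (N - k))))"
      by (simp add: sum_distrib_left mult.left_commute sum.swap[of _ I])
    also have "\<dots> = 0" by (simp add: bern)
    finally have B0: "(\<Sum>i\<in>I. c i * (LINT x|\<mu> i. B x)) = 0" .
    have "\<bar>\<Sum>i\<in>I. c i * (LINT x|\<mu> i. g x)\<bar> = \<bar>\<Sum>i\<in>I. c i * (LINT x|\<mu> i. g x - B x)\<bar>"
      using B0 by (simp add: int g Bc right_diff_distrib sum_subtractf)
    also have "\<dots> \<le> (\<Sum>i\<in>I. \<bar>c i\<bar> * (e * measure (\<mu> i) (space (\<mu> i))))"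
    proof (rule order_trans[OF sum_abs sum_mono], unfold abs_mult, rule mult_left_mono)
      fix i assume i: "i \<in> I"
      interpret finite_measure "\<mu> i" using fin i .
      have "\<bar>LINT x|\<mu> i. g x - B x\<bar> \<le> (LINT x|\<mu> i. \<bar>g x - B x\<bar>)" by (rule integral_abs_bound)
      also have "\<dots> \<le> (LINT x|\<mu> i. e)"
      proof (rule integral_mono_AE)
        show "integrable (\<mu> i) (\<lambda>x. \<bar>g x - B x\<bar>)" by (intro int i continuous_intros g Bc)
        have "\<bar>g x - B x\<bar> \<le> e" if "x \<in> {0..1}" for x using N[OF that] by (simp add: B_def)
        thus "AE x in \<mu> i. \<bar>g x - B x\<bar> \<le> e" using conc[OF i] by (rule eventually_mono[rotated])
      qed simp
      finally show "\<bar>LINT x|\<mu> i. g x - B x\<bar> \<le> e * measure (\<mu> i) (space (\<mu> i))" by (simp add: mult.commute)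
    qed simp
    also have "\<dots> = e * S" by (simp add: S_def sum_distrib_left ac_simps)
    finally show ?thesis .
  qed
  note bound = this
  have "S \<ge> 0" by (simp add: S_def sum_nonneg)
  have "\<bar>\<Sum>i\<in>I. c i * (LINT x|\<mu> i. g x)\<bar> \<le> 0 + e" if "e > 0" for e
  proof -
    have "e / (S + 1) * S \<le> e" using \<open>S \<ge> 0\<close> that by (simp add: field_simps)
    thus ?thesis using bound[of "e / (S + 1)"] \<open>S \<ge> 0\<close> that by (auto intro: order_trans)
  qed
  from field_le_epsilon[OF this] show ?thesis by simp
qed

text \<open>Uniqueness in the moment problem, for linear combinations of several measures. This form
  lets a linear relation between moment sequences pass to the measures, as needed to see that
  measures depend quadratically on a vector.\<close>

theorem measure_eq_0_of_moments:
  fixes \<mu> :: "'i \<Rightarrow> real measure" and c :: "'i \<Rightarrow> real"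
  assumes I: "finite I" and fin: "\<And>i. i \<in> I \<Longrightarrow> finite_measure (\<mu> i)"
    and sets: "\<And>i. i \<in> I \<Longrightarrow> sets (\<mu> i) = sets borel"
    and conc: "\<And>i. i \<in> I \<Longrightarrow> AE x in \<mu> i. x \<in> {0..1}"
    and mom: "\<And>n. (\<Sum>i\<in>I. c i * (LINT x|\<mu> i. x ^ n)) = 0"
    and E: "E \<in> sets borel"
  shows "(\<Sum>i\<in>I. c i * measure (\<mu> i) E) = 0"
proof -
  have half: "(\<Sum>i\<in>I. c i * measure (\<mu> i) {..a}) = 0" for a
  proof -
    \<comment> \<open>Equal to 1 up to \<open>a\<close>, equal to 0 from \<open>a + 1 / n\<close> on
      for positive \<open>n\<close>, and linear in between.\<close>
    define g where "g n x = max 0 (min 1 (1 - real n * (x - a)))" for n x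
    have "(\<lambda>n. LINT x|\<mu> i. g n x) \<longlonglongrightarrow> (LINT x|\<mu> i. indicator {..a} x)" if i: "i \<in> I" for i
    proof -
      interpret finite_measure "\<mu> i" using fin i .
      note [measurable_cong] = sets[OF i]
      show ?thesis
      proof (rule integral_dominated_convergence[where w="\<lambda>_. 1"])
        have "(\<lambda>n. g n x) \<longlonglongrightarrow> indicator {..a} x" for x
        proof (cases "x \<le> a")
          case True
          hence "real n * (x - a) \<le> 0" for n by (simp add: mult_le_0_iff)
          hence "g n x = 1" for n unfolding g_def by (smt (verit))
          thus ?thesis using True by simp
        next
          case False
          then obtain N where N: "real N * (x - a) > 1" using ex_less_of_nat_mult[of "x - a" 1] by auto
          have "g n x = 0" if "n \<ge> N" for n
          proof -
            have "real n * (x - a) \<ge> real N * (x - a)" using that False by (simp add: mult_right_mono)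
            thus ?thesis using N by (simp add: g_def)
          qed
          thus ?thesis using False by (auto intro!: tendsto_eventually eventually_sequentiallyI)
        qed
        thus "AE x in \<mu> i. (\<lambda>n. g n x) \<longlonglongrightarrow> indicator {..a} x" by simp
        show "AE x in \<mu> i. norm (g n x) \<le> 1" for n by (simp add: g_def)
      qed (auto simp: g_def)
    qed
    hence "(\<lambda>n. \<Sum>i\<in>I. c i * (LINT x|\<mu> i. g n x)) \<longlonglongrightarrow> (\<Sum>i\<in>I. c i * (LINT x|\<mu> i. indicator {..a} x))"
      by (intro tendsto_sum tendsto_mult tendsto_const)
    moreover have "(\<Sum>i\<in>I. c i * (LINT x|\<mu> i. g n x)) = 0" for n
      by (rule integral_eq_0_of_moments[OF I fin sets conc mom]) (auto simp: g_def intro!: continuous_intros)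
    ultimately have "(\<Sum>i\<in>I. c i * (LINT x|\<mu> i. indicator {..a} x)) = 0" by (simp add: LIMSEQ_const_iff)
    moreover have "(LINT x|\<mu> i. indicator {..a} x) = measure (\<mu> i) {..a}" if "i \<in> I" for i
      using sets_eq_imp_space_eq[OF sets[OF that]] by simp
    ultimately show ?thesis by simp
  qed
  have univ: "(\<Sum>i\<in>I. c i * measure (\<mu> i) UNIV) = 0"
    using mom[of 0] sets_eq_imp_space_eq[OF sets] by simp
  have "Int_stable (range (\<lambda>a::real. {..a}))" by (auto simp: Int_stable_def)
  moreover have "range (\<lambda>a::real. {..a}) \<subseteq> Pow UNIV" by simp
  moreover have "E \<in> sigma_sets UNIV (range (\<lambda>a::real. {..a}))"
    using E by (simp add: borel_eq_atMost)
  ultimately show ?thesis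
  proof (induction rule: sigma_sets_induct_disjoint)
    case (basic A) thus ?case using half by auto
  next
    case empty show ?case by simp
  next
    case (compl A)
    hence A: "A \<in> sets borel" by (simp add: borel_eq_atMost)
    have "measure (\<mu> i) (UNIV - A) = measure (\<mu> i) UNIV - measure (\<mu> i) A" if i: "i \<in> I" for i
      using finite_measure.finite_measure_compl[OF fin[OF i], of A] sets[OF i] A sets_eq_imp_space_eq[OF sets[OF i]] by simp
    hence "(\<Sum>i\<in>I. c i * measure (\<mu> i) (UNIV - A)) = (\<Sum>i\<in>I. c i * measure (\<mu> i) UNIV) - (\<Sum>i\<in>I. c i * measure (\<mu> i) A)"
      by (simp add: right_diff_distrib sum_subtractf)
    thus ?case using univ compl by simp
  next
    case (union A)
    hence A: "range A \<subseteq> sets borel" by (auto simp: borel_eq_atMost)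
    have "(\<lambda>n. measure (\<mu> i) (A n)) sums measure (\<mu> i) (\<Union>n. A n)" if i: "i \<in> I" for i
      using finite_measure.finite_measure_UNION[OF fin[OF i], of A] sets[OF i] A union by simp
    hence "(\<lambda>n. \<Sum>i\<in>I. c i * measure (\<mu> i) (A n)) sums (\<Sum>i\<in>I. c i * measure (\<mu> i) (\<Union>n. A n))"
      by (intro sums_sum sums_mult)
    moreover have "(\<lambda>n. \<Sum>i\<in>I. c i * measure (\<mu> i) (A n)) = (\<lambda>n. 0)" using union by simp
    ultimately show ?case using sums_unique2 sums_zero by metis
  qed
qed

section \<open>Inversion of Hankel positive matrix sequences\<close>

text \<open>A copy of the square matrices whose multiplication is the matrix product, so that formal
  power series with matrix coefficients form a noncommutative ring.\<close>

typedef ('m::finite) square_matrix = "UNIV :: (real^'m^'m) set"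
  morphisms mat_of Abs_square_matrix by simp

lemmas mat_of_Abs [simp] = Abs_square_matrix_inverse[OF UNIV_I]

lemma matrix_add_distrib_right: "(A + B) ** C = A ** C + (B ** C :: real^'n::finite^'m::finite)"
  by (simp add: matrix_matrix_mult_def vec_eq_iff distrib_right sum.distrib)

instantiation square_matrix :: (finite) ring_1
begin
definition "0 = Abs_square_matrix 0"
definition "1 = Abs_square_matrix (mat 1)"
definition "A + B = Abs_square_matrix (mat_of A + mat_of B)"
definition "A - B = Abs_square_matrix (mat_of A - mat_of B)"
definition "- A = Abs_square_matrix (- mat_of A)"
definition "A * B = Abs_square_matrix (mat_of A ** mat_of B)"
instance
proof
  show "(0 :: 'a square_matrix) \<noteq> 1"
  proof
    assume "(0 :: 'a square_matrix) = 1"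
    hence "mat_of (0 :: 'a square_matrix) = mat_of 1" by simp
    hence "(0 :: real^'a^'a) = mat 1"
      by (simp add: zero_square_matrix_def one_square_matrix_def)
    from arg_cong[OF this, of "\<lambda>A :: real^'a^'a. A $ undefined $ undefined"] show False
      by (simp add: mat_def)
  qed
qed (simp_all add: zero_square_matrix_def one_square_matrix_def plus_square_matrix_def
    minus_square_matrix_def uminus_square_matrix_def times_square_matrix_def
    mat_of_inject[symmetric] matrix_mul_assoc matrix_add_ldistrib matrix_add_distrib_right)
end

lemma mat_of_simps:
  "mat_of 0 = 0" "mat_of 1 = mat 1" "mat_of (A + B) = mat_of A + mat_of B"
  "mat_of (A - B) = mat_of A - mat_of B" "mat_of (- A) = - mat_of A"
  "mat_of (A * B) = mat_of A ** mat_of B"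
  by (simp_all add: zero_square_matrix_def one_square_matrix_def plus_square_matrix_def
    minus_square_matrix_def uminus_square_matrix_def times_square_matrix_def)

lemma mat_of_sum: "mat_of (sum f S) = (\<Sum>x\<in>S. mat_of (f x))"
  by (induction S rule: infinite_finite_induct) (simp_all add: mat_of_simps)

lemma mat_of_of_nat: "mat_of (of_nat n) = mat (of_nat n)"
  by (induction n) (simp_all add: mat_of_simps mat_def vec_eq_iff)

text \<open>The vectors \<open>c a\<close> are the coefficients of a vector-valued polynomial. For
  the moments of a positive matrix measure the sum is the integral of the quadratic form at this
  polynomial.\<close>

definition hankel_psd :: "(nat \<Rightarrow> real^'m::finite^'m) \<Rightarrow> bool" where
  "hankel_psd M \<longleftrightarrow> (\<forall>n c. 0 \<le> (\<Sum>a\<le>n. \<Sum>b\<le>n. c a \<bullet> (M (a + b) *v c b)))"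

text \<open>Coefficient of \<open>x ^ a * y ^ b\<close> in the identity \<open>(G(x) - G(y)) / (x -
  y) = - G(x) * ((F(x) - F(y)) / (x - y)) * G(y)\<close>, which follows from
  \<open>G(x) * (F(y) - F(x)) * G(y) = G(x) - G(y)\<close>. The Hankel matrix of the inverse is thus
  minus the Hankel matrix of \<open>F\<close> between triangular Toeplitz factors.\<close>

lemma inverse_fps_hankel:
  fixes F G :: "'a::ring_1 fps"
  assumes FG: "F * G = 1" and GF: "G * F = 1"
  shows "fps_nth G (Suc (a + b)) =
    - (\<Sum>c\<le>a. \<Sum>d\<le>b. fps_nth G (a - c) * fps_nth F (Suc (c + d)) * fps_nth G (b - d))"
proof (induction a arbitrary: b)
  case 0
  have "0 = fps_nth (F * G) (Suc b)" by (simp add: FG)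
  also have "\<dots> = (\<Sum>e\<le>Suc b. fps_nth F e * fps_nth G (Suc b - e))"
    by (simp add: fps_mult_nth atLeast0AtMost)
  also have "\<dots> = fps_nth F 0 * fps_nth G (Suc b) + (\<Sum>d\<le>b. fps_nth F (Suc d) * fps_nth G (b - d))"
    by (subst sum.atMost_Suc_shift) simp
  finally have eq: "(\<Sum>d\<le>b. fps_nth F (Suc d) * fps_nth G (b - d)) = - (fps_nth F 0 * fps_nth G (Suc b))"
    by (simp add: eq_neg_iff_add_eq_0 add.commute)
  have "fps_nth (G * F) 0 = 1" by (simp add: GF)
  hence g0: "fps_nth G 0 * fps_nth F 0 = 1" by (simp add: fps_mult_nth)
  have "(\<Sum>d\<le>b. fps_nth G 0 * fps_nth F (Suc d) * fps_nth G (b - d)) = fps_nth G 0 * - (fps_nth F 0 * fps_nth G (Suc b))"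
    unfolding eq[symmetric] by (simp add: sum_distrib_left mult.assoc)
  also have "\<dots> = - fps_nth G (Suc b)"
    using g0 by (simp add: mult.assoc[symmetric])
  finally show ?case by simp
next
  case (Suc a)
  define Z where "Z = (\<Sum>c\<le>a. \<Sum>d\<le>b. fps_nth G (a - c) * fps_nth F (Suc (Suc (c + d))) * fps_nth G (b - d))"
  have "0 = fps_nth (F * G) (Suc b)" by (simp add: FG)
  also have "\<dots> = (\<Sum>e\<le>Suc b. fps_nth F e * fps_nth G (Suc b - e))"
    by (simp add: fps_mult_nth atLeast0AtMost)
  also have "\<dots> = fps_nth F 0 * fps_nth G (Suc b) + (\<Sum>d\<le>b. fps_nth F (Suc d) * fps_nth G (b - d))"
    by (subst sum.atMost_Suc_shift) simp
  finally have eq: "(\<Sum>d\<le>b. fps_nth F (Suc d) * fps_nth G (b - d)) = - (fps_nth F 0 * fps_nth G (Suc b))"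
    by (simp add: eq_neg_iff_add_eq_0 add.commute)
  have "0 = fps_nth (G * F) (Suc a)" by (simp add: GF)
  also have "\<dots> = (\<Sum>e\<le>Suc a. fps_nth G (Suc a - e) * fps_nth F e)"
    unfolding fps_mult_nth atLeast0AtMost
    by (rule sum.reindex_bij_witness[of _ "\<lambda>i. Suc a - i" "\<lambda>i. Suc a - i"]) auto
  also have "\<dots> = fps_nth G (Suc a) * fps_nth F 0 + (\<Sum>c\<le>a. fps_nth G (a - c) * fps_nth F (Suc c))"
    by (subst sum.atMost_Suc_shift) simp
  finally have eq': "(\<Sum>c\<le>a. fps_nth G (a - c) * fps_nth F (Suc c)) = - (fps_nth G (Suc a) * fps_nth F 0)"
    by (simp add: eq_neg_iff_add_eq_0 add.commute)
  have "(\<Sum>c\<le>Suc a. \<Sum>d\<le>b. fps_nth G (Suc a - c) * fps_nth F (Suc (c + d)) * fps_nth G (b - d))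
     = fps_nth G (Suc a) * (\<Sum>d\<le>b. fps_nth F (Suc d) * fps_nth G (b - d)) + Z"
    by (subst sum.atMost_Suc_shift) (simp add: Z_def sum_distrib_left mult.assoc)
  \<comment> \<open>Both boundary terms equal minus the product of coefficient \<open>a + 1\<close>
    of \<open>G\<close>, coefficient 0 of \<open>F\<close> and coefficient \<open>b + 1\<close> of
    \<open>G\<close>. This moves one unit of the index from \<open>a\<close> to
    \<open>b\<close>.\<close>
  also have "\<dots> = (\<Sum>c\<le>a. fps_nth G (a - c) * fps_nth F (Suc c)) * fps_nth G (Suc b) + Z"
    unfolding eq eq' by (simp add: mult.assoc)
  also have "\<dots> = (\<Sum>c\<le>a. \<Sum>d\<le>Suc b. fps_nth G (a - c) * fps_nth F (Suc (c + d)) * fps_nth G (Suc b - d))"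
    unfolding sum.atMost_Suc_shift[of _ b] by (simp add: Z_def sum.distrib sum_distrib_right)
  finally show ?case using Suc.IH[of "Suc b"] by simp
qed

lemma sum_triangle_swap:
  fixes g :: "nat \<Rightarrow> nat \<Rightarrow> 'a::comm_monoid_add"
  shows "(\<Sum>a\<le>n. \<Sum>c\<le>a. g a c) = (\<Sum>c\<le>n. \<Sum>a=c..n. g a c)"
proof -
  have "(\<Sum>a\<le>n. \<Sum>c\<le>a. g a c) = (\<Sum>(a,c)\<in>(SIGMA a:{..n}. {..a}). g a c)"
    by (simp add: sum.Sigma)
  also have "\<dots> = (\<Sum>(c,a)\<in>(SIGMA c:{..n}. {c..n}). g a c)"
    by (rule sum.reindex_bij_witness[of _ "\<lambda>(c,a). (a,c)" "\<lambda>(a,c). (c,a)"]) auto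
  also have "\<dots> = (\<Sum>c\<le>n. \<Sum>a=c..n. g a c)" by (simp add: sum.Sigma)
  finally show ?thesis .
qed

lemma matrix_vector_mult_sum_left:
  fixes A :: "'i \<Rightarrow> real^'n::finite^'m::finite"
  shows "sum A S *v x = (\<Sum>i\<in>S. A i *v x)"
  by (induction S rule: infinite_finite_induct) (simp_all add: matrix_vector_mult_add_rdistrib)

lemma minus_matrix_vector_mult: "(- A) *v x = - (A *v (x::real^'n))"
  using matrix_vector_mult_diff_rdistrib[of 0 A x] by simp

lemma matrix_mul_minus_left: "(- A) ** B = - (A ** B :: real^'n::finite^'m::finite)"
  by (simp add: matrix_matrix_mult_def vec_eq_iff sum_negf)

lemma matrix_mul_minus_right: "A ** (- B) = - (A ** B :: real^'n::finite^'m::finite)"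
  by (simp add: matrix_matrix_mult_def vec_eq_iff sum_negf)

text \<open>The symmetric coefficients of \<open>G\<close> let the left Toeplitz factor act on the
  left vector. The Hankel form of \<open>G\<close> at \<open>c\<close> becomes the Hankel form of
  \<open>- F\<close> at transformed vectors.\<close>

lemma hankel_psd_inverse:
  fixes F G :: "'m::finite square_matrix fps"
  assumes FG: "F * G = 1" and GF: "G * F = 1"
    and sym: "\<And>n. transpose (mat_of (fps_nth G n)) = mat_of (fps_nth G n)"
    and psd: "hankel_psd (\<lambda>n. - mat_of (fps_nth F (Suc n)))"
  shows "hankel_psd (\<lambda>n. mat_of (fps_nth G (Suc n)))"
  unfolding hankel_psd_def
proof (intro allI)
  fix n and c :: "nat \<Rightarrow> real^'m"
  let ?F = "\<lambda>n. mat_of (fps_nth F n)" and ?G = "\<lambda>n. mat_of (fps_nth G n)"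
  \<comment> \<open>The vectors \<open>c\<close> after application of the triangular Toeplitz matrix
    of \<open>G\<close>.\<close>
  define e where "e = (\<lambda>i. \<Sum>a=i..n. ?G (a - i) *v c a)"
  have dual: "x \<bullet> (?G k *v y) = (?G k *v x) \<bullet> y" for x y k
    by (metis dot_lmul_matrix inner_commute sym transpose_matrix_vector)
  have "(\<Sum>a\<le>n. \<Sum>b\<le>n. c a \<bullet> (?G (Suc (a + b)) *v c b)) =
     (\<Sum>a\<le>n. \<Sum>b\<le>n. \<Sum>i\<le>a. \<Sum>j\<le>b. (?G (a - i) *v c a) \<bullet> (- ?F (Suc (i + j)) *v (?G (b - j) *v c b)))"
  proof (intro sum.cong refl)
    fix a b
    show "c a \<bullet> (?G (Suc (a + b)) *v c b) =
      (\<Sum>i\<le>a. \<Sum>j\<le>b. (?G (a - i) *v c a) \<bullet> (- ?F (Suc (i + j)) *v (?G (b - j) *v c b)))"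
      unfolding inverse_fps_hankel[OF FG GF, of a b]
      by (simp add: mat_of_simps mat_of_sum matrix_vector_mult_sum_left inner_sum_right dual[symmetric]
        matrix_vector_mul_assoc matrix_mul_assoc minus_matrix_vector_mult sum_negf
        matrix_mul_minus_left matrix_mul_minus_right)
  qed
  also have "\<dots> = (\<Sum>a\<le>n. \<Sum>i\<le>a. \<Sum>b\<le>n. \<Sum>j\<le>b. (?G (a - i) *v c a) \<bullet> (- ?F (Suc (i + j)) *v (?G (b - j) *v c b)))"
    by (intro sum.cong refl sum.swap)
  also have "\<dots> = (\<Sum>i\<le>n. \<Sum>a=i..n. \<Sum>j\<le>n. \<Sum>b=j..n. (?G (a - i) *v c a) \<bullet> (- ?F (Suc (i + j)) *v (?G (b - j) *v c b)))"
    unfolding sum_triangle_swap ..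
  also have "\<dots> = (\<Sum>i\<le>n. \<Sum>j\<le>n. \<Sum>a=i..n. \<Sum>b=j..n. (?G (a - i) *v c a) \<bullet> (- ?F (Suc (i + j)) *v (?G (b - j) *v c b)))"
    by (intro sum.cong refl sum.swap)
  also have "\<dots> = (\<Sum>i\<le>n. \<Sum>j\<le>n. e i \<bullet> (- ?F (Suc (i + j)) *v e j))"
    unfolding e_def linear_sum[OF matrix_vector_mul_linear] inner_sum_left inner_sum_right
    by (intro sum.cong refl sum.swap)
  also have "\<dots> \<ge> 0" using psd unfolding hankel_psd_def by blast
  finally show "0 \<le> (\<Sum>a\<le>n. \<Sum>b\<le>n. c a \<bullet> (?G (Suc (a + b)) *v c b))" .
qed

lemma transpose_add: "transpose (A + B) = transpose A + transpose (B::real^'n^'m)"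
  by (simp add: transpose_def vec_eq_iff)
lemma transpose_diff: "transpose (A - B) = transpose A - transpose (B::real^'n^'m)"
  by (simp add: transpose_def vec_eq_iff)
lemma transpose_sum: "transpose (sum A S) = (\<Sum>i\<in>S. transpose (A i::real^'n::finite^'m::finite))"
  by (induction S rule: infinite_finite_induct) (simp_all add: transpose_add, simp_all add: transpose_def vec_eq_iff)

text \<open>The partial sums in the last conclusion are the coefficients of the two series divided
  by \<open>1 - z\<close>, the form in which exponential moments deliver them. Their product is
  \<open>1 / (1 - z) ^ 3\<close>, whose coefficients are the triangular numbers.\<close>

theorem hankel_psd_conjugate:
  fixes M :: "nat \<Rightarrow> real^'m::finite^'m"
  assumes sym: "\<And>n. transpose (M n) = M n" and inv: "invertible (M 0)"
    and H1: "hankel_psd (\<lambda>n. M (Suc n))" and H2: "hankel_psd (\<lambda>n. M n - M (Suc n))"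
  obtains N where "\<And>n. transpose (N n) = N n"
    and "hankel_psd (\<lambda>n. N (Suc n))" and "hankel_psd (\<lambda>n. N n - N (Suc n))"
    and "\<And>n. (\<Sum>k\<le>n. (\<Sum>j\<le>k. M j) ** (\<Sum>j\<le>n - k. N j)) = mat (real (n + 1) * real (n + 2) / 2)"
proof -
  define F where "F = Abs_fps (\<lambda>n. Abs_square_matrix (M n))"
  define T where "T = (1 - fps_X :: 'm square_matrix fps)"
  define E where "E = (Abs_fps (\<lambda>_. 1) :: 'm square_matrix fps)"
  define P where "P = T * F"
  have comX: "fps_X * A = A * fps_X" for A :: "'m square_matrix fps"
    by (simp add: fps_mult_fps_X_commute)
  have comT: "T * A = A * T" for A by (simp add: T_def algebra_simps comX)
  have TE: "T * E = 1"
    by (rule fps_ext) (simp add: T_def E_def left_diff_distrib fps_X_def[symmetric])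
  have comE: "E * A = A * E" for A
  proof -
    have "E * A = E * A * (T * E)" by (simp add: TE)
    also have "\<dots> = E * (A * T) * E" by (simp add: mult.assoc)
    also have "\<dots> = (T * E) * A * E" unfolding comT[of A, symmetric] comT[of E] by (simp only: mult.assoc)
    also have "\<dots> = A * E" by (simp add: TE)
    finally show ?thesis .
  qed
  obtain B where B: "M 0 ** B = mat 1" "B ** M 0 = mat 1" using inv unfolding invertible_def by blast
  have P0: "fps_nth P 0 = Abs_square_matrix (M 0)"
    by (simp add: P_def T_def F_def left_diff_distrib)
  have l: "Abs_square_matrix B * fps_nth P 0 = 1" and r: "fps_nth P 0 * Abs_square_matrix B = 1"
    unfolding P0 by (simp_all add: mat_of_inject[symmetric] mat_of_simps B)
  define G where "G = fps_right_inverse P (Abs_square_matrix B)"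
  have PG: "P * G = 1" unfolding G_def by (rule fps_right_inverse[OF r])
  have G': "fps_left_inverse P (Abs_square_matrix B) * P = 1" by (rule fps_left_inverse[OF l])
  have GP: "G * P = 1"
    by (metis G' PG mult.assoc mult.left_neutral mult.right_neutral)
  define N where "N = (\<lambda>n. mat_of (fps_nth G n))"
  \<comment> \<open>Transposition reverses products and fixes the coefficients of \<open>P\<close>,
    so \<open>Gt\<close> is again an inverse of \<open>P\<close>. Uniqueness of the inverse makes
    \<open>N\<close> symmetric.\<close>
  define Gt where "Gt = Abs_fps (\<lambda>n. Abs_square_matrix (transpose (N n)))"
  have symP: "transpose (mat_of (fps_nth P n)) = mat_of (fps_nth P n)" for n
    by (cases n) (simp_all add: P_def T_def F_def left_diff_distrib sym mat_of_simps transpose_diff)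
  have "Gt * P = 1"
  proof (rule fps_ext)
    fix n
    have "mat_of (fps_nth (Gt * P) n) = transpose (mat_of (fps_nth (P * G) n))"
      unfolding fps_mult_nth mat_of_sum transpose_sum mat_of_simps matrix_transpose_mul symP atLeast0AtMost
      by (rule sum.reindex_bij_witness[of _ "\<lambda>i. n - i" "\<lambda>i. n - i"]) (auto simp: Gt_def N_def)
    also have "\<dots> = mat_of (fps_nth 1 n)"
      unfolding PG by (cases n) (simp_all add: mat_of_simps transpose_mat, simp add: transpose_def vec_eq_iff)
    finally show "fps_nth (Gt * P) n = fps_nth 1 n" by (simp add: mat_of_inject)
  qed
  hence "Gt = G" by (metis PG mult.assoc mult.left_neutral mult.right_neutral)
  hence symN: "transpose (N n) = N n" for n
    unfolding Gt_def N_def by (metis fps_nth_Abs_fps mat_of_Abs)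
  have P_Suc: "mat_of (fps_nth P (Suc n)) = M (Suc n) - M n" for n
    by (simp add: P_def T_def F_def left_diff_distrib mat_of_simps)
  have N1: "hankel_psd (\<lambda>n. N (Suc n))" unfolding N_def
    by (rule hankel_psd_inverse[OF PG GP]) (use symN H2 in \<open>simp_all add: N_def P_Suc\<close>)
  have TG: "mat_of (fps_nth (T * G) (Suc n)) = N (Suc n) - N n" for n
    by (simp add: T_def left_diff_distrib mat_of_simps N_def)
  have symTG: "transpose (mat_of (fps_nth (T * G) n)) = mat_of (fps_nth (T * G) n)" for n
    by (cases n) (use symN in \<open>simp_all add: T_def left_diff_distrib mat_of_simps transpose_diff N_def\<close>)
  have FTG: "F * (T * G) = 1" using PG unfolding P_def by (metis comT mult.assoc)
  have TGF: "(T * G) * F = 1" using GP unfolding P_def by (metis comT mult.assoc)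
  \<comment> \<open>Inverting \<open>- F\<close> instead of \<open>F\<close> turns \<open>H1\<close>
    into the hypothesis that the inversion lemma asks for, and produces
    \<open>N n - N (Suc n)\<close> with the required sign.\<close>
  have "hankel_psd (\<lambda>n. mat_of (fps_nth (- (T * G)) (Suc n)))"
    by (rule hankel_psd_inverse[of "- F"])
       (use FTG TGF symTG H1 in \<open>simp_all add: mat_of_simps F_def\<close>, simp_all add: transpose_def vec_eq_iff)
  hence N2: "hankel_psd (\<lambda>n. N n - N (Suc n))" by (simp add: mat_of_simps TG)
  have FG: "F * G = E"
  proof -
    have "F * G = E * T * (F * G)" by (metis TE comT mult.left_neutral)
    also have "\<dots> = E * (P * G)" by (simp add: P_def mult.assoc)
    finally show ?thesis by (simp add: PG)
  qed
  have "F * E * (G * E) = E * (E * E)"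
    by (metis FG comE mult.assoc)
  have EE: "fps_nth (E * E) n = of_nat (n + 1)" for n
    by (simp add: E_def fps_mult_nth)
  have EEE: "fps_nth (E * (E * E)) n = of_nat ((n + 1) * (n + 2) div 2)" for n
  proof -
    have "fps_nth (E * (E * E)) n = (\<Sum>i=0..n. of_nat (n - i + 1))"
      unfolding fps_mult_nth[of E] EE by (simp add: E_def)
    also have "\<dots> = of_nat (\<Sum>i=0..n. n - i + 1)" by simp
    also have "(\<Sum>i=0..n. n - i + 1) = (\<Sum>i=0..n. i + 1)"
      by (rule sum.reindex_bij_witness[of _ "\<lambda>i. n - i" "\<lambda>i. n - i"]) auto
    also have "\<dots> = (n + 1) * (n + 2) div 2"
      by (induction n) auto
    finally show ?thesis .
  qed
  have "(\<Sum>k\<le>n. (\<Sum>j\<le>k. M j) ** (\<Sum>j\<le>n - k. N j)) = mat (real (n + 1) * real (n + 2) / 2)" for n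
  proof -
    have a: "mat_of (fps_nth (F * E) k) = (\<Sum>j\<le>k. M j)" for k
      by (simp add: fps_mult_nth E_def F_def mat_of_sum atLeast0AtMost)
    have b: "mat_of (fps_nth (G * E) k) = (\<Sum>j\<le>k. N j)" for k
      by (simp add: fps_mult_nth E_def N_def mat_of_sum atLeast0AtMost)
    have "(\<Sum>k\<le>n. (\<Sum>j\<le>k. M j) ** (\<Sum>j\<le>n - k. N j)) = mat_of (fps_nth (F * E * (G * E)) n)"
      unfolding fps_mult_nth[of "F * E"] mat_of_sum mat_of_simps a b atLeast0AtMost ..
    also have "\<dots> = mat (real ((n + 1) * (n + 2) div 2))"
      unfolding \<open>F * E * (G * E) = E * (E * E)\<close> EEE mat_of_of_nat ..
    also have "real ((n + 1) * (n + 2) div 2) = real (n + 1) * real (n + 2) / 2"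
      by (subst real_of_nat_div) (auto simp: algebra_simps)
    finally show ?thesis .
  qed
  thus ?thesis using that[of N] symN N1 N2 by blast
qed

section \<open>Uniqueness from exponential moments\<close>

lemma power_le_fact_exp:
  fixes t a :: real
  assumes "0 \<le> t" "0 < a"
  shows "t ^ n \<le> fact n / a ^ n * exp (a * t)"
proof -
  have "(\<Sum>i\<in>{n}. (a * t) ^ i / fact i) \<le> (\<Sum>i. (a * t) ^ i / fact i)"
    by (rule sum_le_suminf) (use assms summable_exp[of "a * t"] in \<open>auto simp: divide_inverse mult.commute\<close>)
  also have "\<dots> = exp (a * t)" by (simp add: exp_def divide_inverse mult.commute)
  finally have "(a * t) ^ n / fact n \<le> exp (a * t)" by simp
  thus ?thesis using assms by (simp add: power_mult_distrib field_simps)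
qed

text \<open>The rate 1/2 lies strictly between 0 and 1: functions of linear growth are integrable
  against this class, and all \<open>t ^ n * exp (- t)\<close> belong to it. Negative times are
  unconstrained because the functionals to be treated live on the half-line.\<close>

definition decaying :: "(real \<Rightarrow> real) \<Rightarrow> real \<Rightarrow> bool" where
  "decaying \<psi> B \<longleftrightarrow> continuous_on UNIV \<psi> \<and> (\<forall>t\<ge>0. \<bar>\<psi> t\<bar> \<le> B * exp (- t / 2))"

lemma decaying_lincomb:
  assumes "decaying \<psi> B" "decaying \<phi> C"
  shows "decaying (\<lambda>t. a * \<psi> t + b * \<phi> t) (\<bar>a\<bar> * B + \<bar>b\<bar> * C)"
  unfolding decaying_def
proof (intro conjI allI impI)
  show "continuous_on UNIV (\<lambda>t. a * \<psi> t + b * \<phi> t)"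
    using assms by (auto simp: decaying_def intro!: continuous_intros)
  fix t :: real assume t: "0 \<le> t"
  have 1: "\<bar>\<psi> t\<bar> \<le> B * exp (- t / 2)" "\<bar>\<phi> t\<bar> \<le> C * exp (- t / 2)" using assms t by (auto simp: decaying_def)
  have "\<bar>a * \<psi> t + b * \<phi> t\<bar> \<le> \<bar>a\<bar> * \<bar>\<psi> t\<bar> + \<bar>b\<bar> * \<bar>\<phi> t\<bar>"
    by (rule order_trans[OF abs_triangle_ineq]) (simp add: abs_mult)
  also have "\<dots> \<le> \<bar>a\<bar> * (B * exp (- t / 2)) + \<bar>b\<bar> * (C * exp (- t / 2))"
    by (intro add_mono mult_left_mono 1) auto
  finally show "\<bar>a * \<psi> t + b * \<phi> t\<bar> \<le> (\<bar>a\<bar> * B + \<bar>b\<bar> * C) * exp (- t / 2)"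
    by (simp add: algebra_simps)
qed

lemma decaying_power_exp:
  assumes "1 \<le> p"
  shows "decaying (\<lambda>t. t ^ n * exp (- p * t)) (fact n * 2 ^ n)"
  unfolding decaying_def
proof (intro conjI allI impI)
  fix t :: real assume t: "0 \<le> t"
  have "t ^ n * exp (- p * t) \<le> (fact n / (1/2) ^ n * exp (1 / 2 * t)) * exp (- t)"
    using power_le_fact_exp[OF t, of "1/2" n] mult_right_mono[OF assms t]
    by (intro mult_mono) auto
  also have "\<dots> = fact n * 2 ^ n * (exp (1 / 2 * t) * exp (- t))" by (simp add: power_divide field_simps)
  also have "exp (1 / 2 * t) * exp (- t) = exp (- t / 2)" by (simp add: exp_add[symmetric])
  finally show "\<bar>t ^ n * exp (- p * t)\<bar> \<le> fact n * 2 ^ n * exp (- t / 2)" using t by simp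
qed (intro continuous_intros)

text \<open>Only linearity and a bound by the decay constant are asked, so that both a difference of
  two functions and a sum of double integrals minus its target value are instances.\<close>

locale moment_functional =
  fixes \<Lambda> :: "(real \<Rightarrow> real) \<Rightarrow> real" and C :: real
  assumes lin: "\<And>\<psi> B \<phi> D a b. decaying \<psi> B \<Longrightarrow> decaying \<phi> D \<Longrightarrow>
      \<Lambda> (\<lambda>t. a * \<psi> t + b * \<phi> t) = a * \<Lambda> \<psi> + b * \<Lambda> \<phi>"
    and bound: "\<And>\<psi> B. decaying \<psi> B \<Longrightarrow> \<bar>\<Lambda> \<psi>\<bar> \<le> C * B"
    and moments: "\<And>n. \<Lambda> (\<lambda>t. t ^ n * exp (- t)) = 0"
begin

lemma zero: "\<Lambda> (\<lambda>t. 0) = 0"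
  using bound[of "\<lambda>t. 0" 0] by (simp add: decaying_def)

lemma sum:
  assumes "finite S" "\<And>k. k \<in> S \<Longrightarrow> \<exists>B. decaying (\<psi> k) B"
  shows "(\<exists>B. decaying (\<lambda>t. \<Sum>k\<in>S. a k * \<psi> k t) B) \<and> \<Lambda> (\<lambda>t. \<Sum>k\<in>S. a k * \<psi> k t) = (\<Sum>k\<in>S. a k * \<Lambda> (\<psi> k))"
  using assms
proof (induction S rule: finite_induct)
  case empty
  thus ?case by (auto simp: zero decaying_def intro: exI[of _ 0])
next
  case (insert k S)
  from insert.IH insert.prems obtain B where
    B: "decaying (\<lambda>t. \<Sum>k\<in>S. a k * \<psi> k t) B" and IH: "\<Lambda> (\<lambda>t. \<Sum>k\<in>S. a k * \<psi> k t) = (\<Sum>k\<in>S. a k * \<Lambda> (\<psi> k))"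
    by auto
  from insert.prems obtain D where D: "decaying (\<psi> k) D" by auto
  have eq: "(\<lambda>t. \<Sum>k\<in>insert k S. a k * \<psi> k t) = (\<lambda>t. a k * \<psi> k t + 1 * (\<Sum>k\<in>S. a k * \<psi> k t))"
    using insert.hyps by simp
  show ?case unfolding eq using lin[OF D B, of "a k" 1] decaying_lincomb[OF D B, of "a k" 1] IH insert.hyps
    by auto
qed

text \<open>Partial sums of the exponential series of \<open>exp (- t / 8)\<close> times
  \<open>t ^ n * exp (- p * t)\<close> are annihilated, and the remainder after \<open>K\<close>
  terms tends to 0 in decay constant. There \<open>t ^ (n + K)\<close> is paid with
  \<open>exp (3/8 * t)\<close>, and \<open>3/8 + 1/8 - 1 = - 1/2\<close> leaves exactly the decay of
  the class.\<close>

lemma shifted_moments: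
  assumes p: "1 \<le> p" and 0: "\<And>n. \<Lambda> (\<lambda>t. t ^ n * exp (- p * t)) = 0"
  shows "\<Lambda> (\<lambda>t. t ^ n * exp (- (p + 1/8) * t)) = 0"
proof -
  \<comment> \<open>The ratio 2/3 is the product of 2 from the binomial coefficient, 8/3 from
    absorbing one power of \<open>t\<close>, and 1/8 from the step.\<close>
  define c where "c K = (8/3) ^ n * fact n * 2 ^ n * (2/3 :: real) ^ K" for K
  have "\<bar>\<Lambda> (\<lambda>t. t ^ n * exp (- (p + 1/8) * t))\<bar> \<le> C * c K" for K
  proof -
    define a :: "nat \<Rightarrow> real" where "a k = (- 1 / 8) ^ k / fact k" for k
    define E where "E t = (\<Sum>k<K. a k * (t ^ (n + k) * exp (- p * t)))" for t :: real
    from sum[of "{..<K}" "\<lambda>k t. t ^ (n + k) * exp (- p * t)" a]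
    obtain B where E: "decaying E B" "\<Lambda> E = 0"
      unfolding E_def using 0 decaying_power_exp[OF p] by auto
    have p': "1 \<le> p + 1/8" using p by simp
    have "\<Lambda> (\<lambda>t. 1 * (t ^ n * exp (- (p + 1/8) * t)) + (- 1) * E t) = \<Lambda> (\<lambda>t. t ^ n * exp (- (p + 1/8) * t))"
      using lin[OF decaying_power_exp[OF p', of n] E(1), of 1 "- 1"] E(2) by simp
    moreover have "decaying (\<lambda>t. 1 * (t ^ n * exp (- (p + 1/8) * t)) + (- 1) * E t) (c K)"
      unfolding decaying_def
    proof (intro conjI allI impI)
      show "continuous_on UNIV (\<lambda>t. 1 * (t ^ n * exp (- (p + 1/8) * t)) + (- 1) * E t)"
        using E(1) by (auto simp: decaying_def intro!: continuous_intros)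
      fix t :: real assume t: "0 \<le> t"
      obtain s where s: "\<bar>s\<bar> \<le> \<bar>- t / 8\<bar>" "exp (- t / 8) = (\<Sum>m<K. (- t / 8) ^ m / fact m) + exp s / fact K * (- t / 8) ^ K"
        using Maclaurin_exp_le[of "- t / 8" K] by blast
      have "E t = t ^ n * exp (- p * t) * (\<Sum>m<K. (- t / 8) ^ m / fact m)"
        unfolding E_def a_def sum_distrib_left
      proof (intro sum.cong refl)
        fix k
        have "(- t / 8) ^ k = (- 1 / 8) ^ k * t ^ k" by (simp add: power_mult_distrib[symmetric])
        thus "(- 1 / 8) ^ k / fact k * (t ^ (n + k) * exp (- p * t)) = t ^ n * exp (- p * t) * ((- t / 8) ^ k / fact k)"
          by (simp add: power_add)
      qed
      moreover have "t ^ n * exp (- (p + 1/8) * t) = t ^ n * exp (- p * t) * exp (- t / 8)"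
        by (simp add: exp_add[symmetric] algebra_simps)
      ultimately have "1 * (t ^ n * exp (- (p + 1/8) * t)) + (- 1) * E t = t ^ n * exp (- p * t) * (exp s / fact K * (- t / 8) ^ K)"
        unfolding s(2) by (simp add: algebra_simps)
      hence "\<bar>1 * (t ^ n * exp (- (p + 1/8) * t)) + (- 1) * E t\<bar> = t ^ n * exp (- p * t) * (exp s / fact K * (t / 8) ^ K)"
        using t by (simp add: abs_mult power_abs)
      also have "\<dots> \<le> t ^ n * exp (- t) * (exp (t / 8) / fact K * (t / 8) ^ K)"
        using s(1) t mult_right_mono[OF p t] by (intro mult_mono divide_right_mono) auto
      also have "\<dots> = t ^ (n + K) * (exp (- t) * exp (t / 8)) / (fact K * 8 ^ K)"
        by (simp add: power_add power_divide)
      also have "\<dots> \<le> (fact (n + K) / (3/8) ^ (n + K) * exp (3/8 * t)) * (exp (- t) * exp (t / 8)) / (fact K * 8 ^ K)"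
        using power_le_fact_exp[OF t, of "3/8" "n + K"] by (intro divide_right_mono mult_right_mono) auto
      also have "\<dots> = fact (n + K) / ((3/8) ^ (n + K) * fact K * 8 ^ K) * (exp (3/8 * t) * (exp (- t) * exp (t / 8)))"
        by simp
      also have "exp (3/8 * t) * (exp (- t) * exp (t / 8)) = exp (- t / 2)"
        by (simp add: exp_add[symmetric])
      also have "fact (n + K) / ((3/8) ^ (n + K) * fact K * 8 ^ K) \<le> c K"
      proof -
        have "(n + K) choose K \<le> 2 ^ (n + K)"
          by (rule binomial_le_pow2)
        hence "real ((n + K) choose K) \<le> 2 ^ (n + K)"
          by (metis of_nat_le_iff of_nat_numeral of_nat_power)
        hence "fact n * real ((n + K) choose K) \<le> fact n * 2 ^ (n + K)" by (rule mult_left_mono) simp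
        moreover have "fact n * real ((n + K) choose K) = fact (n + K) / fact K"
          by (simp add: binomial_fact)
        ultimately have le: "fact (n + K) / fact K \<le> fact n * (2 ^ (n + K) :: real)" by simp
        have "fact (n + K) / ((3/8) ^ (n + K) * fact K * 8 ^ K) = fact (n + K) / fact K * ((8/3) ^ n / 3 ^ K :: real)"
          by (simp add: power_add power_divide)
        also have "\<dots> \<le> fact n * 2 ^ (n + K) * ((8/3) ^ n / 3 ^ K)" by (rule mult_right_mono[OF le]) simp
        also have "\<dots> = c K" by (simp add: c_def power_add power_divide)
        finally show ?thesis .
      qed
      finally show "\<bar>1 * (t ^ n * exp (- (p + 1/8) * t)) + (- 1) * E t\<bar> \<le> c K * exp (- t / 2)"
        by simp
    qed
    note bound[OF this]
    ultimately show ?thesis by simp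
  qed
  moreover have "(\<lambda>K. C * c K) \<longlonglongrightarrow> C * ((8/3) ^ n * fact n * 2 ^ n * 0)"
    unfolding c_def by (intro tendsto_mult tendsto_const LIMSEQ_realpow_zero) auto
  ultimately have "\<bar>\<Lambda> (\<lambda>t. t ^ n * exp (- (p + 1/8) * t))\<bar> \<le> C * ((8/3) ^ n * fact n * 2 ^ n * 0)"
    by (intro LIMSEQ_le_const[of "\<lambda>K. C * c K"]) auto
  thus ?thesis by simp
qed

text \<open>The rate is raised from 1 in steps of 1/8. All powers of \<open>t\<close> are carried
  through the induction, since one step at order \<open>n\<close> consumes every higher
  order.\<close>

lemma exponential_moments: "\<Lambda> (\<lambda>t. exp (- t) * exp (- t / 8) ^ k) = 0"
proof -
  have "\<forall>n. \<Lambda> (\<lambda>t. t ^ n * exp (- (1 + real k / 8) * t)) = 0"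
  proof (induction k)
    case 0 thus ?case using moments by simp
  next
    case (Suc k)
    show ?case
    proof
      fix n
      have "1 + real (Suc k) / 8 = (1 + real k / 8) + 1/8" by (simp add: field_simps)
      thus "\<Lambda> (\<lambda>t. t ^ n * exp (- (1 + real (Suc k) / 8) * t)) = 0"
        using shifted_moments[of "1 + real k / 8" n] Suc.IH by simp
    qed
  qed
  hence "\<Lambda> (\<lambda>t. exp (- (1 + real k / 8) * t)) = 0" by (metis (no_types, lifting) ext mult_1 power_0)
  moreover have "exp (- (1 + real k / 8) * t) = exp (- t) * exp (- t / 8) ^ k" for t :: real
    by (simp add: exp_of_nat_mult[symmetric] exp_add[symmetric] algebra_simps)
  ultimately show ?thesis by simp
qed

lemma decaying_exp_times:
  assumes "continuous_on {0..1} \<eta>" "continuous_on UNIV (\<lambda>t. \<eta> (exp (- t / 8)))"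
    and b: "\<And>x. x \<in> {0..1} \<Longrightarrow> \<bar>\<eta> x\<bar> \<le> B"
  shows "decaying (\<lambda>t. exp (- t) * \<eta> (exp (- t / 8))) B"
  unfolding decaying_def
proof (intro conjI allI impI)
  show "continuous_on UNIV (\<lambda>t. exp (- t) * \<eta> (exp (- t / 8)))" by (intro continuous_intros assms)
  fix t :: real assume t: "0 \<le> t"
  have "\<bar>\<eta> (exp (- t / 8))\<bar> \<le> B" using t by (intro b) auto
  thus "\<bar>exp (- t) * \<eta> (exp (- t / 8))\<bar> \<le> B * exp (- t / 2)"
    unfolding abs_mult mult.commute[of "\<bar>exp (- t)\<bar>"] by (rule mult_mono) (use t order_trans[OF abs_ge_zero b[of 0]] in auto)
qed

text \<open>With \<open>x = exp (- t / 8)\<close> one has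
  \<open>\<psi> t = x ^ 8 * \<eta> x\<close>, where \<eta> is continuous on the unit interval and
  zero near 0 because \<psi> vanishes for large \<open>t\<close>. Bernstein polynomials of \<eta>
  are combinations of annihilated exponentials and approximate \<psi> in the decay norm.\<close>

theorem vanishing:
  assumes \<psi>: "continuous_on UNIV \<psi>" and b: "\<And>t. t > b \<Longrightarrow> \<psi> t = 0"
  shows "\<Lambda> \<psi> = 0"
proof -
  \<comment> \<open>The point corresponding to the time \<open>\<bar>b\<bar> + 1\<close>. It exceeds
    \<open>b\<close>, so both branches of \<eta> vanish at \<open>x0\<close>, and it is positive, so
    \<open>x0 \<le> 1\<close>.\<close>
  define x0 where "x0 = exp (- (\<bar>b\<bar> + 1) / 8)"
  have x0: "0 < x0" "x0 \<le> 1" by (auto simp: x0_def)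
  define \<eta> where "\<eta> x = (if x \<le> x0 then 0 else \<psi> (- 8 * ln x) / x ^ 8)" for x
  have cont\<eta>: "continuous_on {0..1} \<eta>"
  proof -
    have "continuous_on ({0..x0} \<union> {x0..1}) (\<lambda>x. if x \<le> x0 then 0 else \<psi> (- 8 * ln x) / x ^ 8)"
    proof (rule continuous_on_cases)
      show "continuous_on {x0..1} (\<lambda>x. \<psi> (- 8 * ln x) / x ^ 8)"
        by (intro continuous_intros continuous_on_compose2[OF \<psi>]) (use x0 in auto)
      show "\<forall>x. x \<in> {0..x0} \<and> \<not> x \<le> x0 \<or> x \<in> {x0..1} \<and> x \<le> x0 \<longrightarrow> 0 = \<psi> (- 8 * ln x) / x ^ 8"
      proof (intro allI impI)
        fix x assume "x \<in> {0..x0} \<and> \<not> x \<le> x0 \<or> x \<in> {x0..1} \<and> x \<le> x0"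
        hence "x = x0" by auto
        hence "- 8 * ln x = \<bar>b\<bar> + 1" by (simp add: x0_def)
        thus "0 = \<psi> (- 8 * ln x) / x ^ 8" using b[of "\<bar>b\<bar> + 1"] by simp
      qed
    qed auto
    moreover have "{0..x0} \<union> {x0..1} = {0..1}" using x0 by auto
    ultimately show ?thesis unfolding \<eta>_def[abs_def] by simp
  qed
  have \<psi>\<eta>: "\<psi> t = exp (- t) * \<eta> (exp (- t / 8))" for t
  proof (cases "t > \<bar>b\<bar> + 1")
    case True
    hence "exp (- t / 8) \<le> x0" by (simp add: x0_def)
    thus ?thesis using b[of t] True by (simp add: \<eta>_def)
  next
    case False
    show ?thesis
    proof (cases "t = \<bar>b\<bar> + 1")
      case True thus ?thesis using b[of t] by (simp add: \<eta>_def x0_def)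
    next
      case False
      with \<open>\<not> t > \<bar>b\<bar> + 1\<close> have "exp (- t / 8) > x0" by (simp add: x0_def)
      moreover have "exp (- t / 8) ^ 8 = exp (- t)" by (simp add: exp_of_nat_mult[symmetric])
      ultimately show ?thesis by (simp add: \<eta>_def)
    qed
  qed
  have cont\<eta>': "continuous_on UNIV (\<lambda>t. \<eta> (exp (- t / 8)))"
  proof -
    have "(\<lambda>t. \<eta> (exp (- t / 8))) = (\<lambda>t. \<psi> t * exp t)" by (simp add: \<psi>\<eta> exp_minus field_simps)
    thus ?thesis by (simp only:) (intro continuous_intros \<psi>)
  qed
  have dec: "\<exists>B. decaying (\<lambda>t. exp (- t) * q (exp (- t / 8))) B" if "continuous_on UNIV q" for q :: "real \<Rightarrow> real"
  proof -
    have "compact (q ` {0..1})" by (intro compact_continuous_image continuous_on_subset[OF that]) auto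
    then obtain B where B: "\<forall>x\<in>{0..1}. \<bar>q x\<bar> \<le> B" by (auto dest!: compact_imp_bounded simp: bounded_iff)
    show ?thesis
      by (intro exI[of _ B] decaying_exp_times continuous_on_subset[OF that] continuous_on_compose2[OF that] continuous_intros)
         (use B in auto)
  qed
  have bern: "\<Lambda> (\<lambda>t. exp (- t) * (exp (- t / 8) ^ k * (1 - exp (- t / 8)) ^ l)) = 0" for k l
  proof (induction l arbitrary: k)
    case 0 thus ?case using exponential_moments by simp
  next
    case (Suc l)
    have c: "continuous_on UNIV (\<lambda>x::real. x ^ k * (1 - x) ^ l)" for k by (intro continuous_intros)
    obtain B where B: "decaying (\<lambda>t. exp (- t) * (exp (- t / 8) ^ k * (1 - exp (- t / 8)) ^ l)) B"
      using dec[OF c[of k]] by blast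
    obtain D where D: "decaying (\<lambda>t. exp (- t) * (exp (- t / 8) ^ Suc k * (1 - exp (- t / 8)) ^ l)) D"
      using dec[OF c[of "Suc k"]] by blast
    from lin[OF B D, of 1 "- 1"] Suc.IH[of k] Suc.IH[of "Suc k"]
    show ?case by (simp add: algebra_simps)
  qed
  have "\<bar>\<Lambda> \<psi>\<bar> \<le> 0 + e" if e: "e > 0" for e
  proof -
    have "e / (\<bar>C\<bar> + 1) > 0" using e by simp
    from Bernstein_Weierstrass[OF cont\<eta> this] obtain N where
      N: "\<forall>x\<in>{0..1}. \<bar>\<eta> x - (\<Sum>k\<le>N. \<eta> (k/N) * Bernstein N k x)\<bar> < e / (\<bar>C\<bar> + 1)" by blast
    define P where "P x = (\<Sum>k\<le>N. \<eta> (k/N) * Bernstein N k x)" for x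
    have P: "continuous_on A P" for A unfolding P_def Bernstein_def by (intro continuous_intros)
    obtain BP where BP: "decaying (\<lambda>t. exp (- t) * P (exp (- t / 8))) BP" using dec[OF P] by blast
    have P0: "\<Lambda> (\<lambda>t. exp (- t) * P (exp (- t / 8))) = 0"
    proof -
      have "(\<lambda>t. exp (- t) * P (exp (- t / 8))) = (\<lambda>t. \<Sum>k\<in>{..N}. (\<eta> (k/N) * real (N choose k)) *
          (exp (- t) * (exp (- t / 8) ^ k * (1 - exp (- t / 8)) ^ (N - k))))"
        by (simp add: P_def Bernstein_def sum_distrib_left ac_simps)
      moreover have "\<exists>B. decaying (\<lambda>t. exp (- t) * (exp (- t / 8) ^ k * (1 - exp (- t / 8)) ^ (N - k))) B" for k
      proof -
        have "continuous_on UNIV (\<lambda>x::real. x ^ k * (1 - x) ^ (N - k))" by (intro continuous_intros)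
        from dec[OF this] show ?thesis .
      qed
      ultimately show ?thesis
        using sum[of "{..N}" "\<lambda>k t. exp (- t) * (exp (- t / 8) ^ k * (1 - exp (- t / 8)) ^ (N - k))" "\<lambda>k. \<eta> (k/N) * real (N choose k)"] bern
        by simp
    qed
    have "compact (\<eta> ` {0..1})" by (intro compact_continuous_image cont\<eta>) auto
    then obtain B\<eta> where "\<forall>x\<in>{0..1}. \<bar>\<eta> x\<bar> \<le> B\<eta>" by (auto dest!: compact_imp_bounded simp: bounded_iff)
    hence B\<eta>: "decaying (\<lambda>t. exp (- t) * \<eta> (exp (- t / 8))) B\<eta>"
      by (intro decaying_exp_times cont\<eta> cont\<eta>') auto
    have "\<Lambda> (\<lambda>t. 1 * (exp (- t) * \<eta> (exp (- t / 8))) + (- 1) * (exp (- t) * P (exp (- t / 8)))) = \<Lambda> \<psi>"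
    proof -
      have "\<Lambda> \<psi> = \<Lambda> (\<lambda>t. exp (- t) * \<eta> (exp (- t / 8)))"
        by (rule arg_cong[of _ _ \<Lambda>]) (rule ext, rule \<psi>\<eta>)
      thus ?thesis using lin[OF B\<eta> BP, of 1 "- 1"] P0 by simp
    qed
    moreover have "decaying (\<lambda>t. exp (- t) * (\<eta> (exp (- t / 8)) - P (exp (- t / 8)))) (e / (\<bar>C\<bar> + 1))"
    proof (rule decaying_exp_times[of "\<lambda>x. \<eta> x - P x"])
      show "\<bar>\<eta> x - P x\<bar> \<le> e / (\<bar>C\<bar> + 1)" if "x \<in> {0..1}" for x using bspec[OF N that] by (simp add: P_def)
      show "continuous_on {0..1} (\<lambda>x. \<eta> x - P x)" by (rule continuous_on_diff[OF cont\<eta> P])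
      have "continuous_on UNIV (\<lambda>t. P (exp (- t / 8)))"
        by (rule continuous_on_compose2[OF P[of UNIV]]) (auto intro!: continuous_intros)
      thus "continuous_on UNIV (\<lambda>t. \<eta> (exp (- t / 8)) - P (exp (- t / 8)))"
        by (rule continuous_on_diff[OF cont\<eta>'])
    qed
    hence "decaying (\<lambda>t. 1 * (exp (- t) * \<eta> (exp (- t / 8))) + (- 1) * (exp (- t) * P (exp (- t / 8)))) (e / (\<bar>C\<bar> + 1))"
      by (simp add: right_diff_distrib)
    note bound[OF this]
    ultimately have "\<bar>\<Lambda> \<psi>\<bar> \<le> C * (e / (\<bar>C\<bar> + 1))" by simp
    also have "\<dots> \<le> \<bar>C\<bar> * (e / (\<bar>C\<bar> + 1))" using e by (intro mult_right_mono) auto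
    also have "\<dots> \<le> e" using e by (simp add: field_simps)
    finally show ?thesis by simp
  qed
  from field_le_epsilon[OF this] show ?thesis by simp
qed

end

section \<open>Creep and relaxation kernels\<close>

text \<open>A measure \<open>\<nu>\<close> integrating \<open>x / (1 + x)\<close> is represented by the finite measure with density
  \<open>x / (1 + x)\<close>, a measure \<open>\<rho>\<close> integrating \<open>1 / (1 + x)\<close> by that with density \<open>1 / (1 + x)\<close>; the
  kernels carry the inverse factor.\<close>

definition creep_kernel :: "real \<Rightarrow> real \<Rightarrow> real" where
  "creep_kernel t x = (if x \<le> 0 then 0 else (1 - exp (- x * t)) * (1 + x) / x)"

definition relaxation_kernel :: "real \<Rightarrow> real \<Rightarrow> real" where
  "relaxation_kernel t x = (if x \<le> 0 then 0 else exp (- t * x) * (1 + x))"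

lemma creep_kernel_nonneg: "0 \<le> t \<Longrightarrow> 0 \<le> creep_kernel t x"
  by (simp add: creep_kernel_def)

text \<open>The factor \<open>(1 + x) / x\<close> is \<open>1 / x + 1\<close>. The first term
  contributes at most \<open>t\<close>, the second at most 1.\<close>

lemma creep_kernel_le: "0 \<le> t \<Longrightarrow> creep_kernel t x \<le> 1 + t"
proof (cases "x \<le> 0")
  case False
  assume t: "0 \<le> t"
  have "1 - exp (- x * t) \<le> x * t" using exp_ge_add_one_self[of "- x * t"] by simp
  hence "(1 - exp (- x * t)) / x \<le> t" using False by (simp add: field_simps)
  moreover have "(1 - exp (- x * t)) * (1 + x) / x = (1 - exp (- x * t)) / x + (1 - exp (- x * t))"
    using False by (simp add: field_simps)
  moreover have "creep_kernel t x = (1 - exp (- x * t)) * (1 + x) / x" using False by (simp add: creep_kernel_def)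
  ultimately show ?thesis using exp_ge_zero[of "- x * t"] by linarith
qed (simp add: creep_kernel_def)

lemma creep_kernel_measurable [measurable]:
  "(\<lambda>z. creep_kernel (fst z) (snd z)) \<in> borel_measurable (borel \<Otimes>\<^sub>M borel)"
  "(\<lambda>z. creep_kernel (snd z) (fst z)) \<in> borel_measurable (borel \<Otimes>\<^sub>M borel)"
  "creep_kernel t \<in> borel_measurable borel"
  unfolding creep_kernel_def[abs_def] by measurable

lemma relaxation_kernel_measurable [measurable]:
  "(\<lambda>z. relaxation_kernel (snd z) (fst z)) \<in> borel_measurable (borel \<Otimes>\<^sub>M borel)"
  "relaxation_kernel t \<in> borel_measurable borel"
  unfolding relaxation_kernel_def[abs_def] by measurable

text \<open>Differentiation in time changes the kernel but not the finite measure: the same measure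
  represents \<nu> with the weight \<open>x / (1 + x)\<close> and \<open>\<rho> = x \<nu>\<close>
  with the weight \<open>1 / (1 + x)\<close>.\<close>

lemma creep_kernel_DERIV: "((\<lambda>t. creep_kernel t x) has_real_derivative relaxation_kernel t x) (at t)"
proof (cases "x \<le> 0")
  case False
  thus ?thesis unfolding creep_kernel_def relaxation_kernel_def
    by (auto intro!: derivative_eq_intros simp: field_simps)
qed (simp add: creep_kernel_def relaxation_kernel_def)

lemma creep_kernel_0 [simp]: "creep_kernel 0 x = 0"
  by (simp add: creep_kernel_def)

lemma relaxation_kernel_nonneg: "0 \<le> relaxation_kernel t x"
  by (simp add: relaxation_kernel_def)

lemma relaxation_kernel_continuous: "continuous_on A (\<lambda>t. relaxation_kernel t x)"
  unfolding relaxation_kernel_def by (cases "x \<le> 0") (auto intro!: continuous_intros)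

lemma half_line_FTC:
  fixes G g :: "real \<Rightarrow> real"
  assumes D: "\<And>t. (G has_real_derivative g t) (at t)" and c: "continuous_on UNIV g"
    and 0: "\<And>t. t \<ge> R \<Longrightarrow> G t = 0" "\<And>t. t \<ge> R \<Longrightarrow> g t = 0"
  shows "integrable lborel (\<lambda>t. indicator {0..} t * g t)"
    and "(LBINT t. indicator {0..} t * g t) = - G 0"
proof -
  define S where "S = max 0 R"
  have eq: "(\<lambda>t. indicator {0..} t * g t) = (\<lambda>t. g t * indicator {0..S} t)"
    using 0(2) by (auto simp: S_def indicator_def fun_eq_iff)
  have isC: "isCont g x" for x using c by (simp add: continuous_on_eq_continuous_at)
  show "(LBINT t. indicator {0..} t * g t) = - G 0"
    unfolding eq using integral_FTC_Icc_real[of 0 S G g] D isC 0(1)[of S] by (simp add: S_def)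
  have "integrable lborel (\<lambda>t. indicator {0..S} t *\<^sub>R g t)"
    by (rule borel_integrable_compact) (auto intro: continuous_on_subset[OF c])
  thus "integrable lborel (\<lambda>t. indicator {0..} t * g t)" unfolding eq by (simp add: mult.commute)
qed

lemma power_exp_integral:
  fixes a :: real assumes a: "a > 0"
  shows "integrable lborel (\<lambda>t. indicator {0..} t * (t ^ n * exp (- a * t)))"
    and "(LBINT t. indicator {0..} t * (t ^ n * exp (- a * t))) = fact n / a ^ Suc n"
proof -
  \<comment> \<open>The antiderivative that vanishes at infinity, obtained by repeated integration
    by parts. The recursion in \<open>n\<close> below is one such integration.\<close>
  define F where "F n t = - (\<Sum>k\<le>n. fact n / fact k / a ^ (n - k + 1) * t ^ k) * exp (- a * t)" for n :: nat and t
  have D: "(F n has_real_derivative t ^ n * exp (- a * t)) (at t)" for t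
  proof (induction n)
    case 0
    show ?case unfolding F_def using a by (auto intro!: derivative_eq_intros simp: field_simps)
  next
    case (Suc n)
    have eq: "F (Suc n) = (\<lambda>t. real (Suc n) / a * F n t - t ^ Suc n / a * exp (- a * t))"
    proof
      fix t
      have "(\<Sum>k\<le>n. fact (Suc n) / fact k / a ^ (Suc n - k + 1) * t ^ k) = real (Suc n) / a * (\<Sum>k\<le>n. fact n / fact k / a ^ (n - k + 1) * t ^ k)"
        unfolding sum_distrib_left by (intro sum.cong refl) (simp add: Suc_diff_le field_simps)
      moreover have "fact (Suc n) / fact (Suc n) / a ^ (Suc n - Suc n + 1) * t ^ Suc n = t ^ Suc n / a" by simp
      ultimately show "F (Suc n) t = real (Suc n) / a * F n t - t ^ Suc n / a * exp (- a * t)"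
        unfolding F_def sum.atMost_Suc by (simp only: left_diff_distrib distrib_right minus_add_distrib mult_minus_left mult_minus_right mult.assoc diff_conv_add_uminus)
    qed
    have "((\<lambda>t. real (Suc n) / a * F n t - t ^ Suc n / a * exp (- a * t)) has_real_derivative
      real (Suc n) / a * (t ^ n * exp (- a * t)) - (real (Suc n) * t ^ n / a * exp (- a * t) + t ^ Suc n / a * (- a * exp (- a * t)))) (at t)"
    proof -
      have p: "((\<lambda>t. t ^ Suc n / a) has_real_derivative real (Suc n) * t ^ n / a) (at t)"
        using DERIV_cdivide[OF DERIV_pow[of "Suc n" t]] by simp
      have e: "((\<lambda>t. exp (- a * t)) has_real_derivative - a * exp (- a * t)) (at t)"
        by (auto intro!: derivative_eq_intros)
      show ?thesis
        by (rule DERIV_cong[OF DERIV_diff[OF DERIV_cmult[OF Suc.IH, of "real (Suc n) / a"] DERIV_mult[OF p e]]])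
           (simp add: algebra_simps)
    qed
    thus ?case unfolding eq using a by (simp add: field_simps)
  qed
  have lim: "(F n \<longlongrightarrow> 0) at_top"
  proof -
    have "((\<lambda>t. t ^ k * exp (- a * t)) \<longlongrightarrow> 0) at_top" for k
      using a by real_asymp
    hence "((\<lambda>t. - (\<Sum>k\<le>n. fact n / fact k / a ^ (n - k + 1) * (t ^ k * exp (- a * t)))) \<longlongrightarrow>
       - (\<Sum>k\<le>n. fact n / fact k / a ^ (n - k + 1) * 0)) at_top"
      by (intro tendsto_minus tendsto_sum tendsto_mult tendsto_const)
    thus ?thesis by (simp add: F_def[abs_def] sum_distrib_right mult.assoc)
  qed
  have F0: "F n 0 = - (fact n / a ^ Suc n)"
  proof -
    have "(\<Sum>k\<le>n. fact n / fact k / a ^ (n - k + 1) * 0 ^ k) = (\<Sum>k\<le>n. if k = 0 then fact n / a ^ Suc n else 0)"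
      by (intro sum.cong) auto
    thus ?thesis by (simp add: F_def)
  qed
  have "(\<integral>\<^sup>+t. ennreal (t ^ n * exp (- a * t)) * indicator {0..} t \<partial>lborel) = 0 - F n 0"
    by (rule nn_integral_FTC_atLeast[OF _ D _ lim]) auto
  hence nn: "(\<integral>\<^sup>+t. ennreal (indicator {0..} t * (t ^ n * exp (- a * t))) \<partial>lborel) = ennreal (fact n / a ^ Suc n)"
    by (simp add: F0 ennreal_indicator[symmetric] ennreal_mult' mult.commute)
  have nonneg: "0 \<le> indicator {0..} t * (t ^ n * exp (- a * t))" for t :: real by (simp add: indicator_def)
  show I: "integrable lborel (\<lambda>t. indicator {0..} t * (t ^ n * exp (- a * t)))"
    by (rule integrableI_nonneg) (use nn nonneg in auto)
  have "0 \<le> fact n / a ^ Suc n" using a by simp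
  from nn_integral_eq_integral[OF I] nonneg nn this
  show "(LBINT t. indicator {0..} t * (t ^ n * exp (- a * t))) = fact n / a ^ Suc n"
    by (simp add: integral_nonneg_AE)
qed

text \<open>The Gamma integrals at the rates 1 and \<open>1 + x\<close> leave
  \<open>1 - (1 / (1 + x)) ^ Suc n\<close> divided by \<open>x / (1 + x) = 1 - 1 / (1 + x)\<close>,
  a finite geometric sum. This is the origin of the variable \<open>1 / (1 + x)\<close>.\<close>

lemma creep_kernel_moment:
  assumes x: "0 < x"
  shows "(LBINT t. indicator {0..} t * (t ^ n * exp (- t)) * creep_kernel t x) = fact n * (\<Sum>k\<le>n. (1 / (1 + x)) ^ k)"
proof -
  have "(\<lambda>t. indicator {0..} t * (t ^ n * exp (- t)) * creep_kernel t x) =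
    (\<lambda>t. (1 + x) / x * (indicator {0..} t * (t ^ n * exp (- 1 * t)) - indicator {0..} t * (t ^ n * exp (- (1 + x) * t))))"
    using x by (auto simp: creep_kernel_def fun_eq_iff indicator_def field_simps exp_add[symmetric] exp_diff[symmetric])
  hence "(LBINT t. indicator {0..} t * (t ^ n * exp (- t)) * creep_kernel t x) =
    (1 + x) / x * (fact n / 1 ^ Suc n - fact n / (1 + x) ^ Suc n)"
    using power_exp_integral[of 1 n] power_exp_integral[of "1 + x" n] x by simp
  also have "\<dots> = fact n * ((1 - (1 / (1 + x)) ^ Suc n) / (1 - 1 / (1 + x)))"
  proof -
    have "1 - 1 / (1 + x) = x / (1 + x)" using x by (simp add: field_simps)
    thus ?thesis using x by (simp add: power_divide field_simps)
  qed
  also have "(1 - (1 / (1 + x)) ^ Suc n) / (1 - 1 / (1 + x)) = (\<Sum>k\<le>n. (1 / (1 + x)) ^ k)"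
    using x sum_gp_basic[of "1 / (1 + x)" n] by (simp add: field_simps)
  finally show ?thesis .
qed

section \<open>Creep and relaxation integrals of one finite measure\<close>

locale creep_measure = finite_measure \<mu> for \<mu> :: "real measure" +
  assumes sets_eq: "sets \<mu> = sets borel" and pos: "AE x in \<mu>. 0 < x"
begin

declare sets_eq [measurable_cong]

lemma pair: "pair_sigma_finite \<mu> lborel"
  by (simp add: pair_sigma_finite_def sigma_finite_measure_axioms sigma_finite_lborel)

definition creep :: "real \<Rightarrow> real" where
  "creep t = (LINT x|\<mu>. creep_kernel t x)"

definition relax :: "real \<Rightarrow> real" where
  "relax t = (LINT x|\<mu>. relaxation_kernel t x)"

lemma creep_measurable [measurable]: "creep \<in> borel_measurable borel"
proof -
  have "(\<lambda>t. LINT x|\<mu>. creep_kernel (fst (t, x)) (snd (t, x))) \<in> borel_measurable borel"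
    by (rule borel_measurable_lebesgue_integral) measurable
  thus ?thesis by (simp add: creep_def[abs_def])
qed

lemma creep_kernel_integrable: "0 \<le> t \<Longrightarrow> integrable \<mu> (creep_kernel t)"
  by (rule integrable_const_bound[of _ "1 + t"])
     (use creep_kernel_nonneg creep_kernel_le in auto)

lemma creep_nonneg: "0 \<le> t \<Longrightarrow> 0 \<le> creep t"
  unfolding creep_def by (simp add: creep_kernel_nonneg)

lemma creep_le: "0 \<le> t \<Longrightarrow> creep t \<le> (1 + t) * measure \<mu> (space \<mu>)"
proof -
  assume t: "0 \<le> t"
  have "creep t \<le> (LINT x|\<mu>. 1 + t)"
    unfolding creep_def by (rule integral_mono) (use t creep_kernel_integrable creep_kernel_le in auto)
  thus ?thesis by (simp add: mult.commute)
qed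

lemma creep_continuous: "continuous_on {0..} creep"
  unfolding continuous_on_sequentially
proof (intro allI ballI impI, elim conjE)
  fix s :: "nat \<Rightarrow> real" and a assume a: "a \<in> {0..}" and s: "\<forall>n. s n \<in> {0..}" "s \<longlonglongrightarrow> a"
  obtain B where B: "\<And>n. s n \<le> B"
    using convergent_imp_bounded[OF s(2)] unfolding bounded_iff by (auto simp: abs_le_iff)
  show "(creep \<circ> s) \<longlonglongrightarrow> creep a"
    unfolding creep_def o_def
  proof (rule integral_dominated_convergence[where w = "\<lambda>_. 1 + B"])
    have "(\<lambda>n. creep_kernel (s n) x) \<longlonglongrightarrow> creep_kernel a x" for x
      by (rule isCont_tendsto_compose[OF DERIV_isCont[OF creep_kernel_DERIV] s(2)])
    thus "AE x in \<mu>. (\<lambda>n. creep_kernel (s n) x) \<longlonglongrightarrow> creep_kernel a x" by simp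
    have "norm (creep_kernel (s n) x) \<le> 1 + B" for n x
      using creep_kernel_nonneg[of "s n" x] creep_kernel_le[of "s n" x] s(1) B[of n] by force
    thus "AE x in \<mu>. norm (creep_kernel (s n) x) \<le> 1 + B" for n by simp
  qed auto
qed

lemma integrable_second:
  assumes w: "integrable lborel (w :: real \<Rightarrow> real)"
  shows "integrable (\<mu> \<Otimes>\<^sub>M lborel) (\<lambda>(x, t). w t)"
proof -
  interpret P: pair_sigma_finite \<mu> lborel by (rule pair)
  have [measurable]: "w \<in> borel_measurable borel" using borel_measurable_integrable[OF w] by simp
  show ?thesis by (rule P.Fubini_integrable) (use w in auto)
qed

lemma power_integrable: "integrable \<mu> (\<lambda>x. (1 / (1 + x)) ^ k)"
proof (rule integrable_const_bound[of _ 1])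
  show "AE x in \<mu>. norm ((1 / (1 + x)) ^ k) \<le> 1"
    using pos by eventually_elim (simp add: power_le_one norm_power)
qed measurable

lemma creep_moment:
  "(LBINT t. indicator {0..} t * (t ^ n * exp (- t)) * creep t) = fact n * (\<Sum>k\<le>n. LINT x|\<mu>. (1 / (1 + x)) ^ k)"
proof -
  interpret P: pair_sigma_finite \<mu> lborel by (rule pair)
  define f where "f x t = indicator {0..} t * (t ^ n * exp (- t)) * creep_kernel t x" for x t :: real
  define w where "w t = indicator {0..} t * (t ^ n * exp (- 1 * t)) + indicator {0..} t * (t ^ Suc n * exp (- 1 * t))" for t :: real
  have w: "integrable lborel w" unfolding w_def by (intro Bochner_Integration.integrable_add power_exp_integral) auto
  have fw: "norm (f x t) \<le> w t" for x t
  proof (cases "0 \<le> t")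
    case True
    have "f x t \<le> (t ^ n * exp (- t)) * (1 + t)"
      using True creep_kernel_le[OF True, of x] by (simp add: f_def mult_left_mono)
    thus ?thesis using True creep_kernel_nonneg[OF True, of x] by (simp add: f_def w_def algebra_simps)
  qed (simp add: f_def w_def)
  have [measurable]: "(\<lambda>(x, t). f x t) \<in> borel_measurable (borel \<Otimes>\<^sub>M borel)"
    unfolding f_def case_prod_unfold by measurable
  have int: "integrable (\<mu> \<Otimes>\<^sub>M lborel) (\<lambda>(x, t). f x t)"
  proof (rule Bochner_Integration.integrable_bound)
    show "integrable (\<mu> \<Otimes>\<^sub>M lborel) (\<lambda>(x, t). w t)" by (rule integrable_second[OF w])
    have "norm (f x t) \<le> norm (w t)" for x t using fw[of x t] by simp
    thus "almost_everywhere (\<mu> \<Otimes>\<^sub>M lborel) (\<lambda>z. norm ((\<lambda>(x, t). f x t) z) \<le> norm ((\<lambda>(x, t). w t) z))"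
      by (simp add: case_prod_unfold)
  qed measurable
  have "(LBINT t. indicator {0..} t * (t ^ n * exp (- t)) * creep t) = (LBINT t. (LINT x|\<mu>. f x t))"
    by (simp add: f_def creep_def)
  also have "\<dots> = (LINT x|\<mu>. (LBINT t. f x t))" by (rule P.Fubini_integral[OF int])
  also have "\<dots> = (LINT x|\<mu>. fact n * (\<Sum>k\<le>n. (1 / (1 + x)) ^ k))"
    by (rule integral_cong_AE) (use pos creep_kernel_moment in \<open>auto simp: f_def elim!: eventually_mono\<close>)
  also have "\<dots> = fact n * (\<Sum>k\<le>n. LINT x|\<mu>. (1 / (1 + x)) ^ k)"
    using power_integrable by simp
  finally show ?thesis .
qed

text \<open>For fixed \<open>x\<close> this is integration by parts in \<open>t\<close>, without
  boundary term because the creep kernel vanishes at time 0 and the test function at infinity.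
  Fubini's theorem then transfers it to the measure.\<close>

lemma creep_deriv:
  assumes \<phi>: "test_function \<phi>"
  shows relax_integrable: "integrable lborel (\<lambda>t. indicator {0..} t * relax t * \<phi> t)"
    and creep_deriv_eq: "- (LBINT t. indicator {0..} t * creep t * deriv \<phi> t) = (LBINT t. indicator {0..} t * relax t * \<phi> t)"
proof -
  interpret P: pair_sigma_finite \<mu> lborel by (rule pair)
  note sm = test_function_smooth[OF \<phi>]
  obtain R where R: "R > 0" "\<forall>x. x \<notin> {-R..R} \<longrightarrow> \<phi> x = 0" using test_function_bounds[OF \<phi>] by blast
  define S where "S = R + 1"
  have S: "S > 0" "\<phi> t = 0" "deriv \<phi> t = 0" if "t \<ge> S" for t
    using R deriv_outside_0[of R \<phi> t] that by (auto simp: S_def)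
  have S0: "S > 0" using R by (simp add: S_def)
  have c\<phi>: "continuous_on A \<phi>" "continuous_on A (deriv \<phi>)" for A
    using smooth_continuous sm smooth_deriv by auto
  have [measurable]: "\<phi> \<in> borel_measurable borel" "deriv \<phi> \<in> borel_measurable borel"
    using c\<phi> by (auto intro: borel_measurable_continuous_onI)
  obtain B where B: "B \<ge> 0" "\<forall>x. \<bar>\<phi> x\<bar> \<le> B" using higher_deriv_bounded[OF \<phi>, of 0] by auto
  obtain B' where B': "B' \<ge> 0" "\<forall>x. \<bar>deriv \<phi> x\<bar> \<le> B'" using higher_deriv_bounded[OF \<phi>, of 1] by auto
  define f where "f x t = indicator {0..} t * creep_kernel t x * deriv \<phi> t" for x t :: real
  define g where "g x t = indicator {0..} t * relaxation_kernel t x * \<phi> t" for x t :: real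
  have [measurable]: "(\<lambda>(x, t). f x t) \<in> borel_measurable (borel \<Otimes>\<^sub>M borel)"
    unfolding f_def case_prod_unfold by measurable
  have gm [measurable]: "(\<lambda>(x, t). g x t) \<in> borel_measurable (borel \<Otimes>\<^sub>M borel)"
    unfolding g_def case_prod_unfold by measurable
  have Df: "((\<lambda>t. creep_kernel t x * \<phi> t) has_real_derivative relaxation_kernel t x * \<phi> t + deriv \<phi> t * creep_kernel t x) (at t)" for x t
    by (rule DERIV_mult[OF creep_kernel_DERIV smooth_DERIV[OF sm]])
  have cck: "continuous_on A (\<lambda>t. creep_kernel t x)" for A x
    by (intro continuous_at_imp_continuous_on ballI DERIV_isCont[OF creep_kernel_DERIV])
  have cut: "integrable lborel (\<lambda>t. indicator {0..} t * q t)" if "continuous_on UNIV q" "\<And>t. t \<ge> S \<Longrightarrow> q t = 0" for q :: "real \<Rightarrow> real"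
  proof -
    have "integrable lborel (\<lambda>t. indicator {0..S} t *\<^sub>R q t)"
      by (rule borel_integrable_compact) (auto intro: continuous_on_subset[OF that(1)])
    also have "(\<lambda>t. indicator {0..S} t *\<^sub>R q t) = (\<lambda>t. indicator {0..} t * q t)"
      using that(2) by (auto simp: fun_eq_iff indicator_def)
    finally show ?thesis .
  qed
  have int_ft: "integrable lborel (f x)" for x
    using cut[of "\<lambda>t. creep_kernel t x * deriv \<phi> t"] S
    by (simp add: f_def[abs_def] mult.assoc continuous_on_mult cck c\<phi>)
  have int_gt: "integrable lborel (g x)" for x
    using cut[of "\<lambda>t. relaxation_kernel t x * \<phi> t"] S
    by (simp add: g_def[abs_def] mult.assoc continuous_on_mult relaxation_kernel_continuous c\<phi>)
  have parts: "(LBINT t. g x t) = - (LBINT t. f x t)" for x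
  proof -
    have "(LBINT t. indicator {0..} t * (relaxation_kernel t x * \<phi> t + deriv \<phi> t * creep_kernel t x)) = - (creep_kernel 0 x * \<phi> 0)"
      by (rule half_line_FTC(2)[OF Df, where R = S])
         (auto intro!: continuous_intros cck c\<phi> relaxation_kernel_continuous simp: S)
    moreover have "indicator {0..} t * (relaxation_kernel t x * \<phi> t + deriv \<phi> t * creep_kernel t x) = g x t + f x t" for t
      by (simp add: f_def g_def algebra_simps)
    ultimately show ?thesis using int_ft[of x] int_gt[of x] by simp
  qed
  have int_f: "integrable (\<mu> \<Otimes>\<^sub>M lborel) (\<lambda>(x, t). f x t)"
  proof (rule Bochner_Integration.integrable_bound)
    have "integrable lborel (\<lambda>t. indicator {0..S} t *\<^sub>R ((1 + t) * B'))"
      by (rule borel_integrable_compact) (auto intro!: continuous_intros)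
    thus "integrable (\<mu> \<Otimes>\<^sub>M lborel) (\<lambda>(x, t). indicator {0..S} t *\<^sub>R ((1 + t) * B'))" by (rule integrable_second)
    have "norm (f x t) \<le> norm (indicator {0..S} t *\<^sub>R ((1 + t) * B'))" for x t
    proof (cases "t \<in> {0..S}")
      case True
      hence t: "0 \<le> t" by simp
      have "\<bar>creep_kernel t x\<bar> * \<bar>deriv \<phi> t\<bar> \<le> (1 + t) * B'"
        using creep_kernel_nonneg[OF t, of x] creep_kernel_le[OF t, of x] B' t by (intro mult_mono) auto
      thus ?thesis using True B' by (simp add: f_def abs_mult)
    next
      case False
      thus ?thesis using S[of t] by (auto simp: f_def indicator_def)
    qed
    thus "almost_everywhere (\<mu> \<Otimes>\<^sub>M lborel) (\<lambda>z. norm ((\<lambda>(x, t). f x t) z) \<le> norm ((\<lambda>(x, t). indicator {0..S} t *\<^sub>R ((1 + t) * B')) z))"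
      by (simp add: case_prod_unfold)
  qed measurable
  \<comment> \<open>Near \<open>t = 0\<close> the relaxation kernel is too large for an integrable
    bound in \<open>t\<close> alone. Integrated in time first it becomes
    \<open>creep_kernel S x\<close>, which is bounded uniformly in \<open>x\<close>.\<close>
  have gb: "(LBINT t. norm (g x t)) \<le> B * (1 + S)" for x
  proof -
    have "(LBINT t. norm (g x t)) \<le> (LBINT t. B * (relaxation_kernel t x * indicator {0..S} t))"
    proof (rule integral_mono)
      show "integrable lborel (\<lambda>t. norm (g x t))" using int_gt by simp
      have "integrable lborel (\<lambda>t. indicator {0..S} t *\<^sub>R relaxation_kernel t x)"
        by (rule borel_integrable_compact) (auto intro!: relaxation_kernel_continuous)
      thus "integrable lborel (\<lambda>t. B * (relaxation_kernel t x * indicator {0..S} t))" by (simp add: mult.commute)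
      fix t
      have "\<bar>relaxation_kernel t x\<bar> * \<bar>\<phi> t\<bar> \<le> relaxation_kernel t x * B"
        using relaxation_kernel_nonneg[of t x] B by (intro mult_mono) auto
      thus "norm (g x t) \<le> B * (relaxation_kernel t x * indicator {0..S} t)"
        using S[of t] by (auto simp: g_def abs_mult indicator_def mult.commute)
    qed
    also have "\<dots> = B * (creep_kernel S x - creep_kernel 0 x)"
    proof -
      have "(LBINT t. relaxation_kernel t x * indicator {0..S} t) = creep_kernel S x - creep_kernel 0 x"
        by (rule integral_FTC_Icc_real)
           (use S0 creep_kernel_DERIV relaxation_kernel_continuous[of UNIV] in \<open>auto simp: continuous_on_eq_continuous_at\<close>)
      thus ?thesis by simp
    qed
    also have "\<dots> \<le> B * (1 + S)" using creep_kernel_le[of S x] S0 B by (simp add: mult_left_mono)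
    finally show ?thesis .
  qed
  have int_g: "integrable (\<mu> \<Otimes>\<^sub>M lborel) (\<lambda>(x, t). g x t)"
  proof (rule P.Fubini_integrable)
    have "(\<lambda>x. LBINT t. norm (case (x, t) of (x, t) \<Rightarrow> g x t)) \<in> borel_measurable \<mu>"
      by (rule lborel.borel_measurable_lebesgue_integral) measurable
    moreover have "norm (LBINT t. norm (g x t)) \<le> B * (1 + S)" for x
      using gb[of x] by (simp add: integral_nonneg_AE)
    ultimately show "integrable \<mu> (\<lambda>x. LBINT t. norm (case (x, t) of (x, t) \<Rightarrow> g x t))"
      by (intro integrable_const_bound[of _ "B * (1 + S)"]) auto
    show "AE x in \<mu>. integrable lborel (\<lambda>t. case (x, t) of (x, t) \<Rightarrow> g x t)" using int_gt by simp
  qed measurable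
  have "(LBINT t. indicator {0..} t * creep t * deriv \<phi> t) = (LBINT t. (LINT x|\<mu>. f x t))"
    by (simp add: f_def creep_def mult.assoc mult.left_commute)
  also have "\<dots> = (LINT x|\<mu>. (LBINT t. f x t))" by (rule P.Fubini_integral[OF int_f])
  finally have "- (LBINT t. indicator {0..} t * creep t * deriv \<phi> t) = (LINT x|\<mu>. (LBINT t. g x t))" by (simp add: parts)
  also have "\<dots> = (LBINT t. (LINT x|\<mu>. g x t))" by (rule P.Fubini_integral[OF int_g, symmetric])
  also have "\<dots> = (LBINT t. indicator {0..} t * relax t * \<phi> t)"
    by (simp add: g_def relax_def mult.assoc mult.left_commute)
  finally show "- (LBINT t. indicator {0..} t * creep t * deriv \<phi> t) = (LBINT t. indicator {0..} t * relax t * \<phi> t)" .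
  have "integrable lborel (\<lambda>t. LINT x|\<mu>. g x t)" by (rule P.integrable_snd[OF int_g])
  thus "integrable lborel (\<lambda>t. indicator {0..} t * relax t * \<phi> t)"
    by (simp add: g_def relax_def mult.assoc mult.left_commute)
qed

end

section \<open>Normal forms of impulse responses and relaxation functions\<close>

definition creep_function ::
    "(real^'m::finite \<Rightarrow> real measure) \<Rightarrow> real^'m^'m \<Rightarrow> real^'m^'m \<Rightarrow> 'm \<Rightarrow> 'm \<Rightarrow> real \<Rightarrow> real" where
  "creep_function \<sigma> L K i j t =
    (if t < 0 then 0 else polar (\<lambda>v. LINT x|\<sigma> v. creep_kernel t x) i j + t * L $ i $ j + K $ i $ j)"

definition relaxation_distribution ::
    "(real^'m::finite \<Rightarrow> real measure) \<Rightarrow> real^'m^'m \<Rightarrow> real^'m^'m \<Rightarrow> 'm \<Rightarrow> 'm \<Rightarrow> functional" where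
  "relaxation_distribution \<sigma> A B i j = (\<lambda>\<phi>. A $ i $ j * dist_of (indicator {0..}) \<phi> + B $ i $ j * dirac0 \<phi> +
     dist_of (\<lambda>t. indicator {0..} t * polar (\<lambda>v. LINT x|\<sigma> v. relaxation_kernel t x) i j) \<phi>)"

lemma quadratic_family_creep_measure: "quadratic_family \<sigma> \<Longrightarrow> creep_measure (\<sigma> v)"
  unfolding quadratic_family_def creep_measure_def creep_measure_axioms_def
  using half_line_AE by (auto simp: half_line_measure_def)

lemma compact_pos_lower_bound:
  assumes "compact K" "K \<subseteq> {0<..}" "continuous_on {0<..} w" "\<And>x. 0 < x \<Longrightarrow> 0 < (w x :: real)"
  shows "\<exists>c>0. \<forall>x\<in>K. c \<le> w x"
proof (cases "K = {}")
  case False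
  from continuous_attains_inf[OF assms(1) False continuous_on_subset[OF assms(3,2)]]
  obtain y where y: "y \<in> K" "\<forall>x\<in>K. w y \<le> w x" by blast
  thus ?thesis using assms(2,4) by (intro exI[of _ "w y"]) auto
qed (auto intro: exI[of _ 1])

interpretation creep_weight: weight "\<lambda>x. x / (1 + x)"
proof
  fix K :: "real set" assume "compact K" "K \<subseteq> {0<..}"
  thus "\<exists>c>0. \<forall>x\<in>K. c \<le> x / (1 + x)"
    by (rule compact_pos_lower_bound) (auto intro!: continuous_intros)
qed auto

interpretation relaxation_weight: weight "\<lambda>x. 1 / (1 + x)"
proof
  fix K :: "real set" assume "compact K" "K \<subseteq> {0<..}"
  thus "\<exists>c>0. \<forall>x\<in>K. c \<le> 1 / (1 + x)"
    by (rule compact_pos_lower_bound) (auto intro!: continuous_intros)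
qed auto

lemma creep_kernel_weight: "0 < x \<Longrightarrow> (1 - exp (- x * t)) / (x / (1 + x)) = creep_kernel t x"
  by (simp add: creep_kernel_def)

lemma creep_bound:
  fixes t x :: real
  shows "0 \<le> t \<Longrightarrow> 0 < x \<Longrightarrow> \<bar>1 - exp (- x * t)\<bar> \<le> (1 + t) * (x / (1 + x))"
  using creep_kernel_le[of t x] creep_kernel_nonneg[of t x]
  by (auto simp: creep_kernel_def field_simps abs_if)

lemma relaxation_kernel_weight: "0 < x \<Longrightarrow> exp (- t * x) / (1 / (1 + x)) = relaxation_kernel t x"
  by (simp add: relaxation_kernel_def)

text \<open>\<open>1 + x \<le> (1 + 1 / t) * (1 + t * x)\<close> and the last factor is at most
  \<open>exp (t * x)\<close>. The constant blows up as \<open>t\<close> tends to 0, so this bound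
  covers positive times only.\<close>

lemma relaxation_bound:
  fixes t x :: real
  assumes "0 < t" "0 < x"
  shows "\<bar>exp (- t * x)\<bar> \<le> (1 + 1 / t) * (1 / (1 + x))"
proof -
  have "1 + x \<le> (1 + 1 / t) * (1 + t * x)" using assms by (simp add: field_simps)
  also have "(1 + 1 / t) * (1 + t * x) \<le> (1 + 1 / t) * exp (t * x)"
    by (rule mult_left_mono[OF exp_ge_add_one_self]) (use assms in simp)
  finally have "1 + x \<le> (1 + 1 / t) * exp (t * x)" .
  hence "(1 + x) * exp (- t * x) \<le> (1 + 1 / t) * exp (t * x) * exp (- t * x)" by (rule mult_right_mono) simp
  also have "\<dots> = 1 + 1 / t" by (simp add: exp_minus mult.assoc)
  finally have "exp (- t * x) \<le> (1 + 1 / t) / (1 + x)" using assms by (simp add: pos_le_divide_eq mult.commute)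
  thus ?thesis by simp
qed

lemma family_integral_cong:
  assumes "quadratic_family \<sigma>" "\<And>x. 0 < x \<Longrightarrow> f x = g x" "f \<in> borel_measurable borel" "g \<in> borel_measurable borel"
  shows "(LINT x|\<sigma> v. f x) = (LINT x|\<sigma> v. (g x :: real))"
proof -
  have h: "half_line_measure (\<sigma> v)" using assms(1) by (simp add: quadratic_family_def)
  show ?thesis
  proof (rule integral_cong_AE)
    show "f \<in> borel_measurable (\<sigma> v)" "g \<in> borel_measurable (\<sigma> v)"
      unfolding half_line_measurable[OF h] by fact+
    show "AE x in \<sigma> v. f x = g x" using half_line_AE[OF h] by eventually_elim (rule assms(2))
  qed
qed

text \<open>The signed matrix measure gives way to finite positive measures, the integrand
  \<open>1 - exp (- x * t)\<close> being divided by the weight \<open>x / (1 + x)\<close>.\<close>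

lemma impulse_response_iff:
  "impulse_response f \<longleftrightarrow> (\<exists>\<sigma> L K. quadratic_family \<sigma> \<and> sym_psd L \<and> sym_psd K \<and> f = creep_function \<sigma> L K)"
  for f :: "'m::finite \<Rightarrow> 'm \<Rightarrow> real \<Rightarrow> real"
proof
  assume "impulse_response f"
  then obtain \<nu> and L K :: "real^'m^'m" where LK: "sym_psd L" "sym_psd K" and \<nu>: "psd_measures \<nu>"
    and fin: "\<forall>i j. (\<integral>\<^sup>+x. ennreal (x / (1 + x)) \<partial>total_variation (\<nu> i j)) < \<infinity>"
    and f: "\<forall>i j t. f i j t = (if t < 0 then 0
         else signed_integral (\<nu> i j) (\<lambda>x. 1 - exp (- x * t)) + t * L $ i $ j + K $ i $ j)"
    unfolding impulse_response_def by blast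
  show "\<exists>\<sigma> L K. quadratic_family \<sigma> \<and> sym_psd L \<and> sym_psd K \<and> f = creep_function \<sigma> L K"
  proof (rule creep_weight.psd_measures_imp_family[OF \<nu> fin[rule_format]])
  fix \<sigma> :: "real^'m \<Rightarrow> real measure"
  assume \<sigma>: "quadratic_family \<sigma>" and si: "\<And>g C i j. g \<in> borel_measurable borel \<Longrightarrow>
      (\<And>x. 0 < x \<Longrightarrow> \<bar>g x\<bar> \<le> C * (x / (1 + x))) \<Longrightarrow>
      signed_integral (\<nu> i j) g = polar (\<lambda>v. LINT x|\<sigma> v. g x / (x / (1 + x))) i j"
  have "signed_integral (\<nu> i j) (\<lambda>x. 1 - exp (- x * t)) = polar (\<lambda>v. LINT x|\<sigma> v. creep_kernel t x) i j"
    if t: "0 \<le> t" for i j t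
    using si[of "\<lambda>x. 1 - exp (- x * t)", OF _ creep_bound[OF t]]
    by (simp add: family_integral_cong[OF \<sigma> creep_kernel_weight, simplified])
  hence "f = creep_function \<sigma> L K" using f by (auto simp: fun_eq_iff creep_function_def)
  thus "\<exists>\<sigma> L K. quadratic_family \<sigma> \<and> sym_psd L \<and> sym_psd K \<and> f = creep_function \<sigma> L K"
    using \<sigma> LK by blast
  qed
next
  assume "\<exists>\<sigma> L K. quadratic_family \<sigma> \<and> sym_psd L \<and> sym_psd K \<and> f = creep_function \<sigma> L K"
  then obtain \<sigma> L K where \<sigma>: "quadratic_family \<sigma>" and LK: "sym_psd L" "sym_psd K" and f: "f = creep_function \<sigma> L K"
    by blast
  show "impulse_response f"
  proof (rule creep_weight.family_imp_psd_measures[OF \<sigma>])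
  fix \<nu> :: "'m \<Rightarrow> 'm \<Rightarrow> real set \<Rightarrow> real" assume \<nu>: "psd_measures \<nu>"
    and fin: "\<And>i j. (\<integral>\<^sup>+x. ennreal (x / (1 + x)) \<partial>total_variation (\<nu> i j)) < \<infinity>"
    and si: "\<And>g C i j. g \<in> borel_measurable borel \<Longrightarrow> (\<And>x. 0 < x \<Longrightarrow> \<bar>g x\<bar> \<le> C * (x / (1 + x))) \<Longrightarrow>
      signed_integral (\<nu> i j) g = polar (\<lambda>v. LINT x|\<sigma> v. g x / (x / (1 + x))) i j"
  have "signed_integral (\<nu> i j) (\<lambda>x. 1 - exp (- x * t)) = polar (\<lambda>v. LINT x|\<sigma> v. creep_kernel t x) i j"
    if t: "0 \<le> t" for i j t
    using si[of "\<lambda>x. 1 - exp (- x * t)", OF _ creep_bound[OF t]]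
    by (simp add: family_integral_cong[OF \<sigma> creep_kernel_weight, simplified])
  hence "\<forall>i j t. f i j t = (if t < 0 then 0
         else signed_integral (\<nu> i j) (\<lambda>x. 1 - exp (- x * t)) + t * L $ i $ j + K $ i $ j)"
    unfolding f creep_function_def by simp
  thus "impulse_response f" unfolding impulse_response_def using \<nu> fin LK by blast
  qed
qed

lemma relaxation_form_iff:
  "relaxation_form r \<longleftrightarrow> (\<exists>\<sigma> A B. quadratic_family \<sigma> \<and> sym_psd A \<and> sym_psd B \<and>
     (\<forall>i j. r i j =\<^sub>D relaxation_distribution \<sigma> A B i j))"
  for r :: "'m::finite \<Rightarrow> 'm \<Rightarrow> functional"
proof -
  have eq: "dist_of (\<lambda>t. indicator {0..} t * signed_integral (\<rho> i j) (\<lambda>x. exp (- t * x))) \<phi> =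
      dist_of (\<lambda>t. indicator {0..} t * polar (\<lambda>v. LINT x|\<sigma> v. relaxation_kernel t x) i j) \<phi>"
    if \<sigma>: "quadratic_family \<sigma>" and si: "\<And>g C i j. g \<in> borel_measurable borel \<Longrightarrow> (\<And>x. 0 < x \<Longrightarrow> \<bar>g x\<bar> \<le> C * (1 / (1 + x))) \<Longrightarrow>
      signed_integral (\<rho> i j) g = polar (\<lambda>v. LINT x|\<sigma> v. g x / (1 / (1 + x))) i j"
    for \<sigma> :: "real^'m \<Rightarrow> real measure" and \<rho> :: "'m \<Rightarrow> 'm \<Rightarrow> real set \<Rightarrow> real" and i j \<phi>
    unfolding dist_of_def
  \<comment> \<open>The time 0 is discarded as a null set: there the integrand is 1, and the mass of
    the entries of \<rho> may be infinite.\<close>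
  proof (rule integral_discrete_difference[of "{0}"])
    fix t :: real assume "t \<notin> {0}"
    then consider "t < 0" | "0 < t" by force
    thus "indicator {0..} t * signed_integral (\<rho> i j) (\<lambda>x. exp (- t * x)) * \<phi> t =
      indicator {0..} t * polar (\<lambda>v. LINT x|\<sigma> v. relaxation_kernel t x) i j * \<phi> t"
    proof cases
      case 2
      show ?thesis
        using si[of "\<lambda>x. exp (- t * x)", OF _ relaxation_bound[OF 2]]
        by (simp add: family_integral_cong[OF \<sigma> relaxation_kernel_weight, simplified])
    qed simp
  qed auto
  show ?thesis
  proof
    assume "relaxation_form r"
    then obtain A B :: "real^'m^'m" and \<rho> where AB: "sym_psd A" "sym_psd B" and \<rho>: "psd_measures \<rho>"
      and fin: "\<forall>i j. (\<integral>\<^sup>+x. ennreal (1 / (1 + x)) \<partial>total_variation (\<rho> i j)) < \<infinity>"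
      and r: "\<forall>i j. r i j =\<^sub>D (\<lambda>\<phi>. A $ i $ j * dist_of (indicator {0..}) \<phi> + B $ i $ j * dirac0 \<phi> +
        dist_of (\<lambda>t. indicator {0..} t * signed_integral (\<rho> i j) (\<lambda>x. exp (- t * x))) \<phi>)"
      unfolding relaxation_form_def by blast
    show "\<exists>\<sigma> A B. quadratic_family \<sigma> \<and> sym_psd A \<and> sym_psd B \<and> (\<forall>i j. r i j =\<^sub>D relaxation_distribution \<sigma> A B i j)"
    proof (rule relaxation_weight.psd_measures_imp_family[OF \<rho> fin[rule_format]])
    fix \<sigma> :: "real^'m \<Rightarrow> real measure"
    assume \<sigma>: "quadratic_family \<sigma>" and si: "\<And>g C i j. g \<in> borel_measurable borel \<Longrightarrow>
        (\<And>x. 0 < x \<Longrightarrow> \<bar>g x\<bar> \<le> C * (1 / (1 + x))) \<Longrightarrow>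
        signed_integral (\<rho> i j) g = polar (\<lambda>v. LINT x|\<sigma> v. g x / (1 / (1 + x))) i j"
    have e: "dist_of (\<lambda>t. indicator {0..} t * signed_integral (\<rho> i j) (\<lambda>x. exp (- t * x))) \<phi> =
      dist_of (\<lambda>t. indicator {0..} t * polar (\<lambda>v. LINT x|\<sigma> v. relaxation_kernel t x) i j) \<phi>" for i j \<phi>
      by (rule eq[OF \<sigma>]) (rule si)
    have "\<forall>i j. r i j =\<^sub>D relaxation_distribution \<sigma> A B i j"
      using r by (simp only: e relaxation_distribution_def simp_thms)
    thus "\<exists>\<sigma> A B. quadratic_family \<sigma> \<and> sym_psd A \<and> sym_psd B \<and> (\<forall>i j. r i j =\<^sub>D relaxation_distribution \<sigma> A B i j)"
      using \<sigma> AB by blast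
    qed
  next
    assume "\<exists>\<sigma> A B. quadratic_family \<sigma> \<and> sym_psd A \<and> sym_psd B \<and> (\<forall>i j. r i j =\<^sub>D relaxation_distribution \<sigma> A B i j)"
    then obtain \<sigma> A B where \<sigma>: "quadratic_family \<sigma>" and AB: "sym_psd A" "sym_psd B"
      and r: "\<forall>i j. r i j =\<^sub>D relaxation_distribution \<sigma> A B i j" by blast
    show "relaxation_form r"
    proof (rule relaxation_weight.family_imp_psd_measures[OF \<sigma>])
    fix \<rho> :: "'m \<Rightarrow> 'm \<Rightarrow> real set \<Rightarrow> real" assume \<rho>: "psd_measures \<rho>"
      and fin: "\<And>i j. (\<integral>\<^sup>+x. ennreal (1 / (1 + x)) \<partial>total_variation (\<rho> i j)) < \<infinity>"
      and si: "\<And>g C i j. g \<in> borel_measurable borel \<Longrightarrow> (\<And>x. 0 < x \<Longrightarrow> \<bar>g x\<bar> \<le> C * (1 / (1 + x))) \<Longrightarrow>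
        signed_integral (\<rho> i j) g = polar (\<lambda>v. LINT x|\<sigma> v. g x / (1 / (1 + x))) i j"
    show "relaxation_form r"
      unfolding relaxation_form_def
    proof (intro exI conjI allI AB \<rho> fin)
      have e: "dist_of (\<lambda>t. indicator {0..} t * signed_integral (\<rho> i j) (\<lambda>x. exp (- t * x))) \<phi> =
        dist_of (\<lambda>t. indicator {0..} t * polar (\<lambda>v. LINT x|\<sigma> v. relaxation_kernel t x) i j) \<phi>" for i j \<phi>
        by (rule eq[OF \<sigma>]) (rule si)
      show "r i j =\<^sub>D (\<lambda>\<phi>. A $ i $ j * dist_of (indicator {0..}) \<phi> + B $ i $ j * dirac0 \<phi> +
        dist_of (\<lambda>t. indicator {0..} t * signed_integral (\<rho> i j) (\<lambda>x. exp (- t * x))) \<phi>)" for i j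
        using r[rule_format, of i j] by (simp only: e relaxation_distribution_def)
    qed (rule AB \<rho> fin)+
    qed
  qed
qed

text \<open>All that the convolution arguments need to know about an impulse response. Linear growth
  guarantees integrability against \<open>exp (- t / 2)\<close>.\<close>

definition moderate :: "(real \<Rightarrow> real) \<Rightarrow> bool" where
  "moderate f \<longleftrightarrow> f \<in> borel_measurable borel \<and> (\<forall>t<0. f t = 0) \<and> (\<exists>C\<ge>0. \<forall>t\<ge>0. \<bar>f t\<bar> \<le> C * (1 + t))"

lemma moderate_locally_bounded:
  assumes "moderate f"
  shows "locally_bounded f"
  unfolding locally_bounded_def
proof (intro conjI allI)
  from assms obtain C where C: "C \<ge> 0" "\<forall>t\<ge>0. \<bar>f t\<bar> \<le> C * (1 + t)" and n: "\<forall>t<0. f t = 0"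
    unfolding moderate_def by blast
  fix R
  show "\<exists>B. \<forall>x\<in>{- R..R}. \<bar>f x\<bar> \<le> B"
  proof (intro exI ballI)
    fix x assume x: "x \<in> {-R..R}"
    show "\<bar>f x\<bar> \<le> C * (1 + R)"
    proof (cases "x < 0")
      case True thus ?thesis using n C x by simp
    next
      case False
      hence "\<bar>f x\<bar> \<le> C * (1 + x)" using C by simp
      also have "\<dots> \<le> C * (1 + R)" using x C by (intro mult_left_mono) auto
      finally show ?thesis .
    qed
  qed
qed (use assms in \<open>simp add: moderate_def\<close>)

context
  fixes \<sigma> :: "real^'m::finite \<Rightarrow> real measure" and L K :: "real^'m^'m"
  assumes \<sigma>: "quadratic_family \<sigma>"
begin

interpretation creep_measure "\<sigma> v" for v by (rule quadratic_family_creep_measure[OF \<sigma>])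

lemma creep_function_eq:
  "creep_function \<sigma> L K i j t = indicator {0..} t * (polar (\<lambda>v. creep_measure.creep (\<sigma> v) t) i j + t * L $ i $ j + K $ i $ j)"
  by (simp add: creep_function_def creep_def indicator_def)

lemma creep_function_moderate: "moderate (creep_function \<sigma> L K i j)"
  unfolding moderate_def
proof (intro conjI allI impI)
  show "creep_function \<sigma> L K i j \<in> borel_measurable borel"
    unfolding creep_function_eq[abs_def] polar_def by measurable
  show "creep_function \<sigma> L K i j t = 0" if "t < 0" for t using that by (simp add: creep_function_def)
  define m where "m v = measure (\<sigma> v) (space (\<sigma> v))" for v
  let ?p = "axis i 1 + axis j 1 :: real^'m" and ?m = "axis i 1 - axis j 1 :: real^'m"
  show "\<exists>C\<ge>0. \<forall>t\<ge>0. \<bar>creep_function \<sigma> L K i j t\<bar> \<le> C * (1 + t)"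
  proof (intro exI conjI allI impI)
    show "0 \<le> m ?p + m ?m + \<bar>L $ i $ j\<bar> + \<bar>K $ i $ j\<bar>" by (simp add: m_def)
    fix t :: real assume t: "0 \<le> t"
    have b: "0 \<le> creep_measure.creep (\<sigma> v) t" "creep_measure.creep (\<sigma> v) t \<le> m v * (1 + t)" for v
      using creep_nonneg[OF t, of v] creep_le[OF t, of v] by (auto simp: m_def mult.commute)
    have "\<bar>polar (\<lambda>v. creep_measure.creep (\<sigma> v) t) i j\<bar> \<le> m ?p * (1 + t) + m ?m * (1 + t)"
      unfolding polar_def by (rule abs_leI; use b[of ?p] b[of ?m] in argo)
    moreover have "\<bar>t * L $ i $ j\<bar> \<le> \<bar>L $ i $ j\<bar> * (1 + t)" using t by (simp add: abs_mult algebra_simps)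
    moreover have "\<bar>K $ i $ j\<bar> \<le> \<bar>K $ i $ j\<bar> * (1 + t)" using t by (simp add: algebra_simps)
    moreover have "creep_function \<sigma> L K i j t = polar (\<lambda>v. creep_measure.creep (\<sigma> v) t) i j + t * L $ i $ j + K $ i $ j"
      using t by (simp add: creep_function_eq)
    ultimately show "\<bar>creep_function \<sigma> L K i j t\<bar> \<le> (m ?p + m ?m + \<bar>L $ i $ j\<bar> + \<bar>K $ i $ j\<bar>) * (1 + t)"
      unfolding distrib_right by linarith
  qed
qed

lemma creep_function_continuous: "continuous_on {0..} (creep_function \<sigma> L K i j)"
proof -
  have "continuous_on {0..} (\<lambda>t. polar (\<lambda>v. creep_measure.creep (\<sigma> v) t) i j + t * L $ i $ j + K $ i $ j)"
    unfolding polar_def by (intro continuous_intros creep_continuous) auto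
  thus ?thesis by (rule continuous_on_eq) (simp add: creep_function_eq)
qed

text \<open>The term \<open>t * L\<close> contributes \<open>L\<close> times the step function, the
  jump \<open>K\<close> at time 0 contributes \<open>K\<close> times the Dirac mass, and the creep
  integral contributes the relaxation integral of the same \<sigma>. Thus the parameters
  \<open>A\<close> and \<open>B\<close> are \<open>L\<close> and \<open>K\<close>.\<close>

lemma creep_function_deriv:
  "dist_deriv (dist_of (creep_function \<sigma> L K i j)) =\<^sub>D relaxation_distribution \<sigma> L K i j"
  unfolding dist_eq_def
proof (intro allI impI)
  fix \<phi> assume \<phi>: "test_function \<phi>"
  note sm = test_function_smooth[OF \<phi>] and \<phi>' = test_function_deriv[OF \<phi>]
  obtain R where R: "R > 0" "\<forall>x. x \<notin> {-R..R} \<longrightarrow> \<phi> x = 0" using test_function_bounds[OF \<phi>] by blast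
  have vanish: "\<phi> t = 0" "deriv \<phi> t = 0" if "t \<ge> R + 1" for t
    using R deriv_outside_0[of R \<phi> t] that by auto
  have c\<phi>: "continuous_on A \<phi>" "continuous_on A (deriv \<phi>)" for A
    using smooth_continuous sm smooth_deriv by auto
  let ?I = "indicator {0..} :: real \<Rightarrow> real"
  let ?c = "\<lambda>v t. creep_measure.creep (\<sigma> v) t" and ?r = "\<lambda>v t. creep_measure.relax (\<sigma> v) t"
  let ?p = "axis i 1 + axis j 1 :: real^'m" and ?m = "axis i 1 - axis j 1 :: real^'m"
  have int_c: "integrable lborel (\<lambda>t. ?I t * ?c v t * deriv \<phi> t)" for v
  proof (rule locally_bounded_test_integrable[OF _ \<phi>'])
    show "locally_bounded (\<lambda>t. ?I t * ?c v t)"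
    proof (rule moderate_locally_bounded, unfold moderate_def, intro conjI allI impI exI)
      show "(\<lambda>t. ?I t * ?c v t) \<in> borel_measurable borel" by measurable
      show "\<bar>?I t * ?c v t\<bar> \<le> measure (\<sigma> v) (space (\<sigma> v)) * (1 + t)" if "0 \<le> t" for t
        using creep_nonneg[OF that, of v] creep_le[OF that, of v] that by (simp add: mult.commute)
    qed auto
  qed
  note int_r = relax_integrable[OF \<phi>] and eq = creep_deriv_eq[OF \<phi>]
  have D1: "((\<lambda>t. t * \<phi> t) has_real_derivative \<phi> t + t * deriv \<phi> t) (at t)" for t
    using smooth_DERIV[OF sm, of t] by (auto intro!: derivative_eq_intros)
  have i\<phi>: "integrable lborel (\<lambda>t. ?I t * deriv \<phi> t)" "(LBINT t. ?I t * deriv \<phi> t) = - \<phi> 0"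
    by (rule half_line_FTC[OF smooth_DERIV[OF sm] c\<phi>(2), of "R + 1"]; use vanish in blast)+
  have it: "integrable lborel (\<lambda>t. ?I t * (\<phi> t + t * deriv \<phi> t))" "(LBINT t. ?I t * (\<phi> t + t * deriv \<phi> t)) = - (0 * \<phi> 0)"
    by (rule half_line_FTC[OF D1, of "R + 1"]; use vanish c\<phi> in \<open>auto intro!: continuous_intros\<close>)+
  have lb1: "locally_bounded ?I"
    by (auto simp: locally_bounded_def intro!: exI[of _ 1])
  have i1: "integrable lborel (\<lambda>t. ?I t * \<phi> t)" by (rule locally_bounded_test_integrable[OF lb1 \<phi>])
  have it': "integrable lborel (\<lambda>t. ?I t * (t * deriv \<phi> t))" and tt: "(LBINT t. ?I t * (t * deriv \<phi> t)) = - (LBINT t. ?I t * \<phi> t)"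
  proof -
    have e: "(\<lambda>t. ?I t * (t * deriv \<phi> t)) = (\<lambda>t. ?I t * (\<phi> t + t * deriv \<phi> t) - ?I t * \<phi> t)"
      by (auto simp: algebra_simps)
    show "integrable lborel (\<lambda>t. ?I t * (t * deriv \<phi> t))" unfolding e by (intro Bochner_Integration.integrable_diff it i1)
    show "(LBINT t. ?I t * (t * deriv \<phi> t)) = - (LBINT t. ?I t * \<phi> t)"
      unfolding e by (subst Bochner_Integration.integral_diff[OF it(1) i1]) (simp add: it(2))
  qed
  have lin4: "(LBINT t. (a t - b t) / 4 + l * c t + k * d t) =
      ((LBINT t. a t) - (LBINT t. b t)) / 4 + l * (LBINT t. c t) + k * (LBINT t. d t)"
    if "integrable lborel a" "integrable lborel b" "integrable lborel c" "integrable lborel d"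
    for a b c d :: "real \<Rightarrow> real" and l k
    using that by simp
  have f_eq: "(\<lambda>t. creep_function \<sigma> L K i j t * deriv \<phi> t) = (\<lambda>t. (?I t * ?c ?p t * deriv \<phi> t - ?I t * ?c ?m t * deriv \<phi> t) / 4
      + L $ i $ j * (?I t * (t * deriv \<phi> t)) + K $ i $ j * (?I t * deriv \<phi> t))"
    by (auto simp: creep_function_eq polar_def fun_eq_iff field_simps)
  have "dist_deriv (dist_of (creep_function \<sigma> L K i j)) \<phi> =
     (- (LBINT t. ?I t * ?c ?p t * deriv \<phi> t) - - (LBINT t. ?I t * ?c ?m t * deriv \<phi> t)) / 4
     + L $ i $ j * (LBINT t. ?I t * \<phi> t) + K $ i $ j * \<phi> 0"
    unfolding dist_deriv_def dist_of_def f_eq lin4[OF int_c int_c it' i\<phi>(1)] tt i\<phi>(2)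
    by (simp add: field_simps)
  also have "\<dots> = ((LBINT t. ?I t * ?r ?p t * \<phi> t) - (LBINT t. ?I t * ?r ?m t * \<phi> t)) / 4
     + L $ i $ j * (LBINT t. ?I t * \<phi> t) + K $ i $ j * \<phi> 0"
    unfolding eq ..
  also have "((LBINT t. ?I t * ?r ?p t * \<phi> t) - (LBINT t. ?I t * ?r ?m t * \<phi> t)) / 4 =
     (LBINT t. ?I t * polar (\<lambda>v. LINT x|\<sigma> v. relaxation_kernel t x) i j * \<phi> t)"
  proof -
    have "(\<lambda>t. ?I t * polar (\<lambda>v. LINT x|\<sigma> v. relaxation_kernel t x) i j * \<phi> t) = (\<lambda>t. (?I t * ?r ?p t * \<phi> t - ?I t * ?r ?m t * \<phi> t) / 4)"
      by (auto simp: polar_def relax_def fun_eq_iff field_simps)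
    thus ?thesis using int_r by simp
  qed
  finally show "dist_deriv (dist_of (creep_function \<sigma> L K i j)) \<phi> = relaxation_distribution \<sigma> L K i j \<phi>"
    by (simp add: relaxation_distribution_def dist_of_def dirac0_def)
qed

end

text \<open>Both forms are parametrized by the same data, a finite family and two positive
  semidefinite matrices, and differentiation fixes the data.\<close>

lemma relaxation_form_iff_deriv:
  "relaxation_form r \<longleftrightarrow> (\<exists>h. impulse_response h \<and> (\<forall>i j. r i j =\<^sub>D dist_deriv (dist_of (h i j))))"
  for r :: "'m::finite \<Rightarrow> 'm \<Rightarrow> functional"
proof
  assume "relaxation_form r"
  then obtain \<sigma> A B where \<sigma>: "quadratic_family \<sigma>" and AB: "sym_psd A" "sym_psd B"
    and r: "\<forall>i j. r i j =\<^sub>D relaxation_distribution \<sigma> A B i j" unfolding relaxation_form_iff by blast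
  have "\<forall>i j. r i j =\<^sub>D dist_deriv (dist_of (creep_function \<sigma> A B i j))"
    using r creep_function_deriv[OF \<sigma>] dist_eq_sym dist_eq_trans by metis
  moreover have "impulse_response (creep_function \<sigma> A B)" unfolding impulse_response_iff using \<sigma> AB by blast
  ultimately show "\<exists>h. impulse_response h \<and> (\<forall>i j. r i j =\<^sub>D dist_deriv (dist_of (h i j)))" by blast
next
  assume "\<exists>h. impulse_response h \<and> (\<forall>i j. r i j =\<^sub>D dist_deriv (dist_of (h i j)))"
  then obtain h where h: "impulse_response h" and r: "\<forall>i j. r i j =\<^sub>D dist_deriv (dist_of (h i j))" by blast
  from h obtain \<sigma> L K where \<sigma>: "quadratic_family \<sigma>" and LK: "sym_psd L" "sym_psd K" and h: "h = creep_function \<sigma> L K"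
    unfolding impulse_response_iff by blast
  have "\<forall>i j. r i j =\<^sub>D relaxation_distribution \<sigma> L K i j"
    using r creep_function_deriv[OF \<sigma>] dist_eq_trans unfolding h by metis
  thus "relaxation_form r" unfolding relaxation_form_iff using \<sigma> LK by blast
qed

lemma impulse_response_moderate: "impulse_response f \<Longrightarrow> moderate (f i j)"
  unfolding impulse_response_iff using creep_function_moderate by blast

lemma impulse_response_continuous: "impulse_response f \<Longrightarrow> continuous_on {0..} (f i j)"
  unfolding impulse_response_iff using creep_function_continuous by blast

lemma moderate_null: "moderate f \<Longrightarrow> t < 0 \<Longrightarrow> f t = 0"
  by (simp add: moderate_def)

lemma moderate_causal: "moderate f \<Longrightarrow> causal_distribution (dist_of f)"
  by (rule causal_distribution_of[OF moderate_locally_bounded]) (auto simp: moderate_def)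

text \<open>Positive times come from the fundamental lemma, the value at 0 from continuity from the
  right, and negative times from causality.\<close>

lemma dist_of_eq_imp_eq:
  assumes f: "moderate f" "continuous_on {0..} f" and g: "moderate g" "continuous_on {0..} g"
    and eq: "dist_of f =\<^sub>D dist_of g"
  shows "f = g"
proof -
  have z: "f t - g t = 0" if t: "0 < t" for t
  proof (rule fundamental_lemma[OF _ _ t])
    show "(LBINT t. (f t - g t) * \<phi> t) = 0" if \<phi>: "test_function \<phi>" for \<phi>
      using dist_eqD[OF eq \<phi>] locally_bounded_test_integrable[OF moderate_locally_bounded[OF f(1)] \<phi>]
        locally_bounded_test_integrable[OF moderate_locally_bounded[OF g(1)] \<phi>]
      by (simp add: left_diff_distrib dist_of_def)
    show "continuous_on {0<..} (\<lambda>t. f t - g t)"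
      by (intro continuous_intros continuous_on_subset[OF f(2)] continuous_on_subset[OF g(2)]) auto
  qed
  have "continuous_on {0..} (\<lambda>t. f t - g t)" by (intro continuous_intros f g)
  hence "((\<lambda>t. f t - g t) \<longlongrightarrow> f 0 - g 0) (at 0 within {0..})" by (simp add: continuous_on_def)
  hence "((\<lambda>t. f t - g t) \<longlongrightarrow> f 0 - g 0) (at_right 0)"
    by (rule tendsto_within_subset) auto
  moreover have "((\<lambda>t. f t - g t) \<longlongrightarrow> 0) (at_right 0)"
    by (rule tendsto_eventually) (use z in \<open>auto simp: eventually_at_filter\<close>)
  ultimately have z0: "f 0 - g 0 = 0" using tendsto_unique trivial_limit_at_right_real by blast
  show ?thesis
  proof
    fix t show "f t = g t"
      using z[of t] z0 moderate_null[OF f(1), of t] moderate_null[OF g(1), of t]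
      by (cases t "0 :: real" rule: linorder_cases) auto
  qed
qed

section \<open>Moments of impulse responses\<close>

text \<open>Otherwise the form would become negative on moving from \<open>c\<close> a little in the
  direction \<open>- N *v c\<close>: the first-order term is \<open>- 2 * e\<close> times the
  squared norm of \<open>N *v c\<close>.\<close>

lemma sym_psd_kernel:
  fixes N :: "real^'m::finite^'m"
  assumes N: "sym_psd N" and c: "c \<bullet> (N *v c) = 0"
  shows "N *v c = 0"
proof (rule ccontr)
  assume nz: "N *v c \<noteq> 0"
  define d where "d = N *v c"
  have dd: "d \<bullet> d > 0" using nz by (simp add: d_def)
  have dual: "x \<bullet> (N *v y) = (N *v x) \<bullet> y" for x y
    using N unfolding sym_psd_def by (metis dot_lmul_matrix transpose_matrix_vector)
  define q where "q = d \<bullet> (N *v d)"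
  have q: "q \<ge> 0" using N by (simp add: q_def sym_psd_def)
  \<comment> \<open>Small enough that \<open>e * q \<le> d \<bullet> d\<close>. The summand 1 covers
    the case \<open>q = 0\<close>.\<close>
  define e where "e = (d \<bullet> d) / (q + 1)"
  have "0 \<le> (c - e *\<^sub>R d) \<bullet> (N *v (c - e *\<^sub>R d))" using N by (simp add: sym_psd_def)
  also have "\<dots> = c \<bullet> (N *v c) - e * (c \<bullet> (N *v d)) - e * (d \<bullet> (N *v c)) + e * e * q"
    by (simp add: q_def matrix_vector_mult_diff_distrib matrix_vector_mult_scaleR inner_diff_left inner_diff_right algebra_simps)
  also have "\<dots> = e * (e * q - 2 * (d \<bullet> d))"
    unfolding c using dual[of c d] by (simp add: d_def inner_commute algebra_simps)
  finally have "0 \<le> e * (e * q - 2 * (d \<bullet> d))" .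
  moreover have e: "e > 0" using dd q by (simp add: e_def)
  ultimately have "2 * (d \<bullet> d) \<le> e * q" by (simp add: zero_le_mult_iff)
  also have "e * q \<le> d \<bullet> d" using q dd by (simp add: e_def field_simps)
  finally show False using dd by simp
qed

lemma quadratic_sym_psd:
  assumes "quadratic F" "\<And>v. 0 \<le> F v"
  shows "sym_psd (\<chi> i j. polar F i j)"
  unfolding sym_psd_def
proof (intro conjI allI)
  show "transpose (\<chi> i j. polar F i j) = (\<chi> i j. polar F i j)"
    using polar_sym[OF assms(1)] by (simp add: transpose_def vec_eq_iff)
  show "0 \<le> x \<bullet> ((\<chi> i j. polar F i j) *v x)" for x
    using assms by (simp add: quadratic_polar_matrix[symmetric])
qed

lemma polar_diff: "polar F i j - polar G i j = polar (\<lambda>v. F v - G v) i j"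
  by (simp add: polar_def field_simps)

lemma polar_sum: "polar (\<lambda>v. \<Sum>k\<in>S. F k v) i j = (\<Sum>k\<in>S. polar (F k) i j)"
  by (simp add: polar_def sum_subtractf sum_divide_distrib[symmetric])

lemma inner_matrix: "x \<bullet> (N *v y) = (\<Sum>i\<in>UNIV. \<Sum>j\<in>UNIV. x $ i * y $ j * N $ i $ j)"
  for x y :: "real^'m::finite"
  by (simp add: inner_vec_def matrix_vector_mult_def sum_distrib_left ac_simps)

definition moment_matrix ::
    "(real^'m::finite \<Rightarrow> real measure) \<Rightarrow> real^'m^'m \<Rightarrow> real^'m^'m \<Rightarrow> nat \<Rightarrow> real^'m^'m" where
  "moment_matrix \<sigma> L K k =
    (\<chi> i j. polar (\<lambda>v. LINT x|\<sigma> v. (1 / (1 + x)) ^ k) i j) + (if k = 0 then K else 0) + L"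

section \<open>Hankel positivity and kernels of the moment matrices\<close>

context
  fixes \<sigma> :: "real^'m::finite \<Rightarrow> real measure"
  assumes \<sigma>: "quadratic_family \<sigma>"
begin

interpretation creep_measure "\<sigma> v" for v by (rule quadratic_family_creep_measure[OF \<sigma>])

lemma family_quadratic_integral:
  assumes "\<And>v. integrable (\<sigma> v) g"
  shows "quadratic (\<lambda>v. LINT x|\<sigma> v. g x)"
  by (rule quadratic_measures.quadratic_integral[OF quadratic_family_measures[OF \<sigma>] assms])

lemma family_space: "space (\<sigma> v) = UNIV"
  using sets_eq_imp_space_eq[OF sets_eq] by simp

text \<open>The matrix-valued integral is a limit of sums \<open>\<Sum>\<^sub>k y\<^sub>k \<bullet> \<sigma>(E\<^sub>k) y\<^sub>k\<close> over the
  partition of the half-line by the values of \<open>\<lfloor>n / (1 + x)\<rfloor>\<close>.\<close>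

lemma family_psd:
  fixes Y :: "'m \<Rightarrow> real \<Rightarrow> real" and g :: "real \<Rightarrow> real"
  assumes Y: "\<And>i. continuous_on UNIV (Y i)" and g: "continuous_on UNIV g" "\<And>u. u \<in> {0..1} \<Longrightarrow> 0 \<le> g u"
  shows "0 \<le> (\<Sum>i\<in>UNIV. \<Sum>j\<in>UNIV. polar (\<lambda>v. LINT x|\<sigma> v. Y i (1 / (1 + x)) * Y j (1 / (1 + x)) * g (1 / (1 + x))) i j)"
proof -
  \<comment> \<open>Off the positive axis, where the family has no mass, the value 0 keeps
    \<open>u\<close> inside the unit interval at every point.\<close>
  define u where "u x = (if x \<le> 0 then 0 else 1 / (1 + x))" for x :: real
  define s where "s n x = real_of_int \<lfloor>real (Suc n) * u x\<rfloor> / real (Suc n)" for n x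
  define F where "F i j t = Y i t * Y j t * g t" for i j t
  have u01: "u x \<in> {0..1}" for x by (auto simp: u_def)
  have [measurable]: "u \<in> borel_measurable borel" unfolding u_def by measurable
  have [measurable]: "s n \<in> borel_measurable borel" for n unfolding s_def by measurable
  have Fc: "continuous_on A (F i j)" for A i j
    unfolding F_def by (intro continuous_intros continuous_on_subset[OF Y] continuous_on_subset[OF g(1)]) auto
  have [measurable]: "F i j \<in> borel_measurable borel" for i j
    by (rule borel_measurable_continuous_onI[OF Fc])
  have fl: "nat \<lfloor>real (Suc n) * u x\<rfloor> \<le> Suc n" "0 \<le> \<lfloor>real (Suc n) * u x\<rfloor>" for n x
  proof -
    have "real (Suc n) * u x \<le> real (Suc n) * 1" by (rule mult_left_mono) (use u01[of x] in auto)
    hence "\<lfloor>real (Suc n) * u x\<rfloor> \<le> \<lfloor>real (Suc n) * 1\<rfloor>" by (rule floor_mono)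
    hence "\<lfloor>real (Suc n) * u x\<rfloor> \<le> int (Suc n)" by simp
    thus "nat \<lfloor>real (Suc n) * u x\<rfloor> \<le> Suc n" by simp
    show "0 \<le> \<lfloor>real (Suc n) * u x\<rfloor>" using u01[of x] by simp
  qed
  have s01: "s n x \<in> {0..1}" for n x
  proof -
    have "real_of_int \<lfloor>real (Suc n) * u x\<rfloor> \<le> real (Suc n) * u x" by (rule of_int_floor_le)
    also have "\<dots> \<le> real (Suc n) * 1" by (rule mult_left_mono) (use u01[of x] in auto)
    finally show ?thesis using fl(2)[of n x] unfolding s_def atLeastAtMost_iff
      by (intro conjI divide_nonneg_nonneg) (auto simp: divide_simps)
  qed
  have lim_s: "(\<lambda>n. s n x) \<longlonglongrightarrow> u x" for x
  proof (rule tendsto_sandwich)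
    show "\<forall>\<^sub>F n in sequentially. u x - 1 / real (Suc n) \<le> s n x"
    proof (intro always_eventually allI)
      fix n
      have "(real (Suc n) * u x - 1) / real (Suc n) \<le> s n x"
        unfolding s_def by (rule divide_right_mono) linarith+
      thus "u x - 1 / real (Suc n) \<le> s n x" by (simp add: diff_divide_distrib del: of_nat_Suc)
    qed
    show "\<forall>\<^sub>F n in sequentially. s n x \<le> u x"
      unfolding s_def by (intro always_eventually allI) (simp add: field_simps del: of_nat_Suc)
    show "(\<lambda>n. u x - 1 / real (Suc n)) \<longlonglongrightarrow> u x"
      using tendsto_diff[OF tendsto_const LIMSEQ_Suc[OF lim_inverse_n'], of "u x"] by simp
  qed simp
  define T where "T n = (\<Sum>i\<in>UNIV. \<Sum>j\<in>UNIV. polar (\<lambda>v. LINT x|\<sigma> v. F i j (s n x)) i j)" for n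
  have T_nonneg: "0 \<le> T n" for n
  proof -
    define E where "E k = {x. nat \<lfloor>real (Suc n) * u x\<rfloor> = k}" for k
    have [measurable]: "E k \<in> sets borel" for k unfolding E_def by measurable
    define p where "p k = real k / real (Suc n)" for k
    have "(LINT x|\<sigma> v. F i j (s n x)) = (\<Sum>k\<le>Suc n. F i j (p k) * measure (\<sigma> v) (E k))" for i j v
    proof -
      have "F i j (s n x) = (\<Sum>k\<le>Suc n. F i j (p k) * indicator (E k) x)" for x
      proof -
        have "s n x = p (nat \<lfloor>real (Suc n) * u x\<rfloor>)" using fl(2)[of n x] by (simp add: s_def p_def)
        moreover have "(\<Sum>k\<le>Suc n. F i j (p k) * indicator (E k) x) = (\<Sum>k\<le>Suc n. if nat \<lfloor>real (Suc n) * u x\<rfloor> = k then F i j (p k) else 0)"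
          by (intro sum.cong refl) (simp add: E_def)
        ultimately show ?thesis using fl(1)[of n x] by simp
      qed
      hence "(LINT x|\<sigma> v. F i j (s n x)) = (LINT x|\<sigma> v. (\<Sum>k\<le>Suc n. F i j (p k) * indicator (E k) x))" by simp
      also have "\<dots> = (\<Sum>k\<le>Suc n. LINT x|\<sigma> v. F i j (p k) * indicator (E k) x)"
        by (rule Bochner_Integration.integral_sum)
           (auto intro!: integrable_mult_right integrable_real_indicator simp: sets_eq less_top[symmetric])
      also have "\<dots> = (\<Sum>k\<le>Suc n. F i j (p k) * measure (\<sigma> v) (E k))"
        by (simp add: family_space)
      finally show ?thesis .
    qed
    hence "T n = (\<Sum>i\<in>UNIV. \<Sum>j\<in>UNIV. \<Sum>k\<le>Suc n. F i j (p k) * polar (\<lambda>v. measure (\<sigma> v) (E k)) i j)"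
      by (simp only: T_def polar_sum polar_cmult)
    also have "\<dots> = (\<Sum>k\<le>Suc n. \<Sum>i\<in>UNIV. \<Sum>j\<in>UNIV. F i j (p k) * polar (\<lambda>v. measure (\<sigma> v) (E k)) i j)"
      by (subst sum.swap[of _ _ "{..Suc n}"]) (simp only: sum.swap[of _ "{..Suc n}"])
    also have "\<dots> = (\<Sum>k\<le>Suc n. g (p k) * measure (\<sigma> (\<chi> i. Y i (p k))) (E k))"
    proof (intro sum.cong refl)
      fix k
      have q: "quadratic (\<lambda>v. measure (\<sigma> v) (E k))" using \<sigma> by (simp add: quadratic_family_def)
      have "measure (\<sigma> (\<chi> i. Y i (p k))) (E k) = (\<Sum>i\<in>UNIV. \<Sum>j\<in>UNIV. Y i (p k) * Y j (p k) * polar (\<lambda>v. measure (\<sigma> v) (E k)) i j)"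
        using spec[OF q[unfolded quadratic_def], of "\<chi> i. Y i (p k)"] by (simp only: vec_lambda_beta)
      thus "(\<Sum>i\<in>UNIV. \<Sum>j\<in>UNIV. F i j (p k) * polar (\<lambda>v. measure (\<sigma> v) (E k)) i j) = g (p k) * measure (\<sigma> (\<chi> i. Y i (p k))) (E k)"
        by (simp add: F_def sum_distrib_left ac_simps)
    qed
    also have "\<dots> \<ge> 0"
    proof (intro sum_nonneg mult_nonneg_nonneg g(2))
      fix k assume "k \<in> {..Suc n}"
      thus "p k \<in> {0..1}" by (auto simp: p_def divide_simps)
    qed simp
    finally show ?thesis .
  qed
  have "(\<lambda>n. LINT x|\<sigma> v. F i j (s n x)) \<longlonglongrightarrow> (LINT x|\<sigma> v. F i j (u x))" for i j v
  proof -
    have "compact (F i j ` {0..1})" by (intro compact_continuous_image Fc) auto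
    then obtain B where B: "\<forall>x\<in>{0..1}. norm (F i j x) \<le> B" by (auto dest!: compact_imp_bounded simp: bounded_iff)
    show ?thesis
    proof (rule integral_dominated_convergence[where w = "\<lambda>_. B"])
      have "isCont (F i j) t" for t using Fc[of UNIV i j] by (simp add: continuous_on_eq_continuous_at)
      thus "AE x in \<sigma> v. (\<lambda>n. F i j (s n x)) \<longlonglongrightarrow> F i j (u x)" by (intro AE_I2 isCont_tendsto_compose[OF _ lim_s])
      show "AE x in \<sigma> v. norm (F i j (s n x)) \<le> B" for n using B s01[of n] by (intro AE_I2) blast
    qed auto
  qed
  hence "T \<longlonglongrightarrow> (\<Sum>i\<in>UNIV. \<Sum>j\<in>UNIV. polar (\<lambda>v. LINT x|\<sigma> v. F i j (u x)) i j)"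
    unfolding T_def polar_def by (intro tendsto_sum tendsto_divide tendsto_diff tendsto_const) auto
  hence "0 \<le> (\<Sum>i\<in>UNIV. \<Sum>j\<in>UNIV. polar (\<lambda>v. LINT x|\<sigma> v. F i j (u x)) i j)"
    by (rule LIMSEQ_le_const) (use T_nonneg in auto)
  also have "(\<lambda>i j v. LINT x|\<sigma> v. F i j (u x)) = (\<lambda>i j v. LINT x|\<sigma> v. F i j (1 / (1 + x)))"
    by (intro ext family_integral_cong[OF \<sigma>]) (auto simp: u_def)
  finally show ?thesis by (simp add: F_def)
qed

context
  fixes L K :: "real^'m^'m"
  assumes L: "sym_psd L" and K: "sym_psd K"
begin

lemma moment_matrix_sym: "transpose (moment_matrix \<sigma> L K k) = moment_matrix \<sigma> L K k"
proof -
  have "transpose (\<chi> i j. polar (\<lambda>v. LINT x|\<sigma> v. (1 / (1 + x)) ^ k) i j) = (\<chi> i j. polar (\<lambda>v. LINT x|\<sigma> v. (1 / (1 + x)) ^ k) i j)"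
    using polar_sym[OF family_quadratic_integral[OF power_integrable]] by (simp add: transpose_def vec_eq_iff)
  moreover have "transpose (0 :: real^'m^'m) = 0" by (simp add: transpose_def vec_eq_iff)
  ultimately show ?thesis using L K by (simp add: moment_matrix_def transpose_add sym_psd_def)
qed

text \<open>With the vector polynomial \<open>Y\<close> of coefficients \<open>c a\<close>, the
  Hankel form is the integral of its quadratic form times \<open>g\<close>. The choices
  \<open>g u = u\<close> and \<open>g u = 1 - u\<close> give the two Hankel conditions.\<close>

lemma moment_hankel_sum:
  fixes c :: "nat \<Rightarrow> real^'m"
  assumes g: "continuous_on UNIV g" "\<And>u. u \<in> {0..1} \<Longrightarrow> 0 \<le> g u"
    and N: "\<And>a b. a \<le> n \<Longrightarrow> b \<le> n \<Longrightarrow> N (a + b) = (\<chi> i j. polar (\<lambda>v. LINT x|\<sigma> v. (1 / (1 + x)) ^ (a + b) * g (1 / (1 + x))) i j)"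
  shows "0 \<le> (\<Sum>a\<le>n. \<Sum>b\<le>n. c a \<bullet> (N (a + b) *v c b))"
proof -
  define Y where "Y i t = (\<Sum>a\<le>n. c a $ i * t ^ a)" for i and t :: real
  have Yc: "continuous_on UNIV (Y i)" for i unfolding Y_def by (intro continuous_intros)
  define I where "I k v = (LINT x|\<sigma> v. (1 / (1 + x)) ^ k * g (1 / (1 + x)))" for k v
  have int: "integrable (\<sigma> v) (\<lambda>x. (1 / (1 + x)) ^ k * g (1 / (1 + x)))" for k v
  proof -
    have "compact (g ` {0..1})" by (intro compact_continuous_image continuous_on_subset[OF g(1)]) auto
    then obtain B where B: "\<forall>x\<in>{0..1}. norm (g x) \<le> B" by (auto dest!: compact_imp_bounded simp: bounded_iff)
    have [measurable]: "g \<in> borel_measurable borel" by (rule borel_measurable_continuous_onI[OF g(1)])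
    show ?thesis
    proof (rule integrable_const_bound[where B = "1 * B"])
      show "AE x in \<sigma> v. norm ((1 / (1 + x)) ^ k * g (1 / (1 + x))) \<le> 1 * B"
        using pos
      proof eventually_elim
        case (elim x)
        hence "1 / (1 + x) \<in> {0..1}" by auto
        thus ?case unfolding norm_mult norm_power using B by (intro mult_mono power_le_one) auto
      qed
    qed measurable
  qed
  have "(LINT x|\<sigma> v. Y i (1 / (1 + x)) * Y j (1 / (1 + x)) * g (1 / (1 + x))) = (\<Sum>a\<le>n. \<Sum>b\<le>n. (c a $ i * c b $ j) * I (a + b) v)" for i j v
  proof -
    have "Y i t * Y j t * g t = (\<Sum>a\<le>n. \<Sum>b\<le>n. (c a $ i * c b $ j) * (t ^ (a + b) * g t))" for t
    proof -
      have "Y i t * Y j t * g t = (\<Sum>a\<le>n. \<Sum>b\<le>n. c a $ i * t ^ a * (c b $ j * t ^ b) * g t)"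
        by (simp only: Y_def sum_product) (simp only: sum_distrib_right)
      also have "\<dots> = (\<Sum>a\<le>n. \<Sum>b\<le>n. (c a $ i * c b $ j) * (t ^ (a + b) * g t))"
        by (intro sum.cong refl) (simp add: power_add ac_simps)
      finally show ?thesis .
    qed
    hence "(LINT x|\<sigma> v. Y i (1 / (1 + x)) * Y j (1 / (1 + x)) * g (1 / (1 + x))) =
       (LINT x|\<sigma> v. (\<Sum>a\<le>n. \<Sum>b\<le>n. (c a $ i * c b $ j) * ((1 / (1 + x)) ^ (a + b) * g (1 / (1 + x)))))" by simp
    also have "\<dots> = (\<Sum>a\<le>n. \<Sum>b\<le>n. (c a $ i * c b $ j) * I (a + b) v)"
      unfolding I_def using int by (subst Bochner_Integration.integral_sum, force)+ simp
    finally show ?thesis .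
  qed
  hence "0 \<le> (\<Sum>i\<in>UNIV. \<Sum>j\<in>UNIV. polar (\<lambda>v. \<Sum>a\<le>n. \<Sum>b\<le>n. (c a $ i * c b $ j) * I (a + b) v) i j)"
    using family_psd[OF Yc g] by simp
  also have "\<dots> = (\<Sum>i\<in>UNIV. \<Sum>j\<in>UNIV. \<Sum>a\<le>n. \<Sum>b\<le>n. (c a $ i * c b $ j) * polar (I (a + b)) i j)"
    by (simp only: polar_sum polar_cmult)
  also have "\<dots> = (\<Sum>i\<in>UNIV. \<Sum>a\<le>n. \<Sum>b\<le>n. \<Sum>j\<in>UNIV. (c a $ i * c b $ j) * polar (I (a + b)) i j)"
    by (subst sum.swap) (simp only: sum.swap[of _ "{..n}" UNIV])
  also have "\<dots> = (\<Sum>a\<le>n. \<Sum>b\<le>n. \<Sum>i\<in>UNIV. \<Sum>j\<in>UNIV. (c a $ i * c b $ j) * polar (I (a + b)) i j)"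
    by (simp only: sum.swap[of _ "{..n}" UNIV])
  also have "\<dots> = (\<Sum>a\<le>n. \<Sum>b\<le>n. c a \<bullet> (N (a + b) *v c b))"
    by (intro sum.cong refl) (simp add: N inner_matrix I_def[abs_def])
  finally show ?thesis .
qed

lemma sum_sym_psd_nonneg:
  fixes c :: "nat \<Rightarrow> real^'m"
  assumes "sym_psd N"
  shows "0 \<le> (\<Sum>a\<le>n. \<Sum>b\<le>n. c a \<bullet> (N *v c b))"
proof -
  have "(\<Sum>a\<le>n. \<Sum>b\<le>n. c a \<bullet> (N *v c b)) = sum c {..n} \<bullet> (N *v sum c {..n})"
    by (simp only: linear_sum[OF matrix_vector_mul_linear] inner_sum_left inner_sum_right) (rule sum.swap)
  thus ?thesis using assms by (simp add: sym_psd_def)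
qed

lemma moment_hankel1: "hankel_psd (\<lambda>n. moment_matrix \<sigma> L K (Suc n))"
  unfolding hankel_psd_def
proof (intro allI)
  fix n and c :: "nat \<Rightarrow> real^'m"
  define N where "N k = (\<chi> i j. polar (\<lambda>v. LINT x|\<sigma> v. (1 / (1 + x)) ^ Suc k) i j)" for k
  have "0 \<le> (\<Sum>a\<le>n. \<Sum>b\<le>n. c a \<bullet> (N (a + b) *v c b))"
    by (rule moment_hankel_sum[of "\<lambda>u. u"]) (auto simp: N_def mult.commute)
  moreover have "moment_matrix \<sigma> L K (Suc k) = N k + L" for k by (simp add: moment_matrix_def N_def)
  ultimately show "0 \<le> (\<Sum>a\<le>n. \<Sum>b\<le>n. c a \<bullet> (moment_matrix \<sigma> L K (Suc (a + b)) *v c b))"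
    using sum_sym_psd_nonneg[OF L, of c n]
    by (simp add: matrix_vector_mult_add_rdistrib inner_add_right sum.distrib)
qed

text \<open>\<open>L\<close> is the same in all moments and cancels. \<open>K\<close> occurs in the
  zeroth moment alone, so it contributes only for \<open>a = b = 0\<close>, the form of
  \<open>K\<close> at \<open>c 0\<close>.\<close>

lemma moment_hankel2: "hankel_psd (\<lambda>n. moment_matrix \<sigma> L K n - moment_matrix \<sigma> L K (Suc n))"
  unfolding hankel_psd_def
proof (intro allI)
  fix n and c :: "nat \<Rightarrow> real^'m"
  define N where "N k = (\<chi> i j. polar (\<lambda>v. LINT x|\<sigma> v. (1 / (1 + x)) ^ k * (1 - 1 / (1 + x))) i j)" for k
  have "0 \<le> (\<Sum>a\<le>n. \<Sum>b\<le>n. c a \<bullet> (N (a + b) *v c b))"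
    by (rule moment_hankel_sum[of "\<lambda>u. 1 - u"]) (auto simp: N_def intro!: continuous_intros)
  moreover have "moment_matrix \<sigma> L K k - moment_matrix \<sigma> L K (Suc k) = N k + (if k = 0 then K else 0)" for k
  proof -
    have "(LINT x|\<sigma> v. (1 / (1 + x)) ^ k) - (LINT x|\<sigma> v. (1 / (1 + x)) ^ Suc k) = (LINT x|\<sigma> v. (1 / (1 + x)) ^ k * (1 - 1 / (1 + x)))" for v
      by (subst Bochner_Integration.integral_diff[symmetric, OF power_integrable power_integrable])
         (simp only: right_diff_distrib power_Suc2 mult_1_right)
    hence "polar (\<lambda>v. LINT x|\<sigma> v. (1 / (1 + x)) ^ k) i j - polar (\<lambda>v. LINT x|\<sigma> v. (1 / (1 + x)) ^ Suc k) i j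
      = N k $ i $ j" for i j
      unfolding N_def polar_diff by (simp del: power_Suc)
    thus ?thesis by (simp add: moment_matrix_def vec_eq_iff)
  qed
  moreover have "(\<Sum>a\<le>n. \<Sum>b\<le>n. c a \<bullet> ((if a + b = 0 then K else 0) *v c b)) = c 0 \<bullet> (K *v c 0)"
  proof -
    have "(\<Sum>a\<le>n. \<Sum>b\<le>n. c a \<bullet> ((if a + b = 0 then K else 0) *v c b)) =
      (\<Sum>a\<le>n. \<Sum>b\<le>n. if b = 0 then (if a = 0 then c a \<bullet> (K *v c b) else 0) else 0)"
      by (intro sum.cong refl) auto
    thus ?thesis by simp
  qed
  moreover have "0 \<le> c 0 \<bullet> (K *v c 0)" using K by (simp add: sym_psd_def)
  ultimately show "0 \<le> (\<Sum>a\<le>n. \<Sum>b\<le>n. c a \<bullet> ((moment_matrix \<sigma> L K (a + b) - moment_matrix \<sigma> L K (Suc (a + b))) *v c b))"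
    by (simp only: matrix_vector_mult_add_rdistrib inner_add_right sum.distrib)
qed

text \<open>The form of the zeroth moment at \<open>c\<close> is the total mass of
  \<open>\<sigma> c\<close> plus the forms of \<open>K\<close> and \<open>L\<close>, all
  nonnegative, so each is 0. The creep form at \<open>c\<close> is bounded by that mass, and a
  positive semidefinite matrix annihilates every vector on which its form vanishes.\<close>

lemma moment_matrix_0_kernel:
  assumes c: "moment_matrix \<sigma> L K 0 *v c = 0"
  shows "(\<Sum>j\<in>UNIV. creep_function \<sigma> L K i j t * c $ j) = 0"
proof (cases "t < 0")
  case False
  hence t: "0 \<le> t" by simp
  let ?N = "\<lambda>k. \<chi> i j. polar (\<lambda>v. LINT x|\<sigma> v. (1 / (1 + x)) ^ k) i j"
  have q: "v \<bullet> (?N k *v v) = (LINT x|\<sigma> v. (1 / (1 + x)) ^ k)" for v k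
    by (rule quadratic_polar_matrix[OF family_quadratic_integral[OF power_integrable], symmetric])
  have "c \<bullet> (?N 0 *v c) + c \<bullet> (K *v c) + c \<bullet> (L *v c) = c \<bullet> (moment_matrix \<sigma> L K 0 *v c)"
    by (simp add: moment_matrix_def matrix_vector_mult_add_rdistrib inner_add_right)
  hence "measure (\<sigma> c) (space (\<sigma> c)) + c \<bullet> (K *v c) + c \<bullet> (L *v c) = 0" unfolding q c by simp
  moreover have "0 \<le> c \<bullet> (K *v c)" "0 \<le> c \<bullet> (L *v c)" using K L by (simp_all add: sym_psd_def)
  ultimately have z: "measure (\<sigma> c) (space (\<sigma> c)) = 0" "c \<bullet> (K *v c) = 0" "c \<bullet> (L *v c) = 0"
    using measure_nonneg[of "\<sigma> c" "space (\<sigma> c)"] by linarith+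
  have Kc: "K *v c = 0" and Lc: "L *v c = 0" using sym_psd_kernel K L z by auto
  let ?C = "\<chi> i j. polar (\<lambda>v. LINT x|\<sigma> v. creep_kernel t x) i j"
  have quad: "quadratic (\<lambda>v. LINT x|\<sigma> v. creep_kernel t x)"
    by (rule family_quadratic_integral[OF creep_kernel_integrable[OF t]])
  have "sym_psd ?C" by (rule quadratic_sym_psd[OF quad]) (use creep_nonneg[OF t] in \<open>simp add: creep_def\<close>)
  moreover have "c \<bullet> (?C *v c) = 0"
    unfolding quadratic_polar_matrix[OF quad, symmetric]
    using creep_nonneg[OF t, of c] creep_le[OF t, of c] z(1) by (simp add: creep_def)
  ultimately have Cc: "?C *v c = 0" by (rule sym_psd_kernel)
  have "(\<Sum>j\<in>UNIV. creep_function \<sigma> L K i j t * c $ j) = (?C *v c) $ i + t * (L *v c) $ i + (K *v c) $ i"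
    using t by (simp add: creep_function_def matrix_vector_mult_def sum.distrib[symmetric] sum_distrib_left algebra_simps)
  thus ?thesis by (simp add: Cc Lc Kc)
qed (simp add: creep_function_def)

text \<open>The term \<open>t * L\<close> yields \<open>(n + 1)!\<close>, that is \<open>n!\<close>
  times one copy of \<open>L\<close> for each \<open>k \<le> n\<close>. The constant
  \<open>K\<close> yields a single copy, carried by \<open>k = 0\<close>.\<close>

lemma creep_function_moment:
  "(LBINT t. indicator {0..} t * (t ^ n * exp (- t)) * creep_function \<sigma> L K i j t) =
    fact n * (\<Sum>k\<le>n. moment_matrix \<sigma> L K k $ i $ j)"
proof -
  let ?I = "indicator {0..} :: real \<Rightarrow> real"
  let ?c = "\<lambda>v t. creep_measure.creep (\<sigma> v) t"
  let ?p = "axis i 1 + axis j 1 :: real^'m" and ?m = "axis i 1 - axis j 1 :: real^'m"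
  have int_c: "integrable lborel (\<lambda>t. ?I t * (t ^ n * exp (- t)) * ?c v t)" for v
  proof (rule Bochner_Integration.integrable_bound)
    define m where "m = measure (\<sigma> v) (space (\<sigma> v))"
    show "integrable lborel (\<lambda>t. m * (?I t * (t ^ n * exp (- 1 * t)) + ?I t * (t ^ Suc n * exp (- 1 * t))))"
      by (intro integrable_mult_right Bochner_Integration.integrable_add power_exp_integral) auto
    have "norm (?I t * (t ^ n * exp (- t)) * ?c v t) \<le> norm (m * (?I t * (t ^ n * exp (- 1 * t)) + ?I t * (t ^ Suc n * exp (- 1 * t))))" for t
    proof (cases "0 \<le> t")
      case True
      have "(t ^ n * exp (- t)) * ?c v t \<le> (t ^ n * exp (- t)) * ((1 + t) * m)"
        using creep_le[OF True, of v] True by (intro mult_left_mono) (auto simp: m_def)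
      also have "\<dots> = m * (t ^ n * exp (- 1 * t) + t ^ Suc n * exp (- 1 * t))" by (simp add: algebra_simps)
      finally show ?thesis using True creep_nonneg[OF True, of v] by (simp add: abs_of_nonneg order_trans[OF _ abs_ge_self])
    qed simp
    thus "AE t in lborel. norm (?I t * (t ^ n * exp (- t)) * ?c v t) \<le> norm (m * (?I t * (t ^ n * exp (- 1 * t)) + ?I t * (t ^ Suc n * exp (- 1 * t))))"
      by simp
  qed measurable
  have i1: "integrable lborel (\<lambda>t. ?I t * (t ^ k * exp (- t)))" "(LBINT t. ?I t * (t ^ k * exp (- t))) = fact k" for k
    using power_exp_integral[of 1 k] by simp_all
  have f_eq: "(\<lambda>t. ?I t * (t ^ n * exp (- t)) * creep_function \<sigma> L K i j t) =
      (\<lambda>t. (?I t * (t ^ n * exp (- t)) * ?c ?p t - ?I t * (t ^ n * exp (- t)) * ?c ?m t) / 4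
        + L $ i $ j * (?I t * (t ^ Suc n * exp (- t))) + K $ i $ j * (?I t * (t ^ n * exp (- t))))"
    by (auto simp: creep_function_eq[OF \<sigma>] polar_def fun_eq_iff field_simps indicator_def)
  have lin4: "(LBINT t. (a t - b t) / 4 + l * c t + k * d t) =
      ((LBINT t. a t) - (LBINT t. b t)) / 4 + l * (LBINT t. c t) + k * (LBINT t. d t)"
    if "integrable lborel a" "integrable lborel b" "integrable lborel c" "integrable lborel d"
    for a b c d :: "real \<Rightarrow> real" and l k
    using that by simp
  have "(LBINT t. ?I t * (t ^ n * exp (- t)) * creep_function \<sigma> L K i j t) =
     (fact n * (\<Sum>k\<le>n. LINT x|\<sigma> ?p. (1 / (1 + x)) ^ k) - fact n * (\<Sum>k\<le>n. LINT x|\<sigma> ?m. (1 / (1 + x)) ^ k)) / 4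
       + L $ i $ j * fact (Suc n) + K $ i $ j * fact n"
    unfolding f_eq lin4[OF int_c int_c i1(1) i1(1)] creep_moment i1(2) ..
  also have "\<dots> = fact n * ((\<Sum>k\<le>n. polar (\<lambda>v. LINT x|\<sigma> v. (1 / (1 + x)) ^ k) i j) + K $ i $ j + real (Suc n) * L $ i $ j)"
    unfolding polar_sum[of "\<lambda>k v. LINT x|\<sigma> v. (1 / (1 + x)) ^ k", symmetric] by (simp add: polar_def field_simps)
  also have "(\<Sum>k\<le>n. polar (\<lambda>v. LINT x|\<sigma> v. (1 / (1 + x)) ^ k) i j) + K $ i $ j + real (Suc n) * L $ i $ j =
     (\<Sum>k\<le>n. moment_matrix \<sigma> L K k $ i $ j)"
  proof -
    have "(\<Sum>k\<le>n. moment_matrix \<sigma> L K k $ i $ j) = (\<Sum>k\<le>n. polar (\<lambda>v. LINT x|\<sigma> v. (1 / (1 + x)) ^ k) i j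
      + (if k = 0 then K $ i $ j else 0) + L $ i $ j)"
      by (intro sum.cong refl) (simp add: moment_matrix_def)
    thus ?thesis by (simp add: sum.distrib)
  qed
  finally show ?thesis .
qed

end
end

text \<open>The moment problem is solved for each vector separately, with measures chosen
  independently of one another. Uniqueness forces them to depend quadratically on the vector. The
  atoms at 1 and 0 are split off as \<open>L\<close> and \<open>K\<close>, and the rest is
  transported from the open unit interval to the half-line.\<close>

lemma family_of_moments:
  fixes N :: "nat \<Rightarrow> real^'m::finite^'m"
  assumes sym: "\<And>n. transpose (N n) = N n"
    and H1: "hankel_psd (\<lambda>n. N (Suc n))" and H2: "hankel_psd (\<lambda>n. N n - N (Suc n))"
  shows "\<exists>\<sigma> L K. quadratic_family \<sigma> \<and> sym_psd L \<and> sym_psd K \<and> (\<forall>n. moment_matrix \<sigma> L K n = N n)"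
proof -
  have "\<exists>\<tau>. finite_measure \<tau> \<and> sets \<tau> = sets borel \<and> emeasure \<tau> (- {0..1}) = 0 \<and> (\<forall>n. (LINT x|\<tau>. x ^ n) = v \<bullet> (N n *v v))" for v
  proof -
    have "hausdorff_moments (\<lambda>n. v \<bullet> (N n *v v))"
    proof
      fix n and c :: "nat \<Rightarrow> real"
      show "0 \<le> (\<Sum>a\<le>n. \<Sum>b\<le>n. c a * c b * (v \<bullet> (N (Suc (a + b)) *v v)))"
        using H1[unfolded hankel_psd_def, rule_format, of "\<lambda>a. c a *\<^sub>R v" n]
        by (simp add: matrix_vector_mult_scaleR ac_simps)
      show "0 \<le> (\<Sum>a\<le>n. \<Sum>b\<le>n. c a * c b * (v \<bullet> (N (a + b) *v v) - v \<bullet> (N (Suc (a + b)) *v v)))"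
        using H2[unfolded hankel_psd_def, rule_format, of "\<lambda>a. c a *\<^sub>R v" n]
        by (simp add: matrix_vector_mult_scaleR ac_simps matrix_vector_mult_diff_rdistrib inner_diff_right right_diff_distrib)
    qed
    show ?thesis by (rule hausdorff_moments.moment_measure[OF \<open>hausdorff_moments _\<close>]) blast
  qed
  then obtain \<tau> where \<tau>: "\<And>v. finite_measure (\<tau> v)" "\<And>v. sets (\<tau> v) = sets borel"
    "\<And>v. emeasure (\<tau> v) (- {0..1}) = 0" "\<And>v n. (LINT x|\<tau> v. x ^ n) = v \<bullet> (N n *v v)" by metis
  note [measurable_cong] = \<tau>(2)
  have AE01: "AE x in \<tau> v. x \<in> {0..1}" for v
    by (rule AE_I[of _ _ "- {0..1}"]) (use \<tau>(2,3) in auto)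
  have quad: "quadratic (\<lambda>v. measure (\<tau> v) E)" if E: "E \<in> sets borel" for E
    unfolding quadratic_iff
  proof
    fix v
    show "(\<Sum>k\<in>UNIV. quadratic_coeff v k * measure (\<tau> (quadratic_vec v k)) E) = 0"
    proof (rule measure_eq_0_of_moments[OF _ \<tau>(1,2) AE01 _ E])
      show "(\<Sum>k\<in>UNIV. quadratic_coeff v k * (LINT x|\<tau> (quadratic_vec v k). x ^ n)) = 0" for n
        using quadratic_matrix[OF sym[of n]] unfolding \<tau>(4) quadratic_iff by blast
    qed simp
  qed
  \<comment> \<open>The inverse of \<open>x \<mapsto> 1 / (1 + x)\<close> on the open unit interval.
    The value 1 elsewhere keeps \<open>T\<close> positive, and the density removes those
    points.\<close>
  define T where "T u = (if 0 < u \<and> u < 1 then (1 - u) / u else 1)" for u :: real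
  have [measurable]: "T \<in> borel_measurable borel" unfolding T_def by measurable
  have Tpos: "0 < T u" for u by (simp add: T_def)
  define \<sigma> where "\<sigma> v = distr (density (\<tau> v) (indicator {0<..<1})) borel T" for v
  have sp: "space (\<tau> v) = UNIV" for v using sets_eq_imp_space_eq[OF \<tau>(2)] by simp
  have em: "emeasure (\<sigma> v) E = emeasure (\<tau> v) (T -` E \<inter> {0<..<1})" if [measurable]: "E \<in> sets borel" for v E
  proof -
    have [measurable]: "T -` E \<in> sets borel" using measurable_sets[of T borel borel E] by simp
    show ?thesis unfolding \<sigma>_def by (simp add: emeasure_distr emeasure_density sp indicator_inter_arith[symmetric] mult.commute)
  qed
  have fam: "quadratic_family \<sigma>"
    unfolding quadratic_family_def half_line_measure_def
  proof (intro conjI allI ballI)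
    fix v
    show "sets (\<sigma> v) = sets borel" by (simp add: \<sigma>_def)
    have "T u \<notin> - {0<..}" for u using Tpos[of u] by simp
    hence "T -` (- {0<..}) = {}" by blast
    thus "emeasure (\<sigma> v) (- {0<..}) = 0" by (subst em) auto
    show "finite_measure (\<sigma> v)"
      by (rule finite_measureI) (use em[of UNIV v] finite_measure.emeasure_finite[OF \<tau>(1)] in \<open>simp add: \<sigma>_def\<close>)
  next
    fix E :: "real set" assume E: "E \<in> sets borel"
    have "T -` E \<inter> {0<..<1} \<in> sets borel" using measurable_sets[of T borel borel E] E by auto
    from quad[OF this] show "quadratic (\<lambda>v. measure (\<sigma> v) E)" by (simp add: measure_def em[OF E])
  qed
  define L where "L = (\<chi> i j. polar (\<lambda>v. measure (\<tau> v) {1}) i j)"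
  define K where "K = (\<chi> i j. polar (\<lambda>v. measure (\<tau> v) {0}) i j)"
  have LK: "sym_psd L" "sym_psd K" unfolding L_def K_def by (rule quadratic_sym_psd[OF quad]; simp)+
  have "moment_matrix \<sigma> L K n = N n" for n
  proof -
    have split: "(LINT x|\<sigma> v. (1 / (1 + x)) ^ n) + (if n = 0 then measure (\<tau> v) {0} else 0) + measure (\<tau> v) {1} = v \<bullet> (N n *v v)" for v
    proof -
      interpret finite_measure "\<tau> v" by (rule \<tau>(1))
      let ?i = "\<lambda>A x. indicator A x :: real"
      have "(LINT x|\<sigma> v. (1 / (1 + x)) ^ n) = (LINT x|density (\<tau> v) (\<lambda>x. ennreal (?i {0<..<1} x)). (1 / (1 + T x)) ^ n)"
        unfolding \<sigma>_def by (subst integral_distr) (auto simp: ennreal_indicator)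
      also have "\<dots> = (LINT x|\<tau> v. ?i {0<..<1} x * (1 / (1 + T x)) ^ n)"
        by (subst integral_density) auto
      also have "(\<lambda>x. ?i {0<..<1} x * (1 / (1 + T x)) ^ n) = (\<lambda>x. ?i {0<..<1} x * x ^ n)"
        by (auto simp: T_def fun_eq_iff indicator_def field_simps)
      finally have 1: "(LINT x|\<sigma> v. (1 / (1 + x)) ^ n) = (LINT x|\<tau> v. ?i {0<..<1} x * x ^ n)" .
      have i1: "integrable (\<tau> v) (\<lambda>x. ?i {0<..<1} x * x ^ n)"
        by (rule integrable_const_bound[where B = 1]) (auto simp: indicator_def power_le_one)
      have i2: "integrable (\<tau> v) (\<lambda>x. (if n = 0 then 1 else 0) * ?i {0} x)" "integrable (\<tau> v) (?i {1})"
        by (auto intro!: integrable_real_indicator simp: less_top[symmetric])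
      have "v \<bullet> (N n *v v) = (LINT x|\<tau> v. ?i {0<..<1} x * x ^ n + (if n = 0 then 1 else 0) * ?i {0} x + ?i {1} x)"
        unfolding \<tau>(4)[symmetric]
      proof (rule integral_cong_AE)
        show "AE x in \<tau> v. x ^ n = ?i {0<..<1} x * x ^ n + (if n = 0 then 1 else 0) * ?i {0} x + ?i {1} x"
          using AE01[of v] by eventually_elim (auto simp: indicator_def)
      qed measurable
      also have "\<dots> = (LINT x|\<tau> v. ?i {0<..<1} x * x ^ n) + (if n = 0 then 1 else 0) * measure (\<tau> v) {0} + measure (\<tau> v) {1}"
        using i1 i2 by (simp add: sp)
      finally show ?thesis unfolding 1 by simp
    qed
    have "moment_matrix \<sigma> L K n $ i $ j = polar (\<lambda>v. v \<bullet> (N n *v v)) i j" for i j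
      unfolding split[symmetric] by (simp add: moment_matrix_def L_def K_def polar_add) (simp add: polar_def)
    thus ?thesis by (simp add: vec_eq_iff polar_quadratic_form[OF sym])
  qed
  thus ?thesis using fam LK by blast
qed

section \<open>Convolution inverses\<close>

text \<open>The convolution of \<open>f\<close> and \<open>h\<close> paired with \<psi>, as a double
  integral so that \<psi> may be any decaying function, not only a test function.\<close>

definition pair_integral :: "(real \<Rightarrow> real) \<Rightarrow> (real \<Rightarrow> real) \<Rightarrow> (real \<Rightarrow> real) \<Rightarrow> real" where
  "pair_integral f h \<psi> = (LINT z|(lborel \<Otimes>\<^sub>M lborel). f (fst z) * h (snd z) * \<psi> (fst z + snd z))"

definition half_square :: "(real \<Rightarrow> real) \<Rightarrow> real" where
  "half_square \<psi> = (LBINT s. indicator {0..} s * (s\<^sup>2 / 2) * \<psi> s)"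

definition exp_mass :: "(real \<Rightarrow> real) \<Rightarrow> real" where
  "exp_mass f = (LBINT t. \<bar>f t\<bar> * exp (- t / 2))"

lemma decaying_nonneg: "decaying \<psi> B \<Longrightarrow> 0 \<le> B"
  unfolding decaying_def using abs_ge_zero[of "\<psi> 0"] by (metis exp_zero mult.right_neutral neg_equal_zero divide_eq_0_iff order.refl order_trans)

lemma decaying_measurable: "decaying \<psi> B \<Longrightarrow> \<psi> \<in> borel_measurable borel"
  unfolding decaying_def by (intro borel_measurable_continuous_onI) simp

lemma decaying_of_vanishing:
  assumes \<psi>: "continuous_on UNIV \<psi>" and b: "\<forall>t>b. \<psi> t = 0"
  shows "\<exists>B. decaying \<psi> B"
proof -
  have "compact (\<psi> ` {0..\<bar>b\<bar>})" by (intro compact_continuous_image continuous_on_subset[OF \<psi>]) auto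
  then obtain B where B: "\<forall>x\<in>{0..\<bar>b\<bar>}. \<bar>\<psi> x\<bar> \<le> B" by (auto dest!: compact_imp_bounded simp: bounded_iff)
  have "0 \<le> B" using B by (metis abs_ge_zero atLeastAtMost_iff order.refl order_trans)
  have "\<bar>\<psi> t\<bar> \<le> B * exp (\<bar>b\<bar> / 2) * exp (- t / 2)" if t: "0 \<le> t" for t
  proof (cases "t \<le> \<bar>b\<bar>")
    case True
    hence "\<bar>\<psi> t\<bar> \<le> B * 1" using B t by simp
    also have "\<dots> \<le> B * (exp (\<bar>b\<bar> / 2) * exp (- t / 2))"
      using True \<open>0 \<le> B\<close> by (intro mult_left_mono) (simp_all add: exp_add[symmetric])
    finally show ?thesis by (simp add: mult.assoc)
  next
    case False
    hence "\<psi> t = 0" using b by auto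
    thus ?thesis using \<open>0 \<le> B\<close> by simp
  qed
  thus ?thesis using \<psi> unfolding decaying_def by blast
qed

lemma moderate_exp_integrable:
  assumes "moderate f"
  shows "integrable lborel (\<lambda>t. \<bar>f t\<bar> * exp (- t / 2))"
proof -
  from assms obtain C where C: "C \<ge> 0" "\<forall>t\<ge>0. \<bar>f t\<bar> \<le> C * (1 + t)" and n: "\<forall>t<0. f t = 0"
    and [measurable]: "f \<in> borel_measurable borel"
    unfolding moderate_def by blast
  show ?thesis
  proof (rule Bochner_Integration.integrable_bound)
    let ?g = "\<lambda>t. C * (indicator {0..} t * (t ^ 0 * exp (- (1/2) * t)) + indicator {0..} t * (t ^ 1 * exp (- (1/2) * t))) :: real"
    show "integrable lborel ?g"
      by (intro integrable_mult_right Bochner_Integration.integrable_add power_exp_integral) auto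
    have "norm (\<bar>f t\<bar> * exp (- t / 2)) \<le> norm (?g t)" for t
    proof (cases "t < 0")
      case False
      hence "\<bar>f t\<bar> * exp (- t / 2) \<le> C * (1 + t) * exp (- t / 2)" using C by (intro mult_right_mono) auto
      thus ?thesis using False C by (simp add: algebra_simps abs_mult)
    qed (use n in simp)
    thus "AE t in lborel. norm (\<bar>f t\<bar> * exp (- t / 2)) \<le> norm (?g t)" by simp
  qed measurable
qed

lemma moderate_decaying_bound:
  assumes f: "moderate f" and \<psi>: "decaying \<psi> B"
  shows "integrable lborel (\<lambda>t. f t * \<psi> t)" "\<bar>LBINT t. f t * \<psi> t\<bar> \<le> exp_mass f * B"
proof -
  have [measurable]: "f \<in> borel_measurable borel" using f by (simp add: moderate_def)
  have [measurable]: "\<psi> \<in> borel_measurable borel" by (rule decaying_measurable[OF \<psi>])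
  have le: "\<bar>f t * \<psi> t\<bar> \<le> B * (\<bar>f t\<bar> * exp (- t / 2))" for t
  proof (cases "t < 0")
    case False
    hence "\<bar>\<psi> t\<bar> \<le> B * exp (- t / 2)" using \<psi> by (simp add: decaying_def)
    hence "\<bar>f t\<bar> * \<bar>\<psi> t\<bar> \<le> \<bar>f t\<bar> * (B * exp (- t / 2))" by (rule mult_left_mono) simp
    thus ?thesis by (simp add: abs_mult ac_simps)
  qed (use f in \<open>simp add: moderate_def\<close>)
  have i: "integrable lborel (\<lambda>t. B * (\<bar>f t\<bar> * exp (- t / 2)))"
    by (intro integrable_mult_right moderate_exp_integrable f)
  show 1: "integrable lborel (\<lambda>t. f t * \<psi> t)"
    by (rule Bochner_Integration.integrable_bound[OF i])
       (use le decaying_nonneg[OF \<psi>] in \<open>auto intro: order_trans[OF _ abs_ge_self]\<close>)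
  have "\<bar>LBINT t. f t * \<psi> t\<bar> \<le> (LBINT t. \<bar>f t * \<psi> t\<bar>)" by (rule integral_abs_bound)
  also have "\<dots> \<le> (LBINT t. B * (\<bar>f t\<bar> * exp (- t / 2)))" by (intro integral_mono integrable_abs 1 i le)
  finally show "\<bar>LBINT t. f t * \<psi> t\<bar> \<le> exp_mass f * B" by (simp add: exp_mass_def mult.commute)
qed

lemma product_integral:
  fixes a b :: "real \<Rightarrow> real"
  assumes a: "integrable lborel a" and b: "integrable lborel b"
  shows "integrable (lborel \<Otimes>\<^sub>M lborel) (\<lambda>z. a (fst z) * b (snd z))"
    and "(LINT z|(lborel \<Otimes>\<^sub>M lborel). a (fst z) * b (snd z)) = (LBINT x. a x) * (LBINT y. b y)"
proof -
  have [measurable]: "a \<in> borel_measurable borel" "b \<in> borel_measurable borel"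
    using a b by (auto dest: borel_measurable_integrable)
  have i: "integrable (lborel \<Otimes>\<^sub>M lborel) (\<lambda>(x, y). a x * b y)"
  proof (rule lborel_pair.Fubini_integrable)
    show "integrable lborel (\<lambda>x. LBINT y. norm (case (x, y) of (x, y) \<Rightarrow> a x * b y))"
      using a by (simp add: abs_mult)
    show "AE x in lborel. integrable lborel (\<lambda>y. case (x, y) of (x, y) \<Rightarrow> a x * b y)" using b by simp
  qed measurable
  thus "integrable (lborel \<Otimes>\<^sub>M lborel) (\<lambda>z. a (fst z) * b (snd z))" by (simp add: case_prod_unfold)
  show "(LINT z|(lborel \<Otimes>\<^sub>M lborel). a (fst z) * b (snd z)) = (LBINT x. a x) * (LBINT y. b y)"
    using lborel_pair.integral_fst[OF i] by (simp add: case_prod_unfold)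
qed

text \<open>Where the product \<open>f (fst z) * h (snd z)\<close> does not vanish both times are
  nonnegative. Hence the bound on \<psi> applies at their sum, and its exponential
  factorizes.\<close>

lemma pair_integral_bound:
  assumes f: "moderate f" and h: "moderate h" and \<psi>: "decaying \<psi> B"
  shows "integrable (lborel \<Otimes>\<^sub>M lborel) (\<lambda>z. f (fst z) * h (snd z) * \<psi> (fst z + snd z))"
    and "\<bar>pair_integral f h \<psi>\<bar> \<le> exp_mass f * exp_mass h * B"
proof -
  have [measurable]: "f \<in> borel_measurable borel" "h \<in> borel_measurable borel" using f h by (auto simp: moderate_def)
  have [measurable]: "\<psi> \<in> borel_measurable borel" by (rule decaying_measurable[OF \<psi>])
  let ?e = "\<lambda>z. B * ((\<bar>f (fst z)\<bar> * exp (- fst z / 2)) * (\<bar>h (snd z)\<bar> * exp (- snd z / 2)))"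
  note P = product_integral[OF moderate_exp_integrable[OF f] moderate_exp_integrable[OF h]]
  have i: "integrable (lborel \<Otimes>\<^sub>M lborel) ?e" by (intro integrable_mult_right P)
  have le: "\<bar>f (fst z) * h (snd z) * \<psi> (fst z + snd z)\<bar> \<le> ?e z" for z
  proof (cases "fst z < 0 \<or> snd z < 0")
    case False
    hence "0 \<le> fst z + snd z" by auto
    hence "\<bar>\<psi> (fst z + snd z)\<bar> \<le> B * exp (- (fst z + snd z) / 2)" using \<psi> unfolding decaying_def by blast
    hence "\<bar>f (fst z) * h (snd z)\<bar> * \<bar>\<psi> (fst z + snd z)\<bar> \<le> \<bar>f (fst z) * h (snd z)\<bar> * (B * exp (- (fst z + snd z) / 2))"
      by (rule mult_left_mono) simp
    also have "exp (- (fst z + snd z) / 2) = exp (- fst z / 2) * exp (- snd z / 2)"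
      by (simp add: exp_add[symmetric] add_divide_distrib)
    finally show ?thesis by (simp add: abs_mult ac_simps)
  next
    case True
    hence "f (fst z) * h (snd z) = 0" using f h by (auto simp: moderate_def)
    thus ?thesis by auto
  qed
  have "0 \<le> ?e z" for z using decaying_nonneg[OF \<psi>] by simp
  hence le': "norm (f (fst z) * h (snd z) * \<psi> (fst z + snd z)) \<le> norm (?e z)" for z
    using le[of z] by simp
  show 1: "integrable (lborel \<Otimes>\<^sub>M lborel) (\<lambda>z. f (fst z) * h (snd z) * \<psi> (fst z + snd z))"
    by (rule Bochner_Integration.integrable_bound[OF i]) (measurable, intro AE_I2 le')
  have "\<bar>pair_integral f h \<psi>\<bar> \<le> (LINT z|(lborel \<Otimes>\<^sub>M lborel). \<bar>f (fst z) * h (snd z) * \<psi> (fst z + snd z)\<bar>)"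
    unfolding pair_integral_def by (rule integral_abs_bound)
  also have "\<dots> \<le> (LINT z|(lborel \<Otimes>\<^sub>M lborel). ?e z)" by (intro integral_mono integrable_abs 1 i le)
  also have "\<dots> = B * (exp_mass f * exp_mass h)" using P(2) by (simp add: exp_mass_def)
  finally show "\<bar>pair_integral f h \<psi>\<bar> \<le> exp_mass f * exp_mass h * B" by (simp add: ac_simps)
qed

lemma pair_integral_iterated:
  assumes f: "moderate f" and h: "moderate h" and \<psi>: "decaying \<psi> B"
  shows "integrable lborel (\<lambda>x. f x * (LBINT y. h y * \<psi> (x + y)))"
    and "pair_integral f h \<psi> = (LBINT x. f x * (LBINT y. h y * \<psi> (x + y)))"
proof -
  have i: "integrable (lborel \<Otimes>\<^sub>M lborel) (\<lambda>(x, y). f x * h y * \<psi> (x + y))"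
    using pair_integral_bound(1)[OF assms] by (simp add: case_prod_unfold)
  have e: "(LBINT y. f x * h y * \<psi> (x + y)) = f x * (LBINT y. h y * \<psi> (x + y))" for x
    by (simp add: mult.assoc)
  show "integrable lborel (\<lambda>x. f x * (LBINT y. h y * \<psi> (x + y)))"
    using lborel_pair.integrable_fst[OF i] by (simp only: e)
  show "pair_integral f h \<psi> = (LBINT x. f x * (LBINT y. h y * \<psi> (x + y)))"
    using lborel_pair.integral_fst[OF i] unfolding e by (simp add: pair_integral_def case_prod_unfold)
qed

lemma pair_integral_commute:
  assumes [measurable]: "f \<in> borel_measurable borel" "h \<in> borel_measurable borel" "\<psi> \<in> borel_measurable borel"
  shows "pair_integral f h \<psi> = pair_integral h f \<psi>"
proof -
  let ?F = "\<lambda>(x, y). f x * h y * \<psi> (x + y)"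
  have "(LINT (x, y)|(lborel \<Otimes>\<^sub>M lborel). ?F (y, x)) = (LINT z|(lborel \<Otimes>\<^sub>M lborel). ?F z)"
    by (rule lborel_pair.integral_product_swap) measurable
  thus ?thesis by (simp add: pair_integral_def case_prod_unfold ac_simps)
qed

lemma pair_integral_lincomb:
  assumes f: "moderate f" and h: "moderate h" and \<psi>: "decaying \<psi> B" and \<phi>: "decaying \<phi> D"
  shows "pair_integral f h (\<lambda>t. a * \<psi> t + b * \<phi> t) = a * pair_integral f h \<psi> + b * pair_integral f h \<phi>"
proof -
  have "(\<lambda>z. f (fst z) * h (snd z) * (a * \<psi> (fst z + snd z) + b * \<phi> (fst z + snd z))) =
    (\<lambda>z. a * (f (fst z) * h (snd z) * \<psi> (fst z + snd z)) + b * (f (fst z) * h (snd z) * \<phi> (fst z + snd z)))"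
    by (simp add: algebra_simps)
  thus ?thesis using pair_integral_bound(1)[OF f h \<psi>] pair_integral_bound(1)[OF f h \<phi>]
    by (simp add: pair_integral_def)
qed

text \<open>The binomial theorem separates the variables. After division by \<open>n!\<close> the
  moments of a convolution form a Cauchy product.\<close>

lemma pair_integral_moment:
  assumes f: "moderate f" and h: "moderate h"
  shows "pair_integral f h (\<lambda>t. t ^ n * exp (- t)) =
    (\<Sum>k\<le>n. real (n choose k) * ((LBINT t. f t * (t ^ k * exp (- t))) * (LBINT t. h t * (t ^ (n - k) * exp (- t)))))"
proof -
  have i: "integrable lborel (\<lambda>t. g t * (t ^ k * exp (- t)))" if "moderate g" for g k
    using moderate_decaying_bound(1)[OF that decaying_power_exp[of 1 k]] by simp
  let ?t = "\<lambda>k z. (f (fst z) * (fst z ^ k * exp (- fst z))) * (h (snd z) * (snd z ^ (n - k) * exp (- snd z)))"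
  have "f (fst z) * h (snd z) * ((fst z + snd z) ^ n * exp (- (fst z + snd z))) = (\<Sum>k\<le>n. real (n choose k) * ?t k z)" for z :: "real \<times> real"
  proof -
    have "exp (- (fst z + snd z)) = exp (- fst z) * exp (- snd z)" by (simp add: exp_add[symmetric])
    moreover have "(fst z + snd z) ^ n = (\<Sum>k\<le>n. real (n choose k) * fst z ^ k * snd z ^ (n - k))"
      by (rule binomial_ring)
    ultimately show ?thesis by (simp add: sum_distrib_left sum_distrib_right ac_simps)
  qed
  hence "pair_integral f h (\<lambda>t. t ^ n * exp (- t)) = (LINT z|(lborel \<Otimes>\<^sub>M lborel). (\<Sum>k\<le>n. real (n choose k) * ?t k z))"
    by (simp add: pair_integral_def)
  also have "\<dots> = (\<Sum>k\<le>n. LINT z|(lborel \<Otimes>\<^sub>M lborel). real (n choose k) * ?t k z)"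
    by (rule Bochner_Integration.integral_sum) (intro integrable_mult_right product_integral i f h)
  also have "\<dots> = (\<Sum>k\<le>n. real (n choose k) * ((LBINT t. f t * (t ^ k * exp (- t))) * (LBINT t. h t * (t ^ (n - k) * exp (- t)))))"
  proof (intro sum.cong refl)
    fix k
    show "(LINT z|(lborel \<Otimes>\<^sub>M lborel). real (n choose k) * ?t k z) =
      real (n choose k) * ((LBINT t. f t * (t ^ k * exp (- t))) * (LBINT t. h t * (t ^ (n - k) * exp (- t))))"
      using product_integral(2)[OF i[OF f, of k] i[OF h, of "n - k"]] by simp
  qed
  finally show ?thesis .
qed

text \<open>The constant 8 is the integral of \<open>s\<^sup>2 / 2 * exp (- s / 2)\<close> over the
  half-line.\<close>

lemma half_square_bound:
  assumes \<psi>: "decaying \<psi> B"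
  shows "integrable lborel (\<lambda>s. indicator {0..} s * (s\<^sup>2 / 2) * \<psi> s)"
    and "\<bar>half_square \<psi>\<bar> \<le> 8 * B"
proof -
  have [measurable]: "\<psi> \<in> borel_measurable borel" by (rule decaying_measurable[OF \<psi>])
  let ?g = "\<lambda>s::real. B / 2 * (indicator {0..} s * (s ^ 2 * exp (- (1/2) * s)))"
  have i: "integrable lborel ?g" by (intro integrable_mult_right power_exp_integral) auto
  have le: "\<bar>indicator {0..} s * (s\<^sup>2 / 2) * \<psi> s\<bar> \<le> ?g s" for s
  proof (cases "s < 0")
    case False
    hence "\<bar>\<psi> s\<bar> \<le> B * exp (- s / 2)" using \<psi> by (simp add: decaying_def)
    hence "s\<^sup>2 / 2 * \<bar>\<psi> s\<bar> \<le> s\<^sup>2 / 2 * (B * exp (- s / 2))" by (rule mult_left_mono) simp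
    thus ?thesis using False by (simp add: abs_mult ac_simps)
  qed simp
  show 1: "integrable lborel (\<lambda>s. indicator {0..} s * (s\<^sup>2 / 2) * \<psi> s)"
    by (rule Bochner_Integration.integrable_bound[OF i])
       (measurable, intro AE_I2, use le in \<open>auto intro: order_trans[OF _ abs_ge_self]\<close>)
  have "\<bar>half_square \<psi>\<bar> \<le> (LBINT s. \<bar>indicator {0..} s * (s\<^sup>2 / 2) * \<psi> s\<bar>)"
    unfolding half_square_def by (rule integral_abs_bound)
  also have "\<dots> \<le> (LBINT s. ?g s)" by (intro integral_mono integrable_abs 1 i le)
  also have "\<dots> = B / 2 * (fact 2 / (1/2) ^ Suc 2)" using power_exp_integral(2)[of "1/2" 2] by simp
  also have "\<dots> = 8 * B" by (simp add: fact_numeral power_divide eval_nat_numeral)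
  finally show "\<bar>half_square \<psi>\<bar> \<le> 8 * B" .
qed

lemma half_square_lincomb:
  assumes "decaying \<psi> B" "decaying \<phi> D"
  shows "half_square (\<lambda>t. a * \<psi> t + b * \<phi> t) = a * half_square \<psi> + b * half_square \<phi>"
proof -
  have "(\<lambda>s. indicator {0..} s * (s\<^sup>2 / 2) * (a * \<psi> s + b * \<phi> s)) =
    (\<lambda>s. a * (indicator {0..} s * (s\<^sup>2 / 2) * \<psi> s) + b * (indicator {0..} s * (s\<^sup>2 / 2) * \<phi> s))"
    by (rule ext) (simp add: field_simps)
  moreover have "(LBINT s. a * p s + b * q s) = a * (LBINT s. p s) + b * (LBINT s. q s)"
    if "integrable lborel p" "integrable lborel q" for p q :: "real \<Rightarrow> real" using that by simp
  ultimately show ?thesis using half_square_bound(1)[OF assms(1)] half_square_bound(1)[OF assms(2)]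
    by (simp only: half_square_def)
qed

lemma half_square_moment: "half_square (\<lambda>t. t ^ n * exp (- t)) = fact n * (real (n + 1) * real (n + 2) / 2)"
proof -
  have "(\<lambda>s::real. indicator {0..} s * (s\<^sup>2 / 2) * (s ^ n * exp (- s))) = (\<lambda>s. 1 / 2 * (indicator {0..} s * (s ^ (n + 2) * exp (- 1 * s))))"
    by (rule ext) (simp add: power_add power2_eq_square field_simps)
  hence "half_square (\<lambda>t. t ^ n * exp (- t)) = 1 / 2 * (fact (n + 2) / 1 ^ Suc (n + 2))"
    unfolding half_square_def using power_exp_integral(2)[of 1 "n + 2"] by simp
  also have "\<dots> = fact n * (real (n + 1) * real (n + 2) / 2)" by (simp add: algebra_simps)
  finally show ?thesis .
qed

text \<open>\<open>s\<^sup>2 / 2\<close> on the half-line is the third primitive of the Dirac mass.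
  The function \<open>G\<close> combines three integrations by parts into one antiderivative of
  \<open>s\<^sup>2 / 2 * E3 s\<close>.\<close>

lemma half_square_deriv3:
  assumes D: "\<And>s. (E0 has_real_derivative E1 s) (at s)" "\<And>s. (E1 has_real_derivative E2 s) (at s)"
      "\<And>s. (E2 has_real_derivative E3 s) (at s)" and c: "continuous_on UNIV E3"
    and z: "\<And>s. s > b \<Longrightarrow> E0 s = 0" "\<And>s. s > b \<Longrightarrow> E1 s = 0" "\<And>s. s > b \<Longrightarrow> E2 s = 0" "\<And>s. s > b \<Longrightarrow> E3 s = 0"
  shows "half_square E3 = - E0 0"
proof -
  define G where "G s = s\<^sup>2 / 2 * E2 s - s * E1 s + E0 s" for s
  have DG: "(G has_real_derivative s\<^sup>2 / 2 * E3 s) (at s)" for s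
    unfolding G_def using D by (auto intro!: derivative_eq_intros simp: field_simps power2_eq_square)
  have "(LBINT s. indicator {0..} s * (s\<^sup>2 / 2 * E3 s)) = - G 0"
    by (rule half_line_FTC(2)[OF DG, of "b + 1"]) (use c z in \<open>auto intro!: continuous_intros simp: G_def\<close>)
  thus ?thesis by (simp add: half_square_def G_def mult.assoc)
qed

section \<open>Convolution inverses obtained from moments\<close>

text \<open>Tested on continuous functions that vanish for large times only. This larger class
  contains the functions \<open>s \<mapsto> T (\<lambda>y. \<phi> (s + y))\<close> for causal
  \<open>T\<close>, to which the inverse is applied when an arbitrary relaxation matrix is
  identified.\<close>

definition conv_inverse ::
    "('m::finite \<Rightarrow> 'm \<Rightarrow> real \<Rightarrow> real) \<Rightarrow> ('m \<Rightarrow> 'm \<Rightarrow> real \<Rightarrow> real) \<Rightarrow> bool" where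
  "conv_inverse f h \<longleftrightarrow> (\<forall>i j \<psi>. continuous_on UNIV \<psi> \<longrightarrow> (\<exists>b. \<forall>t>b. \<psi> t = 0) \<longrightarrow>
     (\<Sum>k\<in>UNIV. pair_integral (f i k) (h k j) \<psi>) = (if i = j then 1 else 0) * half_square \<psi>)"

lemma moderate_moment:
  assumes "moderate f"
  shows "(LBINT t. f t * (t ^ k * exp (- t))) = (LBINT t. indicator {0..} t * (t ^ k * exp (- t)) * f t)"
proof -
  have "(\<lambda>t. f t * (t ^ k * exp (- t))) = (\<lambda>t. indicator {0..} t * (t ^ k * exp (- t)) * f t)"
  proof
    fix t
    show "f t * (t ^ k * exp (- t)) = indicator {0..} t * (t ^ k * exp (- t)) * f t"
      using assms by (cases "t < 0") (auto simp: moderate_def)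
  qed
  thus ?thesis by (rule arg_cong)
qed

text \<open>The difference of the two sides is a \<open>moment_functional\<close>. On
  \<open>t ^ n * exp (- t)\<close> the binomial coefficient cancels the factorials of the two
  moments up to \<open>n!\<close>, and \<open>MN\<close> is exactly the statement that it
  vanishes.\<close>

lemma conv_inverse_of_moments:
  fixes f h :: "'m::finite \<Rightarrow> 'm \<Rightarrow> real \<Rightarrow> real" and M N :: "nat \<Rightarrow> real^'m^'m"
  assumes f: "\<And>i j. moderate (f i j)" and h: "\<And>i j. moderate (h i j)"
    and M: "\<And>n i j. (LBINT t. indicator {0..} t * (t ^ n * exp (- t)) * f i j t) = fact n * (\<Sum>k\<le>n. M k $ i $ j)"
    and N: "\<And>n i j. (LBINT t. indicator {0..} t * (t ^ n * exp (- t)) * h i j t) = fact n * (\<Sum>k\<le>n. N k $ i $ j)"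
    and MN: "\<And>n. (\<Sum>k\<le>n. (\<Sum>j\<le>k. M j) ** (\<Sum>j\<le>n - k. N j)) = mat (real (n + 1) * real (n + 2) / 2)"
  shows "conv_inverse f h"
  unfolding conv_inverse_def
proof (intro allI impI)
  fix i j :: 'm and \<psi> :: "real \<Rightarrow> real"
  assume \<psi>: "continuous_on UNIV \<psi>" and "\<exists>b. \<forall>t>b. \<psi> t = 0"
  then obtain b where b: "\<forall>t>b. \<psi> t = 0" by blast
  define \<delta> where "\<delta> = (if i = j then 1 else 0 :: real)"
  define C where "C = (\<Sum>k\<in>UNIV. exp_mass (f i k) * exp_mass (h k j)) + 8"
  interpret moment_functional "\<lambda>\<psi>. (\<Sum>k\<in>UNIV. pair_integral (f i k) (h k j) \<psi>) - \<delta> * half_square \<psi>" C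
  proof
    fix \<psi> \<phi> :: "real \<Rightarrow> real" and B D a b assume d: "decaying \<psi> B" "decaying \<phi> D"
    show "(\<Sum>k\<in>UNIV. pair_integral (f i k) (h k j) (\<lambda>t. a * \<psi> t + b * \<phi> t)) - \<delta> * half_square (\<lambda>t. a * \<psi> t + b * \<phi> t) =
      a * ((\<Sum>k\<in>UNIV. pair_integral (f i k) (h k j) \<psi>) - \<delta> * half_square \<psi>) +
      b * ((\<Sum>k\<in>UNIV. pair_integral (f i k) (h k j) \<phi>) - \<delta> * half_square \<phi>)"
      unfolding pair_integral_lincomb[OF f h d] half_square_lincomb[OF d]
      by (simp add: sum.distrib sum_distrib_left algebra_simps)
  next
    fix \<psi> :: "real \<Rightarrow> real" and B assume d: "decaying \<psi> B"
    have "\<bar>\<Sum>k\<in>UNIV. pair_integral (f i k) (h k j) \<psi>\<bar> \<le> (\<Sum>k\<in>UNIV. exp_mass (f i k) * exp_mass (h k j) * B)"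
      by (rule order_trans[OF sum_abs sum_mono]) (rule pair_integral_bound(2)[OF f h d])
    moreover have "\<bar>\<delta> * half_square \<psi>\<bar> \<le> 8 * B"
      using half_square_bound(2)[OF d] decaying_nonneg[OF d] by (simp add: \<delta>_def)
    ultimately show "\<bar>(\<Sum>k\<in>UNIV. pair_integral (f i k) (h k j) \<psi>) - \<delta> * half_square \<psi>\<bar> \<le> C * B"
      unfolding C_def distrib_right sum_distrib_right by linarith
  next
    fix n
    have "(\<Sum>k\<in>UNIV. pair_integral (f i k) (h k j) (\<lambda>t. t ^ n * exp (- t))) =
      (\<Sum>k\<in>UNIV. \<Sum>a\<le>n. fact n * ((\<Sum>p\<le>a. M p) $ i $ k * (\<Sum>p\<le>n - a. N p) $ k $ j))"
    proof (rule sum.cong[OF refl])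
      fix k :: 'm
      have "real (n choose a) * ((fact a * (\<Sum>p\<le>a. M p $ i $ k)) * (fact (n - a) * (\<Sum>p\<le>n - a. N p $ k $ j))) =
          fact n * ((\<Sum>p\<le>a. M p) $ i $ k * (\<Sum>p\<le>n - a. N p) $ k $ j)" if "a \<le> n" for a
        unfolding binomial_fact[OF that, where 'a=real] sum_component by (simp add: field_simps)
      thus "pair_integral (f i k) (h k j) (\<lambda>t. t ^ n * exp (- t)) =
          (\<Sum>a\<le>n. fact n * ((\<Sum>p\<le>a. M p) $ i $ k * (\<Sum>p\<le>n - a. N p) $ k $ j))"
        unfolding pair_integral_moment[OF f h] moderate_moment[OF f] moderate_moment[OF h] M N
        by (intro sum.cong[OF refl]) simp
    qed
    also have "\<dots> = fact n * (\<Sum>a\<le>n. (\<Sum>p\<le>a. M p) ** (\<Sum>p\<le>n - a. N p)) $ i $ j"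
      unfolding sum_component matrix_matrix_mult_def vec_lambda_beta sum_distrib_left by (rule sum.swap)
    also have "\<dots> = \<delta> * half_square (\<lambda>t. t ^ n * exp (- t))"
      unfolding MN half_square_moment by (simp add: mat_def \<delta>_def)
    finally show "(\<Sum>k\<in>UNIV. pair_integral (f i k) (h k j) (\<lambda>t. t ^ n * exp (- t))) - \<delta> * half_square (\<lambda>t. t ^ n * exp (- t)) = 0"
      by simp
  qed
  have "(\<Sum>k\<in>UNIV. pair_integral (f i k) (h k j) \<psi>) - \<delta> * half_square \<psi> = 0"
    by (rule vanishing[OF \<psi>]) (use b in blast)
  thus "(\<Sum>k\<in>UNIV. pair_integral (f i k) (h k j) \<psi>) = (if i = j then 1 else 0) * half_square \<psi>"
    by (simp add: \<delta>_def)
qed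

lemma moments_determine:
  assumes f: "moderate f" "continuous_on {0..} f" and g: "moderate g" "continuous_on {0..} g"
    and eq: "\<And>n. (LBINT t. indicator {0..} t * (t ^ n * exp (- t)) * f t) = (LBINT t. indicator {0..} t * (t ^ n * exp (- t)) * g t)"
  shows "f = g"
proof (rule dist_of_eq_imp_eq[OF f g])
  interpret moment_functional "\<lambda>\<psi>. (LBINT t. f t * \<psi> t) - (LBINT t. g t * \<psi> t)" "exp_mass f + exp_mass g"
  proof
    fix \<psi> \<phi> :: "real \<Rightarrow> real" and B D a b assume d: "decaying \<psi> B" "decaying \<phi> D"
    have L: "(LBINT t. q t * (a * \<psi> t + b * \<phi> t)) = a * (LBINT t. q t * \<psi> t) + b * (LBINT t. q t * \<phi> t)" if "moderate q" for q
    proof -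
      have "(\<lambda>t. q t * (a * \<psi> t + b * \<phi> t)) = (\<lambda>t. a * (q t * \<psi> t) + b * (q t * \<phi> t))" by (simp add: algebra_simps)
      thus ?thesis using moderate_decaying_bound(1)[OF that d(1)] moderate_decaying_bound(1)[OF that d(2)] by simp
    qed
    show "(LBINT t. f t * (a * \<psi> t + b * \<phi> t)) - (LBINT t. g t * (a * \<psi> t + b * \<phi> t)) =
      a * ((LBINT t. f t * \<psi> t) - (LBINT t. g t * \<psi> t)) + b * ((LBINT t. f t * \<phi> t) - (LBINT t. g t * \<phi> t))"
      unfolding L[OF f(1)] L[OF g(1)] by (simp add: algebra_simps)
  next
    fix \<psi> :: "real \<Rightarrow> real" and B assume d: "decaying \<psi> B"
    show "\<bar>(LBINT t. f t * \<psi> t) - (LBINT t. g t * \<psi> t)\<bar> \<le> (exp_mass f + exp_mass g) * B"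
      using moderate_decaying_bound(2)[OF f(1) d] moderate_decaying_bound(2)[OF g(1) d]
      unfolding distrib_right by linarith
  qed (simp add: eq moderate_moment[OF f(1)] moderate_moment[OF g(1)])
  show "dist_of f =\<^sub>D dist_of g"
    unfolding dist_eq_def dist_of_def
  proof (intro allI impI)
    fix \<phi> assume \<phi>: "test_function \<phi>"
    obtain R where R: "\<forall>x. x \<notin> {-R..R} \<longrightarrow> \<phi> x = 0" using test_function_bounds[OF \<phi>] by blast
    have "(LBINT t. f t * \<phi> t) - (LBINT t. g t * \<phi> t) = 0"
      by (rule vanishing[OF smooth_continuous[OF test_function_smooth[OF \<phi>]], of R]) (use R in auto)
    thus "(LBINT t. f t * \<phi> t) = (LBINT t. g t * \<phi> t)" by simp
  qed
qed

section \<open>Relaxation functions and conjugate materials\<close>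

lemma test_function_deriv3: "test_function \<phi> \<Longrightarrow> test_function (deriv (deriv (deriv \<phi>)))"
  by (intro test_function_deriv)

lemma test_function_decaying:
  assumes "test_function \<phi>"
  shows "\<exists>B. decaying \<phi> B"
proof -
  obtain R where R: "\<forall>x. x \<notin> {-R..R} \<longrightarrow> \<phi> x = 0" using test_function_bounds[OF assms] by blast
  show ?thesis
    by (rule decaying_of_vanishing[OF smooth_continuous[OF test_function_smooth[OF assms]], of R]) (use R in auto)
qed

lemma causal_shift_continuous:
  assumes T: "causal_distribution T" and \<phi>: "test_function \<phi>"
  shows "continuous_on UNIV (\<lambda>s. T (\<lambda>y. \<phi> (s + y)))"
  using distribution_shift_DERIV[of T \<phi>] T \<phi>
  by (auto simp: causal_distribution_def intro!: continuous_at_imp_continuous_on DERIV_isCont)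

lemma causal_shift_decaying:
  assumes "causal_distribution T" "test_function \<phi>"
  shows "\<exists>B. decaying (\<lambda>s. T (\<lambda>y. \<phi> (s + y))) B"
proof -
  obtain b where "\<forall>s>b. T (\<lambda>y. \<phi> (s + y)) = 0" using causal_shift_eventually_0[OF assms] by blast
  thus ?thesis by (rule decaying_of_vanishing[OF causal_shift_continuous[OF assms]])
qed

text \<open>The integrand is the third derivative in \<open>s\<close> of
  \<open>T (\<lambda>y. \<phi> (s + y))\<close>, so integrating against \<open>s\<^sup>2 / 2\<close>
  recovers its value at \<open>s = 0\<close> up to sign, for every causal \<open>T\<close>.\<close>

lemma half_square_shift_deriv3:
  assumes T: "causal_distribution T" and \<phi>: "test_function \<phi>"
  shows "half_square (\<lambda>s. T (\<lambda>y. deriv (deriv (deriv \<phi>)) (s + y))) = - T \<phi>"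
proof -
  have Td: "is_distribution T" using T by (simp add: causal_distribution_def)
  note t = \<phi> test_function_deriv[OF \<phi>] test_function_deriv[OF test_function_deriv[OF \<phi>]] test_function_deriv3[OF \<phi>]
  obtain b0 where b0: "\<forall>s>b0. T (\<lambda>y. \<phi> (s + y)) = 0" using causal_shift_eventually_0[OF T t(1)] by blast
  obtain b1 where b1: "\<forall>s>b1. T (\<lambda>y. deriv \<phi> (s + y)) = 0" using causal_shift_eventually_0[OF T t(2)] by blast
  obtain b2 where b2: "\<forall>s>b2. T (\<lambda>y. deriv (deriv \<phi>) (s + y)) = 0" using causal_shift_eventually_0[OF T t(3)] by blast
  obtain b3 where b3: "\<forall>s>b3. T (\<lambda>y. deriv (deriv (deriv \<phi>)) (s + y)) = 0" using causal_shift_eventually_0[OF T t(4)] by blast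
  have "half_square (\<lambda>s. T (\<lambda>y. deriv (deriv (deriv \<phi>)) (s + y))) = - T (\<lambda>y. \<phi> (0 + y))"
  proof (rule half_square_deriv3[where b = "max (max b0 b1) (max b2 b3)"])
    show "((\<lambda>s. T (\<lambda>y. \<phi> (s + y))) has_real_derivative T (\<lambda>y. deriv \<phi> (s + y))) (at s)" for s
      by (rule distribution_shift_DERIV[OF Td t(1)])
    show "((\<lambda>s. T (\<lambda>y. deriv \<phi> (s + y))) has_real_derivative T (\<lambda>y. deriv (deriv \<phi>) (s + y))) (at s)" for s
      by (rule distribution_shift_DERIV[OF Td t(2)])
    show "((\<lambda>s. T (\<lambda>y. deriv (deriv \<phi>) (s + y))) has_real_derivative T (\<lambda>y. deriv (deriv (deriv \<phi>)) (s + y))) (at s)" for s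
      by (rule distribution_shift_DERIV[OF Td t(3)])
    show "continuous_on UNIV (\<lambda>s. T (\<lambda>y. deriv (deriv (deriv \<phi>)) (s + y)))" by (rule causal_shift_continuous[OF T t(4)])
  qed (use b0 b1 b2 b3 in auto)
  thus ?thesis by simp
qed

lemma causal_dirac0: "causal_distribution dirac0"
proof -
  have le: "\<bar>\<phi> 0\<bar> \<le> 1 * (\<Sum>n\<le>0. SUP x. \<bar>(deriv ^^ n) \<phi> x\<bar>)" if "test_function \<phi>" for \<phi>
    using higher_deriv_le_SUP[OF that, of 0 0] by simp
  show ?thesis
    unfolding causal_distribution_def is_distribution_def dirac0_def
    by (intro conjI allI impI exI[of _ 1] exI[of _ 0]) (use le support_ext in \<open>auto\<close>)
qed

section \<open>Relaxation matrices as derivatives of convolution inverses\<close>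

lemma relaxation_iff:
  assumes f: "\<And>i j. moderate (f i j)"
  shows "relaxation f r \<longleftrightarrow> (\<forall>i j. causal_distribution (r i j)) \<and>
    (\<forall>i j \<phi>. test_function \<phi> \<longrightarrow>
       (\<Sum>k\<in>UNIV. LBINT t. f i k t * r k j (\<lambda>y. deriv (deriv \<phi>) (t + y))) = (if i = j then 1 else 0) * \<phi> 0)"
proof -
  have E: "(\<Sum>k\<in>UNIV. (dist_deriv (dist_of (f i k)) \<star> dist_deriv (r k j)) \<phi>) =
      (\<Sum>k\<in>UNIV. LBINT t. f i k t * r k j (\<lambda>y. deriv (deriv \<phi>) (t + y)))"
    if "\<forall>i j. causal_distribution (r i j)" "test_function \<phi>" for i j \<phi>
    using that by (intro sum.cong refl convolution_dist_deriv) (auto simp: causal_distribution_def moderate_null[OF f])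
  show ?thesis unfolding relaxation_def dist_eq_def dirac0_def
  proof (rule conj_cong[OF refl])
    assume c: "\<forall>i j. causal_distribution (r i j)"
    show "(\<forall>i j \<phi>. test_function \<phi> \<longrightarrow> (\<Sum>k\<in>UNIV. (dist_deriv (dist_of (f i k)) \<star> dist_deriv (r k j)) \<phi>) = (if i = j then 1 else 0) * \<phi> 0) \<longleftrightarrow>
      (\<forall>i j \<phi>. test_function \<phi> \<longrightarrow> (\<Sum>k\<in>UNIV. LBINT t. f i k t * r k j (\<lambda>y. deriv (deriv \<phi>) (t + y))) = (if i = j then 1 else 0) * \<phi> 0)"
      by (intro all_cong1 imp_cong refl) (simp only: E[OF c])
  qed
qed

lemma relaxation_cong:
  assumes f: "\<And>i j. moderate (f i j)" and r: "relaxation f r" and eq: "\<And>i j. r' i j =\<^sub>D r i j"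
  shows "relaxation f r'"
  unfolding relaxation_iff[OF f]
proof (intro conjI allI impI)
  note rr = r[unfolded relaxation_iff[OF f]]
  show "causal_distribution (r' i j)" for i j using rr causal_distribution_cong[OF _ eq] by blast
  fix i j and \<phi> :: "real \<Rightarrow> real" assume \<phi>: "test_function \<phi>"
  have "r' k j (\<lambda>y. deriv (deriv \<phi>) (t + y)) = r k j (\<lambda>y. deriv (deriv \<phi>) (t + y))" for k t
    by (rule dist_eqD[OF eq test_function_shift[OF test_function_deriv[OF test_function_deriv[OF \<phi>]]]])
  thus "(\<Sum>k\<in>UNIV. LBINT t. f i k t * r' k j (\<lambda>y. deriv (deriv \<phi>) (t + y))) = (if i = j then 1 else 0) * \<phi> 0"
    using rr \<phi> by simp
qed

text \<open>With three derivatives moved to the test function, the pairing of the relaxation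
  relation with \<phi> becomes minus that of the convolution of \<open>f\<close> and
  \<open>h\<close> with the third derivative of \<phi>. The inverse relation evaluates it through
  \<open>half_square\<close>, which gives back \<open>\<phi> 0\<close>.\<close>

lemma relaxation_of_inverse:
  assumes f: "\<And>i j. moderate (f i j)" and h: "\<And>i j. moderate (h i j)"
    and inv: "\<And>i j \<phi>. test_function \<phi> \<Longrightarrow>
      (\<Sum>k\<in>UNIV. pair_integral (f i k) (h k j) \<phi>) = (if i = j then 1 else 0) * half_square \<phi>"
  shows "relaxation f (\<lambda>i j. dist_deriv (dist_of (h i j)))"
  unfolding relaxation_iff[OF f]
proof (intro conjI allI impI)
  show "causal_distribution (dist_deriv (dist_of (h i j)))" for i j
    by (intro causal_distribution_deriv moderate_causal h)
  fix i j and \<phi> :: "real \<Rightarrow> real" assume \<phi>: "test_function \<phi>"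
  let ?\<psi> = "deriv (deriv (deriv \<phi>))"
  obtain B where B: "decaying ?\<psi> B" using test_function_decaying[OF test_function_deriv3[OF \<phi>]] by blast
  have e: "dist_deriv (dist_of (h k j)) (\<lambda>y. deriv (deriv \<phi>) (t + y)) = - (LBINT y. h k j y * ?\<psi> (t + y))" for k t
    unfolding dist_deriv_def dist_of_def
    using deriv_shift[OF test_function_smooth[OF test_function_deriv[OF test_function_deriv[OF \<phi>]]]] by simp
  have p: "(LBINT t. f i k t * dist_deriv (dist_of (h k j)) (\<lambda>y. deriv (deriv \<phi>) (t + y))) = - pair_integral (f i k) (h k j) ?\<psi>" for k
    unfolding e using pair_integral_iterated(2)[OF f h B] by simp
  have "half_square ?\<psi> = - \<phi> 0"
    using half_square_shift_deriv3[OF causal_dirac0 \<phi>] by (simp add: dirac0_def)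
  thus "(\<Sum>k\<in>UNIV. LBINT t. f i k t * dist_deriv (dist_of (h k j)) (\<lambda>y. deriv (deriv \<phi>) (t + y))) = (if i = j then 1 else 0) * \<phi> 0"
    unfolding p sum_negf inv[OF test_function_deriv3[OF \<phi>]] by simp
qed

lemma conv_inverse_test:
  assumes "conv_inverse f h" "test_function \<phi>"
  shows "(\<Sum>k\<in>UNIV. pair_integral (f i k) (h k j) \<phi>) = (if i = j then 1 else 0) * half_square \<phi>"
proof -
  obtain R where R: "\<forall>x. x \<notin> {-R..R} \<longrightarrow> \<phi> x = 0" using test_function_bounds[OF assms(2)] by blast
  hence "\<exists>b. \<forall>t>b. \<phi> t = 0" by (intro exI[of _ R]) auto
  thus ?thesis using assms(1) smooth_continuous[OF test_function_smooth[OF assms(2)]] unfolding conv_inverse_def by blast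
qed

text \<open>Testing \<open>f' * r' = \<delta>\<^sub>0\<close> against \<open>\<theta>'(y + \<cdot>)\<close> and integrating in \<open>y\<close> against \<open>h\<close> cancels \<open>f\<close>.\<close>

lemma relaxation_unique:
  assumes f: "\<And>i j. moderate (f i j)" and h: "\<And>i j. moderate (h i j)"
    and inv: "conv_inverse h f" and r: "relaxation f r"
  shows "r l j =\<^sub>D dist_deriv (dist_of (h l j))"
  unfolding dist_eq_def
proof (intro allI impI)
  fix \<theta> assume \<theta>: "test_function \<theta>"
  note rr = r[unfolded relaxation_iff[OF f]]
  let ?t3 = "deriv (deriv (deriv \<theta>))"
  define \<Psi> where "\<Psi> k s = r k j (\<lambda>y. ?t3 (s + y))" for k s
  have rc: "causal_distribution (r k j)" for k using rr by blast
  have \<Psi>c: "continuous_on UNIV (\<Psi> k)" for k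
    unfolding \<Psi>_def by (rule causal_shift_continuous[OF rc test_function_deriv3[OF \<theta>]])
  have \<Psi>0: "\<exists>b. \<forall>s>b. \<Psi> k s = 0" for k
    unfolding \<Psi>_def by (rule causal_shift_eventually_0[OF rc test_function_deriv3[OF \<theta>]])
  have \<Psi>d: "\<exists>B. decaying (\<Psi> k) B" for k
    unfolding \<Psi>_def by (rule causal_shift_decaying[OF rc test_function_deriv3[OF \<theta>]])
  have key: "(\<Sum>k\<in>UNIV. LBINT t. f i k t * \<Psi> k (y + t)) = (if i = j then 1 else 0) * deriv \<theta> y" for i y
  proof -
    let ?\<phi> = "\<lambda>x. deriv \<theta> (y + x)"
    have \<phi>: "test_function ?\<phi>" by (intro test_function_shift test_function_deriv \<theta>)
    have d: "deriv (deriv ?\<phi>) = (\<lambda>x. ?t3 (y + x))"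
      using deriv_shift[OF test_function_smooth[OF test_function_deriv[OF \<theta>]], of y]
        deriv_shift[OF test_function_smooth[OF test_function_deriv[OF test_function_deriv[OF \<theta>]]], of y] by simp
    have "(\<Sum>k\<in>UNIV. LBINT t. f i k t * r k j (\<lambda>x. deriv (deriv ?\<phi>) (t + x))) = (if i = j then 1 else 0) * ?\<phi> 0"
      using rr \<phi> by blast
    thus ?thesis unfolding d \<Psi>_def by (simp add: add.assoc)
  qed
  have pi: "integrable lborel (\<lambda>y. h l i y * (LBINT t. f i k t * \<Psi> k (y + t)))"
    "(LBINT y. h l i y * (LBINT t. f i k t * \<Psi> k (y + t))) = pair_integral (h l i) (f i k) (\<Psi> k)" for i k
  proof -
    obtain B where B: "decaying (\<Psi> k) B" using \<Psi>d by blast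
    show "integrable lborel (\<lambda>y. h l i y * (LBINT t. f i k t * \<Psi> k (y + t)))"
      "(LBINT y. h l i y * (LBINT t. f i k t * \<Psi> k (y + t))) = pair_integral (h l i) (f i k) (\<Psi> k)"
      using pair_integral_iterated[OF h f B] by simp_all
  qed
  have "(\<Sum>i\<in>UNIV. LBINT y. h l i y * (\<Sum>k\<in>UNIV. LBINT t. f i k t * \<Psi> k (y + t))) = (\<Sum>i\<in>UNIV. if i = j then LBINT y. h l i y * deriv \<theta> y else 0)"
    unfolding key by (intro sum.cong refl) auto
  also have "\<dots> = (LBINT y. h l j y * deriv \<theta> y)" by simp
  finally have 1: "(LBINT y. h l j y * deriv \<theta> y) = (\<Sum>i\<in>UNIV. LBINT y. h l i y * (\<Sum>k\<in>UNIV. LBINT t. f i k t * \<Psi> k (y + t)))" ..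
  have "\<dots> = (\<Sum>i\<in>UNIV. \<Sum>k\<in>UNIV. pair_integral (h l i) (f i k) (\<Psi> k))"
    unfolding sum_distrib_left by (intro sum.cong refl) (simp add: Bochner_Integration.integral_sum pi)
  also have "\<dots> = (\<Sum>k\<in>UNIV. \<Sum>i\<in>UNIV. pair_integral (h l i) (f i k) (\<Psi> k))" by (rule sum.swap)
  also have "\<dots> = (\<Sum>k\<in>UNIV. (if l = k then 1 else 0) * half_square (\<Psi> k))"
    using inv \<Psi>c \<Psi>0 unfolding conv_inverse_def by (intro sum.cong refl) blast
  also have "\<dots> = (\<Sum>k\<in>UNIV. if l = k then half_square (\<Psi> k) else 0)" by (intro sum.cong refl) auto
  also have "\<dots> = half_square (\<Psi> l)" by simp
  also have "\<dots> = - r l j \<theta>" unfolding \<Psi>_def by (rule half_square_shift_deriv3[OF rc \<theta>])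
  finally show "r l j \<theta> = dist_deriv (dist_of (h l j)) \<theta>" using 1 by (simp add: dist_deriv_def dist_of_def)
qed

lemma moderate_lincomb:
  assumes "moderate f" "moderate g"
  shows "moderate (\<lambda>t. f t * a + g t * b)"
proof -
  from assms obtain C where C: "C \<ge> 0" "\<forall>t\<ge>0. \<bar>f t\<bar> \<le> C * (1 + t)" unfolding moderate_def by blast
  from assms obtain D where D: "D \<ge> 0" "\<forall>t\<ge>0. \<bar>g t\<bar> \<le> D * (1 + t)" unfolding moderate_def by blast
  have [measurable]: "f \<in> borel_measurable borel" "g \<in> borel_measurable borel" using assms by (auto simp: moderate_def)
  have "\<bar>f t * a + g t * b\<bar> \<le> (C * \<bar>a\<bar> + D * \<bar>b\<bar>) * (1 + t)" if "0 \<le> t" for t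
  proof -
    have "\<bar>f t\<bar> * \<bar>a\<bar> \<le> C * (1 + t) * \<bar>a\<bar>" "\<bar>g t\<bar> * \<bar>b\<bar> \<le> D * (1 + t) * \<bar>b\<bar>"
      using C D that by (auto intro: mult_right_mono)
    moreover have "\<bar>f t * a + g t * b\<bar> \<le> \<bar>f t\<bar> * \<bar>a\<bar> + \<bar>g t\<bar> * \<bar>b\<bar>"
      by (rule order_trans[OF abs_triangle_ineq]) (simp add: abs_mult)
    ultimately show ?thesis by (simp add: algebra_simps)
  qed
  moreover have "0 \<le> C * \<bar>a\<bar> + D * \<bar>b\<bar>" using C D by simp
  moreover have "\<forall>t<0. f t * a + g t * b = 0" using assms by (simp add: moderate_def)
  ultimately show ?thesis unfolding moderate_def by (intro conjI) (measurable, blast+)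
qed

lemma moderate_sum:
  assumes "\<And>j. moderate (f j)" "finite S"
  shows "moderate (\<lambda>t. \<Sum>j\<in>S. f j t * c j)"
  using assms(2)
proof (induction S)
  case empty
  show ?case by (auto simp: moderate_def)
next
  case (insert x S)
  show ?case using moderate_lincomb[OF assms(1) insert.IH, of x "c x" 1] insert.hyps by simp
qed

lemma dist_of_sum:
  assumes "\<And>j. moderate (f j)" "test_function \<phi>"
  shows "dist_of (\<lambda>t. \<Sum>j\<in>S. f j t * c j) \<phi> = (\<Sum>j\<in>S. dist_of (f j) \<phi> * c j)"
proof -
  have i: "integrable lborel (\<lambda>t. c j * (f j t * \<phi> t))" for j
    by (intro integrable_mult_right locally_bounded_test_integrable moderate_locally_bounded assms)
  have "dist_of (\<lambda>t. \<Sum>j\<in>S. f j t * c j) \<phi> = (LBINT t. (\<Sum>j\<in>S. c j * (f j t * \<phi> t)))"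
    by (simp add: dist_of_def sum_distrib_left sum_distrib_right ac_simps)
  also have "\<dots> = (\<Sum>j\<in>S. LBINT t. c j * (f j t * \<phi> t))" by (rule Bochner_Integration.integral_sum[OF i])
  finally show ?thesis by (simp add: dist_of_def mult.commute)
qed

lemma dist_of_add:
  assumes "moderate f" "moderate g" "test_function \<phi>"
  shows "dist_of (\<lambda>t. f t + g t) \<phi> = dist_of f \<phi> + dist_of g \<phi>"
  using assms locally_bounded_test_integrable[OF moderate_locally_bounded]
  by (simp add: dist_of_def distrib_right)

lemma nondegenerate_dist_mat:
  assumes m: "\<And>i j. moderate (f i j)" and c: "\<And>i j. continuous_on {0..} (f i j)"
  shows "nondegenerate (dist_mat f) \<longleftrightarrow> (\<forall>c. (\<forall>i t. (\<Sum>j\<in>UNIV. f i j t * c $ j) = 0) \<longrightarrow> c = 0)"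
proof -
  have "(\<lambda>\<phi>. \<Sum>j\<in>UNIV. dist_of (f i j) \<phi> * v $ j) =\<^sub>D (\<lambda>\<phi>. 0) \<longleftrightarrow> (\<forall>t. (\<Sum>j\<in>UNIV. f i j t * v $ j) = 0)" for i v
  proof
    assume "(\<lambda>\<phi>. \<Sum>j\<in>UNIV. dist_of (f i j) \<phi> * v $ j) =\<^sub>D (\<lambda>\<phi>. 0)"
    hence "dist_of (\<lambda>t. \<Sum>j\<in>UNIV. f i j t * v $ j) =\<^sub>D dist_of (\<lambda>t. 0)"
      using dist_of_sum[of "f i", OF m] by (simp add: dist_eq_def) (simp add: dist_of_def)
    hence "(\<lambda>t. \<Sum>j\<in>UNIV. f i j t * v $ j) = (\<lambda>t. 0)"
      by (intro dist_of_eq_imp_eq moderate_sum m) (auto intro!: continuous_intros c simp: moderate_def)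
    thus "\<forall>t. (\<Sum>j\<in>UNIV. f i j t * v $ j) = 0" by (simp add: fun_eq_iff)
  next
    assume z: "\<forall>t. (\<Sum>j\<in>UNIV. f i j t * v $ j) = 0"
    show "(\<lambda>\<phi>. \<Sum>j\<in>UNIV. dist_of (f i j) \<phi> * v $ j) =\<^sub>D (\<lambda>\<phi>. 0)"
      unfolding dist_eq_def
    proof (intro allI impI)
      fix \<phi> assume "test_function \<phi>"
      from dist_of_sum[of "f i" \<phi> "\<lambda>j. v $ j" UNIV, OF m this]
      show "(\<Sum>j\<in>UNIV. dist_of (f i j) \<phi> * v $ j) = 0" using z by (simp add: dist_of_def)
    qed
  qed
  thus ?thesis by (simp add: nondegenerate_def)
qed

lemma nondegenerate_cong:
  assumes "\<And>i j. T i j =\<^sub>D T' i j"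
  shows "nondegenerate T \<longleftrightarrow> nondegenerate T'"
  using assms by (simp add: nondegenerate_def dist_eq_def)

text \<open>A causal distribution is null as soon as its derivative is, so differentiation creates
  no new constant vectors in the kernel.\<close>

lemma nondegenerate_deriv:
  assumes h: "\<And>i j. moderate (h i j)"
  shows "nondegenerate (\<lambda>i j. dist_deriv (dist_of (h i j))) \<longleftrightarrow> nondegenerate (dist_mat h)"
proof -
  have "(\<lambda>\<phi>. \<Sum>j\<in>UNIV. dist_deriv (dist_of (h i j)) \<phi> * c $ j) =\<^sub>D (\<lambda>\<phi>. 0) \<longleftrightarrow>
    (\<lambda>\<phi>. \<Sum>j\<in>UNIV. dist_of (h i j) \<phi> * c $ j) =\<^sub>D (\<lambda>\<phi>. 0)" for i c
  proof -
    define T where "T = dist_of (\<lambda>t. \<Sum>j\<in>UNIV. h i j t * c $ j)"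
    have c: "causal_distribution T" unfolding T_def by (intro moderate_causal moderate_sum h) simp
    have T: "T \<phi> = (\<Sum>j\<in>UNIV. dist_of (h i j) \<phi> * c $ j)" if "test_function \<phi>" for \<phi>
      unfolding T_def by (rule dist_of_sum[OF h that])
    have "(\<lambda>\<phi>. \<Sum>j\<in>UNIV. dist_deriv (dist_of (h i j)) \<phi> * c $ j) =\<^sub>D (\<lambda>\<phi>. 0) \<longleftrightarrow> dist_deriv T =\<^sub>D (\<lambda>\<phi>. 0)"
      by (simp add: dist_eq_def dist_deriv_def T test_function_deriv sum_negf)
    also have "\<dots> \<longleftrightarrow> T =\<^sub>D (\<lambda>\<phi>. 0)"
      using causal_deriv_eq_0[OF c] by (auto simp: dist_eq_def dist_deriv_def test_function_deriv)
    also have "\<dots> \<longleftrightarrow> (\<lambda>\<phi>. \<Sum>j\<in>UNIV. dist_of (h i j) \<phi> * c $ j) =\<^sub>D (\<lambda>\<phi>. 0)"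
      by (simp add: dist_eq_def T)
    finally show ?thesis .
  qed
  thus ?thesis by (simp add: nondegenerate_def)
qed

section \<open>Impulse responses encoded by moment sequences\<close>

definition creep_moments :: "('m::finite \<Rightarrow> 'm \<Rightarrow> real \<Rightarrow> real) \<Rightarrow> (nat \<Rightarrow> real^'m^'m) \<Rightarrow> bool" where
  "creep_moments f M \<longleftrightarrow> (\<forall>i j. moderate (f i j)) \<and> (\<forall>i j. continuous_on {0..} (f i j)) \<and>
     (\<forall>n. transpose (M n) = M n) \<and> hankel_psd (\<lambda>n. M (Suc n)) \<and> hankel_psd (\<lambda>n. M n - M (Suc n)) \<and>
     (\<forall>n i j. (LBINT t. indicator {0..} t * (t ^ n * exp (- t)) * f i j t) = fact n * (\<Sum>k\<le>n. M k $ i $ j))"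

lemma creep_moments_creep_function:
  assumes "quadratic_family \<sigma>" "sym_psd L" "sym_psd K"
  shows "creep_moments (creep_function \<sigma> L K) (moment_matrix \<sigma> L K)"
  unfolding creep_moments_def
  using creep_function_moderate[OF assms(1)] creep_function_continuous[OF assms(1)] moment_matrix_sym[OF assms]
    moment_hankel1[OF assms] moment_hankel2[OF assms] creep_function_moment[OF assms] by blast

lemma creep_moments_unique:
  assumes "creep_moments f M" "creep_moments g M"
  shows "f = g"
proof (intro ext)
  fix i j :: 'a and t
  have "f i j = g i j" by (rule moments_determine) (use assms in \<open>auto simp: creep_moments_def\<close>)
  thus "f i j t = g i j t" by simp
qed

text \<open>A sequence with the two Hankel conditions is realized by some normal form, and two
  continuous functions of moderate growth with the same moments coincide. Measures can then be left
  aside: sums of impulse responses are treated by adding sequences.\<close>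

lemma impulse_response_iff_moments: "impulse_response f \<longleftrightarrow> (\<exists>M. creep_moments f M)"
proof
  assume "impulse_response f"
  thus "\<exists>M. creep_moments f M" unfolding impulse_response_iff using creep_moments_creep_function by blast
next
  assume "\<exists>M. creep_moments f M"
  then obtain M where M: "creep_moments f M" by blast
  hence "\<exists>\<sigma> L K. quadratic_family \<sigma> \<and> sym_psd L \<and> sym_psd K \<and> (\<forall>n. moment_matrix \<sigma> L K n = M n)"
    by (intro family_of_moments) (auto simp: creep_moments_def)
  then obtain \<sigma> L K where \<sigma>: "quadratic_family \<sigma>" "sym_psd L" "sym_psd K" and e: "\<forall>n. moment_matrix \<sigma> L K n = M n" by blast
  have "moment_matrix \<sigma> L K = M" using e by (simp add: fun_eq_iff)
  hence "f = creep_function \<sigma> L K" using creep_moments_unique[OF M] creep_moments_creep_function[OF \<sigma>] by simp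
  thus "impulse_response f" unfolding impulse_response_iff using \<sigma> by blast
qed

lemma creep_moments_kernel:
  assumes M: "creep_moments f M" and c: "M 0 *v c = 0"
  shows "(\<Sum>j\<in>UNIV. f i j t * c $ j) = 0"
proof -
  have "impulse_response f" using M unfolding impulse_response_iff_moments by blast
  then obtain \<sigma> L K where \<sigma>: "quadratic_family \<sigma>" "sym_psd L" "sym_psd K" and f: "f = creep_function \<sigma> L K"
    unfolding impulse_response_iff by blast
  have "moment_matrix \<sigma> L K 0 $ i $ j = M 0 $ i $ j" for i j
  proof -
    have "(LBINT t. indicator {0..} t * (t ^ 0 * exp (- t)) * f i j t) = fact 0 * (\<Sum>k\<le>0. M k $ i $ j)"
      using M unfolding creep_moments_def by blast
    moreover have "(LBINT t. indicator {0..} t * (t ^ 0 * exp (- t)) * f i j t) = fact 0 * (\<Sum>k\<le>0. moment_matrix \<sigma> L K k $ i $ j)"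
      unfolding f by (rule creep_function_moment[OF \<sigma>])
    ultimately show ?thesis by simp
  qed
  hence "moment_matrix \<sigma> L K 0 = M 0" by (simp add: vec_eq_iff)
  thus ?thesis using moment_matrix_0_kernel[OF \<sigma>] c unfolding f by simp
qed

lemma impulse_response_sym:
  assumes "impulse_response f"
  shows "f i j = f j i"
proof -
  obtain M where M: "creep_moments f M" using assms unfolding impulse_response_iff_moments by blast
  have s: "M k $ i $ j = M k $ j $ i" for k
  proof -
    have "transpose (M k) $ i $ j = M k $ j $ i" by (simp add: transpose_def)
    thus ?thesis using M by (simp add: creep_moments_def)
  qed
  show ?thesis by (rule moments_determine) (use M s in \<open>auto simp: creep_moments_def\<close>)
qed

lemma hankel_psd_0:
  assumes "hankel_psd M"
  shows "0 \<le> x \<bullet> (M 0 *v x)"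
proof -
  have "0 \<le> (\<Sum>a\<le>0. \<Sum>b\<le>0. c a \<bullet> (M (a + b) *v c b))" for c :: "nat \<Rightarrow> real^'a"
    using assms unfolding hankel_psd_def by blast
  from this[of "\<lambda>_. x"] show ?thesis by simp
qed

text \<open>\<open>M 0\<close> is the sum of \<open>M 1\<close> and \<open>M 0 - M 1\<close>, the
  leading blocks of the two Hankel forms.\<close>

lemma creep_moments_psd:
  assumes M: "creep_moments f M"
  shows "sym_psd (M 0)"
proof -
  have "0 \<le> x \<bullet> (M (Suc 0) *v x)" "0 \<le> x \<bullet> ((M 0 - M (Suc 0)) *v x)" for x
    using M hankel_psd_0 unfolding creep_moments_def by blast+
  hence "0 \<le> x \<bullet> (M 0 *v x)" for x
    using add_nonneg_nonneg[of "x \<bullet> (M (Suc 0) *v x)" "x \<bullet> ((M 0 - M (Suc 0)) *v x)" for x]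
    by (simp add: inner_add_right[symmetric] matrix_vector_mult_add_rdistrib[symmetric])
  thus ?thesis using M by (simp add: sym_psd_def creep_moments_def)
qed

lemma hankel_psd_add: "hankel_psd M \<Longrightarrow> hankel_psd N \<Longrightarrow> hankel_psd (\<lambda>n. M n + N n)"
  unfolding hankel_psd_def
  by (simp add: matrix_vector_mult_add_rdistrib inner_add_right sum.distrib)

lemma creep_moments_add:
  assumes M: "creep_moments f M" and N: "creep_moments g N"
  shows "creep_moments (\<lambda>i j t. f i j t + g i j t) (\<lambda>n. M n + N n)"
  unfolding creep_moments_def
proof (intro conjI allI)
  fix i j :: 'a and n
  have m: "moderate (f i j)" "moderate (g i j)" using M N by (auto simp: creep_moments_def)
  show "moderate (\<lambda>t. f i j t + g i j t)" using moderate_lincomb[OF m, of 1 1] by simp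
  show "continuous_on {0..} (\<lambda>t. f i j t + g i j t)"
    using M N by (intro continuous_on_add) (auto simp: creep_moments_def)
  show "transpose (M n + N n) = M n + N n" using M N by (simp add: transpose_add creep_moments_def)
  have i: "integrable lborel (\<lambda>t. indicator {0..} t * (t ^ n * exp (- t)) * q t)" if "moderate q" for q
  proof -
    have "(\<lambda>t. q t * (t ^ n * exp (- t))) = (\<lambda>t. indicator {0..} t * (t ^ n * exp (- t)) * q t)"
    proof
      fix t show "q t * (t ^ n * exp (- t)) = indicator {0..} t * (t ^ n * exp (- t)) * q t"
        using that by (cases "t < 0") (auto simp: moderate_def)
    qed
    thus ?thesis using moderate_decaying_bound(1)[OF that decaying_power_exp[of 1 n]] by simp
  qed
  have "(LBINT t. indicator {0..} t * (t ^ n * exp (- t)) * (f i j t + g i j t)) =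
    (LBINT t. indicator {0..} t * (t ^ n * exp (- t)) * f i j t) + (LBINT t. indicator {0..} t * (t ^ n * exp (- t)) * g i j t)"
    unfolding distrib_left by (rule Bochner_Integration.integral_add[OF i[OF m(1)] i[OF m(2)]])
  also have "\<dots> = fact n * (\<Sum>k\<le>n. M k $ i $ j) + fact n * (\<Sum>k\<le>n. N k $ i $ j)"
    using M N unfolding creep_moments_def by simp
  also have "\<dots> = fact n * (\<Sum>k\<le>n. (M k + N k) $ i $ j)" by (simp add: sum.distrib distrib_left)
  finally show "(LBINT t. indicator {0..} t * (t ^ n * exp (- t)) * (f i j t + g i j t)) = fact n * (\<Sum>k\<le>n. (M k + N k) $ i $ j)" .
next
  show "hankel_psd (\<lambda>n. M (Suc n) + N (Suc n))"
    using M N by (intro hankel_psd_add) (auto simp: creep_moments_def)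
  have "hankel_psd (\<lambda>n. (M n - M (Suc n)) + (N n - N (Suc n)))"
    using M N by (intro hankel_psd_add) (auto simp: creep_moments_def)
  thus "hankel_psd (\<lambda>n. M n + N n - (M (Suc n) + N (Suc n)))" by (simp add: algebra_simps)
qed

lemma conv_inverse_exists:
  assumes M: "creep_moments f M" and ker: "\<And>c. M 0 *v c = 0 \<Longrightarrow> c = 0"
  shows "\<exists>h. impulse_response h \<and> conv_inverse f h"
proof -
  have inv: "invertible (M 0)"
    unfolding invertible_left_inverse matrix_left_invertible_ker using ker by blast
  note Mc = M[unfolded creep_moments_def]
  show ?thesis
  proof (rule hankel_psd_conjugate[of M])
    show "transpose (M n) = M n" for n using Mc by blast
    show "hankel_psd (\<lambda>n. M (Suc n))" using Mc by blast
    show "hankel_psd (\<lambda>n. M n - M (Suc n))" using Mc by blast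
    fix N :: "nat \<Rightarrow> real^'a^'a"
    assume N: "\<And>n. transpose (N n) = N n" "hankel_psd (\<lambda>n. N (Suc n))" "hankel_psd (\<lambda>n. N n - N (Suc n))"
      and MN: "\<And>n. (\<Sum>k\<le>n. (\<Sum>j\<le>k. M j) ** (\<Sum>j\<le>n - k. N j)) = mat (real (n + 1) * real (n + 2) / 2)"
    obtain \<sigma> L K where \<sigma>: "quadratic_family \<sigma>" "sym_psd L" "sym_psd K" and e: "\<forall>n. moment_matrix \<sigma> L K n = N n"
      using family_of_moments[OF N] by blast
    have "conv_inverse f (creep_function \<sigma> L K)"
    proof (rule conv_inverse_of_moments[OF _ _ _ _ MN])
      show "moderate (f i j)" for i j using Mc by blast
      show "moderate (creep_function \<sigma> L K i j)" for i j by (rule creep_function_moderate[OF \<sigma>(1)])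
      show "(LBINT t. indicator {0..} t * (t ^ n * exp (- t)) * f i j t) = fact n * (\<Sum>k\<le>n. M k $ i $ j)" for n i j
        using Mc by blast
      show "(LBINT t. indicator {0..} t * (t ^ n * exp (- t)) * creep_function \<sigma> L K i j t) = fact n * (\<Sum>k\<le>n. N k $ i $ j)" for n i j
        using creep_function_moment[OF \<sigma>, of n i j] e by simp
    qed
    thus "\<exists>h. impulse_response h \<and> conv_inverse f h" unfolding impulse_response_iff using \<sigma> by blast
  qed (rule inv)
qed

lemma nondegenerate_moments:
  assumes M: "creep_moments f M" and nd: "nondegenerate (dist_mat f)" and c: "M 0 *v c = 0"
  shows "c = 0"
proof -
  have "\<forall>i t. (\<Sum>j\<in>UNIV. f i j t * c $ j) = 0" using creep_moments_kernel[OF M c] by blast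
  thus ?thesis using nd nondegenerate_dist_mat[of f] M unfolding creep_moments_def by blast
qed

lemma nondegenerate_imp_inverse:
  assumes f: "impulse_response f" and nd: "nondegenerate (dist_mat f)"
  shows "\<exists>h. impulse_response h \<and> conv_inverse f h"
proof -
  obtain M where M: "creep_moments f M" using f unfolding impulse_response_iff_moments by blast
  show ?thesis by (rule conv_inverse_exists[OF M nondegenerate_moments[OF M nd]])
qed

text \<open>A constant vector in the kernel of \<open>f\<close> is, by symmetry, also a left kernel
  vector. Multiplying the relaxation relation by it on the left annihilates the convolution and
  leaves \<open>c $ j * \<phi> 0\<close>, where the bump has \<open>\<phi> 0 > 0\<close>.\<close>

lemma relaxation_imp_nondegenerate:
  assumes f: "impulse_response f" and r: "relaxation f r"
  shows "nondegenerate (dist_mat f)"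
  unfolding nondegenerate_dist_mat[OF impulse_response_moderate[OF f] impulse_response_continuous[OF f]]
proof (intro allI impI)
  fix c :: "real^'a" assume z: "\<forall>i t. (\<Sum>j\<in>UNIV. f i j t * c $ j) = 0"
  note m = impulse_response_moderate[OF f]
  note rr = r[unfolded relaxation_iff[OF m]]
  show "c = 0"
  proof (rule test_function_bump[of "-1" 1])
    fix \<phi> :: "real \<Rightarrow> real" assume \<phi>: "test_function \<phi>" and pos: "\<And>x. -1 < x \<Longrightarrow> x < 1 \<Longrightarrow> 0 < \<phi> x"
    let ?d = "deriv (deriv \<phi>)"
    have d: "test_function ?d" by (intro test_function_deriv \<phi>)
    have "c $ j = 0" for j
    proof -
      let ?\<Psi> = "\<lambda>k t. r k j (\<lambda>y. ?d (t + y))"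
      have i: "integrable lborel (\<lambda>t. f i k t * ?\<Psi> k t)" for i k
      proof -
        have "causal_distribution (r k j)" using rr by blast
        then obtain B where "decaying (?\<Psi> k) B" using causal_shift_decaying[OF _ d] by blast
        thus ?thesis by (rule moderate_decaying_bound(1)[OF m])
      qed
      \<comment> \<open>Symmetry of the impulse response turns the right kernel into the left
        one.\<close>
      have z': "(\<Sum>i\<in>UNIV. c $ i * f i k t) = 0" for k t
      proof -
        have "(\<Sum>i\<in>UNIV. c $ i * f i k t) = (\<Sum>i\<in>UNIV. f k i t * c $ i)"
          by (intro sum.cong refl) (metis impulse_response_sym[OF f] mult.commute)
        thus ?thesis using z by simp
      qed
      have "c $ j * \<phi> 0 = (\<Sum>i\<in>UNIV. if i = j then c $ i * \<phi> 0 else 0)" by simp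
      also have "\<dots> = (\<Sum>i\<in>UNIV. c $ i * ((if i = j then 1 else 0) * \<phi> 0))" by (intro sum.cong refl) auto
      also have "\<dots> = (\<Sum>i\<in>UNIV. c $ i * (\<Sum>k\<in>UNIV. LBINT t. f i k t * ?\<Psi> k t))"
        using rr \<phi> by (intro sum.cong refl) simp
      also have "\<dots> = (\<Sum>i\<in>UNIV. \<Sum>k\<in>UNIV. LBINT t. c $ i * (f i k t * ?\<Psi> k t))"
        by (simp add: sum_distrib_left)
      also have "\<dots> = (\<Sum>k\<in>UNIV. \<Sum>i\<in>UNIV. LBINT t. c $ i * (f i k t * ?\<Psi> k t))" by (rule sum.swap)
      also have "\<dots> = (\<Sum>k\<in>UNIV. LBINT t. (\<Sum>i\<in>UNIV. c $ i * (f i k t * ?\<Psi> k t)))"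
        by (intro sum.cong refl Bochner_Integration.integral_sum[symmetric] integrable_mult_right i)
      also have "\<dots> = 0"
        unfolding mult.assoc[symmetric] sum_distrib_right[symmetric] z' by simp
      finally show ?thesis using pos[of 0] by simp
    qed
    thus "c = 0" by (simp add: vec_eq_iff)
  qed simp
qed

text \<open>Transposing a product exchanges its factors. Both matrices are symmetric, and
  convolution of scalar functions commutes.\<close>

lemma conv_inverse_sym:
  assumes f: "impulse_response f" and h: "impulse_response h" and inv: "conv_inverse f h"
  shows "conv_inverse h f"
  unfolding conv_inverse_def
proof (intro allI impI)
  fix i j and \<psi> :: "real \<Rightarrow> real"
  assume \<psi>: "continuous_on UNIV \<psi>" "\<exists>b. \<forall>t>b. \<psi> t = 0"
  have "pair_integral (h i k) (f k j) \<psi> = pair_integral (f j k) (h k i) \<psi>" for k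
  proof -
    have "pair_integral (h i k) (f k j) \<psi> = pair_integral (f k j) (h i k) \<psi>"
      using impulse_response_moderate[OF f] impulse_response_moderate[OF h] \<psi>(1)
      by (intro pair_integral_commute) (auto simp: moderate_def intro: borel_measurable_continuous_onI)
    also have "\<dots> = pair_integral (f j k) (h k i) \<psi>"
      by (metis impulse_response_sym[OF f] impulse_response_sym[OF h])
    finally show ?thesis .
  qed
  hence "(\<Sum>k\<in>UNIV. pair_integral (h i k) (f k j) \<psi>) = (\<Sum>k\<in>UNIV. pair_integral (f j k) (h k i) \<psi>)" by simp
  also have "\<dots> = (if j = i then 1 else 0) * half_square \<psi>" using inv \<psi> unfolding conv_inverse_def by blast
  finally show "(\<Sum>k\<in>UNIV. pair_integral (h i k) (f k j) \<psi>) = (if i = j then 1 else 0) * half_square \<psi>" by auto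
qed

lemma inverse_relaxation:
  assumes "impulse_response f" "impulse_response h" "conv_inverse f h"
  shows "relaxation f (\<lambda>i j. dist_deriv (dist_of (h i j)))"
  by (intro relaxation_of_inverse impulse_response_moderate assms conv_inverse_test)

lemma inverse_relaxation_unique:
  assumes "impulse_response f" "impulse_response h" "conv_inverse f h" "relaxation f r"
  shows "r i j =\<^sub>D dist_deriv (dist_of (h i j))"
  by (rule relaxation_unique[OF impulse_response_moderate[OF assms(1)] impulse_response_moderate[OF assms(2)]
        conv_inverse_sym[OF assms(1-3)] assms(4)])

text \<open>The mere existence of a relaxation matrix forces nondegeneracy, which yields an inverse
  \<open>h\<close>. Uniqueness then identifies the given matrix with the derivative of
  \<open>h\<close>.\<close>

lemma relaxation_inverse:
  assumes "impulse_response f" "relaxation f r"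
  shows "\<exists>h. impulse_response h \<and> conv_inverse f h \<and> (\<forall>i j. r i j =\<^sub>D dist_deriv (dist_of (h i j)))"
  using nondegenerate_imp_inverse[OF assms(1) relaxation_imp_nondegenerate[OF assms]]
    inverse_relaxation_unique[OF assms(1) _ _ assms(2)] by blast

text \<open>With the roles exchanged, the derivative of \<open>f\<close> is a relaxation matrix of
  \<open>h\<close>.\<close>

lemma inverse_nondegenerate:
  assumes "impulse_response f" "impulse_response h" "conv_inverse f h"
  shows "nondegenerate (dist_mat h)"
  by (rule relaxation_imp_nondegenerate[OF assms(2) inverse_relaxation[OF assms(2,1) conv_inverse_sym[OF assms]]])

lemma deriv_determines:
  assumes f: "moderate f" "continuous_on {0..} f" and g: "moderate g" "continuous_on {0..} g"
    and eq: "dist_deriv (dist_of f) =\<^sub>D dist_deriv (dist_of g)"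
  shows "f = g"
  by (rule dist_of_eq_imp_eq[OF f g causal_deriv_inject[OF moderate_causal[OF f(1)] moderate_causal[OF g(1)] eq]])

lemma impulse_response_determined:
  assumes f: "impulse_response f" and g: "impulse_response g"
    and eq: "\<And>i j. dist_deriv (dist_of (f i j)) =\<^sub>D dist_deriv (dist_of (g i j))"
  shows "f = g"
proof (intro ext)
  fix i j t
  have "f i j = g i j"
    by (rule deriv_determines[OF impulse_response_moderate[OF f] impulse_response_continuous[OF f]
          impulse_response_moderate[OF g] impulse_response_continuous[OF g] eq])
  thus "f i j t = g i j t" by simp
qed

lemma causal_primitive_deriv:
  assumes "impulse_response h" "\<And>i j. R i j =\<^sub>D dist_of (h i j)"
  shows "causal_primitive (R i j) (dist_deriv (dist_of (h i j)))"
  unfolding causal_primitive_def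
  using causal_distribution_cong[OF moderate_causal[OF impulse_response_moderate[OF assms(1)]] assms(2)]
    dist_deriv_cong[OF assms(2)] by blast

section \<open>Conjugation, series and parallel connection\<close>

text \<open>A relaxation matrix is unique as a distribution and equals the derivative of an inverse.
  An impulse response whose derivative is that matrix must be this inverse, since its derivative
  determines it.\<close>

lemma conjugate_iff_inverse: "conjugate f h \<longleftrightarrow> impulse_response f \<and> impulse_response h \<and> conv_inverse f h"
proof
  assume c: "conjugate f h"
  then obtain r where f: "impulse_response f" and h: "impulse_response h" and r: "relaxation f r"
    and p: "\<forall>i j. causal_primitive (dist_of (h i j)) (r i j)" unfolding conjugate_def by blast
  obtain g where g: "impulse_response g" "conv_inverse f g" "\<forall>i j. r i j =\<^sub>D dist_deriv (dist_of (g i j))"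
    using relaxation_inverse[OF f r] by blast
  have "h = g"
  proof (rule impulse_response_determined[OF h g(1)])
    fix i j
    have "dist_deriv (dist_of (h i j)) =\<^sub>D r i j" using p by (simp add: causal_primitive_def)
    thus "dist_deriv (dist_of (h i j)) =\<^sub>D dist_deriv (dist_of (g i j))" using g(3) dist_eq_trans by blast
  qed
  thus "impulse_response f \<and> impulse_response h \<and> conv_inverse f h" using f g by simp
next
  assume c: "impulse_response f \<and> impulse_response h \<and> conv_inverse f h"
  hence "relaxation f (\<lambda>i j. dist_deriv (dist_of (h i j)))" using inverse_relaxation by blast
  moreover have "causal_primitive (dist_of (h i j)) (dist_deriv (dist_of (h i j)))" for i j
    by (rule causal_primitive_deriv[where R = "dist_mat h"]) (use c in \<open>auto simp: dist_eq_def\<close>)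
  ultimately show "conjugate f h" unfolding conjugate_def using c by blast
qed

lemma conjugate_sym: "conjugate f h \<Longrightarrow> conjugate h f"
  unfolding conjugate_iff_inverse using conv_inverse_sym by blast

lemma conjugate_material: "conjugate f h \<Longrightarrow> material f"
  unfolding conjugate_def material_def by blast

lemma material_iff_nondegenerate: "impulse_response f \<Longrightarrow> material f \<longleftrightarrow> nondegenerate (dist_mat f)"
  unfolding material_def using relaxation_imp_nondegenerate nondegenerate_imp_inverse inverse_relaxation by blast

lemma material_conjugate: "material f \<Longrightarrow> \<exists>h. conjugate f h"
  unfolding material_def conjugate_iff_inverse using relaxation_inverse by blast

lemma conjugate_unique:
  assumes "conjugate f h" "conjugate f g"
  shows "h = g"
proof -
  have f: "impulse_response f" and h: "impulse_response h" "conv_inverse f h" and g: "impulse_response g" "conv_inverse f g"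
    using assms by (auto simp: conjugate_iff_inverse)
  show ?thesis
    by (rule impulse_response_determined[OF h(1) g(1)], rule inverse_relaxation_unique[OF f g inverse_relaxation[OF f h]])
qed

text \<open>A nondegenerate matrix of the stated form is the derivative of a nondegenerate impulse
  response \<open>h\<close>, which has an inverse \<open>f\<close>. By symmetry of the inverse
  relation the derivative of \<open>h\<close> is then a relaxation matrix of
  \<open>f\<close>.\<close>

lemma relaxation_characterization:
  "(\<exists>f. impulse_response f \<and> relaxation f r) \<longleftrightarrow> relaxation_form r \<and> nondegenerate r"
proof
  assume "\<exists>f. impulse_response f \<and> relaxation f r"
  then obtain f where f: "impulse_response f" "relaxation f r" by blast
  obtain h where h: "impulse_response h" "conv_inverse f h" and r: "\<forall>i j. r i j =\<^sub>D dist_deriv (dist_of (h i j))"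
    using relaxation_inverse[OF f] by blast
  have "nondegenerate r \<longleftrightarrow> nondegenerate (\<lambda>i j. dist_deriv (dist_of (h i j)))"
    by (rule nondegenerate_cong) (use r in blast)
  moreover have "nondegenerate (\<lambda>i j. dist_deriv (dist_of (h i j))) \<longleftrightarrow> nondegenerate (dist_mat h)"
    by (rule nondegenerate_deriv[OF impulse_response_moderate[OF h(1)]])
  ultimately show "relaxation_form r \<and> nondegenerate r"
    unfolding relaxation_form_iff_deriv using inverse_nondegenerate[OF f(1) h] h(1) r by blast
next
  assume "relaxation_form r \<and> nondegenerate r"
  then obtain h where h: "impulse_response h" and r: "\<forall>i j. r i j =\<^sub>D dist_deriv (dist_of (h i j))" and nd: "nondegenerate r"
    unfolding relaxation_form_iff_deriv by blast
  have "nondegenerate r \<longleftrightarrow> nondegenerate (\<lambda>i j. dist_deriv (dist_of (h i j)))"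
    by (rule nondegenerate_cong) (use r in blast)
  hence "nondegenerate (dist_mat h)" using nd nondegenerate_deriv[of h, OF impulse_response_moderate[OF h]] by blast
  then obtain f where f: "impulse_response f" "conv_inverse h f" using nondegenerate_imp_inverse[OF h] by blast
  have "relaxation f (\<lambda>i j. dist_deriv (dist_of (h i j)))"
    by (rule inverse_relaxation[OF f(1) h conv_inverse_sym[OF h f]])
  hence "relaxation f r" by (rule relaxation_cong[OF impulse_response_moderate[OF f(1)]]) (use r in blast)
  thus "\<exists>f. impulse_response f \<and> relaxation f r" using f by blast
qed

text \<open>Causal primitives are unique, so \<open>R\<close> is the inverse impulse response
  itself, and the argument for relaxation matrices applies one integration higher.\<close>

lemma primitive_characterization:
  "(\<exists>f r. impulse_response f \<and> relaxation f r \<and> (\<forall>i j. causal_primitive (R i j) (r i j))) \<longleftrightarrow>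
    nondegenerate R \<and> (\<exists>h. impulse_response h \<and> (\<forall>i j. R i j =\<^sub>D dist_of (h i j)))"
proof
  assume "\<exists>f r. impulse_response f \<and> relaxation f r \<and> (\<forall>i j. causal_primitive (R i j) (r i j))"
  then obtain f r where f: "impulse_response f" "relaxation f r" and p: "\<forall>i j. causal_primitive (R i j) (r i j)" by blast
  obtain h where h: "impulse_response h" "conv_inverse f h" and r: "\<forall>i j. r i j =\<^sub>D dist_deriv (dist_of (h i j))"
    using relaxation_inverse[OF f] by blast
  have R: "R i j =\<^sub>D dist_of (h i j)" for i j
  proof (rule causal_deriv_inject)
    show "causal_distribution (R i j)" using p by (simp add: causal_primitive_def)
    show "causal_distribution (dist_of (h i j))" by (rule moderate_causal[OF impulse_response_moderate[OF h(1)]])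
    have "dist_deriv (R i j) =\<^sub>D r i j" using p by (simp add: causal_primitive_def)
    thus "dist_deriv (R i j) =\<^sub>D dist_deriv (dist_of (h i j))" using r dist_eq_trans by blast
  qed
  thus "nondegenerate R \<and> (\<exists>h. impulse_response h \<and> (\<forall>i j. R i j =\<^sub>D dist_of (h i j)))"
    using nondegenerate_cong[of R "dist_mat h", OF R] inverse_nondegenerate[OF f(1) h] h(1) by blast
next
  assume "nondegenerate R \<and> (\<exists>h. impulse_response h \<and> (\<forall>i j. R i j =\<^sub>D dist_of (h i j)))"
  then obtain h where nd: "nondegenerate R" and h: "impulse_response h" and R: "\<And>i j. R i j =\<^sub>D dist_of (h i j)" by blast
  have "nondegenerate (dist_mat h)" using nd nondegenerate_cong[of R "dist_mat h", OF R] by blast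
  then obtain f where f: "impulse_response f" "conv_inverse h f" using nondegenerate_imp_inverse[OF h] by blast
  have "relaxation f (\<lambda>i j. dist_deriv (dist_of (h i j)))"
    by (rule inverse_relaxation[OF f(1) h conv_inverse_sym[OF h f]])
  thus "\<exists>f r. impulse_response f \<and> relaxation f r \<and> (\<forall>i j. causal_primitive (R i j) (r i j))"
    using f(1) causal_primitive_deriv[of h R, OF h R] by blast
qed

text \<open>The displayed identity is tested on test functions only. This already makes the
  derivative of \<open>h\<close> a relaxation matrix of \<open>f\<close>, hence yields conjugacy,
  while the converse restricts the stronger \<open>conv_inverse\<close>.\<close>

lemma conjugate_iff_convolution:
  assumes f: "impulse_response f" and h: "impulse_response h"
  shows "conjugate f h \<longleftrightarrow> (\<forall>i j. (\<lambda>\<phi>. \<Sum>k\<in>UNIV. (dist_of (f i k) \<star> dist_of (h k j)) \<phi>)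
    =\<^sub>D dist_of (\<lambda>t. (if i = j then 1 else 0) * (t\<^sup>2 / 2) * indicator {0..} t))"
proof -
  note fm = impulse_response_moderate[OF f] and hm = impulse_response_moderate[OF h]
  have c: "(dist_of (f i k) \<star> dist_of (h k j)) \<phi> = pair_integral (f i k) (h k j) \<phi>" if \<phi>: "test_function \<phi>" for i j k \<phi>
  proof -
    obtain B where B: "decaying \<phi> B" using test_function_decaying[OF \<phi>] by blast
    have "(dist_of (f i k) \<star> dist_of (h k j)) \<phi> = (LBINT t. f i k t * dist_of (h k j) (\<lambda>y. \<phi> (t + y)))"
      by (rule convolution_dist_of) (rule moderate_null[OF fm])
    thus ?thesis unfolding pair_integral_iterated(2)[OF fm hm B] by (simp only: dist_of_def)
  qed
  have e: "dist_of (\<lambda>t. (if i = j then 1 else 0) * (t\<^sup>2 / 2) * indicator {0..} t) \<phi> = (if i = j then 1 else 0) * half_square \<phi>" for i j :: 'a and \<phi>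
    by (simp add: dist_of_def half_square_def ac_simps)
  have "conjugate f h \<longleftrightarrow> (\<forall>i j \<phi>. test_function \<phi> \<longrightarrow>
      (\<Sum>k\<in>UNIV. pair_integral (f i k) (h k j) \<phi>) = (if i = j then 1 else 0) * half_square \<phi>)" (is "_ \<longleftrightarrow> ?R")
  proof
    assume "conjugate f h"
    thus ?R unfolding conjugate_iff_inverse using conv_inverse_test by blast
  next
    assume ?R
    hence "relaxation f (\<lambda>i j. dist_deriv (dist_of (h i j)))" by (intro relaxation_of_inverse fm hm) blast
    moreover have "causal_primitive (dist_of (h i j)) (dist_deriv (dist_of (h i j)))" for i j
      by (rule causal_primitive_deriv[where R = "dist_mat h", OF h]) (simp add: dist_eq_def)
    ultimately show "conjugate f h" unfolding conjugate_def using f h by blast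
  qed
  thus ?thesis unfolding dist_eq_def by (simp only: c e cong: imp_cong)
qed

lemma impulse_response_add:
  "impulse_response f \<Longrightarrow> impulse_response g \<Longrightarrow> impulse_response (\<lambda>i j t. f i j t + g i j t)"
  unfolding impulse_response_iff_moments using creep_moments_add by blast

text \<open>A vector on which the form of \<open>M 0 + N 0\<close> vanishes makes both nonnegative
  forms vanish, hence lies in the kernel of \<open>M 0\<close>, which is trivial for a nondegenerate
  response.\<close>

lemma material_add:
  assumes f: "material f" and g: "material g"
  shows "material (\<lambda>i j t. f i j t + g i j t)"
proof -
  have fi: "impulse_response f" and gi: "impulse_response g" using f g by (auto simp: material_def)
  have nd: "nondegenerate (dist_mat f)" using material_iff_nondegenerate[OF fi] f by blast
  obtain M N where M: "creep_moments f M" and N: "creep_moments g N"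
    using fi gi unfolding impulse_response_iff_moments by blast
  have "\<exists>h. impulse_response h \<and> conv_inverse (\<lambda>i j t. f i j t + g i j t) h"
  proof (rule conv_inverse_exists[OF creep_moments_add[OF M N]])
    fix c assume c: "(M 0 + N 0) *v c = 0"
    have "c \<bullet> (M 0 *v c) + c \<bullet> (N 0 *v c) = c \<bullet> ((M 0 + N 0) *v c)"
      by (simp add: inner_add_right matrix_vector_mult_add_rdistrib)
    moreover have "0 \<le> c \<bullet> (M 0 *v c)" "0 \<le> c \<bullet> (N 0 *v c)"
      using creep_moments_psd[OF M] creep_moments_psd[OF N] by (auto simp: sym_psd_def)
    ultimately have "c \<bullet> (M 0 *v c) = 0" using c by simp
    hence "M 0 *v c = 0" by (rule sym_psd_kernel[OF creep_moments_psd[OF M]])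
    thus "c = 0" by (rule nondegenerate_moments[OF M nd])
  qed
  thus ?thesis unfolding material_def using inverse_relaxation impulse_response_add[OF fi gi] by blast
qed

lemma dist_deriv_add:
  assumes "impulse_response f" "impulse_response g"
  shows "(\<lambda>\<phi>. dist_deriv (dist_of (f i j)) \<phi> + dist_deriv (dist_of (g i j)) \<phi>) =\<^sub>D dist_deriv (dist_of (\<lambda>t. f i j t + g i j t))"
  unfolding dist_eq_def dist_deriv_def
  using dist_of_add[OF impulse_response_moderate[OF assms(1)] impulse_response_moderate[OF assms(2)] test_function_deriv]
  by simp

text \<open>Relaxation matrices are the derivatives of the conjugate responses and are unique, so
  adding them amounts to adding the conjugates. Only this direction needs proof, because conjugation
  is symmetric.\<close>

lemma parallel_iff_conjugate_series:
  assumes a: "conjugate a a'" and b: "conjugate b b'" and c: "conjugate c c'"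
  shows "in_parallel a b c \<longleftrightarrow> in_series a' b' c'"
proof
  have ia: "impulse_response a" "impulse_response a'" "conv_inverse a a'"
    and ib: "impulse_response b" "impulse_response b'" "conv_inverse b b'"
    and ic: "impulse_response c" "impulse_response c'" "conv_inverse c c'"
    using a b c by (auto simp: conjugate_iff_inverse)
  {
    assume "in_parallel a b c"
    then obtain r1 r2 where r1: "relaxation a r1" and r2: "relaxation b r2"
      and r: "relaxation c (\<lambda>i j \<phi>. r1 i j \<phi> + r2 i j \<phi>)" unfolding in_parallel_def by blast
    have "c' = (\<lambda>i j t. a' i j t + b' i j t)"
    proof (rule impulse_response_determined[OF ic(2) impulse_response_add[OF ia(2) ib(2)]])
      fix i j
      have "(\<lambda>\<phi>. r1 i j \<phi> + r2 i j \<phi>) =\<^sub>D dist_deriv (dist_of (c' i j))"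
        by (rule inverse_relaxation_unique[OF ic r])
      moreover have "(\<lambda>\<phi>. r1 i j \<phi> + r2 i j \<phi>) =\<^sub>D (\<lambda>\<phi>. dist_deriv (dist_of (a' i j)) \<phi> + dist_deriv (dist_of (b' i j)) \<phi>)"
        using inverse_relaxation_unique[OF ia r1] inverse_relaxation_unique[OF ib r2] by (simp add: dist_eq_def)
      ultimately show "dist_deriv (dist_of (c' i j)) =\<^sub>D dist_deriv (dist_of (\<lambda>t. a' i j t + b' i j t))"
        using dist_deriv_add[OF ia(2) ib(2), of i j] by (simp add: dist_eq_def)
    qed
    thus "in_series a' b' c'" by (simp add: in_series_def)
  next
    assume "in_series a' b' c'"
    hence "c' = (\<lambda>i j t. a' i j t + b' i j t)" by (simp add: in_series_def fun_eq_iff)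
    hence "relaxation c (\<lambda>i j. dist_deriv (dist_of (\<lambda>t. a' i j t + b' i j t)))" using inverse_relaxation[OF ic] by simp
    hence "relaxation c (\<lambda>i j \<phi>. dist_deriv (dist_of (a' i j)) \<phi> + dist_deriv (dist_of (b' i j)) \<phi>)"
      by (rule relaxation_cong[OF impulse_response_moderate[OF ic(1)]]) (rule dist_deriv_add[OF ia(2) ib(2)])
    thus "in_parallel a b c" unfolding in_parallel_def using inverse_relaxation[OF ia] inverse_relaxation[OF ib] by blast
  }
qed

text \<open>The parallel connection is obtained as the conjugate of the series connection of the two
  conjugates.\<close>

lemma material_parallel:
  assumes "material f" "material g"
  shows "\<exists>p. material p \<and> in_parallel f g p"
proof -
  obtain f' g' where f': "conjugate f f'" and g': "conjugate g g'" using assms material_conjugate by blast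
  have "material (\<lambda>i j t. f' i j t + g' i j t)"
    by (intro material_add conjugate_material[OF conjugate_sym[OF f']] conjugate_material[OF conjugate_sym[OF g']])
  then obtain p where "conjugate (\<lambda>i j t. f' i j t + g' i j t) p" using material_conjugate by blast
  hence p: "conjugate p (\<lambda>i j t. f' i j t + g' i j t)" by (rule conjugate_sym)
  have "in_parallel f g p"
    unfolding parallel_iff_conjugate_series[OF f' g' p] by (simp add: in_series_def)
  thus ?thesis using conjugate_material[OF p] by blast
qed

theorem mainTheorem3:
  shows
    "(\<forall>f :: 'm::finite \<Rightarrow> 'm \<Rightarrow> real \<Rightarrow> real.
        impulse_response f \<longrightarrow> (material f \<longleftrightarrow> nondegenerate (dist_mat f)))
   \<and> \<comment> \<open>(i)\<close>
     (\<forall>r :: 'm \<Rightarrow> 'm \<Rightarrow> functional.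
        (\<exists>f. impulse_response f \<and> relaxation f r) \<longleftrightarrow> relaxation_form r \<and> nondegenerate r)
   \<and> \<comment> \<open>(ii)\<close>
     (\<forall>R :: 'm \<Rightarrow> 'm \<Rightarrow> functional.
        (\<exists>f r. impulse_response f \<and> relaxation f r \<and> (\<forall>i j. causal_primitive (R i j) (r i j)))
        \<longleftrightarrow> nondegenerate R \<and>
            (\<exists>h. impulse_response h \<and> (\<forall>i j. R i j =\<^sub>D dist_of (h i j))))
   \<and> (\<forall>f :: 'm \<Rightarrow> 'm \<Rightarrow> real \<Rightarrow> real. material f \<longrightarrow> (\<exists>!h. conjugate f h))
   \<and> (\<forall>f h :: 'm \<Rightarrow> 'm \<Rightarrow> real \<Rightarrow> real. conjugate f h \<longrightarrow> material h)
   \<and> \<comment> \<open>(iii)\<close>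
     (\<forall>f1 f2 :: 'm \<Rightarrow> 'm \<Rightarrow> real \<Rightarrow> real. impulse_response f1 \<and> impulse_response f2 \<longrightarrow>
        (conjugate f1 f2 \<longleftrightarrow>
          (\<forall>i j. (\<lambda>\<phi>. \<Sum>k\<in>UNIV. (dist_of (f1 i k) \<star> dist_of (f2 k j)) \<phi>)
             =\<^sub>D dist_of (\<lambda>t. (if i = j then 1 else 0) * (t\<^sup>2 / 2) * indicator {0..} t))))
   \<and> \<comment> \<open>(iv)\<close>
     (\<forall>f h :: 'm \<Rightarrow> 'm \<Rightarrow> real \<Rightarrow> real. conjugate f h \<longrightarrow> conjugate h f)
   \<and> (\<forall>f1 f2 :: 'm \<Rightarrow> 'm \<Rightarrow> real \<Rightarrow> real. material f1 \<and> material f2 \<longrightarrow>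
        (\<exists>f. material f \<and> in_series f1 f2 f) \<and> (\<exists>f. material f \<and> in_parallel f1 f2 f))
   \<and> (\<forall>f1 f2 f h1 h2 h :: 'm \<Rightarrow> 'm \<Rightarrow> real \<Rightarrow> real.
        conjugate f1 h1 \<and> conjugate f2 h2 \<and> conjugate f h \<longrightarrow>
        (in_series f1 f2 f \<longleftrightarrow> in_parallel h1 h2 h) \<and>
        (in_parallel f1 f2 f \<longleftrightarrow> in_series h1 h2 h))"
proof (intro conjI allI impI; (elim conjE)?)
  fix f :: "'m \<Rightarrow> 'm \<Rightarrow> real \<Rightarrow> real" assume "impulse_response f"
  thus "material f \<longleftrightarrow> nondegenerate (dist_mat f)" by (rule material_iff_nondegenerate)
next
  fix r :: "'m \<Rightarrow> 'm \<Rightarrow> functional"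
  show "(\<exists>f. impulse_response f \<and> relaxation f r) \<longleftrightarrow> relaxation_form r \<and> nondegenerate r"
    by (rule relaxation_characterization)
next
  fix R :: "'m \<Rightarrow> 'm \<Rightarrow> functional"
  show "(\<exists>f r. impulse_response f \<and> relaxation f r \<and> (\<forall>i j. causal_primitive (R i j) (r i j))) \<longleftrightarrow>
      nondegenerate R \<and> (\<exists>h. impulse_response h \<and> (\<forall>i j. R i j =\<^sub>D dist_of (h i j)))"
    by (rule primitive_characterization)
next
  fix f :: "'m \<Rightarrow> 'm \<Rightarrow> real \<Rightarrow> real" assume "material f"
  thus "\<exists>!h. conjugate f h" using material_conjugate conjugate_unique by blast
next
  fix f h :: "'m \<Rightarrow> 'm \<Rightarrow> real \<Rightarrow> real" assume "conjugate f h"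
  thus "material h" by (rule conjugate_material[OF conjugate_sym])
next
  fix f1 f2 :: "'m \<Rightarrow> 'm \<Rightarrow> real \<Rightarrow> real" assume "impulse_response f1" "impulse_response f2"
  thus "conjugate f1 f2 \<longleftrightarrow> (\<forall>i j. (\<lambda>\<phi>. \<Sum>k\<in>UNIV. (dist_of (f1 i k) \<star> dist_of (f2 k j)) \<phi>)
      =\<^sub>D dist_of (\<lambda>t. (if i = j then 1 else 0) * (t\<^sup>2 / 2) * indicator {0..} t))"
    by (rule conjugate_iff_convolution)
next
  fix f h :: "'m \<Rightarrow> 'm \<Rightarrow> real \<Rightarrow> real" assume "conjugate f h"
  thus "conjugate h f" by (rule conjugate_sym)
next
  fix f1 f2 :: "'m \<Rightarrow> 'm \<Rightarrow> real \<Rightarrow> real" assume m: "material f1" "material f2"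
  show "\<exists>f. material f \<and> in_series f1 f2 f"
    using material_add[OF m] by (intro exI[of _ "\<lambda>i j t. f1 i j t + f2 i j t"]) (simp add: in_series_def)
  show "\<exists>f. material f \<and> in_parallel f1 f2 f" by (rule material_parallel[OF m])
next
  fix f1 f2 f h1 h2 h :: "'m \<Rightarrow> 'm \<Rightarrow> real \<Rightarrow> real"
  assume c: "conjugate f1 h1" "conjugate f2 h2" "conjugate f h"
  show "in_series f1 f2 f \<longleftrightarrow> in_parallel h1 h2 h"
    using parallel_iff_conjugate_series[OF conjugate_sym[OF c(1)] conjugate_sym[OF c(2)] conjugate_sym[OF c(3)]] by simp
  show "in_parallel f1 f2 f \<longleftrightarrow> in_series h1 h2 h" by (rule parallel_iff_conjugate_series[OF c])
qed

end
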